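(* Let $\mathfrak{G}$ be the Gaeta topos of $\mathbb{C}$, let $p:\mathfrak{G}\to\mathbf{Set}$ be the canonical (pre-cohesive) geometric morphism, and let $\mathfrak{W}\to\mathfrak{G}$ be the Weil essential subtopos, i.e. the one induced by the full inclusion of the category of Weil algebras over $\mathbb{C}$ into the category of finitely generated directly indecomposable $\mathbb{C}$-algebras. Then the essential subquality $\mathfrak{W}\to\mathfrak{G}$ is level $\epsilon$ of $p$, and it coincides with the largest subquality of $p$.
   Context: Algebras are commutative and unital. A Weil algebra over a field $k$ is a $k$-algebra $A$ which is local with maximal ideal $\mathfrak{m}$, such that $k\to A\to A/\mathfrak{m}$ is an isomorphism, $A$ is finitely generated as a $k$-module, and $\mathfrak{m}^n=0$ for some $n$. A ring is (directly) indecomposable if it has exactly two idempotents. Let $\mathcal{C}$ be the opposite of the (essentially small) category of finitely generated indecomposable $\mathbb{C}$-algebras and let $\mathcal{W}\subseteq\mathcal{C}^{\mathrm{op}}$ be the full subcategory of Weil algebras over $\mathbb{C}$. For a small category $\mathcal{A}$, $\widehat{\mathcal{A}}$ is the topos of presheaves of sets on $\mathcal{A}$. The Gaeta topos of $\mathbb{C}$ is the topos of sheaves on the opposite $\mathcal{D}$ of the category of finitely generated $\mathbb{C}$-algebras for the topology whose basic covers are the finite families $(D_i\to D)_{i\in I}$ with $\sum_i D_i\to D$ an isomorphism; it is identified (by restriction along $\mathcal{C}\to\mathcal{D}$) with $\mathfrak{G}=\widehat{\mathcal{C}}$. The Weil topos is $\mathfrak{W}=\mathbf{Set}^{\mathcal{W}}=\widehat{\mathcal{W}^{\mathrm{op}}}$.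 A full inclusion $\mathcal{B}\to\mathcal{A}$ of small categories induces an essential subtopos $\widehat{\mathcal{B}}\to\widehat{\mathcal{A}}$ whose inverse image is restriction. A subtopos of a topos $\mathcal{E}$ is a geometric morphism $j:\mathcal{E}_j\to\mathcal{E}$ with $j_*$ full and faithful. A subtopos $k$ of $\mathcal{E}$ is above a subtopos $j$ if $j_*$ factors (up to isomorphism) through $k_*$; "largest" refers to this (pre)order. A geometric morphism is essential if its inverse image has a left adjoint. A geometric morphism $p:\mathcal{E}\to\mathcal{S}$ is local if $p_*$ has a full and faithful right adjoint $p^!$; its centre (level 0) is then the subtopos $\mathcal{S}\to\mathcal{E}$ with inverse image $p_*$ and direct image $p^!$. For local $p$ the canonical transformation $\phi:p^*\to p^!$ is the composite $p^*\xrightarrow{\eta_{p^*}}p^!p_*p^*\xrightarrow{p^!\alpha^{-1}}p^!$, where $\eta$ is the unit of $p_*\dashv p^!$ and $\alpha$ the (invertible) unit of $p^*\dashv p_*$. A local $p$ is a quality type if $\phi$ is an isomorphism. A subquality of a local $p:\mathcal{E}\to\mathcal{S}$ is a subtopos $j:\mathcal{E}_j\to\mathcal{E}$ above the centre of $p$ such that $pj:\mathcal{E}_j\to\mathcal{S}$ is a quality type. A subquality is essential if it is so as a subtopos. Level $\epsilon$ of $p$ is, if it exists, the largest essential subquality of $p$. Pre-cohesive geometric morphisms are local, essential and hyperconnected, with the left adjoint $p_!$ of $p^*$ preserving finite products; the canonical $p:\mathfrak{G}\to\mathbf{Set}$ is pre-cohesive. *)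

theory Defs
  imports
    Complex_Main
    "HOL-Library.FuncSet"
    "HOL-Library.Equipollence"
    "HOL-Algebra.Module"
    "HOL-Algebra.Subrings"
    "HOL-Algebra.QuotRing"
    "HOL-Algebra.Ideal_Product"
begin

section \<open>Categories and functors\<close>

text \<open>
  An arrow knows its domain and codomain; \<open>Cmp C g f\<close> is the composite of \<open>f\<close> followed by
  \<open>g\<close> and is meaningful only when \<open>Cod C f = Dom C g\<close>.
\<close>

record ('o, 'a) cat =
  Ob  :: "'o set"
  Ar  :: "'a set"
  Dom :: "'a \<Rightarrow> 'o"
  Cod :: "'a \<Rightarrow> 'o"
  Idt :: "'o \<Rightarrow> 'a"
  Cmp :: "'a \<Rightarrow> 'a \<Rightarrow> 'a"

definition Hom :: "('o, 'a) cat \<Rightarrow> 'o \<Rightarrow> 'o \<Rightarrow> 'a set" where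
  "Hom C A B = {f \<in> Ar C. Dom C f = A \<and> Cod C f = B}"

locale category =
  fixes C :: "('o, 'a) cat"
  assumes dom_in: "f \<in> Ar C \<Longrightarrow> Dom C f \<in> Ob C"
    and cod_in: "f \<in> Ar C \<Longrightarrow> Cod C f \<in> Ob C"
    and idt_in: "A \<in> Ob C \<Longrightarrow> Idt C A \<in> Hom C A A"
    and cmp_in: "f \<in> Hom C A B \<Longrightarrow> g \<in> Hom C B D \<Longrightarrow> Cmp C g f \<in> Hom C A D"
    and cmp_idt: "f \<in> Ar C \<Longrightarrow> Cmp C f (Idt C (Dom C f)) = f"
    and idt_cmp: "f \<in> Ar C \<Longrightarrow> Cmp C (Idt C (Cod C f)) f = f"
    and cmp_assoc: "f \<in> Hom C A B \<Longrightarrow> g \<in> Hom C B D \<Longrightarrow> h \<in> Hom C D E \<Longrightarrow>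
      Cmp C h (Cmp C g f) = Cmp C (Cmp C h g) f"

definition iso_arrow :: "('o, 'a) cat \<Rightarrow> 'a \<Rightarrow> bool" where
  "iso_arrow C f \<longleftrightarrow> f \<in> Ar C \<and>
     (\<exists>g \<in> Hom C (Cod C f) (Dom C f).
        Cmp C g f = Idt C (Dom C f) \<and> Cmp C f g = Idt C (Cod C f))"

definition inv_arrow :: "('o, 'a) cat \<Rightarrow> 'a \<Rightarrow> 'a" where
  "inv_arrow C f = (THE g. g \<in> Hom C (Cod C f) (Dom C f) \<and>
        Cmp C g f = Idt C (Dom C f) \<and> Cmp C f g = Idt C (Cod C f))"

definition mono_arrow :: "('o, 'a) cat \<Rightarrow> 'a \<Rightarrow> bool" where
  "mono_arrow C m \<longleftrightarrow> m \<in> Ar C \<and>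
     (\<forall>A. \<forall>f \<in> Hom C A (Dom C m). \<forall>g \<in> Hom C A (Dom C m). Cmp C m f = Cmp C m g \<longrightarrow> f = g)"

definition op_cat :: "('o, 'a) cat \<Rightarrow> ('o, 'a) cat" where
  "op_cat C = \<lparr>Ob = Ob C, Ar = Ar C, Dom = Cod C, Cod = Dom C, Idt = Idt C,
               Cmp = (\<lambda>g f. Cmp C f g)\<rparr>"

definition full_subcat :: "('o, 'a) cat \<Rightarrow> 'o set \<Rightarrow> ('o, 'a) cat" where
  "full_subcat C X = \<lparr>Ob = Ob C \<inter> X, Ar = {f \<in> Ar C. Dom C f \<in> X \<and> Cod C f \<in> X},
               Dom = Dom C, Cod = Cod C, Idt = Idt C, Cmp = Cmp C\<rparr>"

record ('o, 'a, 'p, 'b) func =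
  FOb :: "'o \<Rightarrow> 'p"
  FAr :: "'a \<Rightarrow> 'b"

definition is_functor :: "('o, 'a) cat \<Rightarrow> ('p, 'b) cat \<Rightarrow> ('o, 'a, 'p, 'b) func \<Rightarrow> bool" where
  "is_functor C D F \<longleftrightarrow> category C \<and> category D \<and>
     (\<forall>A \<in> Ob C. FOb F A \<in> Ob D) \<and>
     (\<forall>f \<in> Ar C. FAr F f \<in> Hom D (FOb F (Dom C f)) (FOb F (Cod C f))) \<and>
     (\<forall>A \<in> Ob C. FAr F (Idt C A) = Idt D (FOb F A)) \<and>
     (\<forall>f \<in> Ar C. \<forall>g \<in> Ar C. Cod C f = Dom C g \<longrightarrow>
        FAr F (Cmp C g f) = Cmp D (FAr F g) (FAr F f))"

definition id_func :: "('o, 'a, 'o, 'a) func" where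
  "id_func = \<lparr>FOb = (\<lambda>A. A), FAr = (\<lambda>f. f)\<rparr>"

definition comp_func ::
    "('p, 'b, 'q, 'c) func \<Rightarrow> ('o, 'a, 'p, 'b) func \<Rightarrow> ('o, 'a, 'q, 'c) func" where
  "comp_func G F = \<lparr>FOb = FOb G \<circ> FOb F, FAr = FAr G \<circ> FAr F\<rparr>"

definition fully_faithful ::
    "('o, 'a) cat \<Rightarrow> ('p, 'b) cat \<Rightarrow> ('o, 'a, 'p, 'b) func \<Rightarrow> bool" where
  "fully_faithful C D F \<longleftrightarrow> (\<forall>A \<in> Ob C. \<forall>B \<in> Ob C.
     bij_betw (FAr F) (Hom C A B) (Hom D (FOb F A) (FOb F B)))"

definition nat_trans ::
    "('o, 'a) cat \<Rightarrow> ('p, 'b) cat \<Rightarrow> ('o, 'a, 'p, 'b) func \<Rightarrow> ('o, 'a, 'p, 'b) func \<Rightarrow>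
     ('o \<Rightarrow> 'b) \<Rightarrow> bool" where
  "nat_trans C D F G \<tau> \<longleftrightarrow> is_functor C D F \<and> is_functor C D G \<and>
     (\<forall>A \<in> Ob C. \<tau> A \<in> Hom D (FOb F A) (FOb G A)) \<and>
     (\<forall>f \<in> Ar C. Cmp D (\<tau> (Cod C f)) (FAr F f) = Cmp D (FAr G f) (\<tau> (Dom C f)))"

definition nat_isomorphic ::
    "('o, 'a) cat \<Rightarrow> ('p, 'b) cat \<Rightarrow> ('o, 'a, 'p, 'b) func \<Rightarrow> ('o, 'a, 'p, 'b) func \<Rightarrow> bool" where
  "nat_isomorphic C D F G \<longleftrightarrow>
     (\<exists>\<tau>. nat_trans C D F G \<tau> \<and> (\<forall>A \<in> Ob C. iso_arrow D (\<tau> A)))"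

text \<open>\<open>adjunction C D F U \<eta> \<epsilon>\<close>: the functor \<open>F\<close> from \<open>C\<close> to \<open>D\<close> is left adjoint to \<open>U\<close>,
  with unit \<open>\<eta>\<close> and counit \<open>\<epsilon>\<close>.\<close>

definition adjunction ::
    "('o, 'a) cat \<Rightarrow> ('p, 'b) cat \<Rightarrow> ('o, 'a, 'p, 'b) func \<Rightarrow> ('p, 'b, 'o, 'a) func \<Rightarrow>
     ('o \<Rightarrow> 'a) \<Rightarrow> ('p \<Rightarrow> 'b) \<Rightarrow> bool" where
  "adjunction C D F U \<eta> \<epsilon> \<longleftrightarrow> is_functor C D F \<and> is_functor D C U \<and>
     nat_trans C C id_func (comp_func U F) \<eta> \<and>
     nat_trans D D (comp_func F U) id_func \<epsilon> \<and>
     (\<forall>A \<in> Ob C. Cmp D (\<epsilon> (FOb F A)) (FAr F (\<eta> A)) = Idt D (FOb F A)) \<and>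
     (\<forall>B \<in> Ob D. Cmp C (FAr U (\<epsilon> B)) (\<eta> (FOb U B)) = Idt C (FOb U B))"

section \<open>Elementary toposes\<close>

definition terminal :: "('o, 'a) cat \<Rightarrow> 'o \<Rightarrow> bool" where
  "terminal C t \<longleftrightarrow> t \<in> Ob C \<and> (\<forall>A \<in> Ob C. \<exists>!f. f \<in> Hom C A t)"

definition is_pullback :: "('o, 'a) cat \<Rightarrow> 'a \<Rightarrow> 'a \<Rightarrow> 'a \<Rightarrow> 'a \<Rightarrow> bool" where
  "is_pullback C f g p q \<longleftrightarrow> f \<in> Ar C \<and> g \<in> Ar C \<and> Cod C f = Cod C g \<and>
     p \<in> Hom C (Dom C p) (Dom C f) \<and> q \<in> Hom C (Dom C p) (Dom C g) \<and>
     Cmp C f p = Cmp C g q \<and>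
     (\<forall>X. \<forall>h \<in> Hom C X (Dom C f). \<forall>k \<in> Hom C X (Dom C g). Cmp C f h = Cmp C g k \<longrightarrow>
        (\<exists>!u. u \<in> Hom C X (Dom C p) \<and> Cmp C p u = h \<and> Cmp C q u = k))"

definition is_product :: "('o, 'a) cat \<Rightarrow> 'o \<Rightarrow> 'o \<Rightarrow> 'o \<Rightarrow> 'a \<Rightarrow> 'a \<Rightarrow> bool" where
  "is_product C A B P p q \<longleftrightarrow> p \<in> Hom C P A \<and> q \<in> Hom C P B \<and>
     (\<forall>X. \<forall>h \<in> Hom C X A. \<forall>k \<in> Hom C X B.
        (\<exists>!u. u \<in> Hom C X P \<and> Cmp C p u = h \<and> Cmp C q u = k))"

text \<open>\<open>E\<close> is the exponential \<open>B\<^sup>A\<close>: the arrow \<open>ev\<close> goes from a product \<open>P\<close> of \<open>E\<close> and \<open>A\<close>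
  to \<open>B\<close>, and every arrow \<open>f\<close> from a product \<open>Q\<close> of \<open>X\<close> and \<open>A\<close> to \<open>B\<close> is the composite of
  \<open>ev\<close> with \<open>u = h \<times> A\<close> for a unique \<open>h\<close> from \<open>X\<close> to \<open>E\<close>.\<close>

definition is_exponential ::
    "('o, 'a) cat \<Rightarrow> 'o \<Rightarrow> 'o \<Rightarrow> 'o \<Rightarrow> 'o \<Rightarrow> 'a \<Rightarrow> 'a \<Rightarrow> 'a \<Rightarrow> bool" where
  "is_exponential C A B E P p q ev \<longleftrightarrow> is_product C E A P p q \<and> ev \<in> Hom C P B \<and>
     (\<forall>X Q r s. is_product C X A Q r s \<longrightarrow> (\<forall>f \<in> Hom C Q B.
        (\<exists>!h. h \<in> Hom C X E \<and>
           (\<exists>u \<in> Hom C Q P. Cmp C p u = Cmp C h r \<and> Cmp C q u = s \<and> Cmp C ev u = f))))"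

definition is_subobject_classifier :: "('o, 'a) cat \<Rightarrow> 'a \<Rightarrow> bool" where
  "is_subobject_classifier C t \<longleftrightarrow> t \<in> Ar C \<and> terminal C (Dom C t) \<and>
     (\<forall>m. mono_arrow C m \<longrightarrow>
        (\<exists>!\<chi>. \<chi> \<in> Hom C (Cod C m) (Cod C t) \<and> (\<exists>b. is_pullback C \<chi> t m b)))"

definition has_finite_limits :: "('o, 'a) cat \<Rightarrow> bool" where
  "has_finite_limits C \<longleftrightarrow> (\<exists>t. terminal C t) \<and>
     (\<forall>f \<in> Ar C. \<forall>g \<in> Ar C. Cod C f = Cod C g \<longrightarrow> (\<exists>p q. is_pullback C f g p q))"

definition topos :: "('o, 'a) cat \<Rightarrow> bool" where
  "topos C \<longleftrightarrow> category C \<and> has_finite_limits C \<and>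
     (\<forall>A \<in> Ob C. \<forall>B \<in> Ob C. \<exists>E P p q ev. is_exponential C A B E P p q ev) \<and>
     (\<exists>t. is_subobject_classifier C t)"

definition preserves_finite_limits ::
    "('o, 'a) cat \<Rightarrow> ('p, 'b) cat \<Rightarrow> ('o, 'a, 'p, 'b) func \<Rightarrow> bool" where
  "preserves_finite_limits C D F \<longleftrightarrow> (\<forall>t. terminal C t \<longrightarrow> terminal D (FOb F t)) \<and>
     (\<forall>f g p q. is_pullback C f g p q \<longrightarrow>
        is_pullback D (FAr F f) (FAr F g) (FAr F p) (FAr F q))"

section \<open>Geometric morphisms, subtoposes and levels\<close>

text \<open>A geometric morphism from \<open>E\<close> to \<open>S\<close> is given by its inverse image (from \<open>S\<close> to \<open>E\<close>),
  its direct image (from \<open>E\<close> to \<open>S\<close>), and the unit and counit of the adjunction.\<close>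

record ('o, 'a, 'p, 'b) geom =
  inv_im :: "('p, 'b, 'o, 'a) func"
  dir_im :: "('o, 'a, 'p, 'b) func"
  gunit :: "'p \<Rightarrow> 'b"
  gcounit :: "'o \<Rightarrow> 'a"

definition geometric_morphism ::
    "('o, 'a) cat \<Rightarrow> ('p, 'b) cat \<Rightarrow> ('o, 'a, 'p, 'b) geom \<Rightarrow> bool" where
  "geometric_morphism E S f \<longleftrightarrow> topos E \<and> topos S \<and>
     adjunction S E (inv_im f) (dir_im f) (gunit f) (gcounit f) \<and>
     preserves_finite_limits S E (inv_im f)"

text \<open>The composite of \<open>j\<close> (from \<open>F\<close> to \<open>E\<close>) followed by \<open>p\<close> (from \<open>E\<close> to \<open>S\<close>).\<close>

definition comp_geom ::
    "('q, 'c) cat \<Rightarrow> ('p, 'b) cat \<Rightarrow> ('o, 'a, 'p, 'b) geom \<Rightarrow> ('q, 'c, 'o, 'a) geom \<Rightarrow>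
     ('q, 'c, 'p, 'b) geom" where
  "comp_geom F S p j =
     \<lparr>inv_im = comp_func (inv_im j) (inv_im p),
      dir_im = comp_func (dir_im p) (dir_im j),
      gunit = (\<lambda>X. Cmp S (FAr (dir_im p) (gunit j (FOb (inv_im p) X))) (gunit p X)),
      gcounit = (\<lambda>Y. Cmp F (gcounit j Y) (FAr (inv_im j) (gcounit p (FOb (dir_im j) Y))))\<rparr>"

definition subtopos ::
    "('o, 'a) cat \<Rightarrow> ('q, 'c) cat \<Rightarrow> ('q, 'c, 'o, 'a) geom \<Rightarrow> bool" where
  "subtopos E F j \<longleftrightarrow> geometric_morphism F E j \<and> fully_faithful F E (dir_im j)"

definition essential :: "('o, 'a) cat \<Rightarrow> ('p, 'b) cat \<Rightarrow> ('o, 'a, 'p, 'b) geom \<Rightarrow> bool" where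
  "essential E S f \<longleftrightarrow> geometric_morphism E S f \<and>
     (\<exists>L \<eta> \<epsilon>. adjunction E S L (inv_im f) \<eta> \<epsilon>)"

text \<open>\<open>above E F k G j\<close>: the subtopos \<open>k\<close> (from \<open>F\<close> to \<open>E\<close>) is above the subtopos \<open>j\<close>
  (from \<open>G\<close> to \<open>E\<close>).\<close>

definition above ::
    "('o, 'a) cat \<Rightarrow> ('p, 'b) cat \<Rightarrow> ('p, 'b, 'o, 'a) geom \<Rightarrow>
     ('q, 'c) cat \<Rightarrow> ('q, 'c, 'o, 'a) geom \<Rightarrow> bool" where
  "above E F k G j \<longleftrightarrow>
     (\<exists>H. is_functor G F H \<and> nat_isomorphic G E (comp_func (dir_im k) H) (dir_im j))"

text \<open>\<open>R\<close> is a fully faithful right adjoint of the direct image of \<open>p\<close>, with unit \<open>\<eta>\<close> and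
  counit \<open>\<epsilon>\<close>.  Such an adjoint is unique up to isomorphism, so that the existential
  quantifiers over \<open>R\<close>, \<open>\<eta>\<close>, \<open>\<epsilon>\<close> below do not depend on a choice.\<close>

definition upper_shriek ::
    "('o, 'a) cat \<Rightarrow> ('p, 'b) cat \<Rightarrow> ('o, 'a, 'p, 'b) geom \<Rightarrow>
     ('p, 'b, 'o, 'a) func \<Rightarrow> ('o \<Rightarrow> 'a) \<Rightarrow> ('p \<Rightarrow> 'b) \<Rightarrow> bool" where
  "upper_shriek E S p R \<eta> \<epsilon> \<longleftrightarrow> adjunction E S (dir_im p) R \<eta> \<epsilon> \<and> fully_faithful S E R"

definition local_geom :: "('o, 'a) cat \<Rightarrow> ('p, 'b) cat \<Rightarrow> ('o, 'a, 'p, 'b) geom \<Rightarrow> bool" where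
  "local_geom E S p \<longleftrightarrow> geometric_morphism E S p \<and> (\<exists>R \<eta> \<epsilon>. upper_shriek E S p R \<eta> \<epsilon>)"

definition centre ::
    "('o, 'a, 'p, 'b) geom \<Rightarrow> ('p, 'b, 'o, 'a) func \<Rightarrow> ('o \<Rightarrow> 'a) \<Rightarrow> ('p \<Rightarrow> 'b) \<Rightarrow>
     ('p, 'b, 'o, 'a) geom" where
  "centre p R \<eta> \<epsilon> = \<lparr>inv_im = dir_im p, dir_im = R, gunit = \<eta>, gcounit = \<epsilon>\<rparr>"

text \<open>The component at \<open>X\<close> of the canonical transformation from the inverse image of \<open>p\<close>
  to \<open>R\<close>.\<close>

definition canonical_trans ::
    "('o, 'a) cat \<Rightarrow> ('p, 'b) cat \<Rightarrow> ('o, 'a, 'p, 'b) geom \<Rightarrow>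
     ('p, 'b, 'o, 'a) func \<Rightarrow> ('o \<Rightarrow> 'a) \<Rightarrow> 'p \<Rightarrow> 'a" where
  "canonical_trans E S p R \<eta> X =
     Cmp E (FAr R (inv_arrow S (gunit p X))) (\<eta> (FOb (inv_im p) X))"

definition quality_type :: "('o, 'a) cat \<Rightarrow> ('p, 'b) cat \<Rightarrow> ('o, 'a, 'p, 'b) geom \<Rightarrow> bool" where
  "quality_type E S p \<longleftrightarrow> geometric_morphism E S p \<and>
     (\<exists>R \<eta> \<epsilon>. upper_shriek E S p R \<eta> \<epsilon> \<and>
        (\<forall>X \<in> Ob S. iso_arrow E (canonical_trans E S p R \<eta> X)))"

definition subquality ::
    "('o, 'a) cat \<Rightarrow> ('p, 'b) cat \<Rightarrow> ('o, 'a, 'p, 'b) geom \<Rightarrow>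
     ('q, 'c) cat \<Rightarrow> ('q, 'c, 'o, 'a) geom \<Rightarrow> bool" where
  "subquality E S p F j \<longleftrightarrow> local_geom E S p \<and> subtopos E F j \<and>
     (\<exists>R \<eta> \<epsilon>. upper_shriek E S p R \<eta> \<epsilon> \<and> above E F j S (centre p R \<eta> \<epsilon>)) \<and>
     quality_type F S (comp_geom F S p j)"

definition essential_subquality ::
    "('o, 'a) cat \<Rightarrow> ('p, 'b) cat \<Rightarrow> ('o, 'a, 'p, 'b) geom \<Rightarrow>
     ('q, 'c) cat \<Rightarrow> ('q, 'c, 'o, 'a) geom \<Rightarrow> bool" where
  "essential_subquality E S p F j \<longleftrightarrow> subquality E S p F j \<and> essential F E j"

text \<open>The first two arguments are the object and arrow types of the toposes against which
  \<open>j\<close> is compared; a theorem in which these are type variables speaks about all of them.\<close>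

definition largest_subquality ::
    "'x itself \<Rightarrow> 'y itself \<Rightarrow> ('o, 'a) cat \<Rightarrow> ('p, 'b) cat \<Rightarrow> ('o, 'a, 'p, 'b) geom \<Rightarrow>
     ('q, 'c) cat \<Rightarrow> ('q, 'c, 'o, 'a) geom \<Rightarrow> bool" where
  "largest_subquality _ _ E S p F j \<longleftrightarrow> subquality E S p F j \<and>
     (\<forall>(G :: ('x, 'y) cat) k. subquality E S p G k \<longrightarrow> above E F j G k)"

definition level_epsilon ::
    "'x itself \<Rightarrow> 'y itself \<Rightarrow> ('o, 'a) cat \<Rightarrow> ('p, 'b) cat \<Rightarrow> ('o, 'a, 'p, 'b) geom \<Rightarrow>
     ('q, 'c) cat \<Rightarrow> ('q, 'c, 'o, 'a) geom \<Rightarrow> bool" where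
  "level_epsilon _ _ E S p F j \<longleftrightarrow> essential_subquality E S p F j \<and>
     (\<forall>(G :: ('x, 'y) cat) k. essential_subquality E S p G k \<longrightarrow> above E F j G k)"

section \<open>Sets and presheaves\<close>

text \<open>
  The category of sets is relative to a universe.  A universe is a type whose cardinality is an
  uncountable strongly inaccessible cardinal; its sets are the subsets of the type of strictly
  smaller cardinality.  No such type can be constructed in HOL itself (a universe yields a model
  of HOL), so inaccessibility is a hypothesis wherever it is needed.
\<close>

definition strongly_inaccessible :: "'u itself \<Rightarrow> bool" where
  "strongly_inaccessible _ \<longleftrightarrow>
     (UNIV :: nat set) \<prec> (UNIV :: 'u set) \<and>
     (\<forall>X :: 'u set. X \<prec> (UNIV :: 'u set) \<longrightarrow> Pow X \<prec> (UNIV :: 'u set)) \<and>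
     (\<forall>(I :: 'u set) (X :: 'u \<Rightarrow> 'u set). I \<prec> (UNIV :: 'u set) \<and>
        (\<forall>i \<in> I. X i \<prec> (UNIV :: 'u set)) \<longrightarrow> (\<Union>i\<in>I. X i) \<prec> (UNIV :: 'u set))"

type_synonym 'u setarr = "'u set \<times> 'u set \<times> ('u \<Rightarrow> 'u)"

definition set_cat :: "('u set, 'u setarr) cat" where
  "set_cat = \<lparr>
     Ob = {X. X \<prec> (UNIV :: 'u set)},
     Ar = {(X, Y, f). X \<prec> (UNIV :: 'u set) \<and> Y \<prec> (UNIV :: 'u set) \<and> f \<in> X \<rightarrow>\<^sub>E Y},
     Dom = (\<lambda>(X, Y, f). X),
     Cod = (\<lambda>(X, Y, f). Y),
     Idt = (\<lambda>X. (X, X, \<lambda>x\<in>X. x)),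
     Cmp = (\<lambda>(Y', Z, g) (X, Y, f). (X, Z, compose X g f))\<rparr>"

type_synonym ('o, 'a, 'p, 'b) functarr =
  "('o, 'a, 'p, 'b) func \<times> ('o, 'a, 'p, 'b) func \<times> ('o \<Rightarrow> 'b)"

definition functor_cat ::
    "('o, 'a) cat \<Rightarrow> ('p, 'b) cat \<Rightarrow> (('o, 'a, 'p, 'b) func, ('o, 'a, 'p, 'b) functarr) cat" where
  "functor_cat A B =
     (let Fun = {F. is_functor A B F \<and> FOb F \<in> extensional (Ob A) \<and> FAr F \<in> extensional (Ar A)}
      in \<lparr>
     Ob = Fun,
     Ar = {(F, G, \<tau>). F \<in> Fun \<and> G \<in> Fun \<and> nat_trans A B F G \<tau> \<and> \<tau> \<in> extensional (Ob A)},
     Dom = (\<lambda>(F, G, \<tau>). F),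
     Cod = (\<lambda>(F, G, \<tau>). G),
     Idt = (\<lambda>F. (F, F, \<lambda>A\<in>Ob A. Idt B (FOb F A))),
     Cmp = (\<lambda>(G', H, \<sigma>) (F, G, \<tau>). (F, H, \<lambda>A\<in>Ob A. Cmp B (\<sigma> A) (\<tau> A)))\<rparr>)"

type_synonym ('o, 'a, 'u) psh = "('o, 'a, 'u set, 'u setarr) func"
type_synonym ('o, 'a, 'u) psharr = "('o, 'a, 'u set, 'u setarr) functarr"

definition presheaves ::
    "('o, 'a) cat \<Rightarrow> (('o, 'a, 'u) psh, ('o, 'a, 'u) psharr) cat" where
  "presheaves A = functor_cat (op_cat A) set_cat"

text \<open>The constant presheaf functor: the inverse image of the canonical geometric morphism from
  \<open>presheaves A\<close> to \<open>set_cat\<close>.\<close>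

definition const_psh :: "('o, 'a) cat \<Rightarrow> 'u set \<Rightarrow> ('o, 'a, 'u) psh" where
  "const_psh A X = \<lparr>FOb = (\<lambda>c\<in>Ob A. X), FAr = (\<lambda>f\<in>Ar A. Idt set_cat X)\<rparr>"

definition const_func ::
    "('o, 'a) cat \<Rightarrow> ('u set, 'u setarr, ('o, 'a, 'u) psh, ('o, 'a, 'u) psharr) func" where
  "const_func A =
     \<lparr>FOb = const_psh A,
      FAr = (\<lambda>h. (const_psh A (Dom set_cat h), const_psh A (Cod set_cat h), \<lambda>c\<in>Ob A. h))\<rparr>"

definition canonical_geom ::
    "('o, 'a) cat \<Rightarrow>
     (('o, 'a, 'u) psh, ('o, 'a, 'u) psharr, 'u set, 'u setarr) geom \<Rightarrow> bool" where
  "canonical_geom A p \<longleftrightarrow> geometric_morphism (presheaves A) set_cat p \<and> inv_im p = const_func A"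

text \<open>Restriction of presheaves along the inclusion of a subcategory \<open>B\<close>.\<close>

definition restrict_psh :: "('o, 'a) cat \<Rightarrow> ('o, 'a, 'u) psh \<Rightarrow> ('o, 'a, 'u) psh" where
  "restrict_psh B P = \<lparr>FOb = restrict (FOb P) (Ob B), FAr = restrict (FAr P) (Ar B)\<rparr>"

definition restrict_func ::
    "('o, 'a) cat \<Rightarrow>
     (('o, 'a, 'u) psh, ('o, 'a, 'u) psharr, ('o, 'a, 'u) psh, ('o, 'a, 'u) psharr) func" where
  "restrict_func B =
     \<lparr>FOb = restrict_psh B,
      FAr = (\<lambda>(P, Q, \<tau>). (restrict_psh B P, restrict_psh B Q, restrict \<tau> (Ob B)))\<rparr>"

definition induced_subtopos ::
    "('o, 'a) cat \<Rightarrow> ('o, 'a) cat \<Rightarrow>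
     (('o, 'a, 'u) psh, ('o, 'a, 'u) psharr, ('o, 'a, 'u) psh, ('o, 'a, 'u) psharr) geom \<Rightarrow>
     bool" where
  "induced_subtopos A B w \<longleftrightarrow>
     subtopos (presheaves A) (presheaves B) w \<and> inv_im w = restrict_func B"

section \<open>Algebras\<close>

definition complex_ring :: "complex ring" where
  "complex_ring = \<lparr>carrier = UNIV, mult = (*), one = 1, zero = 0, add = (+)\<rparr>"

definition subalg :: "('k, 'm) ring_scheme \<Rightarrow> ('k, 'r) module \<Rightarrow> 'r set \<Rightarrow> bool" where
  "subalg K A B \<longleftrightarrow> submodule B K A \<and> subring B A"

definition fg_algebra :: "('k, 'm) ring_scheme \<Rightarrow> ('k, 'r) module \<Rightarrow> bool" where
  "fg_algebra K A \<longleftrightarrow> algebra K A \<and>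
     (\<exists>S. finite S \<and> S \<subseteq> carrier A \<and> (\<forall>B. subalg K A B \<and> S \<subseteq> B \<longrightarrow> B = carrier A))"

definition fg_module :: "('k, 'm) ring_scheme \<Rightarrow> ('k, 'r) module \<Rightarrow> bool" where
  "fg_module K M \<longleftrightarrow> module K M \<and>
     (\<exists>S. finite S \<and> S \<subseteq> carrier M \<and> (\<forall>B. submodule B K M \<and> S \<subseteq> B \<longrightarrow> B = carrier M))"

definition indecomposable :: "('r, 'm) ring_scheme \<Rightarrow> bool" where
  "indecomposable A \<longleftrightarrow> card {e \<in> carrier A. e \<otimes>\<^bsub>A\<^esub> e = e} = 2"

definition weil_algebra :: "('k, 'm) ring_scheme \<Rightarrow> ('k, 'r) module \<Rightarrow> bool" where
  "weil_algebra K A \<longleftrightarrow> algebra K A \<and> fg_module K A \<and>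
     (\<exists>\<mm>. maximalideal \<mm> A \<and> (\<forall>\<nn>. maximalideal \<nn> A \<longrightarrow> \<nn> = \<mm>) \<and>
        (\<lambda>c. \<mm> +>\<^bsub>A\<^esub> (c \<odot>\<^bsub>A\<^esub> \<one>\<^bsub>A\<^esub>)) \<in> ring_iso K (A Quot \<mm>) \<and>
        (\<exists>n :: nat. \<mm> [^]\<^bsub>ideals_set A\<^esub> n = {\<zero>\<^bsub>A\<^esub>}))"

definition alg_hom :: "('k, 'm) ring_scheme \<Rightarrow> ('k, 'r) module \<Rightarrow> ('k, 's) module \<Rightarrow>
    ('r \<Rightarrow> 's) set" where
  "alg_hom K A B = {h \<in> ring_hom A B.
     \<forall>c \<in> carrier K. \<forall>x \<in> carrier A. h (c \<odot>\<^bsub>A\<^esub> x) = c \<odot>\<^bsub>B\<^esub> h x}"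

text \<open>
  A finitely generated complex algebra has at most continuum many elements, hence an isomorphic
  copy whose underlying set is a subset of the type \<open>complex\<close> (the operations of the copy have
  nothing to do with those of \<open>complex\<close>).  So the following category, whose objects are the
  finitely generated indecomposable complex algebras with underlying set of that kind, is a small
  category equivalent to that of all finitely generated indecomposable complex algebras.
\<close>

type_synonym calg = "(complex, complex) module"
type_synonym calgarr = "calg \<times> calg \<times> (complex \<Rightarrow> complex)"

definition fg_indec_algebras :: "(calg, calgarr) cat" where
  "fg_indec_algebras =
     (let Alg = {A :: calg. fg_algebra complex_ring A \<and> indecomposable A}
      in \<lparr>
     Ob = Alg,
     Ar = {(A, B, h). A \<in> Alg \<and> B \<in> Alg \<and>
             h \<in> alg_hom complex_ring A B \<and> h \<in> extensional (carrier A)},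
     Dom = (\<lambda>(A, B, h). A),
     Cod = (\<lambda>(A, B, h). B),
     Idt = (\<lambda>A. (A, A, \<lambda>x\<in>carrier A. x)),
     Cmp = (\<lambda>(B', D, g) (A, B, h). (A, D, compose (carrier A) g h))\<rparr>)"

definition weil_algebras :: "(calg, calgarr) cat" where
  "weil_algebras = full_subcat fg_indec_algebras {A. weil_algebra complex_ring A}"

section \<open>The Gaeta topos and the Weil topos of the complex numbers\<close>

type_synonym 'u calgpsh = "(calg, calgarr, 'u) psh"
type_synonym 'u calgpsharr = "(calg, calgarr, 'u) psharr"

definition gaeta_site :: "(calg, calgarr) cat" where
  "gaeta_site = op_cat fg_indec_algebras"

definition gaeta_topos :: "('u calgpsh, 'u calgpsharr) cat" where
  "gaeta_topos = presheaves gaeta_site"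

definition weil_topos :: "('u calgpsh, 'u calgpsharr) cat" where
  "weil_topos = presheaves (op_cat weil_algebras)"

definition gaeta_canonical :: "('u calgpsh, 'u calgpsharr, 'u set, 'u setarr) geom \<Rightarrow> bool" where
  "gaeta_canonical p \<longleftrightarrow> canonical_geom gaeta_site p"

definition weil_subtopos ::
    "('u calgpsh, 'u calgpsharr, 'u calgpsh, 'u calgpsharr) geom \<Rightarrow> bool" where
  "weil_subtopos w \<longleftrightarrow> induced_subtopos gaeta_site (op_cat weil_algebras) w"

end

theory Submission
  imports Defs "HOL-Computational_Algebra.Fundamental_Theorem_Algebra" "HOL-Analysis.Continuum_Not_Denumerable"
begin

text \<open>If \<open>k\<close> is a subquality, then the canonical comparison from constant to codiscrete presheaves
  becomes invertible after sheafification, so for every algebra \<open>B\<close> the homomorphisms out of \<open>B\<close>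
  that are constant on points form a covering sieve. By the Nullstellensatz such a homomorphism has
  nilpotent fluctuation, and so its image is a Weil algebra; therefore every \<open>k\<close>-sheaf is the right
  Kan extension of its restriction to Weil algebras, and \<open>k\<close> lies below the Weil subtopos. Conversely
  \<open>\<complex>\<close> is both initial and terminal among Weil algebras, which makes the Weil topos a quality
  type, and left Kan extension makes it essential.\<close>

text \<open>The step from the comparison to the sieves works as follows. Let \<open>T\<close> be the
  codiscrete presheaf on the set of points of an algebra \<open>a\<close>: its elements at
  \<open>d\<close> are the functions from the points of \<open>d\<close> to the points of
  \<open>a\<close>. The identity function of the points of \<open>a\<close> is an element of
  \<open>T\<close> at \<open>a\<close>. Pulling the inclusion of the constant functions back along
  it leaves exactly the homomorphisms out of \<open>a\<close> that are constant on points.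
  Sheafification preserves this pullback and inverts the inclusion of constants, hence it inverts
  the inclusion of the sieve into the representable presheaf. The topos side is kept apart from
  algebra by an abstract site with one distinguished object, initial among all objects and terminal
  among the Weil ones; algebras enter only through points and image factorizations. Functors are
  covariant on algebras, so sieves consist of arrows out of an object. The Nullstellensatz rests on
  the uncountability of \<complex>, which turns a non-nilpotent element into a point where it does
  not vanish.\<close>

section \<open>Small sets\<close>

text \<open>Sets over any type may be small, since only cardinalities are compared. Sets of arrows,
  of functions and of equivalence classes can therefore serve as carriers before
  \<open>small_enc\<close> moves them into the universe.\<close>

abbreviation (input) small_in :: "'u itself \<Rightarrow> 'z set \<Rightarrow> bool" where
  "small_in U X \<equiv> X \<prec> (UNIV :: 'u set)"

locale universe =
  fixes U :: "'u itself"
  assumes inaccessible: "strongly_inaccessible TYPE('u)"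
begin

lemma small_lepoll: "X \<lesssim> Y \<Longrightarrow> small_in U Y \<Longrightarrow> small_in U X"
  by (rule lesspoll_trans1)

lemma small_subset: "small_in U Y \<Longrightarrow> X \<subseteq> Y \<Longrightarrow> small_in U X"
  by (meson small_lepoll subset_imp_lepoll)

lemma small_image: "small_in U X \<Longrightarrow> small_in U (f ` X)"
  by (meson small_lepoll image_lepoll)

lemma small_enc:
  assumes "small_in U X" obtains e :: "'z \<Rightarrow> 'u" where "inj_on e X"
  using assms unfolding lesspoll_def lepoll_def by blast

lemma small_nat: "small_in U (UNIV :: nat set)"
  using inaccessible by (simp add: strongly_inaccessible_def)

lemma infinite_U: "infinite (UNIV :: 'u set)"
  using small_nat lesspoll_imp_lepoll infinite_le_lepoll by blast

lemma small_countable: "countable X \<Longrightarrow> small_in U X"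
  using small_lepoll[OF _ small_nat] by (auto simp: countable_def lepoll_def)

lemma small_finite: "finite X \<Longrightarrow> small_in U X"
  by (simp add: small_countable countable_finite)

text \<open>The closure hypothesis speaks of subsets of \<open>'u\<close> only, so the set is first
  moved there by an injection.\<close>

lemma small_Pow:
  assumes "small_in U (X :: 'z set)" shows "small_in U (Pow X)"
proof -
  obtain e :: "'z \<Rightarrow> 'u" where e: "inj_on e X" using small_enc[OF assms] .
  have "Pow X \<lesssim> Pow (e ` X)"
    unfolding lepoll_def using e by (intro exI[of _ "image e"]) (auto simp: inj_on_image_Pow)
  moreover have "small_in U (Pow (e ` X))"
    using inaccessible small_image[OF assms, of e] by (simp add: strongly_inaccessible_def)
  ultimately show ?thesis by (rule small_lepoll)
qed

lemma small_UN_U: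
  fixes X :: "'u \<Rightarrow> 'u set"
  assumes "small_in U I" "\<And>i. i \<in> I \<Longrightarrow> small_in U (X i)" shows "small_in U (\<Union>i\<in>I. X i)"
  using inaccessible[unfolded strongly_inaccessible_def, THEN conjunct2, THEN conjunct2, rule_format, of I X] assms
  by blast

text \<open>Regularity bounds unions of families indexed by \<open>'u\<close>. Index set and fibres
  are both encoded in \<open>'u\<close>, and tagging each element with its index makes the fibres
  disjoint.\<close>

lemma small_Sigma:
  assumes I: "small_in U (I :: 'i set)" and X: "\<And>i. i \<in> I \<Longrightarrow> small_in U (X i :: 'z set)"
  shows "small_in U (Sigma I X)"
proof -
  obtain e :: "'i \<Rightarrow> 'u" where e: "inj_on e I" using small_enc[OF I] .
  have "\<exists>e :: 'z \<Rightarrow> 'u. inj_on e (X i)" if "i \<in> I" for i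
    using X[OF that] by (meson small_enc)
  then obtain d :: "'i \<Rightarrow> 'z \<Rightarrow> 'u" where d: "\<And>i. i \<in> I \<Longrightarrow> inj_on (d i) (X i)" by metis
  \<comment> \<open>An infinite type is equipollent to its square; this supplies the pairing
    function that does the tagging.\<close>
  have "(UNIV :: ('u \<times> 'u) set) \<approx> (UNIV :: 'u set)"
    using card_of_Times_same_infinite[OF infinite_U] by (simp add: eqpoll_iff_card_of_ordIso)
  then obtain pr :: "'u \<times> 'u \<Rightarrow> 'u" where pr: "inj pr"
    unfolding eqpoll_def bij_betw_def by blast
  let ?Y = "\<lambda>j. (\<lambda>x. pr (j, x)) ` (d (inv_into I e j) ` X (inv_into I e j))"
  have "small_in U (?Y j)" if "j \<in> e ` I" for j
    using that by (intro small_image X) (auto simp: inv_into_into)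
  then have "small_in U (\<Union>j \<in> e ` I. ?Y j)"
    using small_image[OF I, of e] by (intro small_UN_U)
  moreover have "Sigma I X \<lesssim> (\<Union>j \<in> e ` I. ?Y j)"
    unfolding lepoll_def
  proof (intro exI conjI)
    show "inj_on (\<lambda>(i, x). pr (e i, d i x)) (Sigma I X)"
    proof (intro inj_onI, clarify)
      fix i x j y
      assume ij: "i \<in> I" "x \<in> X i" "j \<in> I" "y \<in> X j" and eq: "pr (e i, d i x) = pr (e j, d j y)"
      have "(e i, d i x) = (e j, d j y)" using injD[OF pr eq] .
      then have "e i = e j" "d i x = d j y" by simp_all
      then have "i = j" using e ij by (meson inj_onD)
      with \<open>d i x = d j y\<close> show "i = j \<and> x = y" using d[of i] ij by (metis inj_onD)
    qed
    show "(\<lambda>(i, x). pr (e i, d i x)) ` Sigma I X \<subseteq> (\<Union>j \<in> e ` I. ?Y j)"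
      using e by (auto simp: image_iff)
  qed
  ultimately show ?thesis using small_lepoll by blast
qed

lemma small_Times: "small_in U X \<Longrightarrow> small_in U Y \<Longrightarrow> small_in U (X \<times> Y)"
  by (intro small_Sigma)

lemma small_UN: "small_in U I \<Longrightarrow> (\<And>i. i \<in> I \<Longrightarrow> small_in U (X i)) \<Longrightarrow> small_in U (\<Union>i\<in>I. X i)"
  using small_image[OF small_Sigma, of I X snd] by (simp add: snd_image_Sigma)

text \<open>A function on \<open>I\<close> is determined by its graph, a subset of the disjoint
  sum.\<close>

lemma small_PiE:
  assumes I: "small_in U (I :: 'i set)" and X: "\<And>i. i \<in> I \<Longrightarrow> small_in U (X i :: 'z set)"
  shows "small_in U (Pi\<^sub>E I X)"
proof -
  have "Pi\<^sub>E I X \<lesssim> Pow (Sigma I X)"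
    unfolding lepoll_def
  proof (intro exI conjI)
    show "inj_on (\<lambda>f. {(i, f i) | i. i \<in> I}) (Pi\<^sub>E I X)"
    proof (rule inj_onI)
      fix f g assume fg: "f \<in> Pi\<^sub>E I X" "g \<in> Pi\<^sub>E I X"
        and "{(i, f i) | i. i \<in> I} = {(i, g i) | i. i \<in> I}"
      then have "f i = g i" if "i \<in> I" for i using that by blast
      with fg show "f = g" by (meson PiE_ext)
    qed
  qed (auto simp: PiE_iff)
  moreover have "small_in U (Pow (Sigma I X))" by (intro small_Pow small_Sigma I X)
  ultimately show ?thesis by (rule small_lepoll)
qed

lemma small_fun:
  assumes "small_in U (UNIV :: 'a set)" "small_in U (UNIV :: 'b set)" shows "small_in U (UNIV :: ('a \<Rightarrow> 'b) set)"
  using small_PiE[OF assms(1), of "\<lambda>_. UNIV"] assms(2) by simp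

lemma small_inj: "inj f \<Longrightarrow> small_in U (UNIV :: 'b set) \<Longrightarrow> small_in U (UNIV :: 'a set)" for f :: "'a \<Rightarrow> 'b"
  by (meson small_lepoll lepoll_def subset_UNIV)

lemma small_prod: "small_in U (UNIV :: 'a set) \<Longrightarrow> small_in U (UNIV :: 'b set) \<Longrightarrow> small_in U (UNIV :: ('a \<times> 'b) set)"
  using small_Times[of UNIV UNIV] by simp

text \<open>A real number is determined by the rationals below it, so the continuum is bounded by
  the power set of a countable set.\<close>

lemma small_real: "small_in U (UNIV :: real set)"
proof -
  have "inj (\<lambda>x::real. {q :: rat. of_rat q < x})"
  proof (rule linorder_injI)
    fix x y :: real assume "x < y"
    then obtain q where "x < of_rat q" "of_rat q < y" using of_rat_dense by blast
    then show "{q. of_rat q < x} \<noteq> {q. of_rat q < y}" by (metis mem_Collect_eq less_asym)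
  qed
  moreover have "small_in U (UNIV :: rat set set)"
    using small_Pow[OF small_countable[of "UNIV :: rat set"]] by simp
  ultimately show ?thesis by (rule small_inj)
qed

lemma small_complex: "small_in U (UNIV :: complex set)"
  by (rule small_inj[of "\<lambda>z. (Re z, Im z)"])
    (auto intro!: injI small_prod small_real simp: complex_eq_iff)

lemma small_bool: "small_in U (UNIV :: bool set)"
  by (simp add: small_finite)

text \<open>An algebra on a subset of \<complex> is a membership predicate with a tuple of
  operations on \<complex>, so the type of all such records is small.\<close>

lemma small_calgarr: "small_in U (UNIV :: calgarr set)"
proof -
  have "inj (\<lambda>A :: calg. (\<lambda>x. x \<in> carrier A, monoid.mult A, monoid.one A, ring.zero A, ring.add A, module.smult A))"
    by (intro injI) (auto intro!: module.equality simp: fun_eq_iff)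
  then have "small_in U (UNIV :: calg set)"
    by (rule small_inj) (intro small_prod small_fun small_complex small_bool)
  then show ?thesis by (intro small_prod small_fun small_complex)
qed

end

section \<open>Presheaf toposes\<close>

lemma Hom_Ar: "f \<in> Hom C A B \<Longrightarrow> f \<in> Ar C"
  and Hom_Dom: "f \<in> Hom C A B \<Longrightarrow> Dom C f = A"
  and Hom_Cod: "f \<in> Hom C A B \<Longrightarrow> Cod C f = B"
  by (auto simp: Hom_def)

lemma Ar_Hom: "f \<in> Ar C \<Longrightarrow> f \<in> Hom C (Dom C f) (Cod C f)"
  by (simp add: Hom_def)

context category
begin

lemma Hom_Ob: "f \<in> Hom C A B \<Longrightarrow> A \<in> Ob C" "f \<in> Hom C A B \<Longrightarrow> B \<in> Ob C"
  using dom_in cod_in by (auto simp: Hom_def)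

lemma cmp_id_right: "f \<in> Hom C A B \<Longrightarrow> Cmp C f (Idt C A) = f"
  and cmp_id_left: "f \<in> Hom C A B \<Longrightarrow> Cmp C (Idt C B) f = f"
  using cmp_idt idt_cmp by (auto simp: Hom_def)

end

text \<open>Interface to the category of all functors from \<open>A\<close> to small sets. The two
  existence axioms say that every small functor and every natural family is represented. Functor
  categories and the category of sets itself are both instances, so limits, exponentials and the
  subobject classifier are constructed only once.\<close>

locale presheaf_model = universe U + A: category A + E: category E
  for U :: "'u itself" and A :: "('c, 'f) cat" and E :: "('o, 'a) cat" +
  fixes el :: "'o \<Rightarrow> 'c \<Rightarrow> 'u set" and act :: "'o \<Rightarrow> 'f \<Rightarrow> 'u \<Rightarrow> 'u" and app :: "'a \<Rightarrow> 'c \<Rightarrow> 'u \<Rightarrow> 'u"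
  assumes small_Ar: "small_in U (Ar A)"
    and el_small: "F \<in> Ob E \<Longrightarrow> c \<in> Ob A \<Longrightarrow> small_in U (el F c)"
    and act_in: "F \<in> Ob E \<Longrightarrow> f \<in> Hom A c d \<Longrightarrow> x \<in> el F c \<Longrightarrow> act F f x \<in> el F d"
    and act_idt: "F \<in> Ob E \<Longrightarrow> c \<in> Ob A \<Longrightarrow> x \<in> el F c \<Longrightarrow> act F (Idt A c) x = x"
    and act_cmp: "F \<in> Ob E \<Longrightarrow> f \<in> Hom A c d \<Longrightarrow> g \<in> Hom A d e \<Longrightarrow> x \<in> el F c \<Longrightarrow>
      act F (Cmp A g f) x = act F g (act F f x)"
    and app_in: "t \<in> Hom E F G \<Longrightarrow> c \<in> Ob A \<Longrightarrow> x \<in> el F c \<Longrightarrow> app t c x \<in> el G c"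
    and app_nat: "t \<in> Hom E F G \<Longrightarrow> f \<in> Hom A c d \<Longrightarrow> x \<in> el F c \<Longrightarrow>
      app t d (act F f x) = act G f (app t c x)"
    and app_idt: "F \<in> Ob E \<Longrightarrow> c \<in> Ob A \<Longrightarrow> x \<in> el F c \<Longrightarrow> app (Idt E F) c x = x"
    and app_cmp: "s \<in> Hom E F G \<Longrightarrow> t \<in> Hom E G H \<Longrightarrow> c \<in> Ob A \<Longrightarrow> x \<in> el F c \<Longrightarrow>
      app (Cmp E t s) c x = app t c (app s c x)"
    and arr_ext: "s \<in> Hom E F G \<Longrightarrow> t \<in> Hom E F G \<Longrightarrow>
      (\<And>c x. c \<in> Ob A \<Longrightarrow> x \<in> el F c \<Longrightarrow> app s c x = app t c x) \<Longrightarrow> s = t"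
    and arr_ex: "F \<in> Ob E \<Longrightarrow> G \<in> Ob E \<Longrightarrow>
      (\<And>c x. c \<in> Ob A \<Longrightarrow> x \<in> el F c \<Longrightarrow> m c x \<in> el G c) \<Longrightarrow>
      (\<And>f c d x. f \<in> Hom A c d \<Longrightarrow> x \<in> el F c \<Longrightarrow> m d (act F f x) = act G f (m c x)) \<Longrightarrow>
      \<exists>t \<in> Hom E F G. \<forall>c \<in> Ob A. \<forall>x \<in> el F c. app t c x = m c x"
    and obj_ex: "(\<And>c. c \<in> Ob A \<Longrightarrow> small_in U (ob c)) \<Longrightarrow>
      (\<And>f c d x. f \<in> Hom A c d \<Longrightarrow> x \<in> ob c \<Longrightarrow> ac f x \<in> ob d) \<Longrightarrow>
      (\<And>c x. c \<in> Ob A \<Longrightarrow> x \<in> ob c \<Longrightarrow> ac (Idt A c) x = x) \<Longrightarrow>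
      (\<And>f g c d e x. f \<in> Hom A c d \<Longrightarrow> g \<in> Hom A d e \<Longrightarrow> x \<in> ob c \<Longrightarrow>
        ac (Cmp A g f) x = ac g (ac f x)) \<Longrightarrow>
      \<exists>F \<in> Ob E. (\<forall>c \<in> Ob A. el F c = ob c) \<and>
        (\<forall>c d. \<forall>f \<in> Hom A c d. \<forall>x \<in> ob c. act F f x = ac f x)"
begin

lemma arrE:
  assumes "F \<in> Ob E" "G \<in> Ob E" "\<And>c x. c \<in> Ob A \<Longrightarrow> x \<in> el F c \<Longrightarrow> m c x \<in> el G c"
    "\<And>f c d x. f \<in> Hom A c d \<Longrightarrow> x \<in> el F c \<Longrightarrow> m d (act F f x) = act G f (m c x)"
  obtains t where "t \<in> Hom E F G" "\<And>c x. c \<in> Ob A \<Longrightarrow> x \<in> el F c \<Longrightarrow> app t c x = m c x"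
  using arr_ex[of F G m, OF assms] by blast

text \<open>\<open>obj_ex\<close> builds objects whose elements lie in \<open>'u\<close>. Here the
  elements may be of any type: \<open>i\<close> encodes them, \<open>r\<close> decodes them, and the
  action is conjugated by this bijection. Exponentials, the classifier and Kan extensions arise in
  this way.\<close>

lemma objE:
  fixes ob :: "'c \<Rightarrow> 'z set"
  assumes sm: "\<And>c. c \<in> Ob A \<Longrightarrow> small_in U (ob c)"
    and maps: "\<And>f c d x. f \<in> Hom A c d \<Longrightarrow> x \<in> ob c \<Longrightarrow> ac f x \<in> ob d"
    and idt: "\<And>c x. c \<in> Ob A \<Longrightarrow> x \<in> ob c \<Longrightarrow> ac (Idt A c) x = x"
    and cmp: "\<And>f g c d e x. f \<in> Hom A c d \<Longrightarrow> g \<in> Hom A d e \<Longrightarrow> x \<in> ob c \<Longrightarrow>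
        ac (Cmp A g f) x = ac g (ac f x)"
  obtains F i r where "F \<in> Ob E"
    "\<And>c x. c \<in> Ob A \<Longrightarrow> x \<in> ob c \<Longrightarrow> i c x \<in> el F c"
    "\<And>c y. c \<in> Ob A \<Longrightarrow> y \<in> el F c \<Longrightarrow> r c y \<in> ob c"
    "\<And>c x. c \<in> Ob A \<Longrightarrow> x \<in> ob c \<Longrightarrow> r c (i c x) = x"
    "\<And>c y. c \<in> Ob A \<Longrightarrow> y \<in> el F c \<Longrightarrow> i c (r c y) = y"
    "\<And>c d f x. f \<in> Hom A c d \<Longrightarrow> x \<in> ob c \<Longrightarrow> act F f (i c x) = i d (ac f x)"
    "\<And>c d f y. f \<in> Hom A c d \<Longrightarrow> y \<in> el F c \<Longrightarrow> r d (act F f y) = ac f (r c y)"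
proof -
  have "\<exists>e :: 'z \<Rightarrow> 'u. inj_on e (ob c)" if "c \<in> Ob A" for c
    using sm[OF that] by (meson small_enc)
  then obtain i :: "'c \<Rightarrow> 'z \<Rightarrow> 'u" where i: "\<And>c. c \<in> Ob A \<Longrightarrow> inj_on (i c) (ob c)" by metis
  define r where "r = (\<lambda>c. inv_into (ob c) (i c))"
  have ri: "r c (i c x) = x" if "c \<in> Ob A" "x \<in> ob c" for c x
    using i that by (simp add: r_def)
  define ac' where "ac' = (\<lambda>f y. i (Cod A f) (ac f (r (Dom A f) y)))"
  have ac': "ac' f (i c x) = i d (ac f x)" if "f \<in> Hom A c d" "x \<in> ob c" for c d f x
    using that ri A.Hom_Ob[OF that(1)] by (simp add: ac'_def Hom_Cod[OF that(1)] Hom_Dom[OF that(1)])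
  have "\<exists>F \<in> Ob E. (\<forall>c \<in> Ob A. el F c = i c ` ob c) \<and>
        (\<forall>c d. \<forall>f \<in> Hom A c d. \<forall>x \<in> i c ` ob c. act F f x = ac' f x)"
  proof (rule obj_ex)
    fix c assume "c \<in> Ob A" then show "small_in U (i c ` ob c)" by (intro small_image sm)
  next
    fix f c d x assume f: "f \<in> Hom A c d" and "x \<in> i c ` ob c"
    then show "ac' f x \<in> i d ` ob d" using ac'[OF f] maps[OF f] by auto
  next
    fix c x assume c: "c \<in> Ob A" and "x \<in> i c ` ob c"
    then show "ac' (Idt A c) x = x" using ac'[OF A.idt_in[OF c]] idt[OF c] by auto
  next
    fix f g c d e x assume f: "f \<in> Hom A c d" and g: "g \<in> Hom A d e" and "x \<in> i c ` ob c"
    then show "ac' (Cmp A g f) x = ac' g (ac' f x)"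
      using ac'[OF f] ac'[OF g] ac'[OF A.cmp_in[OF f g]] maps[OF f] cmp[OF f g] by auto
  qed
  then obtain F where F: "F \<in> Ob E" and el: "\<And>c. c \<in> Ob A \<Longrightarrow> el F c = i c ` ob c"
    and act: "\<And>c d f x. f \<in> Hom A c d \<Longrightarrow> x \<in> i c ` ob c \<Longrightarrow> act F f x = ac' f x"
    unfolding Bex_def Ball_def by (elim exE conjE) (rule that, assumption, blast+)
  show thesis
  proof (rule that[OF F, of i r])
    fix c x assume "c \<in> Ob A" "x \<in> ob c" then show "i c x \<in> el F c" "r c (i c x) = x"
      using el ri by auto
  next
    fix c y assume "c \<in> Ob A" "y \<in> el F c" then show "r c y \<in> ob c" "i c (r c y) = y"
      using el ri by auto
  next
    fix c d f x assume "f \<in> Hom A c d" "x \<in> ob c" then show "act F f (i c x) = i d (ac f x)"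
      using act ac' by auto
  next
    fix c d f y assume f: "f \<in> Hom A c d" and "y \<in> el F c" then show "r d (act F f y) = ac f (r c y)"
      using act[OF f] ac'[OF f] A.Hom_Ob[OF f] ri el maps[OF f] by auto
  qed
qed

lemma small_Hom: "small_in U (Hom A c d)"
  by (rule small_subset[OF small_Ar]) (auto simp: Hom_def)

text \<open>The functor of arrows out of \<open>c\<close>, encoded through \<open>i\<close> and
  \<open>r\<close>. The last clause is the existence half of the Yoneda lemma.\<close>

lemma representable:
  assumes c: "c \<in> Ob A"
  obtains Y i r where "Y \<in> Ob E"
    "\<And>d f. f \<in> Hom A c d \<Longrightarrow> i d f \<in> el Y d"
    "\<And>d y. d \<in> Ob A \<Longrightarrow> y \<in> el Y d \<Longrightarrow> r d y \<in> Hom A c d"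
    "\<And>d f. f \<in> Hom A c d \<Longrightarrow> r d (i d f) = f"
    "\<And>d y. d \<in> Ob A \<Longrightarrow> y \<in> el Y d \<Longrightarrow> i d (r d y) = y"
    "\<And>d e f g. f \<in> Hom A c d \<Longrightarrow> g \<in> Hom A d e \<Longrightarrow> act Y g (i d f) = i e (Cmp A g f)"
    "\<And>F x. F \<in> Ob E \<Longrightarrow> x \<in> el F c \<Longrightarrow> \<exists>t \<in> Hom E Y F. \<forall>d. \<forall>f \<in> Hom A c d. app t d (i d f) = act F f x"
proof -
  obtain Y i r where Y: "Y \<in> Ob E"
    and i: "\<And>d f. d \<in> Ob A \<Longrightarrow> f \<in> Hom A c d \<Longrightarrow> i d f \<in> el Y d"
    and r: "\<And>d y. d \<in> Ob A \<Longrightarrow> y \<in> el Y d \<Longrightarrow> r d y \<in> Hom A c d"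
    and ri: "\<And>d f. d \<in> Ob A \<Longrightarrow> f \<in> Hom A c d \<Longrightarrow> r d (i d f) = f"
    and ir: "\<And>d y. d \<in> Ob A \<Longrightarrow> y \<in> el Y d \<Longrightarrow> i d (r d y) = y"
    and act: "\<And>d e g f. g \<in> Hom A d e \<Longrightarrow> f \<in> Hom A c d \<Longrightarrow> act Y g (i d f) = i e (Cmp A g f)"
    and actr: "\<And>d e g y. g \<in> Hom A d e \<Longrightarrow> y \<in> el Y d \<Longrightarrow> r e (act Y g y) = Cmp A g (r d y)"
    by (rule objE[of "\<lambda>d. Hom A c d" "\<lambda>g f. Cmp A g f"])
      (auto intro: small_Hom A.cmp_in A.cmp_id_left A.cmp_assoc[symmetric])
  show thesis
  proof (rule that[OF Y, of i r])
    fix F x assume F: "F \<in> Ob E" and x: "x \<in> el F c"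
    obtain t where t: "t \<in> Hom E Y F" "\<And>d y. d \<in> Ob A \<Longrightarrow> y \<in> el Y d \<Longrightarrow> app t d y = act F (r d y) x"
    proof (rule arrE[OF Y F, of "\<lambda>d y. act F (r d y) x"])
      fix g d e y assume g: "g \<in> Hom A d e" and y: "y \<in> el Y d"
      have "r d y \<in> Hom A c d" using r y A.Hom_Ob g by blast
      with g y show "act F (r e (act Y g y)) x = act F g (act F (r d y) x)"
        using actr[OF g y] act_cmp[OF F _ g x, of "r d y"] by simp
    qed (use r act_in[OF F _ x] in auto)
    have "app t d (i d f) = act F f x" if "f \<in> Hom A c d" for d f
      using that A.Hom_Ob[OF that] i ri t(2) by simp
    with t(1) show "\<exists>t \<in> Hom E Y F. \<forall>d. \<forall>f \<in> Hom A c d. app t d (i d f) = act F f x" by blast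
  qed (use A.Hom_Ob i r ri ir act in blast)+
qed

text \<open>The generic element \<open>u\<close> is the encoded identity of \<open>c\<close>. It
  turns elements of \<open>F\<close> at \<open>c\<close> into arrows out of \<open>Y\<close>, so
  that universal properties, which are stated with arrows, can be tested on elements.\<close>

lemma yoneda:
  assumes c: "c \<in> Ob A"
  obtains Y u where "Y \<in> Ob E" "u \<in> el Y c"
    "\<And>F x. F \<in> Ob E \<Longrightarrow> x \<in> el F c \<Longrightarrow> \<exists>t \<in> Hom E Y F. app t c u = x"
    "\<And>F s t. s \<in> Hom E Y F \<Longrightarrow> t \<in> Hom E Y F \<Longrightarrow> app s c u = app t c u \<Longrightarrow> s = t"
proof -
  obtain Y i r where Y: "Y \<in> Ob E"
    and i: "\<And>d f. f \<in> Hom A c d \<Longrightarrow> i d f \<in> el Y d"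
    and r: "\<And>d y. d \<in> Ob A \<Longrightarrow> y \<in> el Y d \<Longrightarrow> r d y \<in> Hom A c d"
    and ri: "\<And>d f. f \<in> Hom A c d \<Longrightarrow> r d (i d f) = f"
    and ir: "\<And>d y. d \<in> Ob A \<Longrightarrow> y \<in> el Y d \<Longrightarrow> i d (r d y) = y"
    and act: "\<And>d e f g. f \<in> Hom A c d \<Longrightarrow> g \<in> Hom A d e \<Longrightarrow> act Y g (i d f) = i e (Cmp A g f)"
    and ex: "\<And>F x. F \<in> Ob E \<Longrightarrow> x \<in> el F c \<Longrightarrow> \<exists>t \<in> Hom E Y F. \<forall>d. \<forall>f \<in> Hom A c d. app t d (i d f) = act F f x"
    by (rule representable[OF c]) blast
  note id = A.idt_in[OF c]
  show thesis
  proof (rule that[OF Y i[OF id]])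
    fix F x assume F: "F \<in> Ob E" "x \<in> el F c"
    then show "\<exists>t \<in> Hom E Y F. app t c (i c (Idt A c)) = x"
      using ex[OF F] id act_idt[OF F(1) c F(2)] by metis
  next
    fix F s t assume s: "s \<in> Hom E Y F" and t: "t \<in> Hom E Y F"
      and eq: "app s c (i c (Idt A c)) = app t c (i c (Idt A c))"
    show "s = t"
    proof (rule arr_ext[OF s t])
      fix d y assume d: "d \<in> Ob A" and y: "y \<in> el Y d"
      have f: "r d y \<in> Hom A c d" using r d y .
      have "y = act Y (r d y) (i c (Idt A c))"
        using act[OF id f] A.cmp_id_right[OF f] ir[OF d y] by simp
      then show "app s d y = app t d y"
        using app_nat[OF s f i[OF id]] app_nat[OF t f i[OF id]] eq by simp
    qed
  qed
qed

text \<open>Pointwise inverses of a natural family are again natural, so invertibility can be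
  checked at each object.\<close>

lemma iso_arrow_iff:
  assumes t: "t \<in> Hom E F G"
  shows "iso_arrow E t \<longleftrightarrow> (\<forall>c \<in> Ob A. bij_betw (app t c) (el F c) (el G c))"
proof
  assume "iso_arrow E t"
  then obtain s where s: "s \<in> Hom E G F" "Cmp E s t = Idt E F" "Cmp E t s = Idt E G"
    using t by (auto simp: iso_arrow_def Hom_def)
  have "app s c (app t c x) = x" if "c \<in> Ob A" "x \<in> el F c" for c x
    using app_cmp[OF t s(1) that] app_idt[OF _ that] E.Hom_Ob[OF t] s(2) by simp
  moreover have "app t c (app s c x) = x" if "c \<in> Ob A" "x \<in> el G c" for c x
    using app_cmp[OF s(1) t that] app_idt[OF _ that] E.Hom_Ob[OF t] s(3) by simp
  ultimately show "\<forall>c \<in> Ob A. bij_betw (app t c) (el F c) (el G c)"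
    using app_in[OF t] app_in[OF s(1)] by (intro ballI bij_betwI[where g = "app s _"]) blast+
next
  assume bij: "\<forall>c \<in> Ob A. bij_betw (app t c) (el F c) (el G c)"
  define v where "v = (\<lambda>c. inv_into (el F c) (app t c))"
  have v: "v c y \<in> el F c" "app t c (v c y) = y" if "c \<in> Ob A" "y \<in> el G c" for c y
    using that bij bij_betw_imp_surj_on[of "app t c" "el F c" "el G c"]
    by (auto simp: v_def inv_into_into f_inv_into_f)
  have tv: "v c (app t c x) = x" if "c \<in> Ob A" "x \<in> el F c" for c x
    using that bij by (metis v_def bij_betw_inv_into_left)
  obtain s where s: "s \<in> Hom E G F" "\<And>c x. c \<in> Ob A \<Longrightarrow> x \<in> el G c \<Longrightarrow> app s c x = v c x"
  proof (rule arrE[of G F v])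
    fix f c d y assume f: "f \<in> Hom A c d" and y: "y \<in> el G c"
    have cd: "c \<in> Ob A" "d \<in> Ob A" using A.Hom_Ob[OF f] by auto
    have "v d (act G f y) = v d (app t d (act F f (v c y)))"
      using app_nat[OF t f v(1)[OF cd(1) y]] v(2)[OF cd(1) y] by simp
    also have "\<dots> = act F f (v c y)"
      using tv[OF cd(2)] act_in[OF _ f v(1)[OF cd(1) y]] E.Hom_Ob[OF t] by simp
    finally show "v d (act G f y) = act F f (v c y)" .
  qed (use v E.Hom_Ob[OF t] in auto)
  have "Cmp E s t = Idt E F"
    by (rule arr_ext[OF E.cmp_in[OF t s(1)] E.idt_in])
      (use E.Hom_Ob[OF t] app_cmp[OF t s(1)] app_idt app_in[OF t] s(2) tv in auto)
  moreover have "Cmp E t s = Idt E G"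
    by (rule arr_ext[OF E.cmp_in[OF s(1) t] E.idt_in])
      (use E.Hom_Ob[OF t] app_cmp[OF s(1) t] app_idt app_in[OF s(1)] s(2) v in auto)
  ultimately show "iso_arrow E t"
    using s(1) t Hom_Dom[OF t] Hom_Cod[OF t] Hom_Ar[OF t] unfolding iso_arrow_def by auto
qed

section \<open>Finite limits, computed elementwise\<close>

lemma terminalI:
  assumes "T \<in> Ob E" "\<And>c. c \<in> Ob A \<Longrightarrow> \<exists>!x. x \<in> el T c"
  shows "terminal E T"
  unfolding terminal_def
proof (intro conjI ballI assms(1))
  fix F assume F: "F \<in> Ob E"
  define p where "p = (\<lambda>c. THE x. x \<in> el T c)"
  have p: "p c \<in> el T c" "x \<in> el T c \<Longrightarrow> x = p c" if "c \<in> Ob A" for c x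
    using theI'[OF assms(2)[OF that]] assms(2)[OF that] by (auto simp: p_def)
  obtain t where t: "t \<in> Hom E F T"
    by (rule arrE[OF F assms(1), of "\<lambda>c x. p c"]) (use p act_in[OF assms(1)] A.Hom_Ob in metis)+
  show "\<exists>!f. f \<in> Hom E F T"
  proof (intro ex1I[of _ t] t)
    fix f assume f: "f \<in> Hom E F T"
    show "f = t" by (rule arr_ext[OF f t]) (metis p(2) app_in f t)
  qed
qed

text \<open>Elements of \<open>T\<close> at \<open>c\<close> correspond to arrows from the
  representable at \<open>c\<close>, and there is exactly one such arrow.\<close>

lemma terminalD:
  assumes "terminal E T" "c \<in> Ob A"
  shows "\<exists>!x. x \<in> el T c"
proof -
  obtain Y u where Y: "Y \<in> Ob E" "u \<in> el Y c"
    "\<And>F x. F \<in> Ob E \<Longrightarrow> x \<in> el F c \<Longrightarrow> \<exists>t \<in> Hom E Y F. app t c u = x" 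
    using yoneda[OF assms(2)] by metis
  have T: "T \<in> Ob E" "\<exists>!f. f \<in> Hom E Y T" using assms(1) Y(1) by (auto simp: terminal_def)
  then show ?thesis using Y(3)[OF T(1)] app_in[OF _ assms(2) Y(2)] by metis
qed

lemma ex_terminal: "\<exists>T. terminal E T"
proof -
  obtain T i r where T: "T \<in> Ob E"
    and i: "\<And>c x. c \<in> Ob A \<Longrightarrow> x \<in> {()} \<Longrightarrow> i c x \<in> el T c"
    and r: "\<And>c y. c \<in> Ob A \<Longrightarrow> y \<in> el T c \<Longrightarrow> i c (r c y) = y"
    by (rule objE[of "\<lambda>c. {()}" "\<lambda>f x. x"]) (auto intro: small_finite)
  have "terminal E T"
  proof (rule terminalI[OF T])
    fix c assume c: "c \<in> Ob A"
    have "y = i c ()" if "y \<in> el T c" for y using r[OF c that] by simp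
    then show "\<exists>!x. x \<in> el T c" using i[OF c] by blast
  qed
  then show ?thesis ..
qed

lemma is_pullbackI:
  assumes f: "f \<in> Hom E X Z" and g: "g \<in> Hom E Y Z" and p: "p \<in> Hom E P X" and q: "q \<in> Hom E P Y"
    and comm: "\<And>c z. c \<in> Ob A \<Longrightarrow> z \<in> el P c \<Longrightarrow> app f c (app p c z) = app g c (app q c z)"
    and ex: "\<And>c x y. c \<in> Ob A \<Longrightarrow> x \<in> el X c \<Longrightarrow> y \<in> el Y c \<Longrightarrow> app f c x = app g c y \<Longrightarrow>
      \<exists>!z. z \<in> el P c \<and> app p c z = x \<and> app q c z = y"
  shows "is_pullback E f g p q"
  unfolding is_pullback_def
proof (intro conjI allI ballI impI)
  note dc = Hom_Dom[OF f] Hom_Cod[OF f] Hom_Dom[OF g] Hom_Cod[OF g] Hom_Dom[OF p] Hom_Dom[OF q]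
  note ob = E.Hom_Ob[OF f] E.Hom_Ob[OF p] E.Hom_Ob[OF g]
  show "f \<in> Ar E" "g \<in> Ar E" "Cod E f = Cod E g" "p \<in> Hom E (Dom E p) (Dom E f)"
    "q \<in> Hom E (Dom E p) (Dom E g)"
    using f g p q dc Hom_Ar by auto
  show "Cmp E f p = Cmp E g q"
    by (rule arr_ext[OF E.cmp_in[OF p f] E.cmp_in[OF q g]])
      (use app_cmp[OF p f] app_cmp[OF q g] comm in auto)
  fix W h k assume h: "h \<in> Hom E W (Dom E f)" and k: "k \<in> Hom E W (Dom E g)"
    and hk: "Cmp E f h = Cmp E g k"
  have h: "h \<in> Hom E W X" and k: "k \<in> Hom E W Y" using h k dc by auto
  have W: "W \<in> Ob E" using E.Hom_Ob h by blast
  have hk': "app f c (app h c x) = app g c (app k c x)" if "c \<in> Ob A" "x \<in> el W c" for c x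
    using app_cmp[OF h f that] app_cmp[OF k g that] hk by simp
  have ex': "\<exists>!z. z \<in> el P c \<and> app p c z = app h c x \<and> app q c z = app k c x"
    if "c \<in> Ob A" "x \<in> el W c" for c x
    by (rule ex[OF that(1) app_in[OF h that] app_in[OF k that] hk'[OF that]])
  define m where "m = (\<lambda>c x. THE z. z \<in> el P c \<and> app p c z = app h c x \<and> app q c z = app k c x)"
  have m: "m c x \<in> el P c" "app p c (m c x) = app h c x" "app q c (m c x) = app k c x"
    if "c \<in> Ob A" "x \<in> el W c" for c x
    using theI'[OF ex'[OF that]] by (auto simp: m_def)
  have m_eq: "z = m c x" if "c \<in> Ob A" "x \<in> el W c" "z \<in> el P c" "app p c z = app h c x" "app q c z = app k c x"
    for c x z using ex'[OF that(1,2)] m[OF that(1,2)] that(3-) by blast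
  obtain t where t: "t \<in> Hom E W P" "\<And>c x. c \<in> Ob A \<Longrightarrow> x \<in> el W c \<Longrightarrow> app t c x = m c x"
  proof (rule arrE[of W P m])
    fix f c d x assume f: "f \<in> Hom A c d" and x: "x \<in> el W c"
    have cd: "c \<in> Ob A" "d \<in> Ob A" using A.Hom_Ob[OF f] by auto
    note mx = m[OF cd(1) x]
    show "m d (act W f x) = act P f (m c x)"
      by (rule m_eq[symmetric])
        (use cd act_in[OF W f x] act_in[OF ob(3) f mx(1)] app_nat[OF p f mx(1)] app_nat[OF q f mx(1)]
          app_nat[OF h f x] app_nat[OF k f x] mx in simp_all)
  qed (use W ob m in auto)
  show "\<exists>!u. u \<in> Hom E W (Dom E p) \<and> Cmp E p u = h \<and> Cmp E q u = k"
  proof (rule ex1I[of _ t])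
    have "Cmp E p t = h"
      by (rule arr_ext[OF E.cmp_in[OF t(1) p] h]) (use app_cmp[OF t(1) p] t(2) m in auto)
    moreover have "Cmp E q t = k"
      by (rule arr_ext[OF E.cmp_in[OF t(1) q] k]) (use app_cmp[OF t(1) q] t(2) m in auto)
    ultimately show "t \<in> Hom E W (Dom E p) \<and> Cmp E p t = h \<and> Cmp E q t = k" using t dc by simp
  next
    fix u assume "u \<in> Hom E W (Dom E p) \<and> Cmp E p u = h \<and> Cmp E q u = k"
    then have u: "u \<in> Hom E W P" "Cmp E p u = h" "Cmp E q u = k" using dc by auto
    show "u = t"
    proof (rule arr_ext[OF u(1) t(1)])
      fix c x assume "c \<in> Ob A" "x \<in> el W c"
      then show "app u c x = app t c x"
        using app_cmp[OF u(1) p] app_cmp[OF u(1) q] u(2,3) app_in[OF u(1)] t(2) m_eq by metis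
    qed
  qed
qed

text \<open>The two elements are arrows out of the representable at \<open>c\<close> that form a
  commuting square; the mediating arrow, applied to the generic element, gives the required
  element.\<close>

lemma is_pullbackD:
  assumes pb: "is_pullback E f g p q" and c: "c \<in> Ob A"
    and x: "x \<in> el (Dom E f) c" and y: "y \<in> el (Dom E g) c" and eq: "app f c x = app g c y"
  shows "\<exists>!z. z \<in> el (Dom E p) c \<and> app p c z = x \<and> app q c z = y"
proof -
  have f: "f \<in> Hom E (Dom E f) (Cod E f)" and g: "g \<in> Hom E (Dom E g) (Cod E f)"
    and p: "p \<in> Hom E (Dom E p) (Dom E f)" and q: "q \<in> Hom E (Dom E p) (Dom E g)"
    using pb Ar_Hom[of f E] Ar_Hom[of g E] by (auto simp: is_pullback_def)
  obtain Y u where Y: "Y \<in> Ob E" "u \<in> el Y c"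
    and ex: "\<And>F x. F \<in> Ob E \<Longrightarrow> x \<in> el F c \<Longrightarrow> \<exists>t \<in> Hom E Y F. app t c u = x"
    and uniq: "\<And>F s t. s \<in> Hom E Y F \<Longrightarrow> t \<in> Hom E Y F \<Longrightarrow> app s c u = app t c u \<Longrightarrow> s = t"
    using yoneda[OF c] by metis
  obtain h where h: "h \<in> Hom E Y (Dom E f)" "app h c u = x" using ex x E.Hom_Ob f by blast
  obtain k where k: "k \<in> Hom E Y (Dom E g)" "app k c u = y" using ex y E.Hom_Ob g by blast
  have "Cmp E f h = Cmp E g k"
    by (rule uniq[OF E.cmp_in[OF h(1) f] E.cmp_in[OF k(1) g]])
      (use app_cmp[OF h(1) f c Y(2)] app_cmp[OF k(1) g c Y(2)] h k eq in simp)
  then have ex1: "\<exists>!v. v \<in> Hom E Y (Dom E p) \<and> Cmp E p v = h \<and> Cmp E q v = k"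
    using pb h(1) k(1) unfolding is_pullback_def by blast
  then obtain v where v: "v \<in> Hom E Y (Dom E p)" "Cmp E p v = h" "Cmp E q v = k" by blast
  show ?thesis
  proof (rule ex1I[of _ "app v c u"])
    show "app v c u \<in> el (Dom E p) c \<and> app p c (app v c u) = x \<and> app q c (app v c u) = y"
      using v app_in[OF v(1) c Y(2)] app_cmp[OF v(1) p c Y(2)] app_cmp[OF v(1) q c Y(2)] h k by simp
  next
    fix z assume z: "z \<in> el (Dom E p) c \<and> app p c z = x \<and> app q c z = y"
    then obtain w where w: "w \<in> Hom E Y (Dom E p)" "app w c u = z" using ex E.Hom_Ob[OF p] by blast
    have "Cmp E p w = h"
      by (rule uniq[OF E.cmp_in[OF w(1) p] h(1)]) (use app_cmp[OF w(1) p c Y(2)] w z h in simp)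
    moreover have "Cmp E q w = k"
      by (rule uniq[OF E.cmp_in[OF w(1) q] k(1)]) (use app_cmp[OF w(1) q c Y(2)] w z k in simp)
    ultimately have "w = v" using ex1 w v by blast
    then show "z = app v c u" using w by simp
  qed
qed

lemma ex_pullback:
  assumes f: "f \<in> Hom E X Z" and g: "g \<in> Hom E Y Z"
  shows "\<exists>p q. is_pullback E f g p q"
proof -
  note ob = E.Hom_Ob[OF f] E.Hom_Ob[OF g]
  define S where "S = (\<lambda>c. {(x, y). x \<in> el X c \<and> y \<in> el Y c \<and> app f c x = app g c y})"
  define ac where "ac = (\<lambda>f (x, y). (act X f x, act Y f y))"
  obtain P i r where P: "P \<in> Ob E"
    and i: "\<And>c x. c \<in> Ob A \<Longrightarrow> x \<in> S c \<Longrightarrow> i c x \<in> el P c"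
    and r: "\<And>c y. c \<in> Ob A \<Longrightarrow> y \<in> el P c \<Longrightarrow> r c y \<in> S c"
    and ri: "\<And>c x. c \<in> Ob A \<Longrightarrow> x \<in> S c \<Longrightarrow> r c (i c x) = x"
    and ir: "\<And>c y. c \<in> Ob A \<Longrightarrow> y \<in> el P c \<Longrightarrow> i c (r c y) = y"
    and ra: "\<And>c d h y. h \<in> Hom A c d \<Longrightarrow> y \<in> el P c \<Longrightarrow> r d (act P h y) = ac h (r c y)"
  proof (rule objE[of S ac])
    fix c assume "c \<in> Ob A"
    then show "small_in U (S c)"
      by (intro small_subset[OF small_Times[of "el X c" "el Y c"]] el_small) (use ob in \<open>auto simp: S_def\<close>)
  qed (use ob act_in act_idt act_cmp app_nat[OF f] app_nat[OF g] in \<open>auto simp: S_def ac_def\<close>)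
  have rS: "fst (r c z) \<in> el X c" "snd (r c z) \<in> el Y c"
    "app f c (fst (r c z)) = app g c (snd (r c z))" if "c \<in> Ob A" "z \<in> el P c" for c z
    using r[OF that] by (auto simp: S_def)
  obtain p where p: "p \<in> Hom E P X" "\<And>c z. c \<in> Ob A \<Longrightarrow> z \<in> el P c \<Longrightarrow> app p c z = fst (r c z)"
    by (rule arrE[OF P ob(1), of "\<lambda>c z. fst (r c z)"]) (use rS ra in \<open>auto simp: ac_def case_prod_beta\<close>)
  obtain q where q: "q \<in> Hom E P Y" "\<And>c z. c \<in> Ob A \<Longrightarrow> z \<in> el P c \<Longrightarrow> app q c z = snd (r c z)"
    by (rule arrE[OF P ob(3), of "\<lambda>c z. snd (r c z)"]) (use rS ra in \<open>auto simp: ac_def case_prod_beta\<close>)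
  have "is_pullback E f g p q"
  proof (rule is_pullbackI[OF f g p(1) q(1)])
    fix c x y assume *: "c \<in> Ob A" "x \<in> el X c" "y \<in> el Y c" "app f c x = app g c y"
    have xy: "(x, y) \<in> S c" using * by (simp add: S_def)
    show "\<exists>!z. z \<in> el P c \<and> app p c z = x \<and> app q c z = y"
    proof (rule ex1I[of _ "i c (x, y)"])
      show "i c (x, y) \<in> el P c \<and> app p c (i c (x, y)) = x \<and> app q c (i c (x, y)) = y"
        using i[OF *(1) xy] ri[OF *(1) xy] p(2) q(2) *(1) by simp
      fix z assume "z \<in> el P c \<and> app p c z = x \<and> app q c z = y"
      then show "z = i c (x, y)" using ir[OF *(1)] p(2) q(2) *(1) by (metis prod.collapse)
    qed
  qed (use p q rS in auto)
  then show ?thesis by blast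
qed

lemma finite_limits: "has_finite_limits E"
  unfolding has_finite_limits_def using ex_terminal ex_pullback Ar_Hom by metis

text \<open>A product is a pullback over the terminal object, so the elementwise criterion carries
  over.\<close>

lemma is_productI:
  assumes p: "p \<in> Hom E P X" and q: "q \<in> Hom E P Y"
    and ex: "\<And>c x y. c \<in> Ob A \<Longrightarrow> x \<in> el X c \<Longrightarrow> y \<in> el Y c \<Longrightarrow>
      \<exists>!z. z \<in> el P c \<and> app p c z = x \<and> app q c z = y"
  shows "is_product E X Y P p q"
proof -
  obtain T where T: "terminal E T" using ex_terminal by blast
  note ob = E.Hom_Ob[OF p] E.Hom_Ob[OF q]
  obtain f where f: "f \<in> Hom E X T" using T ob unfolding terminal_def by blast
  obtain g where g: "g \<in> Hom E Y T" using T ob unfolding terminal_def by blast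
  have eq: "h = k" if "h \<in> Hom E W T" "k \<in> Hom E W T" for W h k
    using that T E.Hom_Ob[OF that(1)] unfolding terminal_def by blast
  have "is_pullback E f g p q"
  proof (rule is_pullbackI[OF f g p q])
    fix c z assume "c \<in> Ob A" "z \<in> el P c"
    then show "app f c (app p c z) = app g c (app q c z)"
      using terminalD[OF T] app_in[OF p] app_in[OF q] app_in[OF f] app_in[OF g] by metis
  qed (rule ex)
  then show ?thesis
    unfolding is_pullback_def is_product_def
    using eq E.cmp_in[OF _ f] E.cmp_in[OF _ g] p q Hom_Dom[OF f] Hom_Dom[OF g] Hom_Dom[OF p] by metis
qed

lemma is_productD:
  assumes pr: "is_product E X Y P p q" and X: "X \<in> Ob E" and Y: "Y \<in> Ob E"
    and c: "c \<in> Ob A" and x: "x \<in> el X c" and y: "y \<in> el Y c"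
  shows "\<exists>!z. z \<in> el P c \<and> app p c z = x \<and> app q c z = y"
proof -
  obtain T where T: "terminal E T" using ex_terminal by blast
  have p: "p \<in> Hom E P X" and q: "q \<in> Hom E P Y" using pr by (auto simp: is_product_def)
  obtain f where f: "f \<in> Hom E X T" using T X unfolding terminal_def by blast
  obtain g where g: "g \<in> Hom E Y T" using T Y unfolding terminal_def by blast
  have eq: "h = k" if "h \<in> Hom E W T" "k \<in> Hom E W T" for W h k
    using that T E.Hom_Ob[OF that(1)] unfolding terminal_def by blast
  have "is_pullback E f g p q"
    using pr f g p q eq[OF E.cmp_in[OF p f] E.cmp_in[OF q g]] Hom_Dom[OF f] Hom_Dom[OF g] Hom_Dom[OF p]
      Hom_Cod[OF f] Hom_Cod[OF g] Hom_Ar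
    unfolding is_pullback_def is_product_def by metis
  moreover have "app f c x = app g c y" using terminalD[OF T c] app_in[OF f c x] app_in[OF g c y] by blast
  ultimately show ?thesis using is_pullbackD[of f g p q c x y] c x y Hom_Dom[OF f] Hom_Dom[OF g] Hom_Dom[OF p] by simp
qed

lemma ex_product:
  assumes X: "X \<in> Ob E" and Y: "Y \<in> Ob E"
  shows "\<exists>P p q. is_product E X Y P p q"
proof -
  obtain T where T: "terminal E T" using ex_terminal by blast
  obtain f where f: "f \<in> Hom E X T" using T X unfolding terminal_def by blast
  obtain g where g: "g \<in> Hom E Y T" using T Y unfolding terminal_def by blast
  obtain p q where pq: "is_pullback E f g p q" using ex_pullback[OF f g] by blast
  have p: "p \<in> Hom E (Dom E p) X" and q: "q \<in> Hom E (Dom E p) Y"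
    using pq Hom_Dom[OF f] Hom_Dom[OF g] by (auto simp: is_pullback_def)
  have "is_product E X Y (Dom E p) p q"
  proof (rule is_productI[OF p q])
    fix c x y assume *: "c \<in> Ob A" "x \<in> el X c" "y \<in> el Y c"
    have "app f c x = app g c y" using terminalD[OF T] app_in[OF f *(1,2)] app_in[OF g *(1,3)] * by blast
    with * show "\<exists>!z. z \<in> el (Dom E p) c \<and> app p c z = x \<and> app q c z = y"
      using is_pullbackD[OF pq] Hom_Dom[OF f] Hom_Dom[OF g] by simp
  qed
  then show ?thesis by blast
qed

text \<open>Two elements are two arrows out of the representable at \<open>c\<close>. If
  \<open>m\<close> agrees on the elements, it agrees on the arrows, by the uniqueness half of the
  Yoneda lemma.\<close>

lemma mono_inj:
  assumes m: "mono_arrow E m" and c: "c \<in> Ob A"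
  shows "inj_on (app m c) (el (Dom E m) c)"
proof (rule inj_onI)
  fix x y assume xy: "x \<in> el (Dom E m) c" "y \<in> el (Dom E m) c" and eq: "app m c x = app m c y"
  have m': "m \<in> Hom E (Dom E m) (Cod E m)" using m Ar_Hom by (auto simp: mono_arrow_def)
  obtain Y u where Y: "Y \<in> Ob E" "u \<in> el Y c"
    and ex: "\<And>F x. F \<in> Ob E \<Longrightarrow> x \<in> el F c \<Longrightarrow> \<exists>t \<in> Hom E Y F. app t c u = x"
    and uniq: "\<And>F s t. s \<in> Hom E Y F \<Longrightarrow> t \<in> Hom E Y F \<Longrightarrow> app s c u = app t c u \<Longrightarrow> s = t"
    using yoneda[OF c] by metis
  obtain h k where h: "h \<in> Hom E Y (Dom E m)" "app h c u = x" and k: "k \<in> Hom E Y (Dom E m)" "app k c u = y"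
    using ex xy E.Hom_Ob[OF m'] by meson
  have "Cmp E m h = Cmp E m k"
    by (rule uniq[OF E.cmp_in[OF h(1) m'] E.cmp_in[OF k(1) m']])
      (use app_cmp[OF h(1) m' c Y(2)] app_cmp[OF k(1) m' c Y(2)] h k eq in simp)
  then have "h = k" using m h(1) k(1) unfolding mono_arrow_def by blast
  then show "x = y" using h k by simp
qed


text \<open>By Yoneda the exponential at \<open>c\<close> has to consist of the natural
  transformations to \<open>Z\<close> from the product of the representable at \<open>c\<close> with
  \<open>X\<close>. They are functions on a small set of pairs \<open>(f, a)\<close>.\<close>

lemma ex_exponential:
  assumes X: "X \<in> Ob E" and Z: "Z \<in> Ob E"
  shows "\<exists>W P p q ev. is_exponential E X Z W P p q ev"
proof -
  \<comment> \<open>All elements of the product of the representable at \<open>c\<close> with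
    \<open>X\<close>, collected over the objects of \<open>A\<close>.\<close>
  define I where "I = (\<lambda>c. SIGMA f:{f \<in> Ar A. Dom A f = c}. el X (Cod A f))"
  define T where "T = (\<lambda>c. {\<theta> \<in> Pi\<^sub>E (I c) (\<lambda>(f, a). el Z (Cod A f)).
    \<forall>d e. \<forall>f \<in> Hom A c d. \<forall>g \<in> Hom A d e. \<forall>a \<in> el X d. \<theta> (Cmp A g f, act X g a) = act Z g (\<theta> (f, a))})"
  define ac :: "'f \<Rightarrow> ('f \<times> 'u \<Rightarrow> 'u) \<Rightarrow> 'f \<times> 'u \<Rightarrow> 'u"
    where "ac = (\<lambda>h \<theta>. \<lambda>(f, a) \<in> I (Cod A h). \<theta> (Cmp A f h, a))"
  have I_iff: "(f, a) \<in> I c \<longleftrightarrow> (\<exists>d. f \<in> Hom A c d \<and> a \<in> el X d)" for f a c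
    by (auto simp: I_def Hom_def)
  have T_in: "\<theta> (f, a) \<in> el Z d" if "\<theta> \<in> T c" "f \<in> Hom A c d" "a \<in> el X d" for \<theta> c d f a
  proof -
    have "(f, a) \<in> I c" using I_iff that by blast
    moreover have "\<theta> \<in> Pi\<^sub>E (I c) (\<lambda>(f, a). el Z (Cod A f))" using that(1) by (simp add: T_def)
    ultimately have "\<theta> (f, a) \<in> el Z (Cod A f)" by (auto dest: PiE_mem)
    then show ?thesis using Hom_Cod[OF that(2)] by simp
  qed
  have T_nat: "\<theta> (Cmp A g f, act X g a) = act Z g (\<theta> (f, a))"
    if "\<theta> \<in> T c" "f \<in> Hom A c d" "g \<in> Hom A d e" "a \<in> el X d" for \<theta> c d e f g a
    using that by (auto simp: T_def)
  have T_ext: "\<theta> = \<theta>'" if "\<theta> \<in> T c" "\<theta>' \<in> T c"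
    "\<And>d f a. f \<in> Hom A c d \<Longrightarrow> a \<in> el X d \<Longrightarrow> \<theta> (f, a) = \<theta>' (f, a)" for \<theta> \<theta>' c
  proof (rule PiE_ext)
    show "\<theta> \<in> Pi\<^sub>E (I c) (\<lambda>(f, a). el Z (Cod A f))" "\<theta>' \<in> Pi\<^sub>E (I c) (\<lambda>(f, a). el Z (Cod A f))"
      using that by (simp_all add: T_def)
    fix z assume "z \<in> I c" then show "\<theta> z = \<theta>' z" using that(3) I_iff by (cases z) blast
  qed
  have ac_app: "ac h \<theta> (f, a) = \<theta> (Cmp A f h, a)" if "h \<in> Hom A b c" "f \<in> Hom A c d" "a \<in> el X d" for h \<theta> f a b c d
    using I_iff that Hom_Cod[OF that(1)] by (auto simp: ac_def)
  have TI: "(\<lambda>z \<in> I c. F z) \<in> T c"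
    if F: "\<And>d f a. f \<in> Hom A c d \<Longrightarrow> a \<in> el X d \<Longrightarrow> F (f, a) \<in> el Z d"
      and n: "\<And>d e f g a. f \<in> Hom A c d \<Longrightarrow> g \<in> Hom A d e \<Longrightarrow> a \<in> el X d \<Longrightarrow> F (Cmp A g f, act X g a) = act Z g (F (f, a))"
    for F c
    unfolding T_def
  proof (intro CollectI conjI allI ballI)
    show "restrict F (I c) \<in> (\<Pi>\<^sub>E (f, a) \<in> I c. el Z (Cod A f))"
    proof (rule restrict_PiE_iff[THEN iffD2], rule ballI)
      fix z assume z: "z \<in> I c"
      obtain f a where fa: "z = (f, a)" by (cases z)
      with z obtain d where d: "f \<in> Hom A c d" "a \<in> el X d" using I_iff by blast
      with F fa show "F z \<in> (case z of (f, a) \<Rightarrow> el Z (Cod A f))" by (simp add: Hom_Cod[OF d(1)])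
    qed
    fix d e f g a assume fg: "f \<in> Hom A c d" "g \<in> Hom A d e" "a \<in> el X d"
    have "(f, a) \<in> I c" "(Cmp A g f, act X g a) \<in> I c"
      using fg I_iff A.cmp_in[OF fg(1,2)] act_in[OF X fg(2,3)] by blast+
    then show "restrict F (I c) (Cmp A g f, act X g a) = act Z g (restrict F (I c) (f, a))"
      using n[OF fg] by simp
  qed
  have acT: "ac h \<theta> \<in> T d" if h: "h \<in> Hom A c d" and \<theta>: "\<theta> \<in> T c" for h c d \<theta>
    unfolding ac_def Hom_Cod[OF h]
  proof (rule TI, unfold split)
    fix e f a assume "f \<in> Hom A d e" "a \<in> el X e"
    then show "\<theta> (Cmp A f h, a) \<in> el Z e" using T_in[OF \<theta> A.cmp_in[OF h]] by blast
  next
    fix b e f g a assume f: "f \<in> Hom A d b" and g: "g \<in> Hom A b e" and a: "a \<in> el X b"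
    show "\<theta> (Cmp A (Cmp A g f) h, act X g a) = act Z g (\<theta> (Cmp A f h, a))"
      using T_nat[OF \<theta> A.cmp_in[OF h f] g a] A.cmp_assoc[OF h f g] by simp
  qed
  obtain W i r where W: "W \<in> Ob E"
    and i: "\<And>c x. c \<in> Ob A \<Longrightarrow> x \<in> T c \<Longrightarrow> i c x \<in> el W c"
    and r: "\<And>c y. c \<in> Ob A \<Longrightarrow> y \<in> el W c \<Longrightarrow> r c y \<in> T c"
    and ri: "\<And>c x. c \<in> Ob A \<Longrightarrow> x \<in> T c \<Longrightarrow> r c (i c x) = x"
    and ir: "\<And>c y. c \<in> Ob A \<Longrightarrow> y \<in> el W c \<Longrightarrow> i c (r c y) = y"
    and ai: "\<And>c d f x. f \<in> Hom A c d \<Longrightarrow> x \<in> T c \<Longrightarrow> act W f (i c x) = i d (ac f x)"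
    and ra: "\<And>c d h y. h \<in> Hom A c d \<Longrightarrow> y \<in> el W c \<Longrightarrow> r d (act W h y) = ac h (r c y)"
  proof (rule objE[of T ac])
    fix c assume "c \<in> Ob A"
    have "small_in U (I c)"
      unfolding I_def by (intro small_Sigma small_subset[OF small_Ar] el_small X) (auto intro: A.cod_in)
    then have "small_in U (Pi\<^sub>E (I c) (\<lambda>(f, a). el Z (Cod A f)))"
      by (intro small_PiE) (auto simp: I_def intro!: el_small Z A.cod_in)
    then show "small_in U (T c)" by (rule small_subset) (auto simp: T_def)
  next
    fix h c d \<theta> assume "h \<in> Hom A c d" "\<theta> \<in> T c" then show "ac h \<theta> \<in> T d" by (rule acT)
  next
    fix c \<theta> assume c: "c \<in> Ob A" and \<theta>: "\<theta> \<in> T c"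
    note id = A.idt_in[OF c]
    show "ac (Idt A c) \<theta> = \<theta>"
      by (rule T_ext[OF acT[OF id \<theta>] \<theta>]) (use ac_app[OF id] A.cmp_id_right in auto)
  next
    fix f g c d e \<theta> assume f: "f \<in> Hom A c d" and g: "g \<in> Hom A d e" and \<theta>: "\<theta> \<in> T c"
    show "ac (Cmp A g f) \<theta> = ac g (ac f \<theta>)"
    proof (rule T_ext[OF acT[OF A.cmp_in[OF f g] \<theta>] acT[OF g acT[OF f \<theta>]]])
      fix b h a assume h: "h \<in> Hom A e b" and a: "a \<in> el X b"
      show "ac (Cmp A g f) \<theta> (h, a) = ac g (ac f \<theta>) (h, a)"
        using ac_app[OF A.cmp_in[OF f g] h a] ac_app[OF g h a] ac_app[OF f A.cmp_in[OF g h] a]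
          A.cmp_assoc[OF f g h] by simp
    qed
  qed blast
  obtain P p q where P: "is_product E W X P p q" using ex_product[OF W X] by blast
  have p: "p \<in> Hom E P W" and q: "q \<in> Hom E P X" using P by (auto simp: is_product_def)
  have id: "Idt A c \<in> Hom A c c" if "c \<in> Ob A" for c using A.idt_in[OF that] .
  \<comment> \<open>A natural transformation is evaluated at the pair of the identity and the given
    element, as in the Yoneda lemma.\<close>
  obtain ev where ev: "ev \<in> Hom E P Z"
    and ev_app: "\<And>c z. c \<in> Ob A \<Longrightarrow> z \<in> el P c \<Longrightarrow> app ev c z = r c (app p c z) (Idt A c, app q c z)"
  proof (rule arrE[of P Z "\<lambda>c z. r c (app p c z) (Idt A c, app q c z)"])
    fix c z assume c: "c \<in> Ob A" and z: "z \<in> el P c"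
    show "r c (app p c z) (Idt A c, app q c z) \<in> el Z c"
      by (rule T_in[OF r[OF c app_in[OF p c z]] id[OF c] app_in[OF q c z]])
  next
    fix f c d z assume f: "f \<in> Hom A c d" and z: "z \<in> el P c"
    have cd: "c \<in> Ob A" "d \<in> Ob A" using A.Hom_Ob[OF f] by auto
    note \<theta> = r[OF cd(1) app_in[OF p cd(1) z]]
    have "r d (app p d (act P f z)) (Idt A d, app q d (act P f z)) = r c (app p c z) (f, act X f (app q c z))"
      using app_nat[OF p f z] app_nat[OF q f z] ra[OF f app_in[OF p cd(1) z]] A.cmp_id_left[OF f]
        ac_app[OF f id[OF cd(2)] act_in[OF X f app_in[OF q cd(1) z]]] by simp
    also have "\<dots> = act Z f (r c (app p c z) (Idt A c, app q c z))"
      using T_nat[OF \<theta> id[OF cd(1)] f app_in[OF q cd(1) z]] A.cmp_id_right[OF f] by simp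
    finally show "r d (app p d (act P f z)) (Idt A d, app q d (act P f z)) =
      act Z f (r c (app p c z) (Idt A c, app q c z))" .
  qed (use E.Hom_Ob[OF p] Z in auto)
  have "\<exists>!h. h \<in> Hom E V W \<and> (\<exists>u \<in> Hom E Q P. Cmp E p u = Cmp E h a \<and> Cmp E q u = b \<and> Cmp E ev u = f)"
    if Q: "is_product E V X Q a b" and f: "f \<in> Hom E Q Z" for V Q a b f
  proof -
    have a: "a \<in> Hom E Q V" and b: "b \<in> Hom E Q X" using Q by (auto simp: is_product_def)
    have V: "V \<in> Ob E" and QO: "Q \<in> Ob E" using E.Hom_Ob[OF a] by auto
    \<comment> \<open>The pairing of \<open>x\<close> and \<open>y\<close> in the product
      \<open>Q\<close>.\<close>
    define pr where "pr = (\<lambda>c x y. THE z. z \<in> el Q c \<and> app a c z = x \<and> app b c z = y)"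
    have pr: "pr c x y \<in> el Q c" "app a c (pr c x y) = x" "app b c (pr c x y) = y"
      if "c \<in> Ob A" "x \<in> el V c" "y \<in> el X c" for c x y
      using theI'[OF is_productD[OF Q V X that]] by (auto simp: pr_def)
    have pr_eq: "z = pr c x y" if "c \<in> Ob A" "z \<in> el Q c" "app a c z = x" "app b c z = y" for c x y z
      using is_productD[OF Q V X that(1) app_in[OF a that(1,2)] app_in[OF b that(1,2)]] pr that
        app_in[OF a that(1,2)] app_in[OF b that(1,2)] by metis
    have pr_act: "act Q g (pr c x y) = pr d (act V g x) (act X g y)"
      if g: "g \<in> Hom A c d" and x: "x \<in> el V c" and y: "y \<in> el X c" for c d g x y
      using pr_eq[of d "act Q g (pr c x y)"] pr[of c x y] A.Hom_Ob[OF g] act_in[OF QO g]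
        app_nat[OF a g] app_nat[OF b g] x y by simp
    \<comment> \<open>The transpose of \<open>f\<close>: the family attached to \<open>x\<close>
      moves \<open>x\<close> along \<open>g\<close>, pairs the result with \<open>y\<close> and
      applies \<open>f\<close>.\<close>
    define H where "H = (\<lambda>c x. \<lambda>(g, y) \<in> I c. app f (Cod A g) (pr (Cod A g) (act V g x) y))"
    have H_app: "H c x (g, y) = app f d (pr d (act V g x) y)" if "g \<in> Hom A c d" "y \<in> el X d" for c d g x y
      using that I_iff Hom_Cod[OF that(1)] by (auto simp: H_def)
    have H: "H c x \<in> T c" if x: "c \<in> Ob A" "x \<in> el V c" for c x
      unfolding H_def
    proof (rule TI, unfold split)
      fix d g y assume g: "g \<in> Hom A c d" and y: "y \<in> el X d"
      show "app f (Cod A g) (pr (Cod A g) (act V g x) y) \<in> el Z d"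
        using app_in[OF f] pr(1) A.Hom_Ob[OF g] act_in[OF V g x(2)] y Hom_Cod[OF g] by simp
    next
      fix d e g h y assume g: "g \<in> Hom A c d" and h: "h \<in> Hom A d e" and y: "y \<in> el X d"
      note hg = A.cmp_in[OF g h]
      have gx: "act V g x \<in> el V d" using act_in[OF V g x(2)] .
      have d: "d \<in> Ob A" using A.Hom_Ob[OF g] by auto
      show "app f (Cod A (Cmp A h g)) (pr (Cod A (Cmp A h g)) (act V (Cmp A h g) x) (act X h y)) =
        act Z h (app f (Cod A g) (pr (Cod A g) (act V g x) y))"
        using Hom_Cod[OF g] Hom_Cod[OF hg] act_cmp[OF V g h x(2)] pr_act[OF h gx y]
          app_nat[OF f h pr(1)[OF d gx y]] by simp
    qed
    obtain h where h: "h \<in> Hom E V W" and h_app: "\<And>c x. c \<in> Ob A \<Longrightarrow> x \<in> el V c \<Longrightarrow> app h c x = i c (H c x)"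
    proof (rule arrE[OF V W, of "\<lambda>c x. i c (H c x)"])
      fix c x assume "c \<in> Ob A" "x \<in> el V c" then show "i c (H c x) \<in> el W c" using i H by simp
    next
      fix g c d x assume g: "g \<in> Hom A c d" and x: "x \<in> el V c"
      have cd: "c \<in> Ob A" "d \<in> Ob A" using A.Hom_Ob[OF g] by auto
      have gH: "ac g (H c x) \<in> T d"
        using r[OF cd(2) act_in[OF W g i[OF cd(1) H[OF cd(1) x]]]] ra[OF g i[OF cd(1) H[OF cd(1) x]]]
          ri[OF cd(1) H[OF cd(1) x]] by simp
      have "H d (act V g x) = ac g (H c x)"
      proof (rule T_ext[OF H[OF cd(2) act_in[OF V g x]] gH])
        fix e k y assume k: "k \<in> Hom A d e" and y: "y \<in> el X e"
        show "H d (act V g x) (k, y) = ac g (H c x) (k, y)"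
          using H_app[OF k y] ac_app[OF g k y] H_app[OF A.cmp_in[OF g k] y] act_cmp[OF V g k x] by simp
      qed
      then show "i d (H d (act V g x)) = act W g (i c (H c x))" using ai[OF g H[OF cd(1) x]] by simp
    qed blast
    have pair: "\<exists>!u. u \<in> Hom E Q P \<and> Cmp E p u = Cmp E k a \<and> Cmp E q u = b" if "k \<in> Hom E V W" for k
      using P E.cmp_in[OF a that] b unfolding is_product_def by blast
    obtain u where u: "u \<in> Hom E Q P" "Cmp E p u = Cmp E h a" "Cmp E q u = b" using pair[OF h] by blast
    show ?thesis
    proof (rule ex1I[of _ h], intro conjI h bexI[of _ u] u)
      show "Cmp E ev u = f"
      proof (rule arr_ext[OF E.cmp_in[OF u(1) ev] f])
        fix c z assume c: "c \<in> Ob A" and z: "z \<in> el Q c"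
        note az = app_in[OF a c z] and bz = app_in[OF b c z] and uz = app_in[OF u(1) c z]
        have "app p c (app u c z) = i c (H c (app a c z))"
          using app_cmp[OF u(1) p c z] app_cmp[OF a h c z] u(2) h_app[OF c az] by simp
        moreover have "app q c (app u c z) = app b c z" using app_cmp[OF u(1) q c z] u(3) by simp
        ultimately have "app ev c (app u c z) = app f c (pr c (app a c z) (app b c z))"
          using ev_app[OF c uz] ri[OF c H[OF c az]] H_app[OF id[OF c] bz] act_idt[OF V c az] by simp
        then show "app (Cmp E ev u) c z = app f c z"
          using app_cmp[OF u(1) ev c z] pr_eq[OF c z refl refl] by simp
      qed
    next
      fix k assume "k \<in> Hom E V W \<and> (\<exists>u \<in> Hom E Q P. Cmp E p u = Cmp E k a \<and> Cmp E q u = b \<and> Cmp E ev u = f)"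
      then obtain v where k: "k \<in> Hom E V W" and v: "v \<in> Hom E Q P" "Cmp E p v = Cmp E k a" "Cmp E q v = b"
        "Cmp E ev v = f" by blast
      show "k = h"
      proof (rule arr_ext[OF k h])
        fix c x assume c: "c \<in> Ob A" and x: "x \<in> el V c"
        note kx = app_in[OF k c x]
        have "r c (app k c x) = H c x"
        proof (rule T_ext[OF r[OF c kx] H[OF c x]])
          fix d g y assume g: "g \<in> Hom A c d" and y: "y \<in> el X d"
          have d: "d \<in> Ob A" using A.Hom_Ob[OF g] by auto
          note gx = act_in[OF V g x]
          \<comment> \<open>Comparing both sides at this element of \<open>Q\<close> forces any
            other transpose to have the same family as \<open>H\<close>.\<close>
          define z where "z = pr d (act V g x) y"
          have z: "z \<in> el Q d" "app a d z = act V g x" "app b d z = y"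
            using pr[OF d gx y] by (auto simp: z_def)
          have "app p d (app v d z) = act W g (app k c x)"
            using app_cmp[OF v(1) p d z(1)] app_cmp[OF a k d z(1)] v(2) z(2) app_nat[OF k g x] by simp
          moreover have "app q d (app v d z) = y" using app_cmp[OF v(1) q d z(1)] v(3) z(3) by simp
          ultimately have "app f d z = ac g (r c (app k c x)) (Idt A d, y)"
            using app_cmp[OF v(1) ev d z(1)] v(4) ev_app[OF d app_in[OF v(1) d z(1)]] ra[OF g kx] by simp
          then show "r c (app k c x) (g, y) = H c x (g, y)"
            using ac_app[OF g id[OF d] y] A.cmp_id_left[OF g] H_app[OF g y] by (simp add: z_def)
        qed
        then show "app k c x = app h c x" using ir[OF c kx] h_app[OF c x] by simp
      qed
    qed
  qed
  then have "is_exponential E X Z W P p q ev" using P ev unfolding is_exponential_def by blast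
  then show ?thesis by blast
qed

text \<open>Truth values at \<open>c\<close> are cosieves, that is, sets of arrows out of
  \<open>c\<close> closed under further composition; sieves become cosieves because the functors are
  covariant on \<open>A\<close>.\<close>

lemma ex_classifier: "\<exists>t. is_subobject_classifier E t"
proof -
  define S where "S = (\<lambda>c. {S. S \<subseteq> {f \<in> Ar A. Dom A f = c} \<and> (\<forall>d e. \<forall>f \<in> S. \<forall>g \<in> Hom A d e. Cod A f = d \<longrightarrow> Cmp A g f \<in> S)})"
  define ac where "ac = (\<lambda>h S. {f \<in> Ar A. Dom A f = Cod A h \<and> Cmp A f h \<in> S})"
  have SD: "Cmp A g f \<in> Q" if "Q \<in> S c" "f \<in> Q" "f \<in> Hom A c d" "g \<in> Hom A d e" for Q c d e f g
    using that Hom_Cod[OF that(3)] unfolding S_def by blast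
  have SI: "{f \<in> Ar A. Dom A f = c \<and> R f} \<in> S c"
    if R: "\<And>d e f g. f \<in> Hom A c d \<Longrightarrow> R f \<Longrightarrow> g \<in> Hom A d e \<Longrightarrow> R (Cmp A g f)" for c R
  proof -
    have "Cmp A g f \<in> {f \<in> Ar A. Dom A f = c \<and> R f}" if "f \<in> Ar A" "Dom A f = c" "R f" "g \<in> Hom A (Cod A f) e" for e f g
    proof -
      have f: "f \<in> Hom A c (Cod A f)" using that Ar_Hom[of f A] by simp
      show ?thesis using A.cmp_in[OF f that(4)] R[OF f that(3,4)] by (simp add: Hom_def)
    qed
    then show ?thesis unfolding S_def by blast
  qed
  have ac_iff: "f \<in> ac h Q \<longleftrightarrow> Cmp A f h \<in> Q" if "h \<in> Hom A c d" "f \<in> Hom A d e" for f h Q c d e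
    using that by (auto simp: ac_def Hom_def)
  have S_ext: "Q = Q'" if "Q \<in> S c" "Q' \<in> S c" "\<And>d f. f \<in> Hom A c d \<Longrightarrow> f \<in> Q \<longleftrightarrow> f \<in> Q'" for Q Q' c
    using that unfolding S_def Hom_def by blast
  have acS: "ac h Q \<in> S d" if h: "h \<in> Hom A c d" and Q: "Q \<in> S c" for h Q c d
    unfolding ac_def Hom_Cod[OF h]
  proof (rule SI)
    fix e k f g assume f: "f \<in> Hom A d e" and Rf: "Cmp A f h \<in> Q" and g: "g \<in> Hom A e k"
    show "Cmp A (Cmp A g f) h \<in> Q"
      using SD[OF Q Rf A.cmp_in[OF h f] g] A.cmp_assoc[OF h f g] by simp
  qed
  obtain W i r where W: "W \<in> Ob E"
    and i: "\<And>c x. c \<in> Ob A \<Longrightarrow> x \<in> S c \<Longrightarrow> i c x \<in> el W c"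
    and r: "\<And>c y. c \<in> Ob A \<Longrightarrow> y \<in> el W c \<Longrightarrow> r c y \<in> S c"
    and ri: "\<And>c x. c \<in> Ob A \<Longrightarrow> x \<in> S c \<Longrightarrow> r c (i c x) = x"
    and ir: "\<And>c y. c \<in> Ob A \<Longrightarrow> y \<in> el W c \<Longrightarrow> i c (r c y) = y"
    and ai: "\<And>c d f x. f \<in> Hom A c d \<Longrightarrow> x \<in> S c \<Longrightarrow> act W f (i c x) = i d (ac f x)"
    and ra: "\<And>c d h y. h \<in> Hom A c d \<Longrightarrow> y \<in> el W c \<Longrightarrow> r d (act W h y) = ac h (r c y)"
  proof (rule objE[of S ac])
    fix c
    show "small_in U (S c)"
      by (rule small_subset[OF small_Pow[OF small_Ar]]) (auto simp: S_def)
  next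
    fix c Q assume c: "c \<in> Ob A" and Q: "Q \<in> S c"
    show "ac (Idt A c) Q = Q"
      by (rule S_ext[OF acS[OF A.idt_in[OF c] Q] Q])
        (use ac_iff[OF A.idt_in[OF c]] A.cmp_id_right in auto)
  next
    fix f g c d e Q assume f: "f \<in> Hom A c d" and g: "g \<in> Hom A d e" and Q: "Q \<in> S c"
    show "ac (Cmp A g f) Q = ac g (ac f Q)"
      by (rule S_ext[OF acS[OF A.cmp_in[OF f g] Q] acS[OF g acS[OF f Q]]])
        (use ac_iff[OF A.cmp_in[OF f g]] ac_iff[OF g] ac_iff[OF f A.cmp_in[OF g]] A.cmp_assoc[OF f g] in auto)
  next
    fix h c d Q assume "h \<in> Hom A c d" "Q \<in> S c" then show "ac h Q \<in> S d" by (rule acS)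
  qed blast
  obtain T where T: "terminal E T" using ex_terminal by blast
  have TO: "T \<in> Ob E" using T by (simp add: terminal_def)
  define top where "top = (\<lambda>c. {f \<in> Ar A. Dom A f = c})"
  have topS: "top c \<in> S c" for c using SI[of c "\<lambda>_. True"] by (simp add: top_def)
  \<comment> \<open>Every arrow is its own composite with the identity, so a cosieve containing the
    identity is maximal.\<close>
  have top_iff: "Q = top c \<longleftrightarrow> Idt A c \<in> Q" if c: "c \<in> Ob A" and Q: "Q \<in> S c" for c Q
  proof
    assume "Q = top c" then show "Idt A c \<in> Q" using A.idt_in[OF c] by (auto simp: top_def Hom_def)
  next
    assume Q1: "Idt A c \<in> Q"
    show "Q = top c"
    proof (rule S_ext[OF Q topS])
      fix d f assume f: "f \<in> Hom A c d"
      show "f \<in> Q \<longleftrightarrow> f \<in> top c"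
        using SD[OF Q Q1 A.idt_in[OF c] f] A.cmp_id_right[OF f] f by (auto simp: top_def Hom_def)
    qed
  qed
  have ac_top: "ac f (top c) = top d" if f: "f \<in> Hom A c d" for f c d
    by (rule S_ext[OF acS[OF f topS] topS])
      (use ac_iff[OF f] A.cmp_in[OF f] in \<open>auto simp: top_def Hom_def\<close>)
  obtain t where t: "t \<in> Hom E T W" and t_app: "\<And>c x. c \<in> Ob A \<Longrightarrow> x \<in> el T c \<Longrightarrow> app t c x = i c (top c)"
  proof (rule arrE[OF TO W, of "\<lambda>c x. i c (top c)"])
    fix c assume "c \<in> Ob A" then show "i c (top c) \<in> el W c" by (rule i[OF _ topS])
  next
    fix f c d assume "f \<in> Hom A c d"
    then show "i d (top d) = act W f (i c (top c))" using ai[OF _ topS] ac_top by simp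
  qed blast
  have "\<exists>!\<chi>. \<chi> \<in> Hom E (Cod E m) (Cod E t) \<and> (\<exists>b. is_pullback E \<chi> t m b)" if mono: "mono_arrow E m" for m
  proof -
    define M X where "M = Dom E m" and "X = Cod E m"
    have m: "m \<in> Hom E M X" using mono Ar_Hom[of m E] by (simp add: M_def X_def mono_arrow_def)
    have MO: "M \<in> Ob E" and XO: "X \<in> Ob E" using E.Hom_Ob[OF m] by auto
    have inj: "inj_on (app m c) (el M c)" if "c \<in> Ob A" for c using mono_inj[OF mono that] by (simp add: M_def)
    \<comment> \<open>The truth value of \<open>x\<close> lying in the subobject: the arrows that
      carry \<open>x\<close> into the image of \<open>m\<close>.\<close>
    define C where "C = (\<lambda>c x. {f \<in> Ar A. Dom A f = c \<and> act X f x \<in> app m (Cod A f) ` el M (Cod A f)})"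
    have C_iff: "f \<in> C c x \<longleftrightarrow> act X f x \<in> app m d ` el M d" if "f \<in> Hom A c d" for c d f x
      using that by (auto simp: C_def Hom_def)
    have C: "C c x \<in> S c" if x: "x \<in> el X c" for c x
      unfolding C_def
    proof (rule SI)
      fix d e f g assume f: "f \<in> Hom A c d" and "act X f x \<in> app m (Cod A f) ` el M (Cod A f)" and g: "g \<in> Hom A d e"
      then obtain y where y: "y \<in> el M d" "act X f x = app m d y" using Hom_Cod[OF f] by auto
      have "act X (Cmp A g f) x = app m e (act M g y)"
        using act_cmp[OF XO f g x] y(2) app_nat[OF m g y(1)] by simp
      then show "act X (Cmp A g f) x \<in> app m (Cod A (Cmp A g f)) ` el M (Cod A (Cmp A g f))"
        using Hom_Cod[OF A.cmp_in[OF f g]] act_in[OF MO g y(1)] by simp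
    qed
    obtain \<chi> where \<chi>: "\<chi> \<in> Hom E X W" and \<chi>_app: "\<And>c x. c \<in> Ob A \<Longrightarrow> x \<in> el X c \<Longrightarrow> app \<chi> c x = i c (C c x)"
    proof (rule arrE[OF XO W, of "\<lambda>c x. i c (C c x)"])
      fix f c d x assume f: "f \<in> Hom A c d" and x: "x \<in> el X c"
      have "C d (act X f x) = ac f (C c x)"
      proof (rule S_ext[OF C[OF act_in[OF XO f x]] acS[OF f C[OF x]]])
        fix e g assume g: "g \<in> Hom A d e"
        show "g \<in> C d (act X f x) \<longleftrightarrow> g \<in> ac f (C c x)"
          using C_iff[OF g] ac_iff[OF f g] C_iff[OF A.cmp_in[OF f g]] act_cmp[OF XO f g x] by simp
      qed
      then show "i d (C d (act X f x)) = act W f (i c (C c x))" using ai[OF f C[OF x]] by simp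
    qed (use i C in auto)
    have top_C: "i c (C c x) = i c (top c) \<longleftrightarrow> x \<in> app m c ` el M c" if c: "c \<in> Ob A" and x: "x \<in> el X c" for c x
    proof -
      have "i c (C c x) = i c (top c) \<longleftrightarrow> C c x = top c" using ri[OF c] C[OF x] topS by metis
      also have "\<dots> \<longleftrightarrow> x \<in> app m c ` el M c"
        using top_iff[OF c C[OF x]] C_iff[OF A.idt_in[OF c]] act_idt[OF XO c x] by simp
      finally show ?thesis .
    qed
    obtain b where b: "b \<in> Hom E M T" using T MO unfolding terminal_def by blast
    have "is_pullback E \<chi> t m b"
    proof (rule is_pullbackI[OF \<chi> t m b])
      fix c z assume c: "c \<in> Ob A" and z: "z \<in> el M c"
      show "app \<chi> c (app m c z) = app t c (app b c z)"
        using \<chi>_app[OF c app_in[OF m c z]] t_app[OF c app_in[OF b c z]] top_C[OF c app_in[OF m c z]] z by simp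
    next
      fix c x y assume c: "c \<in> Ob A" and x: "x \<in> el X c" and y: "y \<in> el T c" and "app \<chi> c x = app t c y"
      then have "x \<in> app m c ` el M c" using top_C[OF c x] \<chi>_app[OF c x] t_app[OF c y] by simp
      then obtain z where z: "z \<in> el M c" "app m c z = x" by blast
      show "\<exists>!z. z \<in> el M c \<and> app m c z = x \<and> app b c z = y"
      proof (rule ex1I[of _ z])
        show "z \<in> el M c \<and> app m c z = x \<and> app b c z = y"
          using z terminalD[OF T c] app_in[OF b c z(1)] y by blast
      qed (use inj[OF c] z in \<open>auto dest: inj_onD\<close>)
    qed
    moreover have "\<chi>' = \<chi>" if \<chi>': "\<chi>' \<in> Hom E X W" and pb: "is_pullback E \<chi>' t m b'" for \<chi>' b'
    proof (rule arr_ext[OF \<chi>' \<chi>])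
      have b': "b' \<in> Hom E M T" and comm: "Cmp E \<chi>' m = Cmp E t b'"
        using pb Hom_Dom[OF t] by (auto simp: is_pullback_def M_def)
      \<comment> \<open>Read elementwise, the pullback property says that the classifying map takes
        the value true exactly on the subobject.\<close>
      have char: "app \<chi>' d y = i d (top d) \<longleftrightarrow> y \<in> app m d ` el M d" if d: "d \<in> Ob A" and y: "y \<in> el X d" for d y
      proof
        assume *: "app \<chi>' d y = i d (top d)"
        obtain z where z: "z \<in> el T d" using terminalD[OF T d] by blast
        have "\<exists>!v. v \<in> el (Dom E m) d \<and> app m d v = y \<and> app b' d v = z"
          by (rule is_pullbackD[OF pb d]) (use y z * t_app[OF d z] Hom_Dom[OF \<chi>'] Hom_Dom[OF t] in auto)
        then show "y \<in> app m d ` el M d" by (auto simp: M_def)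
      next
        assume "y \<in> app m d ` el M d"
        then obtain z where z: "z \<in> el M d" "app m d z = y" by blast
        show "app \<chi>' d y = i d (top d)"
          using z app_cmp[OF m \<chi>' d z(1)] app_cmp[OF b' t d z(1)] comm t_app[OF d app_in[OF b' d z(1)]] by simp
      qed
      fix c x assume c: "c \<in> Ob A" and x: "x \<in> el X c"
      note \<chi>x = app_in[OF \<chi>' c x]
      have "r c (app \<chi>' c x) = C c x"
      proof (rule S_ext[OF r[OF c \<chi>x] C[OF x]])
        fix d f assume f: "f \<in> Hom A c d"
        have d: "d \<in> Ob A" using A.Hom_Ob[OF f] by auto
        note fx = act_in[OF XO f x]
        note \<chi>fx = app_in[OF \<chi>' d fx]
        \<comment> \<open>An arrow \<open>f\<close> belongs to a cosieve if and only if the cosieve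
          moved along \<open>f\<close> is maximal. A classifying map is therefore determined by the
          places where it takes the value true.\<close>
        have "f \<in> r c (app \<chi>' c x) \<longleftrightarrow> Idt A d \<in> ac f (r c (app \<chi>' c x))"
          using ac_iff[OF f A.idt_in[OF d]] A.cmp_id_left[OF f] by simp
        also have "\<dots> \<longleftrightarrow> r d (app \<chi>' d (act X f x)) = top d"
          using ra[OF f \<chi>x] app_nat[OF \<chi>' f x] top_iff[OF d r[OF d \<chi>fx]] by simp
        also have "\<dots> \<longleftrightarrow> app \<chi>' d (act X f x) = i d (top d)"
          using ir[OF d \<chi>fx] ri[OF d topS] by metis
        also have "\<dots> \<longleftrightarrow> f \<in> C c x" using char[OF d fx] C_iff[OF f] by simp
        finally show "f \<in> r c (app \<chi>' c x) \<longleftrightarrow> f \<in> C c x" .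
      qed
      then show "app \<chi>' c x = app \<chi> c x" using ir[OF c \<chi>x] \<chi>_app[OF c x] by simp
    qed
    ultimately show ?thesis using \<chi> Hom_Cod[OF t] unfolding X_def by blast
  qed
  then have "is_subobject_classifier E t"
    using T Hom_Ar[OF t] Hom_Dom[OF t] unfolding is_subobject_classifier_def by auto
  then show ?thesis ..
qed

theorem topos: "topos E"
  unfolding topos_def using E.category_axioms finite_limits ex_exponential ex_classifier by blast

end

section \<open>Categories and adjunctions\<close>

context category
begin

lemma iso_arrowI:
  assumes "f \<in> Hom C A B" "g \<in> Hom C B A" "Cmp C g f = Idt C A" "Cmp C f g = Idt C B"
  shows "iso_arrow C f"
  using assms by (auto simp: iso_arrow_def Hom_def)

lemma iso_arrowE:
  assumes "iso_arrow C f" "f \<in> Hom C A B"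
  obtains g where "g \<in> Hom C B A" "Cmp C g f = Idt C A" "Cmp C f g = Idt C B"
  using assms by (auto simp: iso_arrow_def Hom_def)

lemma inverse_unique:
  assumes f: "f \<in> Hom C A B" and g: "g \<in> Hom C B A" "Cmp C g f = Idt C A"
    and h: "h \<in> Hom C B A" "Cmp C f h = Idt C B"
  shows "g = h"
  using cmp_assoc[OF h(1) f g(1)] g h cmp_id_left[OF h(1)] cmp_id_right[OF g(1)] by simp

lemma inv_arrow:
  assumes "iso_arrow C f" and f: "f \<in> Hom C A B"
  shows "inv_arrow C f \<in> Hom C B A" "Cmp C (inv_arrow C f) f = Idt C A" "Cmp C f (inv_arrow C f) = Idt C B"
proof -
  obtain g where g: "g \<in> Hom C B A" "Cmp C g f = Idt C A" "Cmp C f g = Idt C B"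
    using iso_arrowE[OF assms] .
  have "inv_arrow C f = g"
    unfolding inv_arrow_def Hom_Dom[OF f] Hom_Cod[OF f]
    by (rule the_equality) (use g inverse_unique[OF f] in auto)
  then show "inv_arrow C f \<in> Hom C B A" "Cmp C (inv_arrow C f) f = Idt C A" "Cmp C f (inv_arrow C f) = Idt C B"
    using g by auto
qed

lemma iso_inv_arrow: "iso_arrow C f \<Longrightarrow> f \<in> Hom C A B \<Longrightarrow> iso_arrow C (inv_arrow C f)"
  using inv_arrow iso_arrowI by metis

lemma iso_cmp:
  assumes "iso_arrow C f" "iso_arrow C g" and f: "f \<in> Hom C A B" and g: "g \<in> Hom C B D"
  shows "iso_arrow C (Cmp C g f)"
proof -
  obtain f' where f': "f' \<in> Hom C B A" "Cmp C f' f = Idt C A" "Cmp C f f' = Idt C B"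
    using iso_arrowE[OF assms(1) f] .
  obtain g' where g': "g' \<in> Hom C D B" "Cmp C g' g = Idt C B" "Cmp C g g' = Idt C D"
    using iso_arrowE[OF assms(2) g] .
  have "Cmp C (Cmp C f' g') (Cmp C g f) = Cmp C f' (Cmp C (Cmp C g' g) f)"
    using cmp_assoc[OF cmp_in[OF f g] g'(1) f'(1)] cmp_assoc[OF f g g'(1)] by simp
  then have 1: "Cmp C (Cmp C f' g') (Cmp C g f) = Idt C A" using f' g' cmp_id_left[OF f] by simp
  have "Cmp C (Cmp C g f) (Cmp C f' g') = Cmp C g (Cmp C (Cmp C f f') g')"
    using cmp_assoc[OF cmp_in[OF g'(1) f'(1)] f g] cmp_assoc[OF g'(1) f'(1) f] by simp
  then have 2: "Cmp C (Cmp C g f) (Cmp C f' g') = Idt C D" using f' g' cmp_id_left[OF g'(1)] by simp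
  show ?thesis by (rule iso_arrowI[OF cmp_in[OF f g] cmp_in[OF g'(1) f'(1)] 1 2])
qed

lemma iso_of_left_inverse:
  assumes "iso_arrow C g" and f: "f \<in> Hom C A B" and g: "g \<in> Hom C B A" and gf: "Cmp C g f = Idt C A"
  shows "iso_arrow C f"
proof -
  obtain h where h: "h \<in> Hom C A B" "Cmp C h g = Idt C B" "Cmp C g h = Idt C A"
    using iso_arrowE[OF assms(1) g] .
  have "f = h" using inverse_unique[OF g h(1,2) f gf] by simp
  then show ?thesis using iso_arrowI[OF f g gf] h by simp
qed

lemma iso_pre_ex1:
  assumes "iso_arrow C f" and f: "f \<in> Hom C A B" and g: "g \<in> Hom C A Z"
  shows "\<exists>!h. h \<in> Hom C B Z \<and> Cmp C h f = g"
proof -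
  obtain f' where f': "f' \<in> Hom C B A" "Cmp C f' f = Idt C A" "Cmp C f f' = Idt C B"
    using iso_arrowE[OF assms(1) f] .
  show ?thesis
  proof (rule ex1I[of _ "Cmp C g f'"])
    show "Cmp C g f' \<in> Hom C B Z \<and> Cmp C (Cmp C g f') f = g"
      using cmp_in[OF f'(1) g] cmp_assoc[OF f f'(1) g] f' cmp_id_right[OF g] by simp
    fix h assume h: "h \<in> Hom C B Z \<and> Cmp C h f = g"
    then show "h = Cmp C g f'" using cmp_assoc[OF f'(1) f, of h Z] f' cmp_id_right[of h B Z] by simp
  qed
qed

text \<open>The extension of the identity along \<open>f\<close> is a left inverse; uniqueness of
  the extension of \<open>f\<close> along itself makes it two-sided.\<close>

lemma iso_of_pre_ex1:
  assumes f: "f \<in> Hom C A B"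
    and ex: "\<And>Z g. Z \<in> Ob C \<Longrightarrow> g \<in> Hom C A Z \<Longrightarrow> \<exists>!h. h \<in> Hom C B Z \<and> Cmp C h f = g"
  shows "iso_arrow C f"
proof -
  have AB: "A \<in> Ob C" "B \<in> Ob C" using Hom_Ob[OF f] by auto
  obtain h where h: "h \<in> Hom C B A" "Cmp C h f = Idt C A" using ex[OF AB(1) idt_in[OF AB(1)]] by blast
  have "Cmp C (Cmp C f h) f = f" using cmp_assoc[OF f h(1) f] h cmp_id_right[OF f] by simp
  then have "Cmp C f h = Idt C B"
    using ex[OF AB(2) f] cmp_in[OF h(1) f] idt_in[OF AB(2)] cmp_id_left[OF f] by blast
  then show ?thesis using iso_arrowI[OF f h] by simp
qed

end

section \<open>Functors, natural transformations and opposite categories\<close>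

lemma functor_cats: "is_functor C D F \<Longrightarrow> category C" "is_functor C D F \<Longrightarrow> category D"
  by (auto simp: is_functor_def)

lemma functor_Ob: "is_functor C D F \<Longrightarrow> A \<in> Ob C \<Longrightarrow> FOb F A \<in> Ob D"
  by (auto simp: is_functor_def)

lemma functor_Hom: "is_functor C D F \<Longrightarrow> f \<in> Hom C A B \<Longrightarrow> FAr F f \<in> Hom D (FOb F A) (FOb F B)"
  by (auto simp: is_functor_def Hom_def)

lemma functor_idt: "is_functor C D F \<Longrightarrow> A \<in> Ob C \<Longrightarrow> FAr F (Idt C A) = Idt D (FOb F A)"
  by (auto simp: is_functor_def)

lemma functor_cmp: "is_functor C D F \<Longrightarrow> f \<in> Hom C A B \<Longrightarrow> g \<in> Hom C B E \<Longrightarrow>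
  FAr F (Cmp C g f) = Cmp D (FAr F g) (FAr F f)"
  by (auto simp: is_functor_def Hom_def)

lemma is_functorI:
  assumes "category C" "category D" "\<And>A. A \<in> Ob C \<Longrightarrow> FOb F A \<in> Ob D"
    "\<And>f A B. f \<in> Hom C A B \<Longrightarrow> FAr F f \<in> Hom D (FOb F A) (FOb F B)"
    "\<And>A. A \<in> Ob C \<Longrightarrow> FAr F (Idt C A) = Idt D (FOb F A)"
    "\<And>f g A B E. f \<in> Hom C A B \<Longrightarrow> g \<in> Hom C B E \<Longrightarrow> FAr F (Cmp C g f) = Cmp D (FAr F g) (FAr F f)"
  shows "is_functor C D F"
  unfolding is_functor_def
proof (intro conjI ballI impI assms(1,2))
  fix f assume "f \<in> Ar C"
  then show "FAr F f \<in> Hom D (FOb F (Dom C f)) (FOb F (Cod C f))" using assms(4) Ar_Hom by metis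
next
  fix f g assume "f \<in> Ar C" "g \<in> Ar C" "Cod C f = Dom C g"
  then show "FAr F (Cmp C g f) = Cmp D (FAr F g) (FAr F f)"
    using assms(6)[of f "Dom C f" "Cod C f" g "Cod C g"] by (simp add: Hom_def)
qed (use assms in auto)

lemma functor_comp:
  assumes F: "is_functor C D F" and G: "is_functor D E G" shows "is_functor C E (comp_func G F)"
proof (rule is_functorI)
  fix f g A B X assume f: "f \<in> Hom C A B" and g: "g \<in> Hom C B X"
  show "FAr (comp_func G F) (Cmp C g f) = Cmp E (FAr (comp_func G F) g) (FAr (comp_func G F) f)"
    using functor_cmp[OF F f g] functor_cmp[OF G functor_Hom[OF F f] functor_Hom[OF F g]] by (simp add: comp_func_def)
qed (use F G in \<open>simp_all add: functor_cats comp_func_def functor_Ob functor_Hom functor_idt\<close>)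

lemma functor_id: "category C \<Longrightarrow> is_functor C C id_func"
  by (rule is_functorI) (simp_all add: id_func_def)

lemma comp_func_simps [simp]: "FOb (comp_func G F) A = FOb G (FOb F A)" "FAr (comp_func G F) f = FAr G (FAr F f)"
  by (simp_all add: comp_func_def)

lemma id_func_simps [simp]: "FOb id_func A = A" "FAr id_func f = f"
  by (simp_all add: id_func_def)

lemma functor_iso:
  assumes F: "is_functor C D F" and f: "f \<in> Hom C A B" and "iso_arrow C f"
  shows "iso_arrow D (FAr F f)"
proof -
  interpret C: category C using functor_cats[OF F] by simp
  interpret D: category D using functor_cats[OF F] by simp
  obtain g where g: "g \<in> Hom C B A" "Cmp C g f = Idt C A" "Cmp C f g = Idt C B"
    using C.iso_arrowE[OF assms(3) f] .
  show ?thesis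
    by (rule D.iso_arrowI[OF functor_Hom[OF F f] functor_Hom[OF F g(1)]])
      (use functor_cmp[OF F f g(1)] functor_cmp[OF F g(1) f] g functor_idt[OF F] C.Hom_Ob[OF f] in auto)
qed

lemma nat_transI:
  assumes "is_functor C D F" "is_functor C D G"
    "\<And>A. A \<in> Ob C \<Longrightarrow> t A \<in> Hom D (FOb F A) (FOb G A)"
    "\<And>f A B. f \<in> Hom C A B \<Longrightarrow> Cmp D (t B) (FAr F f) = Cmp D (FAr G f) (t A)"
  shows "nat_trans C D F G t"
  unfolding nat_trans_def
proof (intro conjI ballI assms(1,2))
  fix f assume "f \<in> Ar C"
  then show "Cmp D (t (Cod C f)) (FAr F f) = Cmp D (FAr G f) (t (Dom C f))"
    using assms(4) Ar_Hom by metis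
qed (use assms in auto)

lemma nat_trans_Hom: "nat_trans C D F G t \<Longrightarrow> A \<in> Ob C \<Longrightarrow> t A \<in> Hom D (FOb F A) (FOb G A)"
  by (auto simp: nat_trans_def)

lemma nat_trans_nat: "nat_trans C D F G t \<Longrightarrow> f \<in> Hom C A B \<Longrightarrow> Cmp D (t B) (FAr F f) = Cmp D (FAr G f) (t A)"
  by (auto simp: nat_trans_def Hom_def)

lemma Hom_op [simp]: "Hom (op_cat C) A B = Hom C B A"
  by (auto simp: Hom_def op_cat_def)

lemma op_simps [simp]: "Ob (op_cat C) = Ob C" "Ar (op_cat C) = Ar C" "Dom (op_cat C) = Cod C" "Cod (op_cat C) = Dom C"
  "Idt (op_cat C) = Idt C" "Cmp (op_cat C) g f = Cmp C f g"
  by (simp_all add: op_cat_def)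

lemma op_op [simp]: "op_cat (op_cat C) = C"
  by (simp add: op_cat_def)

lemma category_op: "category C \<Longrightarrow> category (op_cat C)"
  unfolding category_def by (simp) metis

lemma functor_op:
  assumes F: "is_functor C D F" shows "is_functor (op_cat C) (op_cat D) F"
  by (rule is_functorI) (use F in \<open>simp_all add: functor_cats category_op functor_Ob functor_Hom functor_idt functor_cmp\<close>)

lemma nat_trans_op:
  assumes t: "nat_trans C D F G t" shows "nat_trans (op_cat C) (op_cat D) G F t"
proof (rule nat_transI)
  show "is_functor (op_cat C) (op_cat D) G" "is_functor (op_cat C) (op_cat D) F"
    using t by (auto simp: nat_trans_def functor_op)
qed (simp_all add: nat_trans_Hom[OF t] nat_trans_nat[OF t])

lemma adjunction_op:
  "adjunction C D F V \<eta> \<epsilon> \<Longrightarrow> adjunction (op_cat D) (op_cat C) V F \<epsilon> \<eta>"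
  unfolding adjunction_def by (simp add: functor_op nat_trans_op)

text \<open>A terminal object of the comma category of \<open>F\<close> over \<open>B\<close>, that
  is, the value at \<open>B\<close> of a right adjoint together with its counit.\<close>

definition couniversal ::
  "('o, 'a) cat \<Rightarrow> ('p, 'b) cat \<Rightarrow> ('o, 'a, 'p, 'b) func \<Rightarrow> 'p \<Rightarrow> 'o \<Rightarrow> 'b \<Rightarrow> bool" where
  "couniversal C D F B V e \<longleftrightarrow> V \<in> Ob C \<and> e \<in> Hom D (FOb F V) B \<and>
    (\<forall>Z \<in> Ob C. \<forall>g \<in> Hom D (FOb F Z) B. \<exists>!h. h \<in> Hom C Z V \<and> Cmp D e (FAr F h) = g)"

text \<open>The right adjoints of this development are assembled from one universal arrow per
  object. The object map is recorded because \<open>quality_typeI\<close> compares the values of two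
  functors by equality.\<close>

lemma adjunction_of_couniversal:
  assumes F: "is_functor C D F" and cu: "\<And>B. B \<in> Ob D \<Longrightarrow> couniversal C D F B (v B) (e B)"
  shows "\<exists>V \<eta>. adjunction C D F V \<eta> e \<and> FOb V = v"
proof -
  interpret C: category C using functor_cats[OF F] by simp
  interpret D: category D using functor_cats[OF F] by simp
  have v: "v B \<in> Ob C" and e: "e B \<in> Hom D (FOb F (v B)) B" if "B \<in> Ob D" for B
    using cu[OF that] by (auto simp: couniversal_def)
  have ex: "\<exists>!h. h \<in> Hom C Z (v B) \<and> Cmp D (e B) (FAr F h) = g"
    if "Z \<in> Ob C" "g \<in> Hom D (FOb F Z) B" for Z B g
    using cu[of B] D.Hom_Ob[OF that(2)] that by (auto simp: couniversal_def)
  define tr where "tr = (\<lambda>Z B g. THE h. h \<in> Hom C Z (v B) \<and> Cmp D (e B) (FAr F h) = g)"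
  have tr: "tr Z B g \<in> Hom C Z (v B)" "Cmp D (e B) (FAr F (tr Z B g)) = g"
    if "Z \<in> Ob C" "g \<in> Hom D (FOb F Z) B" for Z B g
    using theI'[OF ex[OF that]] by (auto simp: tr_def)
  \<comment> \<open>Arrows into \<open>v B\<close> agree as soon as their composites with the counit
    agree; the functor laws, naturality and the second triangle identity are all reduced to
    this.\<close>
  have eqI: "h = k" if "h \<in> Hom C Z (v B)" "k \<in> Hom C Z (v B)" "B \<in> Ob D"
    "Cmp D (e B) (FAr F h) = Cmp D (e B) (FAr F k)" for h k Z B
    using ex[of Z "Cmp D (e B) (FAr F k)" B] that C.Hom_Ob[OF that(1)] D.cmp_in[OF functor_Hom[OF F that(2)] e]
    by blast
  define V where "V = \<lparr>FOb = v, FAr = (\<lambda>g. tr (v (Dom D g)) (Cod D g) (Cmp D g (e (Dom D g))))\<rparr>"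
  define \<eta> where "\<eta> = (\<lambda>A. tr A (FOb F A) (Idt D (FOb F A)))"
  have VOb: "FOb V B = v B" for B by (simp add: V_def)
  have V: "FAr V g \<in> Hom C (v A) (v B)" "Cmp D (e B) (FAr F (FAr V g)) = Cmp D g (e A)"
    if g: "g \<in> Hom D A B" for g A B
    using tr[OF v D.cmp_in[OF e g]] D.Hom_Ob[OF g] by (auto simp: V_def Hom_Dom[OF g] Hom_Cod[OF g])
  have e_cmp: "Cmp D (e B) (FAr F (Cmp C h k)) = Cmp D (Cmp D (e B) (FAr F h)) (FAr F k)"
    if "h \<in> Hom C Y (v B)" "k \<in> Hom C Z Y" "B \<in> Ob D" for h k Y Z B
    using functor_cmp[OF F that(2,1)] D.cmp_assoc[OF functor_Hom[OF F that(2)] functor_Hom[OF F that(1)] e[OF that(3)]]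
    by simp
  have VF: "is_functor D C V"
  proof (rule is_functorI, unfold VOb)
    fix B assume B: "B \<in> Ob D"
    show "FAr V (Idt D B) = Idt C (v B)"
      by (rule eqI[OF V(1)[OF D.idt_in[OF B]] C.idt_in[OF v[OF B]] B])
        (simp add: V(2)[OF D.idt_in[OF B]] functor_idt[OF F v[OF B]] D.cmp_id_left[OF e[OF B]] D.cmp_id_right[OF e[OF B]])
  next
    fix f g A B E assume f: "f \<in> Hom D A B" and g: "g \<in> Hom D B E"
    have ob: "A \<in> Ob D" "B \<in> Ob D" "E \<in> Ob D" using D.Hom_Ob f g by blast+
    show "FAr V (Cmp D g f) = Cmp C (FAr V g) (FAr V f)"
    proof (rule eqI[OF V(1)[OF D.cmp_in[OF f g]] C.cmp_in[OF V(1)[OF f] V(1)[OF g]] ob(3)])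
      have "Cmp D (e E) (FAr F (Cmp C (FAr V g) (FAr V f))) = Cmp D (Cmp D g (e B)) (FAr F (FAr V f))"
        using e_cmp[OF V(1)[OF g] V(1)[OF f] ob(3)] V(2)[OF g] by simp
      also have "\<dots> = Cmp D (Cmp D g f) (e A)"
        using D.cmp_assoc[OF functor_Hom[OF F V(1)[OF f]] e[OF ob(2)] g] V(2)[OF f] D.cmp_assoc[OF e[OF ob(1)] f g] by simp
      finally show "Cmp D (e E) (FAr F (FAr V (Cmp D g f))) = Cmp D (e E) (FAr F (Cmp C (FAr V g) (FAr V f)))"
        using V(2)[OF D.cmp_in[OF f g]] by simp
    qed
  qed (use V v C.category_axioms D.category_axioms in auto)
  have FO: "FOb F A \<in> Ob D" if "A \<in> Ob C" for A using functor_Ob[OF F that] .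
  have \<eta>: "\<eta> A \<in> Hom C A (v (FOb F A))" "Cmp D (e (FOb F A)) (FAr F (\<eta> A)) = Idt D (FOb F A)" if "A \<in> Ob C" for A
    using tr[OF that D.idt_in[OF FO[OF that]]] by (auto simp: \<eta>_def)
  have "adjunction C D F V \<eta> e"
    unfolding adjunction_def
  proof (intro conjI ballI F VF)
    show "nat_trans C C id_func (comp_func V F) \<eta>"
    proof (rule nat_transI[OF functor_id[OF C.category_axioms] functor_comp[OF F VF]])
      fix f A B assume f: "f \<in> Hom C A B"
      have ob: "A \<in> Ob C" "B \<in> Ob C" using C.Hom_Ob[OF f] by auto
      note Ff = functor_Hom[OF F f]
      have "Cmp C (\<eta> B) f = Cmp C (FAr V (FAr F f)) (\<eta> A)"
      proof (rule eqI[OF C.cmp_in[OF f \<eta>(1)[OF ob(2)]] C.cmp_in[OF \<eta>(1)[OF ob(1)] V(1)[OF Ff]] FO[OF ob(2)]])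
        have "Cmp D (e (FOb F B)) (FAr F (Cmp C (\<eta> B) f)) = FAr F f"
          using e_cmp[OF \<eta>(1)[OF ob(2)] f FO[OF ob(2)]] \<eta>(2)[OF ob(2)] D.cmp_id_left[OF Ff] by simp
        moreover have "Cmp D (e (FOb F B)) (FAr F (Cmp C (FAr V (FAr F f)) (\<eta> A))) = FAr F f"
          using e_cmp[OF V(1)[OF Ff] \<eta>(1)[OF ob(1)] FO[OF ob(2)]] V(2)[OF Ff] \<eta>(2)[OF ob(1)]
            D.cmp_assoc[OF functor_Hom[OF F \<eta>(1)[OF ob(1)]] e[OF FO[OF ob(1)]] Ff] D.cmp_id_right[OF Ff] by simp
        ultimately show "Cmp D (e (FOb F B)) (FAr F (Cmp C (\<eta> B) f)) =
          Cmp D (e (FOb F B)) (FAr F (Cmp C (FAr V (FAr F f)) (\<eta> A)))" by simp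
      qed
      then show "Cmp C (\<eta> B) (FAr id_func f) = Cmp C (FAr (comp_func V F) f) (\<eta> A)" by simp
    qed (use \<eta> VOb in simp)
    show "nat_trans D D (comp_func F V) id_func e"
      by (rule nat_transI[OF functor_comp[OF VF F] functor_id[OF D.category_axioms]]) (use VOb e V in simp_all)
    fix A assume "A \<in> Ob C" then show "Cmp D (e (FOb F A)) (FAr F (\<eta> A)) = Idt D (FOb F A)" by (rule \<eta>)
  next
    fix B assume B: "B \<in> Ob D"
    note \<eta>v = \<eta>[OF v[OF B]] and Ve = V[OF e[OF B]]
    have "Cmp C (FAr V (e B)) (\<eta> (v B)) = Idt C (v B)"
    proof (rule eqI[OF C.cmp_in[OF \<eta>v(1) Ve(1)] C.idt_in[OF v[OF B]] B])
      show "Cmp D (e B) (FAr F (Cmp C (FAr V (e B)) (\<eta> (v B)))) = Cmp D (e B) (FAr F (Idt C (v B)))"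
        using e_cmp[OF Ve(1) \<eta>v(1) B] Ve(2) D.cmp_assoc[OF functor_Hom[OF F \<eta>v(1)] e[OF FO[OF v[OF B]]] e[OF B]] \<eta>v(2)
          functor_idt[OF F v[OF B]] by simp
    qed
    then show "Cmp C (FAr V (e B)) (\<eta> (FOb V B)) = Idt C (FOb V B)" using VOb by simp
  qed
  moreover have "FOb V = v" by (simp add: V_def)
  ultimately show ?thesis by blast
qed

locale adj =
  fixes C :: "('o, 'a) cat" and D :: "('p, 'b) cat" and F V \<eta> \<epsilon>
  assumes adjunction: "adjunction C D F V \<eta> \<epsilon>"
begin

lemma F: "is_functor C D F" and V: "is_functor D C V"
  and \<eta>_nat: "nat_trans C C id_func (comp_func V F) \<eta>"
  and \<epsilon>_nat: "nat_trans D D (comp_func F V) id_func \<epsilon>"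
  using adjunction by (auto simp: adjunction_def)

sublocale C: category C using functor_cats[OF F] by simp
sublocale D: category D using functor_cats[OF F] by simp

lemma \<eta>: "A \<in> Ob C \<Longrightarrow> \<eta> A \<in> Hom C A (FOb V (FOb F A))"
  using nat_trans_Hom[OF \<eta>_nat] by simp

lemma \<epsilon>: "B \<in> Ob D \<Longrightarrow> \<epsilon> B \<in> Hom D (FOb F (FOb V B)) B"
  using nat_trans_Hom[OF \<epsilon>_nat] by simp

lemma \<eta>_natural: "f \<in> Hom C A B \<Longrightarrow> Cmp C (\<eta> B) f = Cmp C (FAr V (FAr F f)) (\<eta> A)"
  using nat_trans_nat[OF \<eta>_nat] by simp

lemma \<epsilon>_natural: "f \<in> Hom D A B \<Longrightarrow> Cmp D (\<epsilon> B) (FAr F (FAr V f)) = Cmp D f (\<epsilon> A)"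
  using nat_trans_nat[OF \<epsilon>_nat] by simp

lemma triangle_F: "A \<in> Ob C \<Longrightarrow> Cmp D (\<epsilon> (FOb F A)) (FAr F (\<eta> A)) = Idt D (FOb F A)"
  and triangle_V: "B \<in> Ob D \<Longrightarrow> Cmp C (FAr V (\<epsilon> B)) (\<eta> (FOb V B)) = Idt C (FOb V B)"
  using adjunction by (auto simp: adjunction_def)

lemmas FOb = functor_Ob[OF F] and VOb = functor_Ob[OF V]
lemmas FHom = functor_Hom[OF F] and VHom = functor_Hom[OF V]
lemmas Fcmp = functor_cmp[OF F] and Vcmp = functor_cmp[OF V]

text \<open>Duality exchanges the two functors and the unit with the counit, so a fact about
  transposition in one direction yields the other.\<close>

lemma adj_op: "adj (op_cat D) (op_cat C) V F \<epsilon> \<eta>"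
  by (rule adj.intro, rule adjunction_op[OF adjunction])

lemma lower_ex1:
  assumes A: "A \<in> Ob C" and g: "g \<in> Hom D (FOb F A) B"
  shows "\<exists>!h. h \<in> Hom C A (FOb V B) \<and> Cmp D (\<epsilon> B) (FAr F h) = g"
proof (rule ex1I[of _ "Cmp C (FAr V g) (\<eta> A)"])
  have B: "B \<in> Ob D" using D.Hom_Ob[OF g] by simp
  have h: "Cmp C (FAr V g) (\<eta> A) \<in> Hom C A (FOb V B)" by (rule C.cmp_in[OF \<eta>[OF A] VHom[OF g]])
  have "Cmp D (\<epsilon> B) (FAr F (Cmp C (FAr V g) (\<eta> A))) = Cmp D (Cmp D (\<epsilon> B) (FAr F (FAr V g))) (FAr F (\<eta> A))"
    using Fcmp[OF \<eta>[OF A] VHom[OF g]] D.cmp_assoc[OF FHom[OF \<eta>[OF A]] FHom[OF VHom[OF g]] \<epsilon>[OF B]] by simp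
  also have "\<dots> = g"
    using \<epsilon>_natural[OF g] D.cmp_assoc[OF FHom[OF \<eta>[OF A]] \<epsilon>[OF FOb[OF A]] g] triangle_F[OF A] D.cmp_id_right[OF g] by simp
  finally show "Cmp C (FAr V g) (\<eta> A) \<in> Hom C A (FOb V B) \<and> Cmp D (\<epsilon> B) (FAr F (Cmp C (FAr V g) (\<eta> A))) = g"
    using h by simp
  fix h assume "h \<in> Hom C A (FOb V B) \<and> Cmp D (\<epsilon> B) (FAr F h) = g"
  then have h: "h \<in> Hom C A (FOb V B)" and g: "g = Cmp D (\<epsilon> B) (FAr F h)" by auto
  have "Cmp C (FAr V g) (\<eta> A) = Cmp C (FAr V (\<epsilon> B)) (Cmp C (FAr V (FAr F h)) (\<eta> A))"
    using g Vcmp[OF FHom[OF h] \<epsilon>[OF B]] C.cmp_assoc[OF \<eta>[OF A] VHom[OF FHom[OF h]] VHom[OF \<epsilon>[OF B]]] by simp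
  also have "\<dots> = h"
    using \<eta>_natural[OF h] C.cmp_assoc[OF h \<eta>[OF VOb[OF B]] VHom[OF \<epsilon>[OF B]]] triangle_V[OF B] C.cmp_id_left[OF h] by simp
  finally show "h = Cmp C (FAr V g) (\<eta> A)" by simp
qed

lemma upper_ex1:
  assumes "B \<in> Ob D" "h \<in> Hom C A (FOb V B)"
  shows "\<exists>!g. g \<in> Hom D (FOb F A) B \<and> Cmp C (FAr V g) (\<eta> A) = h"
  using adj.lower_ex1[OF adj_op, of B h A] assms by simp

text \<open>Fullness gives a preimage \<open>s\<close> of the unit at \<open>FOb V B\<close>;
  faithfulness and the triangle identities show that it inverts the counit.\<close>

lemma counit_iso_of_ff:
  assumes ff: "fully_faithful D C V" and B: "B \<in> Ob D"
  shows "iso_arrow D (\<epsilon> B)"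
proof -
  have "bij_betw (FAr V) (Hom D B (FOb F (FOb V B))) (Hom C (FOb V B) (FOb V (FOb F (FOb V B))))"
    using ff B FOb VOb by (simp add: fully_faithful_def)
  then obtain s where s: "s \<in> Hom D B (FOb F (FOb V B))" "FAr V s = \<eta> (FOb V B)"
    using \<eta>[OF VOb[OF B]] by (metis (no_types, lifting) bij_betw_imp_surj_on image_iff)
  have 1: "Cmp D (\<epsilon> B) s = Idt D B"
  proof -
    have "inj_on (FAr V) (Hom D B B)" using ff B by (simp add: fully_faithful_def bij_betw_def)
    moreover have "FAr V (Cmp D (\<epsilon> B) s) = FAr V (Idt D B)"
      using Vcmp[OF s(1) \<epsilon>[OF B]] s(2) triangle_V[OF B] functor_idt[OF V B] by simp
    ultimately show ?thesis using D.cmp_in[OF s(1) \<epsilon>[OF B]] D.idt_in[OF B] by (metis inj_onD)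
  qed
  have 2: "Cmp D s (\<epsilon> B) = Idt D (FOb F (FOb V B))"
    using \<epsilon>_natural[OF s(1)] s(2) triangle_F[OF VOb[OF B]] by simp
  show ?thesis by (rule D.iso_arrowI[OF \<epsilon>[OF B] s(1) 2 1])
qed

text \<open>Precomposition with the invertible counit turns the transposition bijection into the
  action of \<open>V\<close> on arrows.\<close>

lemma ff_of_counit_iso:
  assumes iso: "\<And>B. B \<in> Ob D \<Longrightarrow> iso_arrow D (\<epsilon> B)"
  shows "fully_faithful D C V"
  unfolding fully_faithful_def
proof (intro ballI)
  fix A B assume A: "A \<in> Ob D" and B: "B \<in> Ob D"
  have eq: "Cmp D (\<epsilon> B) (FAr F (FAr V g)) = Cmp D g (\<epsilon> A)" if "g \<in> Hom D A B" for g
    using \<epsilon>_natural[OF that] .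
  have pre: "\<exists>!g. g \<in> Hom D A B \<and> Cmp D g (\<epsilon> A) = k" if "k \<in> Hom D (FOb F (FOb V A)) B" for k
    using D.iso_pre_ex1[OF iso[OF A] \<epsilon>[OF A] that] .
  show "bij_betw (FAr V) (Hom D A B) (Hom C (FOb V A) (FOb V B))"
    unfolding bij_betw_def
  proof (intro conjI inj_onI equalityI subsetI)
    fix g g' assume g: "g \<in> Hom D A B" and g': "g' \<in> Hom D A B" and "FAr V g = FAr V g'"
    then have "Cmp D g (\<epsilon> A) = Cmp D g' (\<epsilon> A)" using eq by metis
    then show "g = g'" using pre[OF D.cmp_in[OF \<epsilon>[OF A] g]] g g' by metis
  next
    fix h assume h: "h \<in> Hom C (FOb V A) (FOb V B)"
    have k: "Cmp D (\<epsilon> B) (FAr F h) \<in> Hom D (FOb F (FOb V A)) B" by (rule D.cmp_in[OF FHom[OF h] \<epsilon>[OF B]])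
    obtain g where g: "g \<in> Hom D A B" "Cmp D g (\<epsilon> A) = Cmp D (\<epsilon> B) (FAr F h)" using pre[OF k] by blast
    have "FAr V g = h" using lower_ex1[OF VOb[OF A] k] eq[OF g(1)] g(2) h VHom[OF g(1)] by metis
    then show "h \<in> FAr V ` Hom D A B" using g(1) by blast
  qed (use VHom in auto)
qed

lemma F_unit_iso:
  assumes A: "A \<in> Ob C" and "iso_arrow D (\<epsilon> (FOb F A))"
  shows "iso_arrow D (FAr F (\<eta> A))"
  by (rule D.iso_of_left_inverse[OF assms(2) FHom[OF \<eta>[OF A]] \<epsilon>[OF FOb[OF A]] triangle_F[OF A]])

lemma unit_V_iso:
  assumes B: "B \<in> Ob D" and "iso_arrow D (\<epsilon> B)"
  shows "iso_arrow C (\<eta> (FOb V B))"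
  by (rule C.iso_of_left_inverse[OF functor_iso[OF V \<epsilon>[OF B] assms(2)] \<eta>[OF VOb[OF B]] VHom[OF \<epsilon>[OF B]] triangle_V[OF B]])

end

text \<open>The sheaf condition for a single arrow: \<open>X\<close> sees \<open>m\<close> as an
  isomorphism. If \<open>m\<close> is the inclusion of a sieve into a representable functor, it says
  that compatible families have unique gluings.\<close>

definition orthogonal :: "('o, 'a) cat \<Rightarrow> 'a \<Rightarrow> 'o \<Rightarrow> bool" where
  "orthogonal C m X \<longleftrightarrow> (\<forall>u \<in> Hom C (Dom C m) X. \<exists>!v. v \<in> Hom C (Cod C m) X \<and> Cmp C v m = u)"

lemma orthogonalD:
  "orthogonal C m X \<Longrightarrow> m \<in> Hom C P Q \<Longrightarrow> u \<in> Hom C P X \<Longrightarrow> \<exists>!v. v \<in> Hom C Q X \<and> Cmp C v m = u"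
  by (auto simp: orthogonal_def Hom_def)

lemma orthogonalI:
  "m \<in> Hom C P Q \<Longrightarrow> (\<And>u. u \<in> Hom C P X \<Longrightarrow> \<exists>!v. v \<in> Hom C Q X \<and> Cmp C v m = u) \<Longrightarrow> orthogonal C m X"
  by (auto simp: orthogonal_def Hom_def)

lemma orthogonal_iso:
  assumes "category C" and m: "m \<in> Hom C P Q" and o: "orthogonal C m X"
    and r: "r \<in> Hom C X Y" "iso_arrow C r"
  shows "orthogonal C m Y"
proof (rule orthogonalI[OF m])
  interpret category C by fact
  fix u assume u: "u \<in> Hom C P Y"
  obtain s where s: "s \<in> Hom C Y X" "Cmp C s r = Idt C X" "Cmp C r s = Idt C Y"
    using iso_arrowE[OF r(2,1)] .
  note ex = orthogonalD[OF o m cmp_in[OF u s(1)]]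
  obtain v where v: "v \<in> Hom C Q X" "Cmp C v m = Cmp C s u" using ex by blast
  show "\<exists>!v. v \<in> Hom C Q Y \<and> Cmp C v m = u"
  proof (rule ex1I[of _ "Cmp C r v"])
    show "Cmp C r v \<in> Hom C Q Y \<and> Cmp C (Cmp C r v) m = u"
      using cmp_in[OF v(1) r(1)] cmp_assoc[OF m v(1) r(1)] v(2) cmp_assoc[OF u s(1) r(1)] s(3) cmp_id_left[OF u] by simp
    fix w assume w: "w \<in> Hom C Q Y \<and> Cmp C w m = u"
    then have "Cmp C s w \<in> Hom C Q X \<and> Cmp C (Cmp C s w) m = Cmp C s u"
      using cmp_in[OF _ s(1)] cmp_assoc[OF m _ s(1), of w] by auto
    then have "Cmp C s w = v" using ex v by blast
    then show "w = Cmp C r v" using w cmp_assoc[OF _ s(1) r(1), of w Q] s(3) cmp_id_left[of w Q Y] by auto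
  qed
qed

section \<open>Orthogonality and adjunctions\<close>

context adj
begin

text \<open>Transposition turns extension along \<open>m\<close> with values in
  \<open>FOb V Y\<close> into extension along \<open>FAr F m\<close>, which is invertible.\<close>

lemma orthogonal_V:
  assumes m: "m \<in> Hom C P Q" and iso: "iso_arrow D (FAr F m)" and Y: "Y \<in> Ob D"
  shows "orthogonal C m (FOb V Y)"
proof (rule orthogonalI[OF m])
  fix u assume u: "u \<in> Hom C P (FOb V Y)"
  have PQ: "P \<in> Ob C" "Q \<in> Ob C" using C.Hom_Ob[OF m] by auto
  have k: "Cmp D (\<epsilon> Y) (FAr F u) \<in> Hom D (FOb F P) Y" by (rule D.cmp_in[OF FHom[OF u] \<epsilon>[OF Y]])
  note ex = D.iso_pre_ex1[OF iso FHom[OF m] k]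
  have tr: "Cmp D (\<epsilon> Y) (FAr F (Cmp C v m)) = Cmp D (Cmp D (\<epsilon> Y) (FAr F v)) (FAr F m)" if "v \<in> Hom C Q (FOb V Y)" for v
    using Fcmp[OF m that] D.cmp_assoc[OF FHom[OF m] FHom[OF that] \<epsilon>[OF Y]] by simp
  have iff: "Cmp C v m = u \<longleftrightarrow> Cmp D (Cmp D (\<epsilon> Y) (FAr F v)) (FAr F m) = Cmp D (\<epsilon> Y) (FAr F u)"
    if "v \<in> Hom C Q (FOb V Y)" for v
    using tr[OF that] lower_ex1[OF PQ(1) k] C.cmp_in[OF m that] u by metis
  obtain g where g: "g \<in> Hom D (FOb F Q) Y" "Cmp D g (FAr F m) = Cmp D (\<epsilon> Y) (FAr F u)" using ex by blast
  obtain v where v: "v \<in> Hom C Q (FOb V Y)" "Cmp D (\<epsilon> Y) (FAr F v) = g" using lower_ex1[OF PQ(2) g(1)] by blast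
  show "\<exists>!v. v \<in> Hom C Q (FOb V Y) \<and> Cmp C v m = u"
  proof (rule ex1I[of _ v])
    show "v \<in> Hom C Q (FOb V Y) \<and> Cmp C v m = u" using v g iff by simp
    fix w assume w: "w \<in> Hom C Q (FOb V Y) \<and> Cmp C w m = u"
    then have "Cmp D (Cmp D (\<epsilon> Y) (FAr F w)) (FAr F m) = Cmp D (\<epsilon> Y) (FAr F u)" using iff[of w] by blast
    then have "Cmp D (\<epsilon> Y) (FAr F w) = g" using ex g w D.cmp_in[OF FHom \<epsilon>[OF Y], of w Q] by blast
    then show "w = v" using lower_ex1[OF PQ(2) g(1)] v w by blast
  qed
qed

text \<open>The converse transposition: if all values of \<open>V\<close> are local for
  \<open>m\<close>, precomposition with \<open>FAr F m\<close> is bijective for every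
  target.\<close>

lemma F_iso_of_orthogonal:
  assumes m: "m \<in> Hom C P Q" and o: "\<And>B. B \<in> Ob D \<Longrightarrow> orthogonal C m (FOb V B)"
  shows "iso_arrow D (FAr F m)"
proof (rule D.iso_of_pre_ex1[OF FHom[OF m]])
  fix B g assume B: "B \<in> Ob D" and g: "g \<in> Hom D (FOb F P) B"
  have PQ: "P \<in> Ob C" "Q \<in> Ob C" using C.Hom_Ob[OF m] by auto
  obtain u where u: "u \<in> Hom C P (FOb V B)" "Cmp D (\<epsilon> B) (FAr F u) = g" using lower_ex1[OF PQ(1) g] by blast
  note ex = orthogonalD[OF o[OF B] m u(1)]
  have tr: "Cmp D (\<epsilon> B) (FAr F (Cmp C v m)) = Cmp D (Cmp D (\<epsilon> B) (FAr F v)) (FAr F m)" if "v \<in> Hom C Q (FOb V B)" for v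
    using Fcmp[OF m that] D.cmp_assoc[OF FHom[OF m] FHom[OF that] \<epsilon>[OF B]] by simp
  obtain v where v: "v \<in> Hom C Q (FOb V B)" "Cmp C v m = u" using ex by blast
  show "\<exists>!h. h \<in> Hom D (FOb F Q) B \<and> Cmp D h (FAr F m) = g"
  proof (rule ex1I[of _ "Cmp D (\<epsilon> B) (FAr F v)"])
    show "Cmp D (\<epsilon> B) (FAr F v) \<in> Hom D (FOb F Q) B \<and> Cmp D (Cmp D (\<epsilon> B) (FAr F v)) (FAr F m) = g"
      using D.cmp_in[OF FHom[OF v(1)] \<epsilon>[OF B]] tr[OF v(1)] v(2) u(2) by simp
    fix h assume h: "h \<in> Hom D (FOb F Q) B \<and> Cmp D h (FAr F m) = g"
    then obtain w where w: "w \<in> Hom C Q (FOb V B)" "Cmp D (\<epsilon> B) (FAr F w) = h" using lower_ex1[OF PQ(2)] by blast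
    have "Cmp C w m = u"
      using lower_ex1[OF PQ(1) g] u C.cmp_in[OF m w(1)] tr[OF w(1)] w(2) h by metis
    then have "w = v" using ex w v by blast
    then show "h = Cmp D (\<epsilon> B) (FAr F v)" using w by simp
  qed
qed

text \<open>Locality of \<open>X\<close> gives a retraction \<open>r\<close> of the unit. The target
  of the unit is local for it as well, and the composite of \<open>r\<close> with the unit agrees
  with the identity after precomposition with the unit, so \<open>r\<close> is a two-sided
  inverse.\<close>

lemma unit_iso_of_orthogonal:
  assumes ff: "fully_faithful D C V" and X: "X \<in> Ob C" and o: "orthogonal C (\<eta> X) X"
  shows "iso_arrow C (\<eta> X)"
proof -
  let ?Z = "FOb V (FOb F X)"
  have Z: "?Z \<in> Ob C" using VOb FOb X by blast
  note \<eta>X = \<eta>[OF X]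
  have iso: "iso_arrow D (FAr F (\<eta> X))" by (rule F_unit_iso[OF X counit_iso_of_ff[OF ff FOb[OF X]]])
  obtain r where r: "r \<in> Hom C ?Z X" "Cmp C r (\<eta> X) = Idt C X"
    using orthogonalD[OF o \<eta>X C.idt_in[OF X]] by blast
  have "Cmp C (Cmp C (\<eta> X) r) (\<eta> X) = \<eta> X" using C.cmp_assoc[OF \<eta>X r(1) \<eta>X] r(2) C.cmp_id_right[OF \<eta>X] by simp
  then have "Cmp C (\<eta> X) r = Idt C ?Z"
    using orthogonalD[OF orthogonal_V[OF \<eta>X iso FOb[OF X]] \<eta>X \<eta>X] C.cmp_in[OF r(1) \<eta>X] C.idt_in[OF Z] C.cmp_id_left[OF \<eta>X]
    by blast
  then show ?thesis using C.iso_arrowI[OF \<eta>X r] by simp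
qed

text \<open>The form in which one subtopos is shown to be above another: the composite of
  \<open>F\<close> with \<open>K\<close> is the factorization that \<open>above\<close> asks
  for.\<close>

lemma nat_iso_of_unit_iso:
  assumes K: "is_functor G C K" and iso: "\<And>Y. Y \<in> Ob G \<Longrightarrow> iso_arrow C (\<eta> (FOb K Y))"
  shows "is_functor G D (comp_func F K)" "nat_isomorphic G C (comp_func V (comp_func F K)) K"
proof -
  show FK: "is_functor G D (comp_func F K)" by (rule functor_comp[OF K F])
  define t where "t = (\<lambda>Y. inv_arrow C (\<eta> (FOb K Y)))"
  have KO: "FOb K Y \<in> Ob C" if "Y \<in> Ob G" for Y using functor_Ob[OF K that] .
  have t: "t Y \<in> Hom C (FOb V (FOb F (FOb K Y))) (FOb K Y)" "Cmp C (t Y) (\<eta> (FOb K Y)) = Idt C (FOb K Y)"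
    "Cmp C (\<eta> (FOb K Y)) (t Y) = Idt C (FOb V (FOb F (FOb K Y)))" if "Y \<in> Ob G" for Y
    using C.inv_arrow[OF iso[OF that] \<eta>[OF KO[OF that]]] by (auto simp: t_def)
  have "nat_trans G C (comp_func V (comp_func F K)) K t"
  proof (rule nat_transI[OF functor_comp[OF FK V] K])
    fix f A B assume f: "f \<in> Hom G A B"
    interpret G: category G using functor_cats[OF K] by simp
    have AB: "A \<in> Ob G" "B \<in> Ob G" using G.Hom_Ob[OF f] by auto
    note Kf = functor_Hom[OF K f]
    note VFKf = VHom[OF FHom[OF Kf]]
    have "Cmp C (t B) (FAr V (FAr F (FAr K f))) = Cmp C (t B) (Cmp C (FAr V (FAr F (FAr K f))) (Cmp C (\<eta> (FOb K A)) (t A)))"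
      using t(3)[OF AB(1)] C.cmp_id_right[OF VFKf] by simp
    also have "\<dots> = Cmp C (t B) (Cmp C (\<eta> (FOb K B)) (Cmp C (FAr K f) (t A)))"
      using C.cmp_assoc[OF t(1)[OF AB(1)] \<eta>[OF KO[OF AB(1)]] VFKf] \<eta>_natural[OF Kf]
        C.cmp_assoc[OF t(1)[OF AB(1)] Kf \<eta>[OF KO[OF AB(2)]]] by simp
    also have "\<dots> = Cmp C (FAr K f) (t A)"
      using C.cmp_assoc[OF C.cmp_in[OF t(1)[OF AB(1)] Kf] \<eta>[OF KO[OF AB(2)]] t(1)[OF AB(2)]] t(2)[OF AB(2)]
        C.cmp_id_left[OF C.cmp_in[OF t(1)[OF AB(1)] Kf]] by simp
    finally show "Cmp C (t B) (FAr (comp_func V (comp_func F K)) f) = Cmp C (FAr K f) (t A)" by simp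
  qed (use t in simp)
  moreover have "iso_arrow C (t Y)" if "Y \<in> Ob G" for Y
    using C.iso_inv_arrow[OF iso[OF that] \<eta>[OF KO[OF that]]] by (simp add: t_def)
  ultimately show "nat_isomorphic G C (comp_func V (comp_func F K)) K" unfolding nat_isomorphic_def by blast
qed

end

text \<open>The canonical morphism is specified through its inverse image, so its direct image is
  known only up to isomorphism. The last clause allows units to be compared along this
  isomorphism.\<close>

lemma right_adjoint_unique:
  assumes a: "adjunction C D F V \<eta> \<epsilon>" and a': "adjunction C D F V' \<eta>' \<epsilon>'"
  obtains \<theta> where "nat_trans D C V V' \<theta>" "\<And>B. B \<in> Ob D \<Longrightarrow> iso_arrow C (\<theta> B)"
    "\<And>A. A \<in> Ob C \<Longrightarrow> Cmp C (\<theta> (FOb F A)) (\<eta> A) = \<eta>' A"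
proof -
  interpret a: adj C D F V \<eta> \<epsilon> using a by (rule adj.intro)
  interpret a': adj C D F V' \<eta>' \<epsilon>' using a' by (rule adj.intro)
  have ex: "\<exists>\<theta>. \<forall>B \<in> Ob D. \<theta> B \<in> Hom C (FOb V B) (FOb V' B) \<and> Cmp D (\<epsilon>' B) (FAr F (\<theta> B)) = \<epsilon> B"
    using a'.lower_ex1[OF a.VOb a.\<epsilon>] by (intro bchoice) blast
  have ex': "\<exists>\<theta>. \<forall>B \<in> Ob D. \<theta> B \<in> Hom C (FOb V' B) (FOb V B) \<and> Cmp D (\<epsilon> B) (FAr F (\<theta> B)) = \<epsilon>' B"
    using a.lower_ex1[OF a'.VOb a'.\<epsilon>] by (intro bchoice) blast
  obtain \<theta> where \<theta>: "\<And>B. B \<in> Ob D \<Longrightarrow> \<theta> B \<in> Hom C (FOb V B) (FOb V' B)"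
    "\<And>B. B \<in> Ob D \<Longrightarrow> Cmp D (\<epsilon>' B) (FAr F (\<theta> B)) = \<epsilon> B" using ex by blast
  obtain \<zeta> where \<zeta>: "\<And>B. B \<in> Ob D \<Longrightarrow> \<zeta> B \<in> Hom C (FOb V' B) (FOb V B)"
    "\<And>B. B \<in> Ob D \<Longrightarrow> Cmp D (\<epsilon> B) (FAr F (\<zeta> B)) = \<epsilon>' B" using ex' by blast
  have eq: "h = k" if "h \<in> Hom C A (FOb V B)" "k \<in> Hom C A (FOb V B)" "B \<in> Ob D"
    "Cmp D (\<epsilon> B) (FAr F h) = Cmp D (\<epsilon> B) (FAr F k)" for h k A B
    using a.lower_ex1[OF _ a.D.cmp_in[OF a.FHom[OF that(1)] a.\<epsilon>[OF that(3)]]] that a.C.Hom_Ob[OF that(1)] by metis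
  have eq': "h = k" if "h \<in> Hom C A (FOb V' B)" "k \<in> Hom C A (FOb V' B)" "B \<in> Ob D"
    "Cmp D (\<epsilon>' B) (FAr F h) = Cmp D (\<epsilon>' B) (FAr F k)" for h k A B
    using a'.lower_ex1[OF _ a.D.cmp_in[OF a.FHom[OF that(1)] a'.\<epsilon>[OF that(3)]]] that a.C.Hom_Ob[OF that(1)] by metis
  have e: "Cmp D (\<epsilon> B) (FAr F (Cmp C h k)) = Cmp D (Cmp D (\<epsilon> B) (FAr F h)) (FAr F k)"
    if "k \<in> Hom C A X" "h \<in> Hom C X (FOb V B)" "B \<in> Ob D" for h k A X B
    using a.Fcmp[OF that(1,2)] a.D.cmp_assoc[OF a.FHom[OF that(1)] a.FHom[OF that(2)] a.\<epsilon>[OF that(3)]] by simp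
  have e': "Cmp D (\<epsilon>' B) (FAr F (Cmp C h k)) = Cmp D (Cmp D (\<epsilon>' B) (FAr F h)) (FAr F k)"
    if "k \<in> Hom C A X" "h \<in> Hom C X (FOb V' B)" "B \<in> Ob D" for h k A X B
    using a.Fcmp[OF that(1,2)] a.D.cmp_assoc[OF a.FHom[OF that(1)] a.FHom[OF that(2)] a'.\<epsilon>[OF that(3)]] by simp
  have "nat_trans D C V V' \<theta>"
  proof (rule nat_transI[OF a.V a'.V \<theta>(1)])
    fix f A B assume f: "f \<in> Hom D A B"
    have AB: "A \<in> Ob D" "B \<in> Ob D" using a.D.Hom_Ob[OF f] by auto
    show "Cmp C (\<theta> B) (FAr V f) = Cmp C (FAr V' f) (\<theta> A)"
    proof (rule eq'[OF a.C.cmp_in[OF a.VHom[OF f] \<theta>(1)[OF AB(2)]] a.C.cmp_in[OF \<theta>(1)[OF AB(1)] a'.VHom[OF f]] AB(2)])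
      show "Cmp D (\<epsilon>' B) (FAr F (Cmp C (\<theta> B) (FAr V f))) = Cmp D (\<epsilon>' B) (FAr F (Cmp C (FAr V' f) (\<theta> A)))"
        using e'[OF a.VHom[OF f] \<theta>(1)[OF AB(2)] AB(2)] \<theta>(2)[OF AB(2)] a.\<epsilon>_natural[OF f]
          e'[OF \<theta>(1)[OF AB(1)] a'.VHom[OF f] AB(2)] a'.\<epsilon>_natural[OF f] \<theta>(2)[OF AB(1)]
          a.D.cmp_assoc[OF a.FHom[OF \<theta>(1)[OF AB(1)]] a'.\<epsilon>[OF AB(1)] f] by simp
    qed
  qed
  moreover have "iso_arrow C (\<theta> B)" if B: "B \<in> Ob D" for B
  proof (rule a.C.iso_arrowI[OF \<theta>(1)[OF B] \<zeta>(1)[OF B]])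
    show "Cmp C (\<zeta> B) (\<theta> B) = Idt C (FOb V B)"
      by (rule eq[OF a.C.cmp_in[OF \<theta>(1)[OF B] \<zeta>(1)[OF B]] a.C.idt_in[OF a.VOb[OF B]] B])
        (use e[OF \<theta>(1)[OF B] \<zeta>(1)[OF B] B] \<theta>(2)[OF B] \<zeta>(2)[OF B] functor_idt[OF a.F a.VOb[OF B]]
          a.D.cmp_id_right[OF a.\<epsilon>[OF B]] in simp)
    show "Cmp C (\<theta> B) (\<zeta> B) = Idt C (FOb V' B)"
      by (rule eq'[OF a.C.cmp_in[OF \<zeta>(1)[OF B] \<theta>(1)[OF B]] a.C.idt_in[OF a'.VOb[OF B]] B])
        (use e'[OF \<zeta>(1)[OF B] \<theta>(1)[OF B] B] \<theta>(2)[OF B] \<zeta>(2)[OF B] functor_idt[OF a.F a'.VOb[OF B]]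
          a.D.cmp_id_right[OF a'.\<epsilon>[OF B]] in simp)
  qed
  moreover have "Cmp C (\<theta> (FOb F A)) (\<eta> A) = \<eta>' A" if A: "A \<in> Ob C" for A
    by (rule eq'[OF a.C.cmp_in[OF a.\<eta>[OF A] \<theta>(1)[OF a.FOb[OF A]]] a'.\<eta>[OF A] a.FOb[OF A]])
      (use e'[OF a.\<eta>[OF A] \<theta>(1)[OF a.FOb[OF A]] a.FOb[OF A]] \<theta>(2)[OF a.FOb[OF A]] a.triangle_F[OF A] a'.triangle_F[OF A] in simp)
  ultimately show thesis using that by blast
qed

text \<open>Applied to evaluation and to the direct image of the canonical morphism, in both
  directions.\<close>

lemma couniversal_iso:
  assumes F: "is_functor C D F" and F': "is_functor C D F'" and t: "nat_trans C D F' F t"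
    and iso: "\<And>A. A \<in> Ob C \<Longrightarrow> iso_arrow D (t A)" and cu: "couniversal C D F B V e"
  shows "couniversal C D F' B V (Cmp D e (t V))"
  unfolding couniversal_def
proof (intro conjI ballI)
  interpret D: category D using functor_cats[OF F] by simp
  interpret C: category C using functor_cats[OF F] by simp
  have V: "V \<in> Ob C" and e: "e \<in> Hom D (FOb F V) B" using cu by (auto simp: couniversal_def)
  show "V \<in> Ob C" by fact
  show "Cmp D e (t V) \<in> Hom D (FOb F' V) B" by (rule D.cmp_in[OF nat_trans_Hom[OF t V] e])
  fix Z g assume Z: "Z \<in> Ob C" and g: "g \<in> Hom D (FOb F' Z) B"
  obtain s where s: "s \<in> Hom D (FOb F Z) (FOb F' Z)" "Cmp D s (t Z) = Idt D (FOb F' Z)" "Cmp D (t Z) s = Idt D (FOb F Z)"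
    using D.iso_arrowE[OF iso[OF Z] nat_trans_Hom[OF t Z]] .
  have "\<exists>!h. h \<in> Hom C Z V \<and> Cmp D e (FAr F h) = Cmp D g s"
    using cu D.cmp_in[OF s(1) g] Z by (auto simp: couniversal_def)
  moreover have "Cmp D (Cmp D e (t V)) (FAr F' h) = g \<longleftrightarrow> Cmp D e (FAr F h) = Cmp D g s" if h: "h \<in> Hom C Z V" for h
  proof -
    note Fh = functor_Hom[OF F h] and F'h = functor_Hom[OF F' h] and tZ = nat_trans_Hom[OF t Z] and tV = nat_trans_Hom[OF t V]
    have 1: "Cmp D (Cmp D e (t V)) (FAr F' h) = Cmp D (Cmp D e (FAr F h)) (t Z)"
      using D.cmp_assoc[OF F'h tV e] nat_trans_nat[OF t h] D.cmp_assoc[OF tZ Fh e] by simp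
    have eh: "Cmp D e (FAr F h) \<in> Hom D (FOb F Z) B" by (rule D.cmp_in[OF Fh e])
    show ?thesis
      using 1 D.iso_pre_ex1[OF iso[OF Z] tZ g] eh D.cmp_in[OF s(1) g] D.cmp_assoc[OF tZ s(1) g] s(2) D.cmp_id_right[OF g]
      by metis
  qed
  ultimately show "\<exists>!h. h \<in> Hom C Z V \<and> Cmp D (Cmp D e (t V)) (FAr F' h) = g" by metis
qed

text \<open>The unit and counit are written exactly as in \<open>comp_geom\<close>, so that
  composing geometric morphisms is composing adjunctions.\<close>

lemma adjunction_comp:
  assumes p: "adjunction S E L R \<eta> \<epsilon>" and j: "adjunction E G L' R' \<eta>' \<epsilon>'"
  shows "adjunction S G (comp_func L' L) (comp_func R R')
    (\<lambda>X. Cmp S (FAr R (\<eta>' (FOb L X))) (\<eta> X)) (\<lambda>Y. Cmp G (\<epsilon>' Y) (FAr L' (\<epsilon> (FOb R' Y))))"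
    (is "adjunction S G ?L ?R ?\<eta> ?\<epsilon>")
proof -
  interpret p: adj S E L R \<eta> \<epsilon> using p by (rule adj.intro)
  interpret j: adj E G L' R' \<eta>' \<epsilon>' using j by (rule adj.intro)
  have L: "is_functor S G ?L" by (rule functor_comp[OF p.F j.F])
  have R: "is_functor G S ?R" by (rule functor_comp[OF j.V p.V])
  have \<eta>H: "?\<eta> X \<in> Hom S X (FOb R (FOb R' (FOb L' (FOb L X))))" if X: "X \<in> Ob S" for X
    by (rule p.C.cmp_in[OF p.\<eta>[OF X] p.VHom[OF j.\<eta>[OF p.FOb[OF X]]]])
  have \<epsilon>H: "?\<epsilon> Y \<in> Hom G (FOb L' (FOb L (FOb R (FOb R' Y)))) Y" if Y: "Y \<in> Ob G" for Y
    by (rule j.D.cmp_in[OF j.FHom[OF p.\<epsilon>[OF j.VOb[OF Y]]] j.\<epsilon>[OF Y]])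
  show ?thesis
    unfolding adjunction_def
  proof (intro conjI ballI L R)
    show "nat_trans S S id_func (comp_func ?R ?L) ?\<eta>"
    proof (rule nat_transI[OF functor_id[OF p.C.category_axioms] functor_comp[OF L R]])
      fix f A B assume f: "f \<in> Hom S A B"
      have AB: "A \<in> Ob S" "B \<in> Ob S" using p.C.Hom_Ob[OF f] by auto
      note Lf = p.FHom[OF f]
      note RLf = p.VHom[OF Lf] and \<eta>A = p.\<eta>[OF AB(1)] and \<eta>B = p.\<eta>[OF AB(2)]
        and R\<eta>A = p.VHom[OF j.\<eta>[OF p.FOb[OF AB(1)]]] and R\<eta>B = p.VHom[OF j.\<eta>[OF p.FOb[OF AB(2)]]]
      have "Cmp S (?\<eta> B) f = Cmp S (FAr R (\<eta>' (FOb L B))) (Cmp S (FAr R (FAr L f)) (\<eta> A))"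
        using p.C.cmp_assoc[OF f \<eta>B R\<eta>B] p.\<eta>_natural[OF f] by simp
      also have "\<dots> = Cmp S (FAr R (Cmp E (\<eta>' (FOb L B)) (FAr L f))) (\<eta> A)"
        using p.C.cmp_assoc[OF \<eta>A RLf R\<eta>B] p.Vcmp[OF Lf j.\<eta>[OF p.FOb[OF AB(2)]]] by simp
      also have "\<dots> = Cmp S (FAr R (FAr R' (FAr L' (FAr L f)))) (?\<eta> A)"
        using j.\<eta>_natural[OF Lf] p.Vcmp[OF j.\<eta>[OF p.FOb[OF AB(1)]] j.VHom[OF j.FHom[OF Lf]]]
          p.C.cmp_assoc[OF \<eta>A R\<eta>A p.VHom[OF j.VHom[OF j.FHom[OF Lf]]]] by simp
      finally show "Cmp S (?\<eta> B) (FAr id_func f) = Cmp S (FAr (comp_func ?R ?L) f) (?\<eta> A)" by simp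
    qed (use \<eta>H in simp)
    show "nat_trans G G (comp_func ?L ?R) id_func ?\<epsilon>"
    proof (rule nat_transI[OF functor_comp[OF R L] functor_id[OF j.D.category_axioms]])
      fix f A B assume f: "f \<in> Hom G A B"
      have AB: "A \<in> Ob G" "B \<in> Ob G" using j.D.Hom_Ob[OF f] by auto
      note Rf = j.VHom[OF f]
      note LRRf = p.FHom[OF p.VHom[OF Rf]] and \<epsilon>A = p.\<epsilon>[OF j.VOb[OF AB(1)]] and \<epsilon>B = p.\<epsilon>[OF j.VOb[OF AB(2)]]
      have "Cmp G (?\<epsilon> B) (FAr L' (FAr L (FAr R (FAr R' f)))) =
        Cmp G (\<epsilon>' B) (FAr L' (Cmp E (\<epsilon> (FOb R' B)) (FAr L (FAr R (FAr R' f)))))"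
        using j.D.cmp_assoc[OF j.FHom[OF LRRf] j.FHom[OF \<epsilon>B] j.\<epsilon>[OF AB(2)]] j.Fcmp[OF LRRf \<epsilon>B] by simp
      also have "\<dots> = Cmp G (Cmp G (\<epsilon>' B) (FAr L' (FAr R' f))) (FAr L' (\<epsilon> (FOb R' A)))"
        using p.\<epsilon>_natural[OF Rf] j.Fcmp[OF \<epsilon>A Rf] j.D.cmp_assoc[OF j.FHom[OF \<epsilon>A] j.FHom[OF Rf] j.\<epsilon>[OF AB(2)]] by simp
      also have "\<dots> = Cmp G f (?\<epsilon> A)"
        using j.\<epsilon>_natural[OF f] j.D.cmp_assoc[OF j.FHom[OF \<epsilon>A] j.\<epsilon>[OF AB(1)] f] by simp
      finally show "Cmp G (?\<epsilon> B) (FAr (comp_func ?L ?R) f) = Cmp G (FAr id_func f) (?\<epsilon> A)" by simp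
    qed (use \<epsilon>H in simp)
  next
    fix A assume A: "A \<in> Ob S"
    define X where "X = FOb L A"
    have X: "X \<in> Ob E" using p.FOb[OF A] by (simp add: X_def)
    note \<eta>X = j.\<eta>[OF X]
    note \<epsilon>X = j.\<epsilon>[OF j.FOb[OF X]]
    note \<epsilon>RX = p.\<epsilon>[OF j.VOb[OF j.FOb[OF X]]]
    note L\<eta> = p.FHom[OF p.\<eta>[OF A], folded X_def]
    note LR\<eta> = p.FHom[OF p.VHom[OF \<eta>X]]
    have "FAr L (?\<eta> A) = Cmp E (FAr L (FAr R (\<eta>' X))) (FAr L (\<eta> A))"
      using p.Fcmp[OF p.\<eta>[OF A, folded X_def] p.VHom[OF \<eta>X]] by (simp add: X_def)
    moreover have "Cmp E (\<epsilon> (FOb R' (FOb L' X))) (Cmp E (FAr L (FAr R (\<eta>' X))) (FAr L (\<eta> A))) = \<eta>' X"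
      using p.D.cmp_assoc[OF L\<eta> LR\<eta> \<epsilon>RX] p.\<epsilon>_natural[OF \<eta>X] p.D.cmp_assoc[OF L\<eta> p.\<epsilon>[OF X] \<eta>X]
        p.triangle_F[OF A, folded X_def] p.D.cmp_id_right[OF \<eta>X] by simp
    ultimately have 1: "Cmp E (\<epsilon> (FOb R' (FOb L' X))) (FAr L (?\<eta> A)) = \<eta>' X" by simp
    have L\<eta>A: "FAr L (?\<eta> A) \<in> Hom E X (FOb L (FOb R (FOb R' (FOb L' X))))"
      using p.FHom[OF \<eta>H[OF A]] by (simp add: X_def)
    have "Cmp G (?\<epsilon> (FOb L' X)) (FAr L' (FAr L (?\<eta> A))) = Cmp G (\<epsilon>' (FOb L' X)) (FAr L' (\<eta>' X))"
      using j.D.cmp_assoc[OF j.FHom[OF L\<eta>A] j.FHom[OF \<epsilon>RX] \<epsilon>X] j.Fcmp[OF L\<eta>A \<epsilon>RX] 1 by simp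
    then show "Cmp G (?\<epsilon> (FOb ?L A)) (FAr ?L (?\<eta> A)) = Idt G (FOb ?L A)"
      using j.triangle_F[OF X] by (simp add: X_def)
  next
    fix B assume B: "B \<in> Ob G"
    define Y where "Y = FOb R' B"
    have Y: "Y \<in> Ob E" using j.VOb[OF B] by (simp add: Y_def)
    note \<epsilon>Y = p.\<epsilon>[OF Y]
    note RY = p.VOb[OF Y]
    note R'\<epsilon> = j.VHom[OF j.FHom[OF \<epsilon>Y]]
    note \<epsilon>B = j.\<epsilon>[OF B, folded Y_def]
    note R'\<epsilon>B = j.VHom[OF \<epsilon>B, folded Y_def]
    note \<eta>L = j.\<eta>[OF p.FOb[OF RY]]
    have R'\<epsilon>1: "FAr R' (?\<epsilon> B) = Cmp E (FAr R' (\<epsilon>' B)) (FAr R' (FAr L' (\<epsilon> Y)))"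
      using j.Vcmp[OF j.FHom[OF \<epsilon>Y] \<epsilon>B] by (simp add: Y_def)
    have R'\<epsilon>H: "FAr R' (?\<epsilon> B) \<in> Hom E (FOb R' (FOb L' (FOb L (FOb R Y)))) Y"
      using j.VHom[OF \<epsilon>H[OF B]] by (simp add: Y_def)
    have "Cmp E (FAr R' (?\<epsilon> B)) (\<eta>' (FOb L (FOb R Y))) = Cmp E (FAr R' (\<epsilon>' B)) (Cmp E (\<eta>' Y) (\<epsilon> Y))"
      using R'\<epsilon>1 p.D.cmp_assoc[OF \<eta>L R'\<epsilon> R'\<epsilon>B] j.\<eta>_natural[OF \<epsilon>Y] by simp
    also have "\<dots> = \<epsilon> Y"
      using p.D.cmp_assoc[OF \<epsilon>Y j.\<eta>[OF Y] R'\<epsilon>B] j.triangle_V[OF B, folded Y_def] p.D.cmp_id_left[OF \<epsilon>Y] by simp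
    finally have 2: "Cmp E (FAr R' (?\<epsilon> B)) (\<eta>' (FOb L (FOb R Y))) = \<epsilon> Y" .
    have "Cmp S (FAr R (FAr R' (?\<epsilon> B))) (?\<eta> (FOb R Y)) = Cmp S (FAr R (\<epsilon> Y)) (\<eta> (FOb R Y))"
      using p.C.cmp_assoc[OF p.\<eta>[OF RY] p.VHom[OF \<eta>L] p.VHom[OF R'\<epsilon>H]] p.Vcmp[OF \<eta>L R'\<epsilon>H] 2 by simp
    then show "Cmp S (FAr ?R (?\<epsilon> B)) (?\<eta> (FOb ?R B)) = Idt S (FOb ?R B)"
      using p.triangle_V[OF Y] by (simp add: Y_def)
  qed
qed

lemma geometric_morphism_comp:
  assumes p: "geometric_morphism E S p" and j: "geometric_morphism G E j"
  shows "geometric_morphism G S (comp_geom G S p j)"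
proof -
  have "adjunction S G (inv_im (comp_geom G S p j)) (dir_im (comp_geom G S p j))
    (gunit (comp_geom G S p j)) (gcounit (comp_geom G S p j))"
    using adjunction_comp p j by (fastforce simp: comp_geom_def geometric_morphism_def)
  moreover have "preserves_finite_limits S G (inv_im (comp_geom G S p j))"
    using p j by (simp add: comp_geom_def geometric_morphism_def preserves_finite_limits_def)
  ultimately show ?thesis using p j by (simp add: geometric_morphism_def)
qed

section \<open>Subqualities\<close>

text \<open>When both adjoints of the direct image have the same values, the canonical arrow at
  \<open>X\<close> is the unit at \<open>FOb R X\<close> followed by \<open>R\<close> of an
  isomorphism; invertible counits make that unit invertible.\<close>

lemma quality_typeI:
  assumes q: "geometric_morphism E S q" and a: "adjunction E S (dir_im q) R \<eta> \<epsilon>"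
    and \<epsilon>: "\<And>X. X \<in> Ob S \<Longrightarrow> iso_arrow S (\<epsilon> X)"
    and R: "\<And>X. X \<in> Ob S \<Longrightarrow> FOb (inv_im q) X = FOb R X"
    and u: "\<And>X. X \<in> Ob S \<Longrightarrow> iso_arrow S (gunit q X)"
  shows "quality_type E S q"
proof -
  interpret q: adj S E "inv_im q" "dir_im q" "gunit q" "gcounit q"
    using q by (intro adj.intro) (simp add: geometric_morphism_def)
  interpret r: adj E S "dir_im q" R \<eta> \<epsilon> using a by (rule adj.intro)
  have "iso_arrow E (canonical_trans E S q R \<eta> X)" if X: "X \<in> Ob S" for X
  proof -
    note uX = q.\<eta>[OF X]
    have Ru: "FAr R (inv_arrow S (gunit q X)) \<in> Hom E (FOb R (FOb (dir_im q) (FOb (inv_im q) X))) (FOb R X)"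
      by (rule r.VHom[OF q.C.inv_arrow(1)[OF u[OF X] uX]])
    have "iso_arrow E (FAr R (inv_arrow S (gunit q X)))"
      by (rule functor_iso[OF r.V q.C.inv_arrow(1)[OF u[OF X] uX] q.C.iso_inv_arrow[OF u[OF X] uX]])
    moreover have "iso_arrow E (\<eta> (FOb R X))" by (rule r.unit_V_iso[OF X \<epsilon>[OF X]])
    ultimately show ?thesis
      unfolding canonical_trans_def R[OF X]
      using q.D.iso_cmp[OF _ _ r.\<eta>[OF r.VOb[OF X]]] Ru R[OF X] by simp
  qed
  moreover have "upper_shriek E S q R \<eta> \<epsilon>"
    using a r.ff_of_counit_iso[OF \<epsilon>] by (simp add: upper_shriek_def)
  ultimately show ?thesis using q unfolding quality_type_def by blast
qed

text \<open>If \<open>k\<close> is a subquality of \<open>p\<close>, then the object \<open>p\<^sup>!X\<close> is, up to isomorphism, a \<open>k\<close>-sheaf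
  and the canonical arrow to it from \<open>p\<^sup>*X\<close> is inverted by the sheafification \<open>k\<^sup>*\<close>.\<close>

lemma subquality_sheafification:
  assumes k: "subquality E S p G k" and X: "X \<in> Ob S"
    and up: "\<And>X. X \<in> Ob S \<Longrightarrow> iso_arrow S (gunit p X)"
  obtains T e \<tau> where "couniversal E S (dir_im p) X T e" "\<tau> \<in> Hom E (FOb (inv_im p) X) T"
    "iso_arrow G (FAr (inv_im k) \<tau>)"
    "Cmp S (Cmp S e (FAr (dir_im p) \<tau>)) (gunit p X) = Idt S X"
proof -
  obtain R0 \<eta>0 \<epsilon>0 where R0: "upper_shriek E S p R0 \<eta>0 \<epsilon>0" and ab: "above E G k S (centre p R0 \<eta>0 \<epsilon>0)"
    using k by (auto simp: subquality_def)
  obtain H where H: "is_functor S G H" and kH: "nat_isomorphic S E (comp_func (dir_im k) H) R0"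
    using ab by (auto simp: above_def centre_def)
  obtain R \<eta> \<epsilon> where R: "upper_shriek G S (comp_geom G S p k) R \<eta> \<epsilon>"
    and can: "\<And>X. X \<in> Ob S \<Longrightarrow> iso_arrow G (canonical_trans G S (comp_geom G S p k) R \<eta> X)"
    using k by (auto simp: subquality_def quality_type_def)
  have gp: "geometric_morphism E S p" and gk: "geometric_morphism G E k" and ffk: "fully_faithful G E (dir_im k)"
    using k by (auto simp: subquality_def local_geom_def subtopos_def)
  interpret p: adj S E "inv_im p" "dir_im p" "gunit p" "gcounit p"
    using gp by (intro adj.intro) (simp add: geometric_morphism_def)
  interpret k: adj E G "inv_im k" "dir_im k" "gunit k" "gcounit k"
    using gk by (intro adj.intro) (simp add: geometric_morphism_def)
  interpret r: adj E S "dir_im p" R0 \<eta>0 \<epsilon>0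
    using R0 by (intro adj.intro) (simp add: upper_shriek_def)
  interpret q: adj G S "comp_func (dir_im p) (dir_im k)" R \<eta> \<epsilon>
    using R by (intro adj.intro) (simp add: upper_shriek_def comp_geom_def)
  have k_unit: "iso_arrow G (FAr (inv_im k) (gunit k Z))" if "Z \<in> Ob E" for Z
    by (rule k.F_unit_iso[OF that k.counit_iso_of_ff[OF ffk k.FOb[OF that]]])
  \<comment> \<open>The direct image of \<open>p\<close> inverts the units of \<open>k\<close>:
    since \<open>k\<close> is above the centre, every value of \<open>R0\<close> is a
    \<open>k\<close>-sheaf up to isomorphism and is therefore local for those units.\<close>
  have pk: "iso_arrow S (FAr (dir_im p) (gunit k Z))" if Z: "Z \<in> Ob E" for Z
  proof (rule r.F_iso_of_orthogonal[OF k.\<eta>[OF Z]])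
    fix B assume B: "B \<in> Ob S"
    obtain t where t: "nat_trans S E (comp_func (dir_im k) H) R0 t" "iso_arrow E (t B)"
      using kH B by (auto simp: nat_isomorphic_def)
    have "orthogonal E (gunit k Z) (FOb (dir_im k) (FOb H B))"
      by (rule k.orthogonal_V[OF k.\<eta>[OF Z] k_unit[OF Z] functor_Ob[OF H B]])
    then show "orthogonal E (gunit k Z) (FOb R0 B)"
      using orthogonal_iso[OF p.D.category_axioms k.\<eta>[OF Z]] nat_trans_Hom[OF t(1) B] t(2) by simp
  qed
  \<comment> \<open>The value at \<open>X\<close> of the right adjoint of the composite direct
    image, included into \<open>E\<close>. By \<open>pk\<close> an object and its sheafification
    have isomorphic direct images under \<open>p\<close>, so \<open>T\<close> is universal for
    \<open>p\<close> as well.\<close>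
  define T where "T = FOb (dir_im k) (FOb R X)"
  define e where "e = \<epsilon> X"
  have RX: "FOb R X \<in> Ob G" by (rule q.VOb[OF X])
  have T: "T \<in> Ob E" unfolding T_def by (rule k.VOb[OF RX])
  have e: "e \<in> Hom S (FOb (dir_im p) T) X" using q.\<epsilon>[OF X] by (simp add: e_def T_def)
  have cu: "couniversal E S (dir_im p) X T e"
    unfolding couniversal_def
  proof (intro conjI ballI T e)
    fix Z g assume Z: "Z \<in> Ob E" and g: "g \<in> Hom S (FOb (dir_im p) Z) X"
    note \<kappa> = k.\<eta>[OF Z]
    note p\<kappa> = p.VHom[OF \<kappa>]
    note pre = p.C.iso_pre_ex1[OF pk[OF Z] p\<kappa> g]
    obtain g' where g': "g' \<in> Hom S (FOb (dir_im p) (FOb (dir_im k) (FOb (inv_im k) Z))) X"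
      "Cmp S g' (FAr (dir_im p) (gunit k Z)) = g" using pre by blast
    have low: "\<exists>!h. h \<in> Hom G (FOb (inv_im k) Z) (FOb R X) \<and> Cmp S e (FAr (dir_im p) (FAr (dir_im k) h)) = g'"
      using q.lower_ex1[OF k.FOb[OF Z], of g' X] g'(1) by (simp add: e_def)
    then obtain h where h: "h \<in> Hom G (FOb (inv_im k) Z) (FOb R X)"
      "Cmp S e (FAr (dir_im p) (FAr (dir_im k) h)) = g'" by blast
    have tr: "Cmp S e (FAr (dir_im p) (Cmp E (FAr (dir_im k) h) (gunit k Z))) =
      Cmp S (Cmp S e (FAr (dir_im p) (FAr (dir_im k) h))) (FAr (dir_im p) (gunit k Z))"
      if "h \<in> Hom G (FOb (inv_im k) Z) (FOb R X)" for h
      using p.Vcmp[OF \<kappa> k.VHom[OF that]] p.C.cmp_assoc[OF p\<kappa> p.VHom[OF k.VHom[OF that]] e[unfolded T_def]] by simp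
    show "\<exists>!h. h \<in> Hom E Z T \<and> Cmp S e (FAr (dir_im p) h) = g"
    proof (rule ex1I[of _ "Cmp E (FAr (dir_im k) h) (gunit k Z)"])
      show "Cmp E (FAr (dir_im k) h) (gunit k Z) \<in> Hom E Z T \<and>
        Cmp S e (FAr (dir_im p) (Cmp E (FAr (dir_im k) h) (gunit k Z))) = g"
        using p.D.cmp_in[OF \<kappa> k.VHom[OF h(1)]] tr[OF h(1)] h(2) g'(2) by (simp add: T_def)
      fix f assume f: "f \<in> Hom E Z T \<and> Cmp S e (FAr (dir_im p) f) = g"
      then obtain l where l: "l \<in> Hom G (FOb (inv_im k) Z) (FOb R X)" "f = Cmp E (FAr (dir_im k) l) (gunit k Z)"
        using k.upper_ex1[OF RX, of f Z] by (auto simp: T_def)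
      have "Cmp S (Cmp S e (FAr (dir_im p) (FAr (dir_im k) l))) (FAr (dir_im p) (gunit k Z)) = g"
        using tr[OF l(1)] l(2) f by simp
      moreover have "Cmp S e (FAr (dir_im p) (FAr (dir_im k) l)) \<in> Hom S (FOb (dir_im p) (FOb (dir_im k) (FOb (inv_im k) Z))) X"
        using p.C.cmp_in[OF p.VHom[OF k.VHom[OF l(1)]]] e by (simp add: T_def)
      ultimately have "Cmp S e (FAr (dir_im p) (FAr (dir_im k) l)) = g'" using pre g' by blast
      then have "l = h" using low l(1) h by blast
      then show "f = Cmp E (FAr (dir_im k) h) (gunit k Z)" using l by simp
    qed
  qed
  define Y where "Y = FOb (inv_im p) X"
  have Y: "Y \<in> Ob E" unfolding Y_def by (rule p.FOb[OF X])
  define Q where "Q = FOb (inv_im k) Y"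
  have Q: "Q \<in> Ob G" unfolding Q_def by (rule k.FOb[OF Y])
  \<comment> \<open>The unit at \<open>X\<close> of the composite geometric morphism, invertible
    because of \<open>up\<close> and \<open>pk\<close>.\<close>
  define u where "u = Cmp S (FAr (dir_im p) (gunit k Y)) (gunit p X)"
  note \<kappa>Y = k.\<eta>[OF Y, folded Q_def]
  note p\<kappa>Y = p.VHom[OF \<kappa>Y]
  have uX: "gunit p X \<in> Hom S X (FOb (dir_im p) Y)" using p.\<eta>[OF X] by (simp add: Y_def)
  have u: "u \<in> Hom S X (FOb (dir_im p) (FOb (dir_im k) Q))"
    unfolding u_def by (rule p.C.cmp_in[OF uX p\<kappa>Y])
  have u_iso: "iso_arrow S u" unfolding u_def by (rule p.C.iso_cmp[OF up[OF X] pk[OF Y] uX p\<kappa>Y])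
  note ui = p.C.inv_arrow[OF u_iso u]
  \<comment> \<open>The canonical arrow of the composite at \<open>X\<close>, which the quality type
    makes invertible.\<close>
  define \<phi> where "\<phi> = Cmp G (FAr R (inv_arrow S u)) (\<eta> Q)"
  have \<phi>_iso: "iso_arrow G \<phi>"
    using can[OF X] by (simp add: canonical_trans_def comp_geom_def \<phi>_def u_def Y_def Q_def)
  have \<eta>Q: "\<eta> Q \<in> Hom G Q (FOb R (FOb (dir_im p) (FOb (dir_im k) Q)))" using q.\<eta>[OF Q] by simp
  note Rui = q.VHom[OF ui(1)]
  have \<phi>: "\<phi> \<in> Hom G Q (FOb R X)" unfolding \<phi>_def by (rule k.D.cmp_in[OF \<eta>Q Rui])
  define q\<phi> where "q\<phi> = FAr (dir_im p) (FAr (dir_im k) \<phi>)"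
  have q\<phi>: "q\<phi> \<in> Hom S (FOb (dir_im p) (FOb (dir_im k) Q)) (FOb (dir_im p) T)"
    unfolding q\<phi>_def T_def by (rule p.VHom[OF k.VHom[OF \<phi>]])
  \<comment> \<open>Naturality of the counit and a triangle identity: the arrow that corresponds to
    \<open>\<phi>\<close> under the adjunction is the inverse of \<open>u\<close>.\<close>
  have e\<phi>: "Cmp S e q\<phi> = inv_arrow S u"
  proof -
    have 1: "q\<phi> = Cmp S (FAr (dir_im p) (FAr (dir_im k) (FAr R (inv_arrow S u)))) (FAr (dir_im p) (FAr (dir_im k) (\<eta> Q)))"
      using q.Fcmp[OF \<eta>Q Rui] by (simp add: q\<phi>_def \<phi>_def)
    have "Cmp S e q\<phi> = Cmp S (Cmp S e (FAr (dir_im p) (FAr (dir_im k) (FAr R (inv_arrow S u))))) (FAr (dir_im p) (FAr (dir_im k) (\<eta> Q)))"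
      using 1 p.C.cmp_assoc[OF p.VHom[OF k.VHom[OF \<eta>Q]] p.VHom[OF k.VHom[OF Rui]] e[unfolded T_def]] by simp
    also have "Cmp S e (FAr (dir_im p) (FAr (dir_im k) (FAr R (inv_arrow S u)))) =
      Cmp S (inv_arrow S u) (\<epsilon> (FOb (dir_im p) (FOb (dir_im k) Q)))"
      using q.\<epsilon>_natural[OF ui(1)] by (simp add: e_def)
    also have "Cmp S \<dots> (FAr (dir_im p) (FAr (dir_im k) (\<eta> Q))) = inv_arrow S u"
      using p.C.cmp_assoc[OF p.VHom[OF k.VHom[OF \<eta>Q]] _ ui(1), of "\<epsilon> (FOb (dir_im p) (FOb (dir_im k) Q))"]
        q.\<epsilon>[OF p.VOb[OF k.VOb[OF Q]]] q.triangle_F[OF Q] p.C.cmp_id_right[OF ui(1)] by simp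
    finally show ?thesis .
  qed
  \<comment> \<open>The transpose of \<open>\<phi>\<close> along \<open>k\<close>. Sheafification
    inverts both factors: the unit, because the direct image of \<open>k\<close> is fully faithful,
    and the image of the isomorphism \<open>\<phi>\<close>.\<close>
  define \<tau> where "\<tau> = Cmp E (FAr (dir_im k) \<phi>) (gunit k Y)"
  note k\<phi> = k.VHom[OF \<phi>]
  have \<tau>: "\<tau> \<in> Hom E Y T" unfolding \<tau>_def T_def by (rule p.D.cmp_in[OF \<kappa>Y k\<phi>])
  have "iso_arrow G (FAr (inv_im k) \<tau>)"
    unfolding \<tau>_def k.Fcmp[OF \<kappa>Y k\<phi>]
  proof (rule k.D.iso_cmp[OF k_unit[OF Y] _ k.FHom[OF \<kappa>Y] k.FHom[OF k\<phi>]])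
    show "iso_arrow G (FAr (inv_im k) (FAr (dir_im k) \<phi>))"
      by (rule functor_iso[OF k.F k\<phi> functor_iso[OF k.V \<phi> \<phi>_iso]])
  qed
  moreover have "Cmp S (Cmp S e (FAr (dir_im p) \<tau>)) (gunit p X) = Idt S X"
  proof -
    have "Cmp S e (FAr (dir_im p) \<tau>) = Cmp S (inv_arrow S u) (FAr (dir_im p) (gunit k Y))"
      using p.Vcmp[OF \<kappa>Y k\<phi>] p.C.cmp_assoc[OF p\<kappa>Y q\<phi> e] e\<phi> by (simp add: \<tau>_def q\<phi>_def)
    then show ?thesis
      using p.C.cmp_assoc[OF uX p\<kappa>Y ui(1)] ui(2) by (simp add: u_def)
  qed
  ultimately show thesis using that[OF cu] \<tau> by (simp add: Y_def)
qed

section \<open>Sets and presheaves as models\<close>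

definition fn :: "'u setarr \<Rightarrow> 'u \<Rightarrow> 'u" where
  "fn h = snd (snd h)"

definition set_arrow :: "'u set \<Rightarrow> 'u set \<Rightarrow> ('u \<Rightarrow> 'u) \<Rightarrow> 'u setarr" where
  "set_arrow X Y f = (X, Y, restrict f X)"

lemma fn_set_arrow [simp]: "x \<in> X \<Longrightarrow> fn (set_arrow X Y f) x = f x"
  by (simp add: fn_def set_arrow_def)

lemma Ob_set_cat [simp]: "X \<in> Ob set_cat \<longleftrightarrow> X \<prec> (UNIV :: 'u set)" for X :: "'u set"
  by (simp add: set_cat_def)

lemma Hom_set_cat: "h \<in> Hom set_cat X Y \<longleftrightarrow> X \<prec> (UNIV :: 'u set) \<and> Y \<prec> (UNIV :: 'u set) \<and>
    fst h = X \<and> fst (snd h) = Y \<and> fn h \<in> X \<rightarrow>\<^sub>E Y" for X Y :: "'u set"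
  by (cases h) (auto simp: Hom_def set_cat_def fn_def)

lemma fn_in: "h \<in> Hom set_cat X Y \<Longrightarrow> x \<in> X \<Longrightarrow> fn h x \<in> Y"
  by (auto simp: Hom_set_cat)

lemma fn_Idt: "x \<in> X \<Longrightarrow> fn (Idt set_cat X) x = x"
  by (simp add: set_cat_def fn_def)

lemma fn_Cmp: "h \<in> Hom set_cat X Y \<Longrightarrow> x \<in> X \<Longrightarrow> fn (Cmp set_cat k h) x = fn k (fn h x)"
  by (cases h; cases k) (auto simp: Hom_def set_cat_def fn_def compose_def)

lemma set_ext: "h \<in> Hom set_cat X Y \<Longrightarrow> k \<in> Hom set_cat X Y \<Longrightarrow> (\<And>x. x \<in> X \<Longrightarrow> fn h x = fn k x) \<Longrightarrow> h = k"
  by (cases h; cases k) (auto simp: Hom_set_cat fn_def intro: PiE_ext)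

lemma set_arrow_Hom: "X \<prec> (UNIV :: 'u set) \<Longrightarrow> Y \<prec> (UNIV :: 'u set) \<Longrightarrow> (\<And>x. x \<in> X \<Longrightarrow> f x \<in> Y) \<Longrightarrow>
    set_arrow X Y f \<in> Hom set_cat X Y" for X Y :: "'u set"
  by (auto simp: Hom_set_cat set_arrow_def fn_def)

lemma category_set_cat: "category set_cat"
proof
  fix f :: "'u setarr" assume f: "f \<in> Ar set_cat"
  then have f': "f \<in> Hom set_cat (Dom set_cat f) (Cod set_cat f)" by (rule Ar_Hom)
  show "Dom set_cat f \<in> Ob set_cat" "Cod set_cat f \<in> Ob set_cat" using f' by (auto simp: Hom_set_cat)
  show "Cmp set_cat f (Idt set_cat (Dom set_cat f)) = f" "Cmp set_cat (Idt set_cat (Cod set_cat f)) f = f"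
    using f by (auto simp: set_cat_def compose_def fun_eq_iff PiE_def extensional_def)
next
  fix A :: "'u set" assume "A \<in> Ob set_cat"
  then show "Idt set_cat A \<in> Hom set_cat A A" by (simp add: Hom_def set_cat_def)
next
  fix f g :: "'u setarr" and A B D assume "f \<in> Hom set_cat A B" "g \<in> Hom set_cat B D"
  then show "Cmp set_cat g f \<in> Hom set_cat A D"
    by (auto simp: Hom_def set_cat_def compose_def PiE_iff)
next
  fix f g h :: "'u setarr" and A B D E assume "f \<in> Hom set_cat A B" "g \<in> Hom set_cat B D" "h \<in> Hom set_cat D E"
  then show "Cmp set_cat h (Cmp set_cat g f) = Cmp set_cat (Cmp set_cat h g) f"
    by (auto simp: Hom_def set_cat_def compose_def PiE_iff fun_eq_iff)
qed

definition unit_cat :: "(unit, unit) cat" where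
  "unit_cat = \<lparr>Ob = UNIV, Ar = UNIV, Dom = (\<lambda>_. ()), Cod = (\<lambda>_. ()), Idt = (\<lambda>_. ()), Cmp = (\<lambda>_ _. ())\<rparr>"

lemma category_unit_cat: "category unit_cat"
  by unfold_locales (auto simp: unit_cat_def Hom_def)

text \<open>A set is a functor on the category with a single arrow, so the general construction also
  shows that sets form a topos.\<close>

lemma (in universe) set_model:
  "presheaf_model unit_cat (set_cat :: ('u set, 'u setarr) cat) (\<lambda>X _. X) (\<lambda>X _ x. x) (\<lambda>h _. fn h)"
proof (intro presheaf_model.intro presheaf_model_axioms.intro)
  show "universe TYPE('u)" by (rule universe_axioms)
  show "category unit_cat" by (rule category_unit_cat)
  show "category (set_cat :: ('u set, 'u setarr) cat)" by (rule category_set_cat)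
  show "small_in U (Ar unit_cat)" by (simp add: unit_cat_def small_finite)
next
  fix F G :: "'u set" and m :: "unit \<Rightarrow> 'u \<Rightarrow> 'u"
  assume "F \<in> Ob set_cat" "G \<in> Ob set_cat" and m: "\<And>c x. c \<in> Ob unit_cat \<Longrightarrow> x \<in> F \<Longrightarrow> m c x \<in> G"
  then have "set_arrow F G (m ()) \<in> Hom set_cat F G" by (intro set_arrow_Hom) (auto simp: unit_cat_def)
  then show "\<exists>t \<in> Hom set_cat F G. \<forall>c \<in> Ob unit_cat. \<forall>x \<in> F. fn t x = m c x" by (rule bexI[rotated]) simp
next
  fix ob :: "unit \<Rightarrow> 'u set" and ac :: "unit \<Rightarrow> 'u \<Rightarrow> 'u"
  assume ob: "\<And>c. c \<in> Ob unit_cat \<Longrightarrow> ob c \<prec> (UNIV :: 'u set)"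
    and id: "\<And>c x. c \<in> Ob unit_cat \<Longrightarrow> x \<in> ob c \<Longrightarrow> ac (Idt unit_cat c) x = x"
  show "\<exists>F \<in> Ob set_cat. (\<forall>c \<in> Ob unit_cat. F = ob c) \<and> (\<forall>c d. \<forall>f \<in> Hom unit_cat c d. \<forall>x \<in> ob c. x = ac f x)"
    using ob[of "()"] id[of "()"] by (intro bexI[of _ "ob ()"]) (auto simp: unit_cat_def)
next
  fix F G :: "'u set" and s t assume "s \<in> Hom set_cat F G" "t \<in> Hom set_cat F G"
    and "\<And>c x. c \<in> Ob unit_cat \<Longrightarrow> x \<in> F \<Longrightarrow> fn s x = fn t x"
  then show "s = t" by (intro set_ext[of s F G t]) (simp_all add: unit_cat_def)
qed (auto simp: fn_in fn_Idt fn_Cmp)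

section \<open>Functor categories\<close>

lemma functor_cat_Ob: "F \<in> Ob (functor_cat A B) \<longleftrightarrow>
    is_functor A B F \<and> FOb F \<in> extensional (Ob A) \<and> FAr F \<in> extensional (Ar A)"
  by (simp add: functor_cat_def Let_def)

lemma functor_cat_Hom: "t \<in> Hom (functor_cat A B) F G \<longleftrightarrow> F \<in> Ob (functor_cat A B) \<and> G \<in> Ob (functor_cat A B) \<and>
    fst t = F \<and> fst (snd t) = G \<and> nat_trans A B F G (snd (snd t)) \<and> snd (snd t) \<in> extensional (Ob A)"
  by (cases t) (auto simp: functor_cat_def Let_def Hom_def)

lemma functor_cat_Idt: "Idt (functor_cat A B) F = (F, F, \<lambda>c\<in>Ob A. Idt B (FOb F c))"
  by (simp add: functor_cat_def Let_def)

lemma functor_cat_Cmp: "Cmp (functor_cat A B) t s = (fst s, fst (snd t), \<lambda>c\<in>Ob A. Cmp B (snd (snd t) c) (snd (snd s) c))"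
  by (cases s; cases t) (simp add: functor_cat_def Let_def)

lemma functor_cat_DomCod: "Dom (functor_cat A B) t = fst t" "Cod (functor_cat A B) t = fst (snd t)"
  by (cases t, simp add: functor_cat_def Let_def)+

lemma functor_cat_ArD: "t \<in> Ar (functor_cat A B) \<Longrightarrow> t \<in> Hom (functor_cat A B) (fst t) (fst (snd t))"
  using Ar_Hom[of t "functor_cat A B"] by (simp add: functor_cat_DomCod)

lemma category_functor_cat:
  assumes A: "category A" and B: "category B"
  shows "category (functor_cat A B)"
proof
  interpret A: category A by fact
  interpret B: category B by fact
  let ?C = "functor_cat A B"
  have comp: "snd (snd t) c \<in> Hom B (FOb F c) (FOb G c)" if "t \<in> Hom ?C F G" "c \<in> Ob A" for t F G c
    using that by (auto simp: functor_cat_Hom intro: nat_trans_Hom)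
  have nat: "Cmp B (snd (snd t) d) (FAr F f) = Cmp B (FAr G f) (snd (snd t) c)" if "t \<in> Hom ?C F G" "f \<in> Hom A c d" for t F G f c d
    using that by (auto simp: functor_cat_Hom intro: nat_trans_nat)
  have func: "is_functor A B F" if "F \<in> Ob ?C" for F using that by (simp add: functor_cat_Ob)
  fix t assume "t \<in> Ar ?C"
  then have t: "t \<in> Hom ?C (fst t) (fst (snd t))" by (rule functor_cat_ArD)
  show "Dom ?C t \<in> Ob ?C" "Cod ?C t \<in> Ob ?C" using t by (auto simp: functor_cat_DomCod functor_cat_Hom)
  have ext: "snd (snd t) \<in> extensional (Ob A)" using t by (simp add: functor_cat_Hom)
  have "(\<lambda>c\<in>Ob A. Cmp B (snd (snd t) c) (Idt B (FOb (fst t) c))) = snd (snd t)"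
    using B.cmp_id_right[OF comp[OF t]] ext by (auto simp: fun_eq_iff extensional_def)
  then show "Cmp ?C t (Idt ?C (Dom ?C t)) = t"
    by (simp add: functor_cat_DomCod functor_cat_Idt functor_cat_Cmp cong: restrict_cong)
  have "(\<lambda>c\<in>Ob A. Cmp B (Idt B (FOb (fst (snd t)) c)) (snd (snd t) c)) = snd (snd t)"
    using B.cmp_id_left[OF comp[OF t]] ext by (auto simp: fun_eq_iff extensional_def)
  then show "Cmp ?C (Idt ?C (Cod ?C t)) t = t"
    by (simp add: functor_cat_DomCod functor_cat_Idt functor_cat_Cmp cong: restrict_cong)
next
  interpret A: category A by fact
  interpret B: category B by fact
  let ?C = "functor_cat A B"
  fix F assume F: "F \<in> Ob ?C"
  then have f: "is_functor A B F" by (simp add: functor_cat_Ob)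
  have "nat_trans A B F F (\<lambda>c\<in>Ob A. Idt B (FOb F c))"
  proof (rule nat_transI[OF f f])
    fix g c d assume g: "g \<in> Hom A c d"
    show "Cmp B ((\<lambda>c\<in>Ob A. Idt B (FOb F c)) d) (FAr F g) = Cmp B (FAr F g) ((\<lambda>c\<in>Ob A. Idt B (FOb F c)) c)"
      using A.Hom_Ob[OF g] B.cmp_id_left[OF functor_Hom[OF f g]] B.cmp_id_right[OF functor_Hom[OF f g]] by simp
  qed (use B.idt_in functor_Ob[OF f] in simp)
  then show "Idt ?C F \<in> Hom ?C F F" using F by (simp add: functor_cat_Idt functor_cat_Hom)
next
  interpret A: category A by fact
  interpret B: category B by fact
  let ?C = "functor_cat A B"
  fix s t F G H assume s: "s \<in> Hom ?C F G" and t: "t \<in> Hom ?C G H"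
  have s': "nat_trans A B F G (snd (snd s))" and t': "nat_trans A B G H (snd (snd t))"
    using s t by (auto simp: functor_cat_Hom)
  have f: "is_functor A B F" "is_functor A B G" "is_functor A B H" using s' t' by (auto simp: nat_trans_def)
  have "nat_trans A B F H (\<lambda>c\<in>Ob A. Cmp B (snd (snd t) c) (snd (snd s) c))"
  proof (rule nat_transI[OF f(1,3)])
    fix g c d assume g: "g \<in> Hom A c d"
    note cd = A.Hom_Ob[OF g]
    show "Cmp B ((\<lambda>c\<in>Ob A. Cmp B (snd (snd t) c) (snd (snd s) c)) d) (FAr F g) =
      Cmp B (FAr H g) ((\<lambda>c\<in>Ob A. Cmp B (snd (snd t) c) (snd (snd s) c)) c)"
      using cd nat_trans_nat[OF s' g] nat_trans_nat[OF t' g]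
        B.cmp_assoc[OF functor_Hom[OF f(1) g] nat_trans_Hom[OF s' cd(2)] nat_trans_Hom[OF t' cd(2)]]
        B.cmp_assoc[OF nat_trans_Hom[OF s' cd(1)] functor_Hom[OF f(2) g] nat_trans_Hom[OF t' cd(2)]]
        B.cmp_assoc[OF nat_trans_Hom[OF s' cd(1)] nat_trans_Hom[OF t' cd(1)] functor_Hom[OF f(3) g]] by simp
  qed (use B.cmp_in[OF nat_trans_Hom[OF s'] nat_trans_Hom[OF t']] in simp)
  then show "Cmp ?C t s \<in> Hom ?C F H" using s t by (simp add: functor_cat_Cmp functor_cat_Hom)
next
  interpret B: category B by fact
  let ?C = "functor_cat A B"
  fix s t r F G H K assume s: "s \<in> Hom ?C F G" and t: "t \<in> Hom ?C G H" and r: "r \<in> Hom ?C H K"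
  have "nat_trans A B F G (snd (snd s))" "nat_trans A B G H (snd (snd t))" "nat_trans A B H K (snd (snd r))"
    using s t r by (auto simp: functor_cat_Hom)
  then show "Cmp ?C r (Cmp ?C t s) = Cmp ?C (Cmp ?C r t) s"
    using B.cmp_assoc[OF nat_trans_Hom nat_trans_Hom nat_trans_Hom]
    by (auto simp: functor_cat_Cmp fun_eq_iff restrict_def)
qed

definition psh_act :: "('o, 'a, 'u) psh \<Rightarrow> 'a \<Rightarrow> 'u \<Rightarrow> 'u" where
  "psh_act F f = fn (FAr F f)"

definition psh_app :: "('o, 'a, 'u) psharr \<Rightarrow> 'o \<Rightarrow> 'u \<Rightarrow> 'u" where
  "psh_app t c = fn (snd (snd t) c)"

text \<open>\<open>A\<close> stands for the opposite of the site: presheaves on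
  \<open>op_cat A\<close> are covariant functors on \<open>A\<close>. For the Gaeta topos
  \<open>A\<close> is the category of algebras itself.\<close>

locale small_category = universe U + category A for U :: "'u itself" and A :: "('c, 'f) cat" +
  assumes Ar_small: "small_in U (Ar A)"
begin

abbreviation E :: "(('c, 'f, 'u) psh, ('c, 'f, 'u) psharr) cat" where
  "E \<equiv> functor_cat A set_cat"

abbreviation S :: "('u set, 'u setarr) cat" where
  "S \<equiv> set_cat"

lemma E_func: "F \<in> Ob E \<Longrightarrow> is_functor A S F"
  by (simp add: functor_cat_Ob)

lemma functor_model: "presheaf_model A E FOb psh_act psh_app"
proof (intro presheaf_model.intro presheaf_model_axioms.intro)
  show "universe TYPE('u)" by (rule universe_axioms)
  show "category A" by (rule category_axioms)
  show "category E" by (rule category_functor_cat[OF category_axioms category_set_cat])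
  show "small_in U (Ar A)" by (rule Ar_small)
next
  fix F :: "('c, 'f, 'u) psh" and c assume F: "F \<in> Ob E" and "c \<in> Ob A"
  then show "small_in U (FOb F c)" using functor_Ob[OF E_func[OF F]] by simp
next
  fix F :: "('c, 'f, 'u) psh" and f c d x assume F: "F \<in> Ob E" and f: "f \<in> Hom A c d" and x: "x \<in> FOb F c"
  note Ff = functor_Hom[OF E_func[OF F] f]
  then show "psh_act F f x \<in> FOb F d" unfolding psh_act_def using x by (rule fn_in)
  fix g e assume g: "g \<in> Hom A d e"
  show "psh_act F (Cmp A g f) x = psh_act F g (psh_act F f x)"
    using functor_cmp[OF E_func[OF F] f g] fn_Cmp[OF Ff x] by (simp add: psh_act_def)
next
  fix F :: "('c, 'f, 'u) psh" and c x assume F: "F \<in> Ob E" and c: "c \<in> Ob A" and x: "x \<in> FOb F c"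
  show "psh_act F (Idt A c) x = x"
    using functor_idt[OF E_func[OF F] c] fn_Idt[OF x] by (simp add: psh_act_def)
  show "psh_app (Idt E F) c x = x" using c fn_Idt[OF x] by (simp add: psh_app_def functor_cat_Idt)
next
  fix F G :: "('c, 'f, 'u) psh" and t c x assume t: "t \<in> Hom E F G" and c: "c \<in> Ob A" and x: "x \<in> FOb F c"
  have t': "nat_trans A S F G (snd (snd t))" using t by (simp add: functor_cat_Hom)
  show "psh_app t c x \<in> FOb G c" unfolding psh_app_def by (rule fn_in[OF nat_trans_Hom[OF t' c] x])
next
  fix F G :: "('c, 'f, 'u) psh" and t c d f x assume t: "t \<in> Hom E F G" and f: "f \<in> Hom A c d" and x: "x \<in> FOb F c"
  have t': "nat_trans A S F G (snd (snd t))" using t by (simp add: functor_cat_Hom)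
  have F: "is_functor A S F" using t' by (simp add: nat_trans_def)
  show "psh_app t d (psh_act F f x) = psh_act G f (psh_app t c x)"
    using nat_trans_nat[OF t' f] fn_Cmp[OF functor_Hom[OF F f] x] fn_Cmp[OF nat_trans_Hom[OF t' Hom_Ob(1)[OF f]] x]
    by (metis psh_act_def psh_app_def)
next
  fix F G H :: "('c, 'f, 'u) psh" and s t c x assume s: "s \<in> Hom E F G" and "t \<in> Hom E G H" and c: "c \<in> Ob A" and x: "x \<in> FOb F c"
  have s': "nat_trans A S F G (snd (snd s))" using s by (simp add: functor_cat_Hom)
  show "psh_app (Cmp E t s) c x = psh_app t c (psh_app s c x)"
    using c fn_Cmp[OF nat_trans_Hom[OF s' c] x] by (simp add: psh_app_def functor_cat_Cmp)
next
  fix F G :: "('c, 'f, 'u) psh" and s t assume s: "s \<in> Hom E F G" and t: "t \<in> Hom E F G"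
    and eq: "\<And>c x. c \<in> Ob A \<Longrightarrow> x \<in> FOb F c \<Longrightarrow> psh_app s c x = psh_app t c x"
  have "snd (snd s) = snd (snd t)"
  proof (rule extensionalityI[of _ "Ob A"])
    fix c assume c: "c \<in> Ob A"
    show "snd (snd s) c = snd (snd t) c"
      by (rule set_ext[of _ "FOb F c" "FOb G c"])
        (use s t c eq in \<open>auto simp: functor_cat_Hom psh_app_def intro: nat_trans_Hom\<close>)
  qed (use s t in \<open>auto simp: functor_cat_Hom\<close>)
  then show "s = t" using s t by (auto simp: functor_cat_Hom prod_eq_iff)
next
  fix F G :: "('c, 'f, 'u) psh" and m :: "'c \<Rightarrow> 'u \<Rightarrow> 'u"
  assume F: "F \<in> Ob E" and G: "G \<in> Ob E" and m: "\<And>c x. c \<in> Ob A \<Longrightarrow> x \<in> FOb F c \<Longrightarrow> m c x \<in> FOb G c"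
    and n: "\<And>f c d x. f \<in> Hom A c d \<Longrightarrow> x \<in> FOb F c \<Longrightarrow> m d (psh_act F f x) = psh_act G f (m c x)"
  define t where "t = (\<lambda>c\<in>Ob A. set_arrow (FOb F c) (FOb G c) (m c))"
  have tH: "t c \<in> Hom S (FOb F c) (FOb G c)" if "c \<in> Ob A" for c
    using functor_Ob[OF E_func[OF F] that] functor_Ob[OF E_func[OF G] that] m[OF that] that
    by (auto simp: t_def intro!: set_arrow_Hom)
  have "nat_trans A S F G t"
  proof (rule nat_transI[OF E_func[OF F] E_func[OF G] tH])
    fix f c d assume f: "f \<in> Hom A c d"
    have cd: "c \<in> Ob A" "d \<in> Ob A" using Hom_Ob[OF f] by auto
    note Ff = functor_Hom[OF E_func[OF F] f] and Gf = functor_Hom[OF E_func[OF G] f]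
    interpret S: category S by (rule category_set_cat)
    show "Cmp S (t d) (FAr F f) = Cmp S (FAr G f) (t c)"
    proof (rule set_ext[OF S.cmp_in[OF Ff tH[OF cd(2)]] S.cmp_in[OF tH[OF cd(1)] Gf]])
      fix x assume x: "x \<in> FOb F c"
      show "fn (Cmp S (t d) (FAr F f)) x = fn (Cmp S (FAr G f) (t c)) x"
        using fn_Cmp[OF Ff x] fn_Cmp[OF tH[OF cd(1)] x] n[OF f x] fn_in[OF Ff x] x cd by (simp add: t_def psh_act_def)
    qed
  qed
  then have "(F, G, t) \<in> Hom E F G" using F G by (simp add: functor_cat_Hom t_def)
  moreover have "\<forall>c \<in> Ob A. \<forall>x \<in> FOb F c. psh_app (F, G, t) c x = m c x" by (simp add: psh_app_def t_def)
  ultimately show "\<exists>t \<in> Hom E F G. \<forall>c \<in> Ob A. \<forall>x \<in> FOb F c. psh_app t c x = m c x" by blast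
next
  fix ob :: "'c \<Rightarrow> 'u set" and ac :: "'f \<Rightarrow> 'u \<Rightarrow> 'u"
  assume ob: "\<And>c. c \<in> Ob A \<Longrightarrow> small_in U (ob c)"
    and maps: "\<And>f c d x. f \<in> Hom A c d \<Longrightarrow> x \<in> ob c \<Longrightarrow> ac f x \<in> ob d"
    and id: "\<And>c x. c \<in> Ob A \<Longrightarrow> x \<in> ob c \<Longrightarrow> ac (Idt A c) x = x"
    and cmp: "\<And>f g c d e x. f \<in> Hom A c d \<Longrightarrow> g \<in> Hom A d e \<Longrightarrow> x \<in> ob c \<Longrightarrow> ac (Cmp A g f) x = ac g (ac f x)"
  \<comment> \<open>Objects of the functor category are required to be undefined off
    \<open>A\<close>, hence the restrictions.\<close>
  define F :: "('c, 'f, 'u) psh" where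
    "F = \<lparr>FOb = restrict ob (Ob A), FAr = (\<lambda>f\<in>Ar A. set_arrow (ob (Dom A f)) (ob (Cod A f)) (ac f))\<rparr>"
  have FOb: "FOb F c = ob c" if "c \<in> Ob A" for c using that by (simp add: F_def)
  have FAr: "FAr F f = set_arrow (ob c) (ob d) (ac f)" if "f \<in> Hom A c d" for f c d
    using that by (auto simp: F_def Hom_def)
  have arH: "set_arrow (ob c) (ob d) (ac f) \<in> Hom S (ob c) (ob d)" if "f \<in> Hom A c d" for f c d
    using maps[OF that] ob Hom_Ob[OF that] by (auto intro!: set_arrow_Hom)
  interpret S: category S by (rule category_set_cat)
  have "is_functor A S F"
  proof (rule is_functorI[OF category_axioms category_set_cat])
    fix c assume c: "c \<in> Ob A" then show "FOb F c \<in> Ob S" using ob by (simp add: FOb)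
    have "set_arrow (ob c) (ob c) (ac (Idt A c)) = Idt S (ob c)"
      by (rule set_ext[OF arH[OF idt_in[OF c]] S.idt_in]) (use id c ob in \<open>auto simp: fn_Idt\<close>)
    then show "FAr F (Idt A c) = Idt S (FOb F c)" using FAr[OF idt_in[OF c]] FOb[OF c] by simp
  next
    fix f c d assume f: "f \<in> Hom A c d"
    then show "FAr F f \<in> Hom S (FOb F c) (FOb F d)" using FAr arH FOb Hom_Ob[OF f] by simp
    fix g e assume g: "g \<in> Hom A d e"
    show "FAr F (Cmp A g f) = Cmp S (FAr F g) (FAr F f)"
      unfolding FAr[OF f] FAr[OF g] FAr[OF cmp_in[OF f g]]
      by (rule set_ext[OF arH[OF cmp_in[OF f g]] S.cmp_in[OF arH[OF f] arH[OF g]]])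
        (use fn_Cmp[OF arH[OF f]] maps[OF f] cmp[OF f g] in simp)
  qed
  then have "F \<in> Ob E" by (simp add: functor_cat_Ob F_def)
  moreover have "psh_act F f x = ac f x" if "f \<in> Hom A c d" "x \<in> ob c" for f c d x
    using FAr[OF that(1)] that(2) by (simp add: psh_act_def)
  ultimately show "\<exists>F \<in> Ob E. (\<forall>c \<in> Ob A. FOb F c = ob c) \<and> (\<forall>c d. \<forall>f \<in> Hom A c d. \<forall>x \<in> ob c. psh_act F f x = ac f x)"
    using FOb by blast
qed

end

section \<open>Sites with an initial object\<close>

lemma (in universe) topos_set_cat: "topos (set_cat :: ('u set, 'u setarr) cat)"
proof -
  interpret presheaf_model U unit_cat "set_cat :: ('u set, 'u setarr) cat" "\<lambda>X _. X" "\<lambda>X _ x. x" "\<lambda>h _. fn h"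
    by (rule set_model)
  show ?thesis by (rule topos)
qed

text \<open>At an initial object of \<open>A\<close> this is the global sections functor.\<close>

definition ev_func :: "'o \<Rightarrow> (('o, 'a, 'u) psh, ('o, 'a, 'u) psharr, 'u set, 'u setarr) func" where
  "ev_func c = \<lparr>FOb = (\<lambda>F. FOb F c), FAr = (\<lambda>t. snd (snd t) c)\<rparr>"

lemma ev_func_simps [simp]: "FOb (ev_func c) F = FOb F c" "fn (FAr (ev_func c) t) = psh_app t c"
  by (simp_all add: ev_func_def psh_app_def fun_eq_iff)

lemma set_bij_iso:
  assumes h: "h \<in> Hom set_cat X Y" and "bij_betw (fn h) X Y" shows "iso_arrow set_cat h"
proof -
  interpret S: category set_cat by (rule category_set_cat)
  have XY: "X \<prec> (UNIV :: 'a set)" "Y \<prec> (UNIV :: 'a set)" using h by (auto simp: Hom_set_cat)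
  let ?g = "set_arrow Y X (inv_into X (fn h))"
  have g: "?g \<in> Hom set_cat Y X"
    using assms(2) XY by (intro set_arrow_Hom) (auto simp: bij_betw_def inv_into_into)
  show ?thesis
  proof (rule S.iso_arrowI[OF h g])
    show "Cmp set_cat ?g h = Idt set_cat X"
      by (rule set_ext[OF S.cmp_in[OF h g] S.idt_in])
        (use XY fn_Cmp[OF h] fn_in[OF h] assms(2) in \<open>auto simp: fn_Idt bij_betw_inv_into_left\<close>)
    show "Cmp set_cat h ?g = Idt set_cat Y"
      by (rule set_ext[OF S.cmp_in[OF g h] S.idt_in])
        (use XY fn_Cmp[OF g] assms(2) in \<open>auto simp: fn_Idt bij_betw_inv_into_right\<close>)
  qed
qed

text \<open>The site has a terminal object, which is initial in \<open>A\<close>; for algebras it is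
  \<complex>.\<close>

locale initial_site = small_category U A for U :: "'u itself" and A :: "('c, 'f) cat" +
  fixes z :: 'c
  assumes z_Ob: "z \<in> Ob A" and initial: "c \<in> Ob A \<Longrightarrow> \<exists>!f. f \<in> Hom A z c"
begin

sublocale E: presheaf_model U A E FOb psh_act psh_app
  by (rule functor_model)

abbreviation K :: "('u set, 'u setarr, ('c, 'f, 'u) psh, ('c, 'f, 'u) psharr) func" where
  "K \<equiv> const_func A"

abbreviation ev :: "(('c, 'f, 'u) psh, ('c, 'f, 'u) psharr, 'u set, 'u setarr) func" where
  "ev \<equiv> ev_func z"

lemma const_FOb [simp]: "c \<in> Ob A \<Longrightarrow> FOb (FOb K X) c = X"
  by (simp add: const_func_def const_psh_def)

lemma const_act: "f \<in> Hom A c d \<Longrightarrow> x \<in> X \<Longrightarrow> psh_act (FOb K X) f x = x"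
  by (simp add: const_func_def const_psh_def psh_act_def Hom_def fn_Idt)

lemma const_app: "c \<in> Ob A \<Longrightarrow> psh_app (FAr K h) c x = fn h x"
  by (simp add: const_func_def psh_app_def)

lemma const_Ob: assumes X: "X \<in> Ob S" shows "FOb K X \<in> Ob E"
proof -
  interpret S: category S by (rule category_set_cat)
  have "is_functor A S (FOb K X)"
  proof (rule is_functorI[OF category_axioms category_set_cat])
    fix f g c d e assume f: "f \<in> Hom A c d" and g: "g \<in> Hom A d e"
    show "FAr (FOb K X) (Cmp A g f) = Cmp S (FAr (FOb K X) g) (FAr (FOb K X) f)"
      using Hom_Ar[OF f] Hom_Ar[OF g] Hom_Ar[OF cmp_in[OF f g]] S.cmp_id_left[OF S.idt_in[OF X]]
      by (simp add: const_func_def const_psh_def)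
  qed (use X S.idt_in[OF X] Hom_Ob Hom_Ar[OF idt_in] in \<open>auto simp: const_func_def const_psh_def Hom_Ar\<close>)
  then show ?thesis by (simp add: functor_cat_Ob const_func_def const_psh_def)
qed

lemma const_Hom: assumes h: "h \<in> Hom S X Y" shows "FAr K h \<in> Hom E (FOb K X) (FOb K Y)"
proof -
  interpret S: category S by (rule category_set_cat)
  note XY = S.Hom_Ob[OF h]
  have "nat_trans A S (FOb K X) (FOb K Y) (\<lambda>c\<in>Ob A. h)"
  proof (rule nat_transI[OF E_func[OF const_Ob[OF XY(1)]] E_func[OF const_Ob[OF XY(2)]]])
    fix f c d assume f: "f \<in> Hom A c d"
    show "Cmp S ((\<lambda>c\<in>Ob A. h) d) (FAr (FOb K X) f) = Cmp S (FAr (FOb K Y) f) ((\<lambda>c\<in>Ob A. h) c)"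
      using Hom_Ob[OF f] Hom_Ar[OF f] S.cmp_id_left[OF h] S.cmp_id_right[OF h] by (simp add: const_func_def const_psh_def)
  qed (use h in simp)
  then show ?thesis using const_Ob XY Hom_Dom[OF h] Hom_Cod[OF h] by (simp add: functor_cat_Hom const_func_def)
qed

lemma const_functor: "is_functor S E K"
proof (rule is_functorI[OF category_set_cat E.E.category_axioms const_Ob const_Hom])
  interpret S: category S by (rule category_set_cat)
  fix X assume X: "X \<in> Ob S"
  show "FAr K (Idt S X) = Idt E (FOb K X)"
    by (rule E.arr_ext[OF const_Hom[OF S.idt_in[OF X]] E.E.idt_in[OF const_Ob[OF X]]])
      (simp add: const_app E.app_idt[OF const_Ob[OF X]] fn_Idt)
next
  interpret S: category S by (rule category_set_cat)
  fix f g X Y Z assume f: "f \<in> Hom S X Y" and g: "g \<in> Hom S Y Z"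
  show "FAr K (Cmp S g f) = Cmp E (FAr K g) (FAr K f)"
    by (rule E.arr_ext[OF const_Hom[OF S.cmp_in[OF f g]] E.E.cmp_in[OF const_Hom[OF f] const_Hom[OF g]]])
      (simp add: const_app E.app_cmp[OF const_Hom[OF f] const_Hom[OF g]] fn_Cmp[OF f])
qed

lemma ev_Hom: "t \<in> Hom E F G \<Longrightarrow> FAr ev t \<in> Hom S (FOb F z) (FOb G z)"
  using z_Ob by (auto simp: functor_cat_Hom ev_func_def intro: nat_trans_Hom)

lemma ev_functor: "is_functor E S ev"
proof (rule is_functorI[OF E.E.category_axioms category_set_cat])
  interpret S: category S by (rule category_set_cat)
  fix F :: "('c, 'f, 'u) psh" assume F: "F \<in> Ob E"
  then show "FOb ev F \<in> Ob S" using E.el_small z_Ob by simp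
  show "FAr ev (Idt E F) = Idt S (FOb ev F)" using z_Ob by (simp add: ev_func_def functor_cat_Idt)
next
  fix s t F G H assume "s \<in> Hom E F G" "t \<in> Hom E G H"
  show "FAr ev (Cmp E t s) = Cmp S (FAr ev t) (FAr ev s)" using z_Ob by (simp add: ev_func_def functor_cat_Cmp)
qed (simp add: ev_Hom)

text \<open>An element at \<open>z\<close> can be moved to every \<open>c\<close> along the only
  arrow from \<open>z\<close>, which gives the counit. The unit can be the identity, because a
  constant functor has the same set as its value at \<open>z\<close>.\<close>

lemma const_ev_adjunction:
  obtains \<epsilon> where "adjunction S E K ev (\<lambda>X. Idt S X) \<epsilon>"
proof -
  interpret S: category S by (rule category_set_cat)
  define i where "i = (\<lambda>c. THE f. f \<in> Hom A z c)"
  have i: "i c \<in> Hom A z c" if "c \<in> Ob A" for c using theI'[OF initial[OF that]] by (simp add: i_def)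
  have i_cmp: "Cmp A f (i c) = i d" if "f \<in> Hom A c d" for f c d
    using initial[of d] i Hom_Ob[OF that] cmp_in[OF i that] by blast
  have i_id: "i z = Idt A z" using initial[OF z_Ob] i[OF z_Ob] idt_in[OF z_Ob] by blast
  have Fz: "FOb F z \<in> Ob S" if "F \<in> Ob E" for F using E.el_small[OF that z_Ob] by simp
  have "\<exists>t. t \<in> Hom E (FOb K (FOb F z)) F \<and> (\<forall>c \<in> Ob A. \<forall>x \<in> FOb F z. psh_app t c x = psh_act F (i c) x)"
    if F: "F \<in> Ob E" for F :: "('c, 'f, 'u) psh"
  proof -
    obtain t where "t \<in> Hom E (FOb K (FOb F z)) F"
      "\<And>c x. c \<in> Ob A \<Longrightarrow> x \<in> FOb (FOb K (FOb F z)) c \<Longrightarrow> psh_app t c x = psh_act F (i c) x"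
    proof (rule E.arrE[OF const_Ob[OF Fz[OF F]] F, of "\<lambda>c x. psh_act F (i c) x"])
      fix c x assume "c \<in> Ob A" "x \<in> FOb (FOb K (FOb F z)) c"
      then show "psh_act F (i c) x \<in> FOb F c" using E.act_in[OF F i] by simp
    next
      fix f c d x assume f: "f \<in> Hom A c d" and "x \<in> FOb (FOb K (FOb F z)) c"
      then have x: "x \<in> FOb F z" using Hom_Ob[OF f] by simp
      show "psh_act F (i d) (psh_act (FOb K (FOb F z)) f x) = psh_act F f (psh_act F (i c) x)"
        using const_act[OF f x] E.act_cmp[OF F i[OF Hom_Ob(1)[OF f]] f x] i_cmp[OF f] by simp
    qed blast
    then show ?thesis by (intro exI[of _ t]) simp
  qed
  then obtain \<epsilon> where \<epsilon>: "\<And>F. F \<in> Ob E \<Longrightarrow> \<epsilon> F \<in> Hom E (FOb K (FOb F z)) F"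
    "\<And>F c x. F \<in> Ob E \<Longrightarrow> c \<in> Ob A \<Longrightarrow> x \<in> FOb F z \<Longrightarrow> psh_app (\<epsilon> F) c x = psh_act F (i c) x" by metis
  have "adjunction S E K ev (\<lambda>X. Idt S X) \<epsilon>"
    unfolding adjunction_def
  proof (intro conjI ballI const_functor ev_functor)
    show "nat_trans S S id_func (comp_func ev K) (\<lambda>X. Idt S X)"
    proof (rule nat_transI[OF functor_id[OF category_set_cat] functor_comp[OF const_functor ev_functor]])
      fix f :: "'u setarr" and X Y assume f: "f \<in> Hom S X Y"
      have "FAr ev (FAr K f) = f"
        by (rule set_ext[of _ X Y]) (use ev_Hom[OF const_Hom[OF f]] f z_Ob in \<open>auto simp: const_app\<close>)
      then show "Cmp S (Idt S Y) (FAr id_func f) = Cmp S (FAr (comp_func ev K) f) (Idt S X)"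
        using S.cmp_id_left[OF f] S.cmp_id_right[OF f] by simp
    qed (use S.idt_in z_Ob in simp)
    show "nat_trans E E (comp_func K ev) id_func \<epsilon>"
    proof (rule nat_transI[OF functor_comp[OF ev_functor const_functor] functor_id[OF E.E.category_axioms]])
      fix t and F G :: "('c, 'f, 'u) psh" assume t: "t \<in> Hom E F G"
      have FG: "F \<in> Ob E" "G \<in> Ob E" using E.E.Hom_Ob[OF t] by auto
      note kt = const_Hom[OF ev_Hom[OF t]]
      have "Cmp E (\<epsilon> G) (FAr K (FAr ev t)) = Cmp E t (\<epsilon> F)"
      proof (rule E.arr_ext[OF E.E.cmp_in[OF kt \<epsilon>(1)[OF FG(2)]] E.E.cmp_in[OF \<epsilon>(1)[OF FG(1)] t]])
        fix c x assume c: "c \<in> Ob A" and "x \<in> FOb (FOb K (FOb F z)) c"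
        then have x: "x \<in> FOb F z" by simp
        have x': "x \<in> FOb (FOb K (FOb F z)) c" using x c by simp
        show "psh_app (Cmp E (\<epsilon> G) (FAr K (FAr ev t))) c x = psh_app (Cmp E t (\<epsilon> F)) c x"
          unfolding E.app_cmp[OF kt \<epsilon>(1)[OF FG(2)] c x'] E.app_cmp[OF \<epsilon>(1)[OF FG(1)] t c x']
          using \<epsilon>(2)[OF FG(2) c] \<epsilon>(2)[OF FG(1) c x] E.app_nat[OF t i[OF c] x] E.app_in[OF t z_Ob x] const_app[OF c] by simp
      qed
      then show "Cmp E (\<epsilon> G) (FAr (comp_func K ev) t) = Cmp E (FAr id_func t) (\<epsilon> F)" by simp
    qed (use \<epsilon> in simp)
  next
    fix X :: "'u set" assume X: "X \<in> Ob S"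
    note kX = const_Ob[OF X]
    have "\<epsilon> (FOb K X) \<in> Hom E (FOb K X) (FOb K X)" using \<epsilon>(1)[OF kX] z_Ob by simp
    then have "\<epsilon> (FOb K X) = Idt E (FOb K X)"
      by (rule E.arr_ext[OF _ E.E.idt_in[OF kX]])
        (use \<epsilon>(2)[OF kX] E.app_idt[OF kX] const_act[OF i] z_Ob in auto)
    then show "Cmp E (\<epsilon> (FOb K X)) (FAr K (Idt S X)) = Idt E (FOb K X)"
      using functor_idt[OF const_functor X] E.E.cmp_id_left[OF E.E.idt_in[OF kX]] by simp
  next
    fix F :: "('c, 'f, 'u) psh" assume F: "F \<in> Ob E"
    have e: "FAr ev (\<epsilon> F) \<in> Hom S (FOb F z) (FOb F z)" using ev_Hom[OF \<epsilon>(1)[OF F]] z_Ob by simp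
    have "FAr ev (\<epsilon> F) = Idt S (FOb F z)"
      by (rule set_ext[OF e S.idt_in[OF Fz[OF F]]])
        (use \<epsilon>(2)[OF F z_Ob] i_id E.act_idt[OF F z_Ob] in \<open>auto simp: fn_Idt\<close>)
    then show "Cmp S (FAr ev (\<epsilon> F)) (Idt S (FOb ev F)) = Idt S (FOb ev F)"
      using S.cmp_id_left[OF S.idt_in[OF Fz[OF F]]] by simp
  qed
  then show thesis by (rule that)
qed

lemma const_preserves: "preserves_finite_limits S E K"
  unfolding preserves_finite_limits_def
proof (intro conjI allI impI)
  interpret S: presheaf_model U unit_cat S "\<lambda>X _. X" "\<lambda>X _ x. x" "\<lambda>h _. fn h" by (rule set_model)
  fix T :: "'u set" assume T: "terminal S T"
  then have "T \<in> Ob S" by (simp add: terminal_def)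
  then show "terminal E (FOb K T)"
    by (intro E.terminalI const_Ob) (use S.terminalD[OF T, of "()"] in \<open>simp_all add: unit_cat_def\<close>)
next
  interpret S: presheaf_model U unit_cat S "\<lambda>X _. X" "\<lambda>X _ x. x" "\<lambda>h _. fn h" by (rule set_model)
  fix f g p q :: "'u setarr" assume pb: "is_pullback S f g p q"
  have f: "f \<in> Hom S (Dom S f) (Cod S f)" and g: "g \<in> Hom S (Dom S g) (Cod S f)"
    and p: "p \<in> Hom S (Dom S p) (Dom S f)" and q: "q \<in> Hom S (Dom S p) (Dom S g)"
    and comm: "Cmp S f p = Cmp S g q"
    using pb Ar_Hom[of f S] Ar_Hom[of g S] by (auto simp: is_pullback_def)
  show "is_pullback E (FAr K f) (FAr K g) (FAr K p) (FAr K q)"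
  proof (rule E.is_pullbackI[OF const_Hom[OF f] const_Hom[OF g] const_Hom[OF p] const_Hom[OF q]])
    fix c x assume "c \<in> Ob A" "x \<in> FOb (FOb K (Dom S p)) c"
    then show "psh_app (FAr K f) c (psh_app (FAr K p) c x) = psh_app (FAr K g) c (psh_app (FAr K q) c x)"
      using fn_Cmp[OF p, of x f] fn_Cmp[OF q, of x g] comm by (simp add: const_app)
  next
    fix c x y assume "c \<in> Ob A" "x \<in> FOb (FOb K (Dom S f)) c" "y \<in> FOb (FOb K (Dom S g)) c"
      "psh_app (FAr K f) c x = psh_app (FAr K g) c y"
    then show "\<exists>!w. w \<in> FOb (FOb K (Dom S p)) c \<and> psh_app (FAr K p) c w = x \<and> psh_app (FAr K q) c w = y"
      using S.is_pullbackD[OF pb, of "()" x y] by (simp add: const_app unit_cat_def)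
  qed
qed

lemma canonical_exists:
  "\<exists>p. geometric_morphism E S p \<and> inv_im p = K"
proof -
  obtain \<epsilon> where a: "adjunction S E K ev (\<lambda>X. Idt S X) \<epsilon>" by (rule const_ev_adjunction)
  show ?thesis
    using a E.topos topos_set_cat const_preserves
    by (intro exI[of _ "\<lparr>inv_im = K, dir_im = ev, gunit = (\<lambda>X. Idt S X), gcounit = \<epsilon>\<rparr>"])
      (simp add: geometric_morphism_def)
qed

text \<open>Comparison with evaluation at \<open>z\<close>, whose unit is the identity, exhibits the
  unit of \<open>p\<close> as a section of an isomorphism.\<close>

lemma direct_image_ev:
  assumes p: "geometric_morphism E S p" and K: "inv_im p = K"
  obtains \<theta> where "nat_trans E S (dir_im p) ev \<theta>" "\<And>F. F \<in> Ob E \<Longrightarrow> iso_arrow S (\<theta> F)"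
    "\<And>X. X \<in> Ob S \<Longrightarrow> Cmp S (\<theta> (FOb K X)) (gunit p X) = Idt S X"
    "\<And>X. X \<in> Ob S \<Longrightarrow> iso_arrow S (gunit p X)"
proof -
  interpret S: category S by (rule category_set_cat)
  obtain \<epsilon> where a: "adjunction S E K ev (\<lambda>X. Idt S X) \<epsilon>" by (rule const_ev_adjunction)
  have ap: "adjunction S E K (dir_im p) (gunit p) (gcounit p)" using p K by (simp add: geometric_morphism_def)
  interpret p: adj S E K "dir_im p" "gunit p" "gcounit p" using ap by (rule adj.intro)
  obtain \<theta> where \<theta>: "nat_trans E S (dir_im p) ev \<theta>" "\<And>F. F \<in> Ob E \<Longrightarrow> iso_arrow S (\<theta> F)"
    "\<And>X. X \<in> Ob S \<Longrightarrow> Cmp S (\<theta> (FOb K X)) (gunit p X) = Idt S X"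
    using right_adjoint_unique[OF ap a] by metis
  have "iso_arrow S (gunit p X)" if X: "X \<in> Ob S" for X
    by (rule S.iso_of_left_inverse[OF \<theta>(2)[OF const_Ob[OF X]] p.\<eta>[OF X] _ \<theta>(3)[OF X]])
      (use nat_trans_Hom[OF \<theta>(1) const_Ob[OF X]] z_Ob in simp)
  then show thesis using that \<theta> by blast
qed

text \<open>The right adjoint of evaluation is the codiscrete functor, whose value at
  \<open>c\<close> consists of the functions to \<open>X\<close> from the points of
  \<open>c\<close>, the arrows from \<open>c\<close> to \<open>z\<close>. Since \<open>z\<close> has
  only one point, the value at \<open>z\<close> is \<open>X\<close> again.\<close>

lemma ev_couniversal:
  assumes X: "X \<in> Ob S"
  obtains T e where "couniversal E S ev X T e" "iso_arrow S e"
proof -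
  \<comment> \<open>A function of points of the domain becomes one of points of the codomain,
    because points compose with \<open>h\<close>.\<close>
  define ac :: "'f \<Rightarrow> ('f \<Rightarrow> 'u) \<Rightarrow> 'f \<Rightarrow> 'u"
    where "ac = (\<lambda>h \<theta>. \<lambda>f \<in> Hom A (Cod A h) z. \<theta> (Cmp A f h))"
  have acP: "ac h \<theta> \<in> Hom A d z \<rightarrow>\<^sub>E X" if "h \<in> Hom A c d" "\<theta> \<in> Hom A c z \<rightarrow>\<^sub>E X" for h \<theta> c d
    using that cmp_in[OF that(1)] by (auto simp: ac_def Hom_Cod[OF that(1)])
  have ac_app: "ac h \<theta> f = \<theta> (Cmp A f h)" if "h \<in> Hom A c d" "f \<in> Hom A d z" for h \<theta> c d f
    using that by (simp add: ac_def Hom_Cod[OF that(1)])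
  obtain T i r where T: "T \<in> Ob E"
    and i: "\<And>c \<theta>. c \<in> Ob A \<Longrightarrow> \<theta> \<in> Hom A c z \<rightarrow>\<^sub>E X \<Longrightarrow> i c \<theta> \<in> FOb T c"
    and r: "\<And>c y. c \<in> Ob A \<Longrightarrow> y \<in> FOb T c \<Longrightarrow> r c y \<in> Hom A c z \<rightarrow>\<^sub>E X"
    and ri: "\<And>c \<theta>. c \<in> Ob A \<Longrightarrow> \<theta> \<in> Hom A c z \<rightarrow>\<^sub>E X \<Longrightarrow> r c (i c \<theta>) = \<theta>"
    and ir: "\<And>c y. c \<in> Ob A \<Longrightarrow> y \<in> FOb T c \<Longrightarrow> i c (r c y) = y"
    and ai: "\<And>c d f \<theta>. f \<in> Hom A c d \<Longrightarrow> \<theta> \<in> Hom A c z \<rightarrow>\<^sub>E X \<Longrightarrow> psh_act T f (i c \<theta>) = i d (ac f \<theta>)"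
    and ra: "\<And>c d f y. f \<in> Hom A c d \<Longrightarrow> y \<in> FOb T c \<Longrightarrow> r d (psh_act T f y) = ac f (r c y)"
  proof (rule E.objE[of "\<lambda>c. Hom A c z \<rightarrow>\<^sub>E X" ac])
    fix c show "small_in U (Hom A c z \<rightarrow>\<^sub>E X)" using X by (intro small_PiE E.small_Hom) simp
  next
    fix f c d \<theta> assume "f \<in> Hom A c d" "\<theta> \<in> Hom A c z \<rightarrow>\<^sub>E X"
    then show "ac f \<theta> \<in> Hom A d z \<rightarrow>\<^sub>E X" by (rule acP)
  next
    fix c \<theta> assume c: "c \<in> Ob A" and \<theta>: "\<theta> \<in> Hom A c z \<rightarrow>\<^sub>E X"
    show "ac (Idt A c) \<theta> = \<theta>"
      by (rule PiE_ext[OF acP[OF idt_in[OF c] \<theta>] \<theta>]) (simp add: ac_app[OF idt_in[OF c]] cmp_id_right)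
  next
    fix f g c d e \<theta> assume f: "f \<in> Hom A c d" and g: "g \<in> Hom A d e" and \<theta>: "\<theta> \<in> Hom A c z \<rightarrow>\<^sub>E X"
    show "ac (Cmp A g f) \<theta> = ac g (ac f \<theta>)"
      by (rule PiE_ext[OF acP[OF cmp_in[OF f g] \<theta>] acP[OF g acP[OF f \<theta>]]])
        (simp add: ac_app[OF cmp_in[OF f g]] ac_app[OF g] ac_app[OF f cmp_in[OF g]] cmp_assoc[OF f g])
  qed blast
  have id: "Hom A z z = {Idt A z}" using initial[OF z_Ob] idt_in[OF z_Ob] by blast
  define e where "e = set_arrow (FOb T z) X (\<lambda>y. r z y (Idt A z))"
  have e_in: "r z y (Idt A z) \<in> X" if "y \<in> FOb T z" for y
    using r[OF z_Ob that] idt_in[OF z_Ob] by blast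
  have e: "e \<in> Hom S (FOb T z) X" unfolding e_def
    using e_in E.el_small[OF T z_Ob] X by (intro set_arrow_Hom) simp_all
  have "bij_betw (fn e) (FOb T z) X"
  proof (rule bij_betw_byWitness[where f' = "\<lambda>x. i z (\<lambda>f \<in> Hom A z z. x)"])
    show "\<forall>y \<in> FOb T z. i z (\<lambda>f \<in> Hom A z z. fn e y) = y"
    proof
      fix y assume y: "y \<in> FOb T z"
      have "(\<lambda>f \<in> Hom A z z. r z y (Idt A z)) = r z y"
        by (rule PiE_ext[OF _ r[OF z_Ob y]]) (use e_in[OF y] id in auto)
      then show "i z (\<lambda>f \<in> Hom A z z. fn e y) = y" using ir[OF z_Ob y] y by (simp add: e_def)
    qed
    show "\<forall>x \<in> X. fn e (i z (\<lambda>f \<in> Hom A z z. x)) = x"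
      using i[OF z_Ob] ri[OF z_Ob] idt_in[OF z_Ob] by (auto simp: e_def)
  qed (use i[OF z_Ob] fn_in[OF e] in auto)
  then have iso: "iso_arrow S e" by (rule set_bij_iso[OF e])
  have "couniversal E S ev X T e"
    unfolding couniversal_def
  proof (intro conjI ballI T)
    show "e \<in> Hom S (FOb ev T) X" using e by simp
    fix Z g assume Z: "Z \<in> Ob E" and g: "g \<in> Hom S (FOb ev Z) X"
    have g: "g \<in> Hom S (FOb Z z) X" using g by simp
    \<comment> \<open>The transpose of \<open>g\<close>: move \<open>x\<close> along each point and
      apply \<open>g\<close>.\<close>
    define m where "m = (\<lambda>c x. \<lambda>f \<in> Hom A c z. fn g (psh_act Z f x))"
    have m: "m c x \<in> Hom A c z \<rightarrow>\<^sub>E X" if "c \<in> Ob A" "x \<in> FOb Z c" for c x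
      using fn_in[OF g] E.act_in[OF Z _ that(2)] by (auto simp: m_def)
    obtain h where h: "h \<in> Hom E Z T" and h_app: "\<And>c x. c \<in> Ob A \<Longrightarrow> x \<in> FOb Z c \<Longrightarrow> psh_app h c x = i c (m c x)"
    proof (rule E.arrE[OF Z T, of "\<lambda>c x. i c (m c x)"])
      fix c x assume "c \<in> Ob A" "x \<in> FOb Z c" then show "i c (m c x) \<in> FOb T c" using i m by simp
    next
      fix f c d x assume f: "f \<in> Hom A c d" and x: "x \<in> FOb Z c"
      have cd: "c \<in> Ob A" "d \<in> Ob A" using Hom_Ob[OF f] by auto
      have "m d (psh_act Z f x) = ac f (m c x)"
        by (rule PiE_ext[OF m[OF cd(2) E.act_in[OF Z f x]] acP[OF f m[OF cd(1) x]]])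
          (use cmp_in[OF f] E.act_cmp[OF Z f _ x] in \<open>simp add: m_def ac_app[OF f]\<close>)
      then show "i d (m d (psh_act Z f x)) = psh_act T f (i c (m c x))" using ai[OF f m[OF cd(1) x]] by simp
    qed blast
    have app_e: "fn (Cmp S e (FAr ev k)) x = r z (psh_app k z x) (Idt A z)" if "k \<in> Hom E Z T" "x \<in> FOb Z z" for k x
      using fn_Cmp[OF ev_Hom[OF that(1)] that(2)] E.app_in[OF that(1) z_Ob that(2)] by (simp add: e_def)
    interpret S: category S by (rule category_set_cat)
    show "\<exists>!h. h \<in> Hom E Z T \<and> Cmp S e (FAr ev h) = g"
    proof (rule ex1I[of _ h], intro conjI h)
      show "Cmp S e (FAr ev h) = g"
      proof (rule set_ext[OF S.cmp_in[OF ev_Hom[OF h] e] g])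
        fix x assume x: "x \<in> FOb Z z"
        show "fn (Cmp S e (FAr ev h)) x = fn g x"
          using app_e[OF h x] h_app[OF z_Ob x] ri[OF z_Ob m[OF z_Ob x]] idt_in[OF z_Ob] E.act_idt[OF Z z_Ob x]
          by (simp add: m_def)
      qed
      fix k assume k': "k \<in> Hom E Z T \<and> Cmp S e (FAr ev k) = g"
      then have k: "k \<in> Hom E Z T" by simp
      show "k = h"
      proof (rule E.arr_ext[OF k h])
        fix c x assume c: "c \<in> Ob A" and x: "x \<in> FOb Z c"
        note kx = E.app_in[OF k c x]
        have "r c (psh_app k c x) = m c x"
        proof (rule PiE_ext[OF r[OF c kx] m[OF c x]])
          fix f assume f: "f \<in> Hom A c z"
          note fx = E.act_in[OF Z f x]
          have "m c x f = r z (psh_app k z (psh_act Z f x)) (Idt A z)"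
            using f app_e[OF k fx] k' by (simp add: m_def)
          also have "\<dots> = r c (psh_app k c x) f"
            using E.app_nat[OF k f x] ra[OF f kx] ac_app[OF f idt_in[OF z_Ob]] cmp_id_left[OF f] by simp
          finally show "r c (psh_app k c x) f = m c x f" by simp
        qed
        then show "psh_app k c x = psh_app h c x" using ir[OF c kx] h_app[OF c x] by simp
      qed
    qed
  qed
  then show thesis using that iso by blast
qed

text \<open>The comparison with evaluation changes the universal arrows but not the objects
  \<open>T X\<close>; \<open>quality_of_zero\<close> relies on this.\<close>

lemma upper_shriek_of_ev_couniversal:
  assumes p: "geometric_morphism E S p" and K: "inv_im p = K"
    and cu: "\<And>X. X \<in> Ob S \<Longrightarrow> couniversal E S ev X (T X) (e X)" and e: "\<And>X. X \<in> Ob S \<Longrightarrow> iso_arrow S (e X)"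
  obtains R \<eta> \<epsilon> where "upper_shriek E S p R \<eta> \<epsilon>" "FOb R = T" "\<And>X. X \<in> Ob S \<Longrightarrow> iso_arrow S (\<epsilon> X)"
proof -
  interpret S: category S by (rule category_set_cat)
  obtain \<theta> where \<theta>: "nat_trans E S (dir_im p) ev \<theta>" "\<And>F. F \<in> Ob E \<Longrightarrow> iso_arrow S (\<theta> F)"
    using direct_image_ev[OF p K] by metis
  have f: "is_functor E S (dir_im p)" using \<theta>(1) by (simp add: nat_trans_def)
  define \<epsilon> where "\<epsilon> = (\<lambda>X. Cmp S (e X) (\<theta> (T X)))"
  have "couniversal E S (dir_im p) X (T X) (\<epsilon> X)" if "X \<in> Ob S" for X
    unfolding \<epsilon>_def by (rule couniversal_iso[OF ev_functor f \<theta> cu[OF that]])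
  then obtain R \<eta> where R: "adjunction E S (dir_im p) R \<eta> \<epsilon>" "FOb R = T"
    using adjunction_of_couniversal[OF f, of T \<epsilon>] by blast
  interpret r: adj E S "dir_im p" R \<eta> \<epsilon> using R(1) by (rule adj.intro)
  have \<epsilon>_iso: "iso_arrow S (\<epsilon> X)" if X: "X \<in> Ob S" for X
  proof -
    have TX: "T X \<in> Ob E" "e X \<in> Hom S (FOb (T X) z) X" using cu[OF X] by (auto simp: couniversal_def)
    show ?thesis
      unfolding \<epsilon>_def using S.iso_cmp[OF \<theta>(2)[OF TX(1)] e[OF X]] nat_trans_Hom[OF \<theta>(1) TX(1)] TX(2) by simp
  qed
  then show thesis using that[of R \<eta> \<epsilon>] R r.ff_of_counit_iso by (simp add: upper_shriek_def)
qed

lemma upper_shriek_exists: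
  assumes p: "geometric_morphism E S p" and K: "inv_im p = K"
  shows "\<exists>R \<eta> \<epsilon>. upper_shriek E S p R \<eta> \<epsilon>"
proof -
  have "\<exists>T e. \<forall>X \<in> Ob S. couniversal E S ev X (T X) (e X) \<and> iso_arrow S (e X)"
  proof -
    have ex: "\<forall>X \<in> Ob S. \<exists>Te. couniversal E S ev X (fst Te) (snd Te) \<and> iso_arrow S (snd Te)"
    proof
      fix X :: "'u set" assume "X \<in> Ob S"
      then obtain T e where "couniversal E S ev X T e" "iso_arrow S e" by (rule ev_couniversal)
      then show "\<exists>Te. couniversal E S ev X (fst Te) (snd Te) \<and> iso_arrow S (snd Te)"
        by (intro exI[of _ "(T, e)"]) simp
    qed
    from bchoice[OF ex] obtain Te
      where Te: "\<forall>X \<in> Ob S. couniversal E S ev X (fst (Te X)) (snd (Te X)) \<and> iso_arrow S (snd (Te X))" ..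
    show ?thesis by (rule exI[of _ "\<lambda>X. fst (Te X)"], rule exI[of _ "\<lambda>X. snd (Te X)"], rule Te)
  qed
  then obtain T e where cu: "\<And>X. X \<in> Ob S \<Longrightarrow> couniversal E S ev X (T X) (e X)"
    and e: "\<And>X. X \<in> Ob S \<Longrightarrow> iso_arrow S (e X)" by blast
  obtain R \<eta> \<epsilon> where "upper_shriek E S p R \<eta> \<epsilon>"
    by (rule upper_shriek_of_ev_couniversal[OF p K cu e])
  then show ?thesis by blast
qed

text \<open>If every object has exactly one point, a function of points is a constant, so the
  constant functor is itself the codiscrete one.\<close>

lemma quality_of_zero:
  assumes q: "geometric_morphism E S q" and K: "inv_im q = K"
    and zero: "\<And>c. c \<in> Ob A \<Longrightarrow> \<exists>!f. f \<in> Hom A c z"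
  shows "quality_type E S q"
proof -
  interpret S: category S by (rule category_set_cat)
  have cu: "couniversal E S ev X (FOb K X) (Idt S X)" if X: "X \<in> Ob S" for X
    unfolding couniversal_def
  proof (intro conjI ballI const_Ob[OF X])
    show "Idt S X \<in> Hom S (FOb ev (FOb K X)) X" using S.idt_in[OF X] z_Ob by simp
    fix Z g assume Z: "Z \<in> Ob E" and "g \<in> Hom S (FOb ev Z) X"
    then have g: "g \<in> Hom S (FOb Z z) X" by simp
    \<comment> \<open>The only point of \<open>c\<close>; uniqueness makes the choice compatible
      with all arrows, hence the transpose natural.\<close>
    define t where "t = (\<lambda>c. THE f. f \<in> Hom A c z)"
    have t: "t c \<in> Hom A c z" if "c \<in> Ob A" for c using theI'[OF zero[OF that]] by (simp add: t_def)
    have t_cmp: "Cmp A (t d) f = t c" if "f \<in> Hom A c d" for f c d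
      using zero[of c] t Hom_Ob[OF that] cmp_in[OF that t] by blast
    have t_id: "t z = Idt A z" using zero[OF z_Ob] t[OF z_Ob] idt_in[OF z_Ob] by blast
    obtain h where h: "h \<in> Hom E Z (FOb K X)"
      and h_app: "\<And>c x. c \<in> Ob A \<Longrightarrow> x \<in> FOb Z c \<Longrightarrow> psh_app h c x = fn g (psh_act Z (t c) x)"
    proof (rule E.arrE[OF Z const_Ob[OF X], of "\<lambda>c x. fn g (psh_act Z (t c) x)"])
      fix c x assume "c \<in> Ob A" "x \<in> FOb Z c"
      then show "fn g (psh_act Z (t c) x) \<in> FOb (FOb K X) c" using fn_in[OF g E.act_in[OF Z t]] by simp
    next
      fix f c d x assume f: "f \<in> Hom A c d" and x: "x \<in> FOb Z c"
      have cd: "c \<in> Ob A" "d \<in> Ob A" using Hom_Ob[OF f] by auto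
      show "fn g (psh_act Z (t d) (psh_act Z f x)) = psh_act (FOb K X) f (fn g (psh_act Z (t c) x))"
        using E.act_cmp[OF Z f t[OF cd(2)] x] t_cmp[OF f] const_act[OF f fn_in[OF g E.act_in[OF Z t[OF cd(1)] x]]] by simp
    qed blast
    have cmp: "Cmp S (Idt S X) (FAr ev k) = FAr ev k" if "k \<in> Hom E Z (FOb K X)" for k
      using S.cmp_id_left[of "FAr ev k" "FOb Z z" X] ev_Hom[OF that] z_Ob by simp
    show "\<exists>!h. h \<in> Hom E Z (FOb K X) \<and> Cmp S (Idt S X) (FAr ev h) = g"
    proof (rule ex1I[of _ h], intro conjI h)
      have ev_h: "FAr ev h \<in> Hom S (FOb Z z) X" using ev_Hom[OF h] z_Ob by simp
      have "FAr ev h = g"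
        by (rule set_ext[OF ev_h g]) (use h_app[OF z_Ob] t_id E.act_idt[OF Z z_Ob] in simp)
      then show "Cmp S (Idt S X) (FAr ev h) = g" using cmp[OF h] by simp
      fix k assume k': "k \<in> Hom E Z (FOb K X) \<and> Cmp S (Idt S X) (FAr ev k) = g"
      then have k: "k \<in> Hom E Z (FOb K X)" and kg: "FAr ev k = g" using cmp[of k] by simp_all
      show "k = h"
      proof (rule E.arr_ext[OF k h])
        fix c x assume c: "c \<in> Ob A" and x: "x \<in> FOb Z c"
        have kx: "psh_app k c x \<in> X" using E.app_in[OF k c x] c by simp
        have "psh_app k c x = psh_app k z (psh_act Z (t c) x)"
          using E.app_nat[OF k t[OF c] x] const_act[OF t[OF c] kx] by simp
        also have "\<dots> = fn g (psh_act Z (t c) x)" using kg ev_func_simps(2)[of z k] by simp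
        finally show "psh_app k c x = psh_app h c x" using h_app[OF c x] by simp
      qed
    qed
  qed
  have iso: "iso_arrow S (Idt S X)" if "X \<in> Ob S" for X
    using S.iso_arrowI[OF S.idt_in[OF that] S.idt_in[OF that]] S.cmp_id_left[OF S.idt_in[OF that]] by simp
  obtain R \<eta> \<epsilon> where R: "upper_shriek E S q R \<eta> \<epsilon>" "FOb R = FOb K" "\<And>X. X \<in> Ob S \<Longrightarrow> iso_arrow S (\<epsilon> X)"
    using upper_shriek_of_ev_couniversal[OF q K cu iso] by metis
  have u: "iso_arrow S (gunit q X)" if "X \<in> Ob S" for X
    using direct_image_ev[OF q K] that by metis
  show ?thesis
    by (rule quality_typeI[OF q R(1)[unfolded upper_shriek_def, THEN conjunct1] R(3) _ u]) (simp_all add: R(2) K)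
qed

end

section \<open>Restriction to a full subcategory\<close>

lemma Hom_full_subcat: "Hom (full_subcat C X) c d = {f \<in> Hom C c d. c \<in> X \<and> d \<in> X}"
  by (auto simp: Hom_def full_subcat_def)

lemma full_subcat_simps [simp]: "Ob (full_subcat C X) = Ob C \<inter> X"
  "Idt (full_subcat C X) = Idt C" "Cmp (full_subcat C X) = Cmp C"
  by (simp_all add: full_subcat_def)

lemma category_full_subcat:
  assumes "category C" shows "category (full_subcat C X)"
proof -
  interpret category C by fact
  show ?thesis
    by unfold_locales
      (auto simp: Hom_full_subcat idt_in cmp_in cmp_assoc dom_in cod_in cmp_idt idt_cmp, auto simp: full_subcat_def dom_in cod_in cmp_idt idt_cmp)
qed

locale subsite = initial_site U A z for U :: "'u itself" and A :: "('c, 'f) cat" and z +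
  fixes X0 :: "'c set"
  assumes z_X0: "z \<in> X0"
begin

abbreviation W :: "('c, 'f) cat" where
  "W \<equiv> full_subcat A X0"

lemma W_Hom: "f \<in> Hom W c d \<longleftrightarrow> f \<in> Hom A c d \<and> c \<in> X0 \<and> d \<in> X0"
  by (auto simp: Hom_full_subcat)

lemma initial_site_W: "initial_site TYPE('u) W z"
proof (intro initial_site.intro small_category.intro small_category_axioms.intro initial_site_axioms.intro universe_axioms)
  show "category W" by (rule category_full_subcat[OF category_axioms])
  show "small_in U (Ar W)" by (rule small_subset[OF Ar_small]) (auto simp: full_subcat_def)
  show "z \<in> Ob W" using z_Ob z_X0 by simp
  fix c assume "c \<in> Ob W" then show "\<exists>!f. f \<in> Hom W z c" using initial[of c] z_X0 by (simp add: W_Hom)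
qed

sublocale W: initial_site U W z
  by (rule initial_site_W)

abbreviation Rs :: "(('c, 'f, 'u) psh, ('c, 'f, 'u) psharr, ('c, 'f, 'u) psh, ('c, 'f, 'u) psharr) func" where
  "Rs \<equiv> restrict_func W"

lemma Rs_FOb [simp]: "c \<in> Ob A \<Longrightarrow> c \<in> X0 \<Longrightarrow> FOb (FOb Rs F) c = FOb F c"
  by (simp add: restrict_func_def restrict_psh_def)

lemma Rs_act: "f \<in> Hom W c d \<Longrightarrow> psh_act (FOb Rs F) f = psh_act F f"
  by (simp add: restrict_func_def restrict_psh_def psh_act_def Hom_Ar[of f W])

lemma Rs_app: "c \<in> Ob A \<Longrightarrow> c \<in> X0 \<Longrightarrow> psh_app (FAr Rs t) c = psh_app t c"
  by (cases t) (simp add: restrict_func_def psh_app_def)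

lemma Rs_Ob: assumes F: "F \<in> Ob E" shows "FOb Rs F \<in> Ob W.E"
proof -
  note f = E_func[OF F]
  have FA: "FAr (FOb Rs F) f = FAr F f" if "f \<in> Hom W c d" for f c d
    using Hom_Ar[OF that] by (simp add: restrict_func_def restrict_psh_def)
  have "is_functor W S (FOb Rs F)"
  proof (rule is_functorI[OF W.category_axioms category_set_cat])
    fix c assume c: "c \<in> Ob W"
    then show "FOb (FOb Rs F) c \<in> Ob S" using functor_Ob[OF f, of c] by simp
    show "FAr (FOb Rs F) (Idt W c) = Idt S (FOb (FOb Rs F) c)"
      using FA[OF W.idt_in[OF c]] functor_idt[OF f, of c] c by simp
  next
    fix g c d assume g: "g \<in> Hom W c d"
    then have g': "g \<in> Hom A c d" "c \<in> X0" "d \<in> X0" by (auto simp: W_Hom)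
    show "FAr (FOb Rs F) g \<in> Hom S (FOb (FOb Rs F) c) (FOb (FOb Rs F) d)"
      using FA[OF g] functor_Hom[OF f g'(1)] g' Hom_Ob[OF g'(1)] by simp
    fix h e assume h: "h \<in> Hom W d e"
    then have h': "h \<in> Hom A d e" by (simp add: W_Hom)
    show "FAr (FOb Rs F) (Cmp W h g) = Cmp S (FAr (FOb Rs F) h) (FAr (FOb Rs F) g)"
      using FA[OF g] FA[OF h] FA[OF W.cmp_in[OF g h]] functor_cmp[OF f g'(1) h'] by simp
  qed
  then show ?thesis by (simp add: functor_cat_Ob restrict_func_def restrict_psh_def)
qed

lemma Rs_Hom: assumes t: "t \<in> Hom E F G" shows "FAr Rs t \<in> Hom W.E (FOb Rs F) (FOb Rs G)"
proof -
  have FG: "F \<in> Ob E" "G \<in> Ob E" using E.E.Hom_Ob[OF t] by auto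
  obtain n where n: "t = (F, G, n)" "nat_trans A S F G n" using t by (cases t) (auto simp: functor_cat_Hom)
  have "nat_trans W S (FOb Rs F) (FOb Rs G) (restrict n (Ob W))"
  proof (rule nat_transI[OF W.E_func[OF Rs_Ob[OF FG(1)]] W.E_func[OF Rs_Ob[OF FG(2)]]])
    fix c assume "c \<in> Ob W"
    then show "restrict n (Ob W) c \<in> Hom S (FOb (FOb Rs F) c) (FOb (FOb Rs G) c)"
      using nat_trans_Hom[OF n(2), of c] by simp
  next
    fix f c d assume f: "f \<in> Hom W c d"
    then have "f \<in> Hom A c d" by (simp add: W_Hom)
    then show "Cmp S (restrict n (Ob W) d) (FAr (FOb Rs F) f) = Cmp S (FAr (FOb Rs G) f) (restrict n (Ob W) c)"
      using nat_trans_nat[OF n(2), of f c d] W.Hom_Ob[OF f] Hom_Ar[OF f] by (simp add: restrict_func_def restrict_psh_def)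
  qed
  then show ?thesis using Rs_Ob FG n(1) by (simp add: functor_cat_Hom restrict_func_def)
qed

lemma Rs_functor: "is_functor E W.E Rs"
proof (rule is_functorI[OF E.E.category_axioms W.E.E.category_axioms Rs_Ob Rs_Hom])
  fix F :: "('c, 'f, 'u) psh" assume F: "F \<in> Ob E"
  show "FAr Rs (Idt E F) = Idt W.E (FOb Rs F)"
    by (rule W.E.arr_ext[OF Rs_Hom[OF E.E.idt_in[OF F]] W.E.E.idt_in[OF Rs_Ob[OF F]]])
      (use E.app_idt[OF F] W.E.app_idt[OF Rs_Ob[OF F]] in \<open>simp add: Rs_app\<close>)
next
  fix s t F G H assume s: "s \<in> Hom E F G" and t: "t \<in> Hom E G H"
  show "FAr Rs (Cmp E t s) = Cmp W.E (FAr Rs t) (FAr Rs s)"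
    by (rule W.E.arr_ext[OF Rs_Hom[OF E.E.cmp_in[OF s t]] W.E.E.cmp_in[OF Rs_Hom[OF s] Rs_Hom[OF t]]])
      (use E.app_cmp[OF s t] W.E.app_cmp[OF Rs_Hom[OF s] Rs_Hom[OF t]] in \<open>simp add: Rs_app\<close>)
qed

text \<open>The equation is strict, so the composite of the canonical morphism with the Weil
  subtopos is recognised by its inverse image.\<close>

lemma Rs_const: "comp_func Rs (const_func A) = const_func W"
proof -
  have 1: "restrict_psh W (const_psh A X) = const_psh W X" for X :: "'u set"
    by (auto simp: restrict_psh_def const_psh_def restrict_def fun_eq_iff full_subcat_def)
  show ?thesis
    by (auto simp: comp_func_def restrict_func_def const_func_def fun_eq_iff 1 restrict_def)
qed

lemma Rs_preserves: "preserves_finite_limits E W.E Rs"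
  unfolding preserves_finite_limits_def
proof (intro conjI allI impI)
  fix T :: "('c, 'f, 'u) psh" assume T: "terminal E T"
  then have "T \<in> Ob E" by (simp add: terminal_def)
  then show "terminal W.E (FOb Rs T)"
    using E.terminalD[OF T] by (intro W.E.terminalI Rs_Ob) simp_all
next
  fix f g p q :: "('c, 'f, 'u) psharr" assume pb: "is_pullback E f g p q"
  have f: "f \<in> Hom E (Dom E f) (Cod E f)" and g: "g \<in> Hom E (Dom E g) (Cod E f)"
    and p: "p \<in> Hom E (Dom E p) (Dom E f)" and q: "q \<in> Hom E (Dom E p) (Dom E g)"
    and comm: "Cmp E f p = Cmp E g q"
    using pb Ar_Hom[of f E] Ar_Hom[of g E] by (auto simp: is_pullback_def)
  show "is_pullback W.E (FAr Rs f) (FAr Rs g) (FAr Rs p) (FAr Rs q)"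
  proof (rule W.E.is_pullbackI[OF Rs_Hom[OF f] Rs_Hom[OF g] Rs_Hom[OF p] Rs_Hom[OF q]])
    fix c x assume "c \<in> Ob W" "x \<in> FOb (FOb Rs (Dom E p)) c"
    then show "psh_app (FAr Rs f) c (psh_app (FAr Rs p) c x) = psh_app (FAr Rs g) c (psh_app (FAr Rs q) c x)"
      using E.app_cmp[OF p f, of c x] E.app_cmp[OF q g, of c x] comm by (simp add: Rs_app)
  next
    fix c x y assume "c \<in> Ob W" "x \<in> FOb (FOb Rs (Dom E f)) c" "y \<in> FOb (FOb Rs (Dom E g)) c"
      "psh_app (FAr Rs f) c x = psh_app (FAr Rs g) c y"
    then show "\<exists>!w. w \<in> FOb (FOb Rs (Dom E p)) c \<and> psh_app (FAr Rs p) c w = x \<and> psh_app (FAr Rs q) c w = y"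
      using E.is_pullbackD[OF pb, of c x y] by (simp add: Rs_app)
  qed
qed

text \<open>The pointwise right Kan extension: its value at \<open>c\<close> is a limit over all
  arrows from \<open>c\<close> into the subcategory. For \<open>c\<close> in the subcategory the
  identity is initial among these, hence the counit is invertible.\<close>

lemma right_Kan:
  assumes F: "F \<in> Ob W.E"
  obtains T e where "couniversal E W.E Rs F T e" "iso_arrow W.E e"
proof -
  define G where "G = (\<lambda>c. {g \<in> Ar A. Dom A g = c \<and> Cod A g \<in> X0})"
  define T where "T = (\<lambda>c. {\<theta> \<in> Pi\<^sub>E (G c) (\<lambda>g. FOb F (Cod A g)).
    \<forall>d e. \<forall>g \<in> Hom A c d. \<forall>h \<in> Hom W d e. \<theta> (Cmp A h g) = psh_act F h (\<theta> g)})"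
  define ac :: "'f \<Rightarrow> ('f \<Rightarrow> 'u) \<Rightarrow> 'f \<Rightarrow> 'u" where "ac = (\<lambda>k \<theta>. \<lambda>g \<in> G (Cod A k). \<theta> (Cmp A g k))"
  have G_iff: "g \<in> G c \<longleftrightarrow> (\<exists>d \<in> X0. g \<in> Hom A c d)" for g c by (auto simp: G_def Hom_def)
  have T_in: "\<theta> g \<in> FOb F d" if "\<theta> \<in> T c" "g \<in> Hom A c d" "d \<in> X0" for \<theta> c g d
  proof -
    have "\<theta> \<in> Pi\<^sub>E (G c) (\<lambda>g. FOb F (Cod A g))" using that(1) by (simp add: T_def)
    then have "\<theta> g \<in> FOb F (Cod A g)" using that G_iff by blast
    then show ?thesis using Hom_Cod[OF that(2)] by simp
  qed
  have T_nat: "\<theta> (Cmp A h g) = psh_act F h (\<theta> g)" if "\<theta> \<in> T c" "g \<in> Hom A c d" "h \<in> Hom W d e" for \<theta> c g d h e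
    using that unfolding T_def by blast
  have T_ext: "\<theta> = \<theta>'" if "\<theta> \<in> T c" "\<theta>' \<in> T c" "\<And>d g. d \<in> X0 \<Longrightarrow> g \<in> Hom A c d \<Longrightarrow> \<theta> g = \<theta>' g" for \<theta> \<theta>' c
  proof (rule PiE_ext)
    show "\<theta> \<in> Pi\<^sub>E (G c) (\<lambda>g. FOb F (Cod A g))" "\<theta>' \<in> Pi\<^sub>E (G c) (\<lambda>g. FOb F (Cod A g))"
      using that by (simp_all add: T_def)
    fix g assume "g \<in> G c" then show "\<theta> g = \<theta>' g" using that(3) G_iff by blast
  qed
  have TI: "restrict f (G c) \<in> T c"
    if f: "\<And>d g. d \<in> X0 \<Longrightarrow> g \<in> Hom A c d \<Longrightarrow> f g \<in> FOb F d"
      and n: "\<And>d e g h. g \<in> Hom A c d \<Longrightarrow> h \<in> Hom W d e \<Longrightarrow> f (Cmp A h g) = psh_act F h (f g)" for f c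
    unfolding T_def
  proof (intro CollectI conjI allI ballI)
    show "restrict f (G c) \<in> Pi\<^sub>E (G c) (\<lambda>g. FOb F (Cod A g))"
    proof (rule restrict_PiE_iff[THEN iffD2], rule ballI)
      fix g assume "g \<in> G c"
      then obtain d where "d \<in> X0" "g \<in> Hom A c d" using G_iff by blast
      then show "f g \<in> FOb F (Cod A g)" using f by (simp add: Hom_Cod)
    qed
    fix d e g h assume g: "g \<in> Hom A c d" and h: "h \<in> Hom W d e"
    then have "h \<in> Hom A d e" "d \<in> X0" "e \<in> X0" by (auto simp: W_Hom)
    then have "g \<in> G c" "Cmp A h g \<in> G c" using G_iff g cmp_in[OF g] by blast+
    then show "restrict f (G c) (Cmp A h g) = psh_act F h (restrict f (G c) g)" using n[OF g h] by simp
  qed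
  have ac_app: "ac k \<theta> g = \<theta> (Cmp A g k)" if "k \<in> Hom A b c" "g \<in> Hom A c d" "d \<in> X0" for k \<theta> g b c d
    using that G_iff Hom_Cod[OF that(1)] by (auto simp: ac_def)
  have acT: "ac k \<theta> \<in> T c" if k: "k \<in> Hom A b c" and \<theta>: "\<theta> \<in> T b" for k \<theta> b c
    unfolding ac_def Hom_Cod[OF k]
  proof (rule TI)
    fix d g assume "d \<in> X0" "g \<in> Hom A c d"
    then show "\<theta> (Cmp A g k) \<in> FOb F d" using T_in[OF \<theta> cmp_in[OF k]] by blast
  next
    fix d e g h assume g: "g \<in> Hom A c d" and h: "h \<in> Hom W d e"
    then have h': "h \<in> Hom A d e" by (simp add: W_Hom)
    show "\<theta> (Cmp A (Cmp A h g) k) = psh_act F h (\<theta> (Cmp A g k))"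
      using T_nat[OF \<theta> cmp_in[OF k g] h] cmp_assoc[OF k g h'] by simp
  qed
  obtain R i r where R: "R \<in> Ob E"
    and i: "\<And>c \<theta>. c \<in> Ob A \<Longrightarrow> \<theta> \<in> T c \<Longrightarrow> i c \<theta> \<in> FOb R c"
    and r: "\<And>c y. c \<in> Ob A \<Longrightarrow> y \<in> FOb R c \<Longrightarrow> r c y \<in> T c"
    and ri: "\<And>c \<theta>. c \<in> Ob A \<Longrightarrow> \<theta> \<in> T c \<Longrightarrow> r c (i c \<theta>) = \<theta>"
    and ir: "\<And>c y. c \<in> Ob A \<Longrightarrow> y \<in> FOb R c \<Longrightarrow> i c (r c y) = y"
    and ai: "\<And>c d f \<theta>. f \<in> Hom A c d \<Longrightarrow> \<theta> \<in> T c \<Longrightarrow> psh_act R f (i c \<theta>) = i d (ac f \<theta>)"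
    and ra: "\<And>c d f y. f \<in> Hom A c d \<Longrightarrow> y \<in> FOb R c \<Longrightarrow> r d (psh_act R f y) = ac f (r c y)"
  proof (rule E.objE[of T ac])
    fix c
    have "small_in U (Pi\<^sub>E (G c) (\<lambda>g. FOb F (Cod A g)))"
    proof (intro small_PiE)
      show "small_in U (G c)" by (rule small_subset[OF Ar_small]) (auto simp: G_def)
      fix g assume "g \<in> G c"
      then show "small_in U (FOb F (Cod A g))" using W.E.el_small[OF F, of "Cod A g"] cod_in[of g] by (simp add: G_def)
    qed
    then show "small_in U (T c)" by (rule small_subset) (auto simp: T_def)
  next
    fix k c d \<theta> assume "k \<in> Hom A c d" "\<theta> \<in> T c" then show "ac k \<theta> \<in> T d" by (rule acT)
  next
    fix c \<theta> assume c: "c \<in> Ob A" and \<theta>: "\<theta> \<in> T c"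
    show "ac (Idt A c) \<theta> = \<theta>"
      by (rule T_ext[OF acT[OF idt_in[OF c] \<theta>] \<theta>]) (use ac_app[OF idt_in[OF c]] cmp_id_right in simp)
  next
    fix f g c d e \<theta> assume f: "f \<in> Hom A c d" and g: "g \<in> Hom A d e" and \<theta>: "\<theta> \<in> T c"
    show "ac (Cmp A g f) \<theta> = ac g (ac f \<theta>)"
    proof (rule T_ext[OF acT[OF cmp_in[OF f g] \<theta>] acT[OF g acT[OF f \<theta>]]])
      fix b h assume b: "b \<in> X0" and h: "h \<in> Hom A e b"
      show "ac (Cmp A g f) \<theta> h = ac g (ac f \<theta>) h"
        using ac_app[OF cmp_in[OF f g] h b] ac_app[OF g h b] ac_app[OF f cmp_in[OF g h] b] cmp_assoc[OF f g h] by simp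
    qed
  qed blast
  have RsR: "FOb Rs R \<in> Ob W.E" by (rule Rs_Ob[OF R])
  have idA: "Idt A d \<in> Hom A d d" if "d \<in> Ob W" for d using idt_in that by simp
  obtain e where e: "e \<in> Hom W.E (FOb Rs R) F"
    and e_app: "\<And>d y. d \<in> Ob W \<Longrightarrow> y \<in> FOb (FOb Rs R) d \<Longrightarrow> psh_app e d y = r d y (Idt A d)"
  proof (rule W.E.arrE[OF RsR F, of "\<lambda>d y. r d y (Idt A d)"])
    fix d y assume d: "d \<in> Ob W" and y: "y \<in> FOb (FOb Rs R) d"
    then show "r d y (Idt A d) \<in> FOb F d" using T_in[OF r idA[OF d]] by simp
  next
    fix h d b y assume h: "h \<in> Hom W d b" and y: "y \<in> FOb (FOb Rs R) d"
    have d: "d \<in> Ob W" "b \<in> Ob W" using W.Hom_Ob[OF h] by auto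
    have h': "h \<in> Hom A d b" using h by (simp add: W_Hom)
    have y': "y \<in> FOb R d" using y d by simp
    have b: "b \<in> X0" using d by simp
    have "r b (psh_act R h y) (Idt A b) = r d y h"
      using ra[OF h' y'] ac_app[OF h' idA[OF d(2)] b] cmp_id_left[OF h'] by simp
    also have "\<dots> = psh_act F h (r d y (Idt A d))"
      using T_nat[OF r[OF _ y'] idA[OF d(1)] h] d cmp_id_right[OF h'] by simp
    finally show "r b (psh_act (FOb Rs R) h y) (Idt A b) = psh_act F h (r d y (Idt A d))" by (simp add: Rs_act[OF h])
  qed blast
  have "iso_arrow W.E e"
    unfolding W.E.iso_arrow_iff[OF e]
  proof
    fix d assume d: "d \<in> Ob W"
    then have d': "d \<in> Ob A" "d \<in> X0" by auto
    \<comment> \<open>The compatible family generated by a single element; generating it is inverse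
      to evaluation at the identity.\<close>
    have xT: "(\<lambda>g \<in> G d. psh_act F g x) \<in> T d" if x: "x \<in> FOb F d" for x
    proof (rule TI)
      fix b g assume "b \<in> X0" "g \<in> Hom A d b"
      then show "psh_act F g x \<in> FOb F b" using W.E.act_in[OF F _ x] d' by (simp add: W_Hom)
    next
      fix b c g h assume g: "g \<in> Hom A d b" and h: "h \<in> Hom W b c"
      have "g \<in> Hom W d b" using g h d' by (simp add: W_Hom)
      then show "psh_act F (Cmp A h g) x = psh_act F h (psh_act F g x)" using W.E.act_cmp[OF F _ h x] by simp
    qed
    have idG: "Idt A d \<in> G d" using G_iff idA[OF d] d' by blast
    show "bij_betw (psh_app e d) (FOb (FOb Rs R) d) (FOb F d)"
    proof (rule bij_betw_byWitness[where f' = "\<lambda>x. i d (\<lambda>g \<in> G d. psh_act F g x)"])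
      show "\<forall>y \<in> FOb (FOb Rs R) d. i d (\<lambda>g \<in> G d. psh_act F g (psh_app e d y)) = y"
      proof
        fix y assume y: "y \<in> FOb (FOb Rs R) d"
        then have y': "y \<in> FOb R d" using d' by simp
        have "(\<lambda>g \<in> G d. psh_act F g (psh_app e d y)) = r d y"
        proof (rule T_ext[OF xT[OF W.E.app_in[OF e d y]] r[OF d'(1) y']])
          fix b g assume b: "b \<in> X0" and g: "g \<in> Hom A d b"
          have "g \<in> G d" using G_iff b g by blast
          moreover have "g \<in> Hom W d b" using g b d' by (simp add: W_Hom)
          ultimately show "(\<lambda>g \<in> G d. psh_act F g (psh_app e d y)) g = r d y g"
            using e_app[OF d y] T_nat[OF r[OF d'(1) y'] idA[OF d], of g b] cmp_id_right[OF g] by simp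
        qed
        then show "i d (\<lambda>g \<in> G d. psh_act F g (psh_app e d y)) = y" using ir[OF d'(1) y'] by simp
      qed
      show "\<forall>x \<in> FOb F d. psh_app e d (i d (\<lambda>g \<in> G d. psh_act F g x)) = x"
        using e_app[OF d] i[OF d'(1) xT] ri[OF d'(1) xT] idG W.E.act_idt[OF F d] d' by simp
    qed (use i[OF d'(1) xT] W.E.app_in[OF e d] d' in auto)
  qed
  moreover have "couniversal E W.E Rs F R e"
    unfolding couniversal_def
  proof (intro conjI ballI R e)
    fix Z t assume Z: "Z \<in> Ob E" and t: "t \<in> Hom W.E (FOb Rs Z) F"
    define m where "m = (\<lambda>c x. \<lambda>g \<in> G c. psh_app t (Cod A g) (psh_act Z g x))"
    have m_app: "m c x g = psh_app t d (psh_act Z g x)" if "g \<in> Hom A c d" "d \<in> X0" for c x g d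
      using that G_iff Hom_Cod[OF that(1)] by (auto simp: m_def)
    have mT: "m c x \<in> T c" if x: "x \<in> FOb Z c" for c x
      unfolding m_def
    proof (rule TI)
      fix d g assume d: "d \<in> X0" and g: "g \<in> Hom A c d"
      then show "psh_app t (Cod A g) (psh_act Z g x) \<in> FOb F d"
        using W.E.app_in[OF t, of d] E.act_in[OF Z g x] Hom_Ob[OF g] by (simp add: Hom_Cod[OF g])
    next
      fix d b g h assume g: "g \<in> Hom A c d" and h: "h \<in> Hom W d b"
      then have h': "h \<in> Hom A d b" "d \<in> X0" by (auto simp: W_Hom)
      have "psh_act Z g x \<in> FOb (FOb Rs Z) d" using E.act_in[OF Z g x] Hom_Ob[OF g] h' by simp
      then show "psh_app t (Cod A (Cmp A h g)) (psh_act Z (Cmp A h g) x) = psh_act F h (psh_app t (Cod A g) (psh_act Z g x))"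
        using W.E.app_nat[OF t h] E.act_cmp[OF Z g h'(1) x] by (simp add: Hom_Cod[OF g] Hom_Cod[OF cmp_in[OF g h'(1)]] Rs_act[OF h])
    qed
    obtain h where h: "h \<in> Hom E Z R" and h_app: "\<And>c x. c \<in> Ob A \<Longrightarrow> x \<in> FOb Z c \<Longrightarrow> psh_app h c x = i c (m c x)"
    proof (rule E.arrE[OF Z R, of "\<lambda>c x. i c (m c x)"])
      fix c x assume "c \<in> Ob A" "x \<in> FOb Z c" then show "i c (m c x) \<in> FOb R c" using i mT by simp
    next
      fix f c d x assume f: "f \<in> Hom A c d" and x: "x \<in> FOb Z c"
      have "m d (psh_act Z f x) = ac f (m c x)"
      proof (rule T_ext[OF mT[OF E.act_in[OF Z f x]] acT[OF f mT[OF x]]])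
        fix b g assume b: "b \<in> X0" and g: "g \<in> Hom A d b"
        show "m d (psh_act Z f x) g = ac f (m c x) g"
          using m_app[OF g b] ac_app[OF f g b] m_app[OF cmp_in[OF f g] b] E.act_cmp[OF Z f g x] by simp
      qed
      then show "i d (m d (psh_act Z f x)) = psh_act R f (i c (m c x))" using ai[OF f mT[OF x]] by simp
    qed blast
    have e_R: "psh_app (Cmp W.E e (FAr Rs k)) d x = r d (psh_app k d x) (Idt A d)"
      if k: "k \<in> Hom E Z R" and d: "d \<in> Ob W" and x: "x \<in> FOb Z d" for k d x
      using W.E.app_cmp[OF Rs_Hom[OF k] e d, of x] e_app[OF d] E.app_in[OF k _ x] d x by (simp add: Rs_app)
    show "\<exists>!h. h \<in> Hom E Z R \<and> Cmp W.E e (FAr Rs h) = t"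
    proof (rule ex1I[of _ h], intro conjI h)
      show "Cmp W.E e (FAr Rs h) = t"
      proof (rule W.E.arr_ext[OF W.E.E.cmp_in[OF Rs_Hom[OF h] e] t])
        fix d x assume d: "d \<in> Ob W" and "x \<in> FOb (FOb Rs Z) d"
        then have x: "x \<in> FOb Z d" by simp
        show "psh_app (Cmp W.E e (FAr Rs h)) d x = psh_app t d x"
          using e_R[OF h d x] h_app[OF _ x] ri[OF _ mT[OF x]] m_app[OF idA[OF d]] E.act_idt[OF Z _ x] d by simp
      qed
      fix k assume k': "k \<in> Hom E Z R \<and> Cmp W.E e (FAr Rs k) = t"
      then have k: "k \<in> Hom E Z R" by simp
      show "k = h"
      proof (rule E.arr_ext[OF k h])
        fix c x assume c: "c \<in> Ob A" and x: "x \<in> FOb Z c"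
        note kx = E.app_in[OF k c x]
        have "r c (psh_app k c x) = m c x"
        proof (rule T_ext[OF r[OF c kx] mT[OF x]])
          fix d g assume d: "d \<in> X0" and g: "g \<in> Hom A c d"
          have d': "d \<in> Ob W" using d Hom_Ob[OF g] by simp
          note gx = E.act_in[OF Z g x]
          have "m c x g = r d (psh_app k d (psh_act Z g x)) (Idt A d)"
            using m_app[OF g d] e_R[OF k d' gx] k' by simp
          also have "\<dots> = r c (psh_app k c x) g"
            using E.app_nat[OF k g x] ra[OF g kx] ac_app[OF g idA[OF d'] d] cmp_id_left[OF g] by simp
          finally show "r c (psh_app k c x) g = m c x g" by simp
        qed
        then show "psh_app k c x = psh_app h c x" using ir[OF c kx] h_app[OF c x] by simp
      qed
    qed
  qed
  ultimately show thesis using that by blast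
qed

lemma weil_exists: "\<exists>w. subtopos E W.E w \<and> inv_im w = Rs"
proof -
  have ex: "\<forall>F \<in> Ob W.E. \<exists>Te. couniversal E W.E Rs F (fst Te) (snd Te) \<and> iso_arrow W.E (snd Te)"
  proof
    fix F :: "('c, 'f, 'u) psh" assume "F \<in> Ob W.E"
    then obtain T e where "couniversal E W.E Rs F T e" "iso_arrow W.E e" by (rule right_Kan)
    then show "\<exists>Te. couniversal E W.E Rs F (fst Te) (snd Te) \<and> iso_arrow W.E (snd Te)"
      by (intro exI[of _ "(T, e)"]) simp
  qed
  from bchoice[OF ex] obtain Te
    where Te: "\<forall>F \<in> Ob W.E. couniversal E W.E Rs F (fst (Te F)) (snd (Te F)) \<and> iso_arrow W.E (snd (Te F))" ..
  define \<epsilon> where "\<epsilon> = (\<lambda>F. snd (Te F))"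
  have "couniversal E W.E Rs F (fst (Te F)) (\<epsilon> F)" if "F \<in> Ob W.E" for F using Te that by (simp add: \<epsilon>_def)
  from adjunction_of_couniversal[OF Rs_functor this] obtain V \<eta> where V: "adjunction E W.E Rs V \<eta> \<epsilon>" by blast
  interpret v: adj E W.E Rs V \<eta> \<epsilon> using V by (rule adj.intro)
  have "fully_faithful W.E E V" by (rule v.ff_of_counit_iso) (use Te in \<open>simp add: \<epsilon>_def\<close>)
  then show ?thesis
    using V E.topos W.E.topos Rs_preserves
    by (intro exI[of _ "\<lparr>inv_im = Rs, dir_im = V, gunit = \<eta>, gcounit = \<epsilon>\<rparr>"])
      (simp add: subtopos_def geometric_morphism_def)
qed

text \<open>The pointwise left Kan extension, a quotient of formal pairs. It is phrased as a
  couniversal arrow between opposite categories so that \<open>adjunction_of_couniversal\<close>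
  produces the left adjoint by duality.\<close>

lemma left_Kan:
  assumes F: "F \<in> Ob W.E"
  obtains L e where "couniversal (op_cat E) (op_cat W.E) Rs F L e"
proof -
  \<comment> \<open>A pair \<open>(f, x)\<close> stands for \<open>x\<close> moved along
    \<open>f\<close>; the relation \<open>N\<close> identifies the two ways of moving an element
    along a composite.\<close>
  define P where "P = (\<lambda>c. {(f, x). \<exists>d \<in> X0. f \<in> Hom A d c \<and> x \<in> FOb F d})"
  define N where "N = (\<lambda>c. {((Cmp A f h, x), (f, psh_act F h x)) | f h x d b. h \<in> Hom W d b \<and> f \<in> Hom A b c \<and> x \<in> FOb F d})"
  \<comment> \<open>Symmetrizing first makes the reflexive transitive closure an equivalence
    relation.\<close>
  define R where "R = (\<lambda>c. (N c \<union> (N c)\<inverse>)\<^sup>*)"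
  define cl where "cl = (\<lambda>c p. R c `` {p})"
  define L where "L = (\<lambda>c. cl c ` P c)"
  have symR: "sym (R c)" for c unfolding R_def by (intro sym_rtrancl) (auto simp: sym_def)
  have cl_eq: "cl c p = cl c q \<longleftrightarrow> (p, q) \<in> R c" for c p q
  proof
    assume "cl c p = cl c q" then show "(p, q) \<in> R c" by (auto simp: cl_def R_def)
  next
    assume pq: "(p, q) \<in> R c"
    then have qp: "(q, p) \<in> R c" using symR by (meson symD)
    show "cl c p = cl c q"
      using pq qp by (auto simp: cl_def R_def intro: rtrancl_trans)
  qed
  have NI: "((Cmp A f h, x), (f, psh_act F h x)) \<in> N c" if "h \<in> Hom W d b" "f \<in> Hom A b c" "x \<in> FOb F d" for f h x d b c
    using that by (auto simp: N_def)
  have NE: thesis if "(p, q) \<in> N c"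
    "\<And>f h x d b. p = (Cmp A f h, x) \<Longrightarrow> q = (f, psh_act F h x) \<Longrightarrow> h \<in> Hom W d b \<Longrightarrow> f \<in> Hom A b c \<Longrightarrow> x \<in> FOb F d \<Longrightarrow> thesis"
    for p q c thesis using that by (auto simp: N_def)
  define mv where "mv = (\<lambda>k p. (Cmp A k (fst p) :: 'f, snd p :: 'u))"
  have mvP: "mv k p \<in> P d" if "k \<in> Hom A c d" "p \<in> P c" for k p c d
    using that(2) cmp_in[OF _ that(1)] unfolding P_def mv_def by (cases p) (simp, blast)
  have mvR: "(mv k p, mv k q) \<in> R d" if k: "k \<in> Hom A c d" and pq: "(p, q) \<in> R c" for k p q c d
    using pq unfolding R_def
  proof (induction rule: rtrancl_induct)
    case (step q q')
    have mvN: "(mv k p, mv k q) \<in> N d" if "(p, q) \<in> N c" for p q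
      using that
    proof (rule NE)
      fix f h x d' b assume *: "p = (Cmp A f h, x)" "q = (f, psh_act F h x)" and h: "h \<in> Hom W d' b" and f: "f \<in> Hom A b c" and x: "x \<in> FOb F d'"
      have "h \<in> Hom A d' b" using h by (simp add: W_Hom)
      then show "(mv k p, mv k q) \<in> N d"
        using NI[OF h cmp_in[OF f k] x] cmp_assoc[OF _ f k] by (simp add: mv_def *)
    qed
    have "(mv k q, mv k q') \<in> N d \<union> (N d)\<inverse>" using step(2) mvN[of q q'] mvN[of q' q] by blast
    with step.IH show ?case by (rule rtrancl_into_rtrancl)
  qed simp
  \<comment> \<open>The members of a class are all sent into one class, so the union over them is
    that class and the action involves no choice.\<close>
  define ac where "ac = (\<lambda>k C. \<Union>p\<in>C. cl (Cod A k) (mv k p))"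
  have ac_cl: "ac k (cl c p) = cl d (mv k p)" if k: "k \<in> Hom A c d" for k c d p
  proof -
    have "cl d (mv k q) = cl d (mv k p)" if "q \<in> cl c p" for q
    proof -
      have "(p, q) \<in> R c" using that by (simp add: cl_def)
      then show ?thesis unfolding cl_eq using mvR[OF k] symR[of d] by (meson symD)
    qed
    moreover have "p \<in> cl c p" by (simp add: cl_def R_def)
    ultimately show ?thesis unfolding ac_def Hom_Cod[OF k] by blast
  qed
  obtain Q i r where Q: "Q \<in> Ob E"
    and i: "\<And>c y. c \<in> Ob A \<Longrightarrow> y \<in> L c \<Longrightarrow> i c y \<in> FOb Q c"
    and r: "\<And>c y. c \<in> Ob A \<Longrightarrow> y \<in> FOb Q c \<Longrightarrow> r c y \<in> L c"
    and ri: "\<And>c y. c \<in> Ob A \<Longrightarrow> y \<in> L c \<Longrightarrow> r c (i c y) = y"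
    and ir: "\<And>c y. c \<in> Ob A \<Longrightarrow> y \<in> FOb Q c \<Longrightarrow> i c (r c y) = y"
    and ai: "\<And>c d f y. f \<in> Hom A c d \<Longrightarrow> y \<in> L c \<Longrightarrow> psh_act Q f (i c y) = i d (ac f y)"
    and ra: "\<And>c d f y. f \<in> Hom A c d \<Longrightarrow> y \<in> FOb Q c \<Longrightarrow> r d (psh_act Q f y) = ac f (r c y)"
  proof (rule E.objE[of L ac])
    fix c assume "c \<in> Ob A"
    have sub: "P c \<subseteq> Ar A \<times> (\<Union>d \<in> Ob W. FOb F d)" using Hom_Ar Hom_Ob by (fastforce simp: P_def)
    have "small_in U (Ob W)"
    proof (rule small_subset[OF small_image[OF Ar_small, of "Dom A"]])
      show "Ob W \<subseteq> Dom A ` Ar A"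
      proof
        fix d assume "d \<in> Ob W"
        then have "Idt A d \<in> Hom A d d" using idt_in by simp
        then show "d \<in> Dom A ` Ar A" using Hom_Ar Hom_Dom by (metis imageI)
      qed
    qed
    then have "small_in U (Ar A \<times> (\<Union>d \<in> Ob W. FOb F d))"
      by (intro small_Times Ar_small small_UN W.E.el_small F)
    then have "small_in U (P c)" by (rule small_subset[OF _ sub])
    then show "small_in U (L c)" unfolding L_def by (rule small_image)
  next
    fix k c d y assume k: "k \<in> Hom A c d" and "y \<in> L c"
    then obtain p where "p \<in> P c" "y = cl c p" by (auto simp: L_def)
    then show "ac k y \<in> L d" using ac_cl[OF k] mvP[OF k] by (simp add: L_def)
  next
    fix c y assume c: "c \<in> Ob A" and "y \<in> L c"
    then obtain p where p: "p \<in> P c" "y = cl c p" by (auto simp: L_def)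
    then have "mv (Idt A c) p = p" using cmp_id_left by (cases p) (auto simp: mv_def P_def)
    then show "ac (Idt A c) y = y" using ac_cl[OF idt_in[OF c]] p by simp
  next
    fix f g c d e y assume f: "f \<in> Hom A c d" and g: "g \<in> Hom A d e" and "y \<in> L c"
    then obtain p where p: "p \<in> P c" "y = cl c p" by (auto simp: L_def)
    then have "mv (Cmp A g f) p = mv g (mv f p)" using cmp_assoc[OF _ f g] by (auto simp: mv_def P_def)
    then show "ac (Cmp A g f) y = ac g (ac f y)" using ac_cl[OF cmp_in[OF f g]] ac_cl[OF f] ac_cl[OF g] p by simp
  qed blast
  have RsQ: "FOb Rs Q \<in> Ob W.E" by (rule Rs_Ob[OF Q])
  have idP: "(Idt A d, x) \<in> P d" if "d \<in> Ob W" "x \<in> FOb F d" for d x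
    using that idt_in by (auto simp: P_def)
  have PL: "cl c p \<in> L c" if "p \<in> P c" for c p using that by (simp add: L_def)
  obtain e where e: "e \<in> Hom W.E F (FOb Rs Q)"
    and e_app: "\<And>d x. d \<in> Ob W \<Longrightarrow> x \<in> FOb F d \<Longrightarrow> psh_app e d x = i d (cl d (Idt A d, x))"
  proof (rule W.E.arrE[OF F RsQ, of "\<lambda>d x. i d (cl d (Idt A d, x))"])
    fix d x assume "d \<in> Ob W" "x \<in> FOb F d"
    then show "i d (cl d (Idt A d, x)) \<in> FOb (FOb Rs Q) d" using i PL[OF idP] by simp
  next
    fix h d b x assume h: "h \<in> Hom W d b" and x: "x \<in> FOb F d"
    have db: "d \<in> Ob W" "b \<in> Ob W" using W.Hom_Ob[OF h] by auto
    have h': "h \<in> Hom A d b" using h by (simp add: W_Hom)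
    have "((h, x), (Idt A b, psh_act F h x)) \<in> N b" using NI[OF h idt_in x] db cmp_id_left[OF h'] by simp
    then have "cl b (Idt A b, psh_act F h x) = cl b (h, x)" unfolding cl_eq R_def by blast
    moreover have "ac h (cl d (Idt A d, x)) = cl b (h, x)" using ac_cl[OF h'] cmp_id_right[OF h'] by (simp add: mv_def)
    ultimately show "i b (cl b (Idt A b, psh_act F h x)) = psh_act (FOb Rs Q) h (i d (cl d (Idt A d, x)))"
      using ai[OF h' PL[OF idP[OF db(1) x]]] by (simp add: Rs_act[OF h])
  qed blast
  have Q_gen: "i c (cl c (f, x)) = psh_act Q f (psh_app e d x)" if "f \<in> Hom A d c" "d \<in> X0" "x \<in> FOb F d" for c d f x
  proof -
    have d: "d \<in> Ob W" using that Hom_Ob by simp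
    show ?thesis
      using e_app[OF d that(3)] ai[OF that(1) PL[OF idP[OF d that(3)]]] ac_cl[OF that(1)] cmp_id_right[OF that(1)] by (simp add: mv_def)
  qed
  have Q_el: thesis if c: "c \<in> Ob A" and y: "y \<in> FOb Q c"
    and *: "\<And>d f x. d \<in> X0 \<Longrightarrow> f \<in> Hom A d c \<Longrightarrow> x \<in> FOb F d \<Longrightarrow> y = i c (cl c (f, x)) \<Longrightarrow> thesis" for c y thesis
  proof -
    obtain f x where fx: "(f, x) \<in> P c" "r c y = cl c (f, x)" using r[OF c y] by (auto simp: L_def)
    then obtain d where "d \<in> X0" "f \<in> Hom A d c" "x \<in> FOb F d" by (auto simp: P_def)
    then show thesis using * ir[OF c y] fx(2) by metis
  qed
  have "\<exists>!h. h \<in> Hom E Q Z \<and> Cmp W.E (FAr Rs h) e = t" if Z: "Z \<in> Ob E" and t: "t \<in> Hom W.E F (FOb Rs Z)" for Z t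
  proof -
    define v where "v = (\<lambda>p. psh_act Z (fst p) (psh_app t (Dom A (fst p)) (snd p)))"
    have v: "v (f, x) = psh_act Z f (psh_app t d x)" if "f \<in> Hom A d c" for f x c d
      using that by (simp add: v_def Hom_Dom)
    have vN: "v p = v q" if "(p, q) \<in> N c" for p q c
      using that
    proof (rule NE)
      fix f h x d b assume *: "p = (Cmp A f h, x)" "q = (f, psh_act F h x)" and h: "h \<in> Hom W d b" and f: "f \<in> Hom A b c" and x: "x \<in> FOb F d"
      have h': "h \<in> Hom A d b" "d \<in> X0" using h by (auto simp: W_Hom)
      have d: "d \<in> Ob W" using W.Hom_Ob[OF h] by simp
      have tx: "psh_app t d x \<in> FOb Z d" using W.E.app_in[OF t d x] d by simp
      show "v p = v q"
        using v[OF cmp_in[OF h'(1) f]] v[OF f] E.act_cmp[OF Z h'(1) f tx] W.E.app_nat[OF t h x] by (simp add: * Rs_act[OF h])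
    qed
    have vR: "v p = v q" if "(p, q) \<in> R c" for p q c
      using that unfolding R_def by (induction rule: rtrancl_induct) (use vN in auto)
    \<comment> \<open>A representative is chosen here; by \<open>vR\<close> the value does not
      depend on it.\<close>
    define m where "m = (\<lambda>c y. v (SOME p. p \<in> P c \<and> cl c p = r c y))"
    have m: "m c (i c (cl c p)) = v p" if c: "c \<in> Ob A" and p: "p \<in> P c" for c p
    proof -
      have "\<exists>q. q \<in> P c \<and> cl c q = r c (i c (cl c p))" using ri[OF c PL[OF p]] p by (intro exI[of _ p]) simp
      then have "cl c (SOME q. q \<in> P c \<and> cl c q = r c (i c (cl c p))) = cl c p"
        using someI_ex[of "\<lambda>q. q \<in> P c \<and> cl c q = r c (i c (cl c p))"] ri[OF c PL[OF p]] by simp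
      then show ?thesis unfolding m_def cl_eq by (rule vR)
    qed
    have mf: "m c (i c (cl c (f, x))) = psh_act Z f (psh_app t d x)" if "f \<in> Hom A d c" "d \<in> X0" "x \<in> FOb F d" for c d f x
      using m[of c "(f, x)"] v[OF that(1)] Hom_Ob[OF that(1)] that by (auto simp: P_def)
    have tZ: "psh_app t d x \<in> FOb Z d" if "d \<in> X0" "f \<in> Hom A d c" "x \<in> FOb F d" for d f c x
      using W.E.app_in[OF t, of d x] Hom_Ob[OF that(2)] that by simp
    obtain h where h: "h \<in> Hom E Q Z" and h_app: "\<And>c y. c \<in> Ob A \<Longrightarrow> y \<in> FOb Q c \<Longrightarrow> psh_app h c y = m c y"
    proof (rule E.arrE[OF Q Z, of m])
      fix c y assume c: "c \<in> Ob A" and y: "y \<in> FOb Q c"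
      show "m c y \<in> FOb Z c"
        by (rule Q_el[OF c y]) (use mf E.act_in[OF Z _ tZ] in simp)
    next
      fix k c c' y assume k: "k \<in> Hom A c c'" and y: "y \<in> FOb Q c"
      show "m c' (psh_act Q k y) = psh_act Z k (m c y)"
      proof (rule Q_el[OF Hom_Ob(1)[OF k] y])
        fix d f x assume d: "d \<in> X0" and f: "f \<in> Hom A d c" and x: "x \<in> FOb F d" and y: "y = i c (cl c (f, x))"
        have fx: "(f, x) \<in> P c" using d f x by (auto simp: P_def)
        have "psh_act Q k y = i c' (cl c' (Cmp A k f, x))" using y ai[OF k PL[OF fx]] ac_cl[OF k] by (simp add: mv_def)
        then show "m c' (psh_act Q k y) = psh_act Z k (m c y)"
          using mf[OF cmp_in[OF f k] d x] mf[OF f d x] y E.act_cmp[OF Z f k tZ[OF d f x]] by simp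
      qed
    qed blast
    have comp: "psh_app (Cmp W.E (FAr Rs k) e) d x = psh_app k d (psh_app e d x)"
      if "k \<in> Hom E Q Z" "d \<in> Ob W" "x \<in> FOb F d" for k d x
      using W.E.app_cmp[OF e Rs_Hom[OF that(1)] that(2,3)] that(2) by (simp add: Rs_app)
    show ?thesis
    proof (rule ex1I[of _ h], intro conjI h)
      show "Cmp W.E (FAr Rs h) e = t"
      proof (rule W.E.arr_ext[OF W.E.E.cmp_in[OF e Rs_Hom[OF h]] t])
        fix d x assume d: "d \<in> Ob W" and x: "x \<in> FOb F d"
        have d': "d \<in> Ob A" "d \<in> X0" using d by auto
        show "psh_app (Cmp W.E (FAr Rs h) e) d x = psh_app t d x"
          using comp[OF h d x] e_app[OF d x] h_app[OF d'(1) i[OF d'(1) PL[OF idP[OF d x]]]] mf[OF idt_in[OF d'(1)] d'(2) x]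
            E.act_idt[OF Z d'(1)] tZ[OF d'(2) idt_in[OF d'(1)] x] by simp
      qed
      fix k assume k': "k \<in> Hom E Q Z \<and> Cmp W.E (FAr Rs k) e = t"
      then have k: "k \<in> Hom E Q Z" by simp
      show "k = h"
      proof (rule E.arr_ext[OF k h])
        fix c y assume c: "c \<in> Ob A" and y: "y \<in> FOb Q c"
        show "psh_app k c y = psh_app h c y"
        proof (rule Q_el[OF c y])
          fix d f x assume d: "d \<in> X0" and f: "f \<in> Hom A d c" and x: "x \<in> FOb F d" and y': "y = i c (cl c (f, x))"
          have dW: "d \<in> Ob W" using d Hom_Ob[OF f] by simp
          have ex: "psh_app e d x \<in> FOb Q d" using W.E.app_in[OF e dW x] dW by simp
          have "psh_app k c y = psh_act Z f (psh_app k d (psh_app e d x))"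
            using y' Q_gen[OF f d x] E.app_nat[OF k f ex] by simp
          also have "\<dots> = psh_act Z f (psh_app t d x)" using comp[OF k dW x] k' by simp
          finally show "psh_app k c y = psh_app h c y" using h_app[OF c y] mf[OF f d x] y' by simp
        qed
      qed
    qed
  qed
  then have "couniversal (op_cat E) (op_cat W.E) Rs F Q e"
    using Q e by (simp add: couniversal_def)
  then show thesis by (rule that)
qed

lemma Rs_left_adjoint: "\<exists>L \<eta> \<epsilon>. adjunction W.E E L Rs \<eta> \<epsilon>"
proof -
  have ex: "\<forall>F \<in> Ob (op_cat W.E). \<exists>Te. couniversal (op_cat E) (op_cat W.E) Rs F (fst Te) (snd Te)"
  proof
    fix F :: "('c, 'f, 'u) psh" assume "F \<in> Ob (op_cat W.E)"
    then have "F \<in> Ob W.E" by simp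
    then obtain T e where "couniversal (op_cat E) (op_cat W.E) Rs F T e" by (rule left_Kan)
    then show "\<exists>Te. couniversal (op_cat E) (op_cat W.E) Rs F (fst Te) (snd Te)"
      by (intro exI[of _ "(T, e)"]) simp
  qed
  from bchoice[OF ex] obtain Te
    where Te: "\<forall>F \<in> Ob (op_cat W.E). couniversal (op_cat E) (op_cat W.E) Rs F (fst (Te F)) (snd (Te F))" ..
  have "couniversal (op_cat E) (op_cat W.E) Rs F (fst (Te F)) (snd (Te F))" if "F \<in> Ob (op_cat W.E)" for F
    using Te that by simp
  from adjunction_of_couniversal[OF functor_op[OF Rs_functor] this] obtain V \<eta>
    where V: "adjunction (op_cat E) (op_cat W.E) Rs V \<eta> (\<lambda>F. snd (Te F))" by blast
  show ?thesis using adjunction_op[OF V] by auto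
qed

end

section \<open>Weil sites\<close>

lemma nat_trans_inverse:
  assumes t: "nat_trans C D F G t" and iso: "\<And>A. A \<in> Ob C \<Longrightarrow> iso_arrow D (t A)"
  shows "nat_trans C D G F (\<lambda>A. inv_arrow D (t A))" "\<And>A. A \<in> Ob C \<Longrightarrow> iso_arrow D (inv_arrow D (t A))"
proof -
  have F: "is_functor C D F" and G: "is_functor C D G" using t by (auto simp: nat_trans_def)
  interpret C: category C using functor_cats[OF F] by simp
  interpret D: category D using functor_cats[OF F] by simp
  have inv: "inv_arrow D (t A) \<in> Hom D (FOb G A) (FOb F A)" "Cmp D (inv_arrow D (t A)) (t A) = Idt D (FOb F A)"
    "Cmp D (t A) (inv_arrow D (t A)) = Idt D (FOb G A)" if "A \<in> Ob C" for A
    using D.inv_arrow[OF iso[OF that] nat_trans_Hom[OF t that]] by auto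
  show "nat_trans C D G F (\<lambda>A. inv_arrow D (t A))"
  proof (rule nat_transI[OF G F inv(1)])
    fix f A B assume f: "f \<in> Hom C A B"
    have AB: "A \<in> Ob C" "B \<in> Ob C" using C.Hom_Ob[OF f] by auto
    note Ff = functor_Hom[OF F f] and Gf = functor_Hom[OF G f] and tA = nat_trans_Hom[OF t AB(1)] and tB = nat_trans_Hom[OF t AB(2)]
    note iA = inv[OF AB(1)] and iB = inv[OF AB(2)]
    have "Cmp D (inv_arrow D (t B)) (FAr G f) = Cmp D (inv_arrow D (t B)) (Cmp D (FAr G f) (Cmp D (t A) (inv_arrow D (t A))))"
      using iA(3) D.cmp_id_right[OF Gf] by simp
    also have "\<dots> = Cmp D (inv_arrow D (t B)) (Cmp D (t B) (Cmp D (FAr F f) (inv_arrow D (t A))))"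
      using D.cmp_assoc[OF iA(1) tA Gf] nat_trans_nat[OF t f] D.cmp_assoc[OF iA(1) Ff tB] by simp
    also have "\<dots> = Cmp D (FAr F f) (inv_arrow D (t A))"
      using D.cmp_assoc[OF D.cmp_in[OF iA(1) Ff] tB iB(1)] iB(2) D.cmp_id_left[OF D.cmp_in[OF iA(1) Ff]] by simp
    finally show "Cmp D (inv_arrow D (t B)) (FAr G f) = Cmp D (FAr F f) (inv_arrow D (t A))" .
  qed
  show "iso_arrow D (inv_arrow D (t A))" if "A \<in> Ob C" for A
    by (rule D.iso_inv_arrow[OF iso[OF that] nat_trans_Hom[OF t that]])
qed

text \<open>With an inverse of \<open>g\<close> at hand, the identity of the domain of
  \<open>f\<close> lifts to the pullback, and the lift is inverse to \<open>p\<close>.\<close>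

lemma pullback_of_iso:
  assumes "category C" and pb: "is_pullback C f g p q" and iso: "iso_arrow C g"
  shows "iso_arrow C p"
proof -
  interpret category C by fact
  have f: "f \<in> Hom C (Dom C f) (Cod C f)" and g: "g \<in> Hom C (Dom C g) (Cod C f)"
    and p: "p \<in> Hom C (Dom C p) (Dom C f)" and q: "q \<in> Hom C (Dom C p) (Dom C g)" and comm: "Cmp C f p = Cmp C g q"
    using pb Ar_Hom[of f C] Ar_Hom[of g C] by (auto simp: is_pullback_def)
  obtain g' where g': "g' \<in> Hom C (Cod C f) (Dom C g)" "Cmp C g' g = Idt C (Dom C g)" "Cmp C g g' = Idt C (Cod C f)"
    using iso_arrowE[OF iso g] .
  have ex: "\<exists>!u. u \<in> Hom C X (Dom C p) \<and> Cmp C p u = h \<and> Cmp C q u = k"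
    if "h \<in> Hom C X (Dom C f)" "k \<in> Hom C X (Dom C g)" "Cmp C f h = Cmp C g k" for X h k
    using pb that unfolding is_pullback_def by blast
  note k = cmp_in[OF f g'(1)]
  have "Cmp C f (Idt C (Dom C f)) = Cmp C g (Cmp C g' f)"
    using cmp_assoc[OF f g'(1) g] g'(3) cmp_id_left[OF f] cmp_id_right[OF f] by simp
  then obtain s where s: "s \<in> Hom C (Dom C f) (Dom C p)" "Cmp C p s = Idt C (Dom C f)"
    using ex[OF idt_in[OF Hom_Ob(1)[OF f]] k] by blast
  have q_eq: "q' = Cmp C g' (Cmp C f h)" if "q' \<in> Hom C X (Dom C g)" "Cmp C f h = Cmp C g q'" for q' X h
    using cmp_assoc[OF that(1) g g'(1)] that g'(2) cmp_id_left[OF that(1)] by simp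
  have "Cmp C p (Cmp C s p) = p" using cmp_assoc[OF p s(1) p] s(2) cmp_id_left[OF p] by simp
  moreover have "Cmp C q (Cmp C s p) = q"
  proof -
    have sp: "Cmp C s p \<in> Hom C (Dom C p) (Dom C p)" by (rule cmp_in[OF p s(1)])
    have "Cmp C f p = Cmp C g (Cmp C q (Cmp C s p))"
      using cmp_assoc[OF sp q g] comm cmp_assoc[OF sp p f] \<open>Cmp C p (Cmp C s p) = p\<close> by simp
    then show ?thesis using q_eq[OF cmp_in[OF sp q], of p] q_eq[OF q comm] by simp
  qed
  ultimately have "Cmp C s p = Idt C (Dom C p)"
    using ex[OF p q comm] cmp_in[OF p s(1)] idt_in[OF Hom_Ob(1)[OF p]] cmp_id_right[OF p] cmp_id_right[OF q] by blast
  then show ?thesis using iso_arrowI[OF p s(1)] s(2) by simp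
qed

context initial_site
begin

text \<open>The sheafification lemma with evaluation at \<open>z\<close> in place of the direct
  image of \<open>p\<close>. The last clause says that a constant, seen as a function of points by
  \<open>\<tau>\<close>, has itself as its value.\<close>

lemma subquality_ev:
  assumes k: "subquality E S p G k" and K: "inv_im p = K" and N: "N \<in> Ob S"
  obtains T e \<tau> where "couniversal E S ev N T e" "\<tau> \<in> Hom E (FOb K N) T" "iso_arrow G (FAr (inv_im k) \<tau>)"
    "\<And>x. x \<in> N \<Longrightarrow> fn e (psh_app \<tau> z x) = x"
proof -
  interpret S: category S by (rule category_set_cat)
  have gp: "geometric_morphism E S p" using k by (simp add: subquality_def local_geom_def)
  interpret p: adj S E K "dir_im p" "gunit p" "gcounit p"
    using gp K by (intro adj.intro) (simp add: geometric_morphism_def)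
  obtain \<theta> where \<theta>: "nat_trans E S (dir_im p) ev \<theta>" "\<And>F. F \<in> Ob E \<Longrightarrow> iso_arrow S (\<theta> F)"
    "\<And>X. X \<in> Ob S \<Longrightarrow> Cmp S (\<theta> (FOb K X)) (gunit p X) = Idt S X"
    "\<And>X. X \<in> Ob S \<Longrightarrow> iso_arrow S (gunit p X)"
    using direct_image_ev[OF gp K] by metis
  obtain T e \<tau> where cu: "couniversal E S (dir_im p) N T e" and \<tau>: "\<tau> \<in> Hom E (FOb K N) T"
    and \<tau>_iso: "iso_arrow G (FAr (inv_im k) \<tau>)"
    and sec: "Cmp S (Cmp S e (FAr (dir_im p) \<tau>)) (gunit p N) = Idt S N"
    using subquality_sheafification[OF k N \<theta>(4)] unfolding K by metis
  have T: "T \<in> Ob E" and e: "e \<in> Hom S (FOb (dir_im p) T) N" using cu by (auto simp: couniversal_def)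
  define i where "i = inv_arrow S (\<theta> T)"
  note \<theta>T = nat_trans_Hom[OF \<theta>(1) T]
  have i: "i \<in> Hom S (FOb T z) (FOb (dir_im p) T)" "Cmp S i (\<theta> T) = Idt S (FOb (dir_im p) T)"
    using S.inv_arrow[OF \<theta>(2)[OF T] \<theta>T] by (auto simp: i_def)
  have e': "Cmp S e i \<in> Hom S (FOb T z) N" by (rule S.cmp_in[OF i(1) e])
  have cu': "couniversal E S ev N T (Cmp S e i)"
    unfolding i_def by (rule couniversal_iso[OF _ ev_functor nat_trans_inverse[OF \<theta>(1,2)] cu])
      (use \<theta>(1) in \<open>simp add: nat_trans_def\<close>)
  have "Cmp S (Cmp S e i) (FAr ev \<tau>) = Idt S N"
  proof -
    note KN = const_Ob[OF N]
    have \<theta>K: "\<theta> (FOb K N) \<in> Hom S (FOb (dir_im p) (FOb K N)) N"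
      using nat_trans_Hom[OF \<theta>(1) KN] z_Ob by simp
    have ev\<tau>: "FAr ev \<tau> \<in> Hom S N (FOb T z)" using ev_Hom[OF \<tau>] z_Ob by simp
    note p\<tau> = p.VHom[OF \<tau>] and u = p.\<eta>[OF N]
    have \<theta>T': "\<theta> T \<in> Hom S (FOb (dir_im p) T) (FOb T z)" using \<theta>T by simp
    have "Cmp S (Cmp S e i) (FAr ev \<tau>) = Cmp S (Cmp S (Cmp S e i) (FAr ev \<tau>)) (Cmp S (\<theta> (FOb K N)) (gunit p N))"
      using \<theta>(3)[OF N] S.cmp_id_right[OF S.cmp_in[OF ev\<tau> e']] by simp
    also have "\<dots> = Cmp S (Cmp S (Cmp S e i) (Cmp S (FAr ev \<tau>) (\<theta> (FOb K N)))) (gunit p N)"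
      using S.cmp_assoc[OF u \<theta>K S.cmp_in[OF ev\<tau> e']] S.cmp_assoc[OF \<theta>K ev\<tau> e'] by simp
    also have "Cmp S (FAr ev \<tau>) (\<theta> (FOb K N)) = Cmp S (\<theta> T) (FAr (dir_im p) \<tau>)"
      using nat_trans_nat[OF \<theta>(1) \<tau>] by simp
    also have "Cmp S (Cmp S e i) (Cmp S (\<theta> T) (FAr (dir_im p) \<tau>)) = Cmp S e (FAr (dir_im p) \<tau>)"
      using S.cmp_assoc[OF p\<tau> \<theta>T' e'] S.cmp_assoc[OF \<theta>T' i(1) e] i(2) S.cmp_id_right[OF e] by simp
    also have "Cmp S \<dots> (gunit p N) = Idt S N" by (rule sec)
    finally show ?thesis .
  qed
  then have "fn (Cmp S e i) (psh_app \<tau> z x) = x" if "x \<in> N" for x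
    using fn_Cmp[of "FAr ev \<tau>" N "FOb T z" x "Cmp S e i"] ev_Hom[OF \<tau>] z_Ob that fn_Idt[OF that] by simp
  then show thesis using that[OF cu' \<tau> \<tau>_iso] by blast
qed

end

text \<open>What the topos argument uses of algebras: Weil objects have exactly one point, all
  objects have a point, and an arrow whose composites with all points coincide factors through a
  Weil object. The last clause makes the factorization functorial in the codomain; the naturality in
  \<open>subquality_weil_sheaf\<close> rests on it.\<close>

locale weil_site = subsite U A z X0 for U :: "'u itself" and A :: "('c, 'f) cat" and z X0 +
  fixes im :: "'f \<Rightarrow> 'c" and quo inc :: "'f \<Rightarrow> 'f"
  assumes zero: "d \<in> Ob A \<Longrightarrow> d \<in> X0 \<Longrightarrow> \<exists>!f. f \<in> Hom A d z"
    and point: "b \<in> Ob A \<Longrightarrow> \<exists>f. f \<in> Hom A b z"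
    and factor: "f \<in> Hom A a b \<Longrightarrow> (\<And>\<chi> \<chi>'. \<chi> \<in> Hom A b z \<Longrightarrow> \<chi>' \<in> Hom A b z \<Longrightarrow> Cmp A \<chi> f = Cmp A \<chi>' f) \<Longrightarrow>
      im f \<in> X0 \<and> quo f \<in> Hom A a (im f) \<and> inc f \<in> Hom A (im f) b \<and> Cmp A (inc f) (quo f) = f \<and>
      (\<forall>c. \<forall>h \<in> Hom A b c. \<exists>r \<in> Hom A (im f) (im (Cmp A h f)).
        Cmp A r (quo f) = quo (Cmp A h f) \<and> Cmp A (inc (Cmp A h f)) r = Cmp A h (inc f))"
begin

text \<open>An element at \<open>a\<close> of the right Kan extension of the restriction of
  \<open>X\<close> to the Weil objects.\<close>

definition matching :: "'c \<Rightarrow> ('c, 'f, 'u) psh \<Rightarrow> ('f \<Rightarrow> 'u) \<Rightarrow> bool" where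
  "matching a X \<xi> \<longleftrightarrow> (\<forall>d \<in> X0. \<forall>g \<in> Hom A a d. \<xi> g \<in> FOb X d \<and>
    (\<forall>e. \<forall>h \<in> Hom W d e. \<xi> (Cmp A h g) = psh_act X h (\<xi> g)))"

text \<open>Bijectivity of the canonical arrow from \<open>X\<close> to the right Kan extension of
  its restriction.\<close>

definition weil_sheaf :: "('c, 'f, 'u) psh \<Rightarrow> bool" where
  "weil_sheaf X \<longleftrightarrow> (\<forall>a \<in> Ob A. \<forall>\<xi>. matching a X \<xi> \<longrightarrow>
    (\<exists>!x. x \<in> FOb X a \<and> (\<forall>d \<in> X0. \<forall>g \<in> Hom A a d. psh_act X g x = \<xi> g)))"

text \<open>Since \<open>X\<close> is determined by its restriction, an arrow into \<open>X\<close>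
  may be prescribed on Weil objects alone, and there \<open>m\<close> can be inverted.\<close>

lemma weil_sheaf_orthogonal:
  assumes X: "X \<in> Ob E" and sh: "weil_sheaf X" and m: "m \<in> Hom E P Q" and iso: "iso_arrow W.E (FAr Rs m)"
  shows "orthogonal E m X"
proof (rule orthogonalI[OF m])
  have P: "P \<in> Ob E" and Q: "Q \<in> Ob E" using E.E.Hom_Ob[OF m] by auto
  have bij: "bij_betw (psh_app m d) (FOb P d) (FOb Q d)" if "d \<in> Ob A" "d \<in> X0" for d
    using iso that unfolding W.E.iso_arrow_iff[OF Rs_Hom[OF m]] by (simp add: Rs_app)
  define n where "n = (\<lambda>d. inv_into (FOb P d) (psh_app m d))"
  have n: "n d y \<in> FOb P d" "psh_app m d (n d y) = y" if "d \<in> Ob A" "d \<in> X0" "y \<in> FOb Q d" for d y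
    using bij[OF that(1,2)] that(3) by (auto simp: n_def bij_betw_def inv_into_into f_inv_into_f)
  have nm: "n d (psh_app m d x) = x" if "d \<in> Ob A" "d \<in> X0" "x \<in> FOb P d" for d x
    using bij[OF that(1,2)] that(3) by (simp add: n_def bij_betw_inv_into_left)
  have n_act: "n e (psh_act Q h y) = psh_act P h (n d y)" if h: "h \<in> Hom W d e" and y: "y \<in> FOb Q d" for h d e y
  proof -
    have h': "h \<in> Hom A d e" "d \<in> X0" "e \<in> X0" using h by (auto simp: W_Hom)
    have de: "d \<in> Ob A" "e \<in> Ob A" using Hom_Ob[OF h'(1)] by auto
    note ny = n[OF de(1) h'(2) y]
    have "psh_act Q h y = psh_app m e (psh_act P h (n d y))" using E.app_nat[OF m h'(1) ny(1)] ny(2) by simp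
    then show ?thesis using nm[OF de(2) h'(3) E.act_in[OF P h'(1) ny(1)]] by simp
  qed
  fix u assume u: "u \<in> Hom E P X"
  \<comment> \<open>Move \<open>q\<close> to a Weil object, lift it through \<open>m\<close> there,
    and apply \<open>u\<close>.\<close>
  define \<xi> where "\<xi> = (\<lambda>q g. psh_app u (Cod A g) (n (Cod A g) (psh_act Q g q)))"
  have \<xi>: "\<xi> q g = psh_app u d (n d (psh_act Q g q))" if "g \<in> Hom A a d" for q g a d
    using that by (simp add: \<xi>_def Hom_Cod)
  have match: "matching a X (\<xi> q)" if q: "q \<in> FOb Q a" for a q
    unfolding matching_def
  proof (intro ballI conjI allI)
    fix d g assume d: "d \<in> X0" and g: "g \<in> Hom A a d"
    have d': "d \<in> Ob A" using Hom_Ob[OF g] by simp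
    note gq = E.act_in[OF Q g q]
    note ng = n[OF d' d gq]
    show "\<xi> q g \<in> FOb X d" unfolding \<xi>[OF g] by (rule E.app_in[OF u d' ng(1)])
    fix e h assume h: "h \<in> Hom W d e"
    then have h': "h \<in> Hom A d e" by (simp add: W_Hom)
    show "\<xi> q (Cmp A h g) = psh_act X h (\<xi> q g)"
      unfolding \<xi>[OF g] \<xi>[OF cmp_in[OF g h']]
      using E.act_cmp[OF Q g h' q] n_act[OF h gq] E.app_nat[OF u h' ng(1)] by simp
  qed
  define v where "v = (\<lambda>a q. THE x. x \<in> FOb X a \<and> (\<forall>d \<in> X0. \<forall>g \<in> Hom A a d. psh_act X g x = \<xi> q g))"
  have ex: "\<exists>!x. x \<in> FOb X a \<and> (\<forall>d \<in> X0. \<forall>g \<in> Hom A a d. psh_act X g x = \<xi> q g)" if "a \<in> Ob A" "q \<in> FOb Q a" for a q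
    using sh match[OF that(2)] that(1) unfolding weil_sheaf_def by blast
  have v: "v a q \<in> FOb X a" "\<And>d g. d \<in> X0 \<Longrightarrow> g \<in> Hom A a d \<Longrightarrow> psh_act X g (v a q) = \<xi> q g"
    if "a \<in> Ob A" "q \<in> FOb Q a" for a q
    using theI'[OF ex[OF that]] by (auto simp: v_def)
  have v_eq: "x = v a q" if "a \<in> Ob A" "q \<in> FOb Q a" "x \<in> FOb X a"
    "\<And>d g. d \<in> X0 \<Longrightarrow> g \<in> Hom A a d \<Longrightarrow> psh_act X g x = \<xi> q g" for a q x
    using ex[OF that(1,2)] v[OF that(1,2)] that(3,4) by blast
  obtain t where t: "t \<in> Hom E Q X" and t_app: "\<And>a q. a \<in> Ob A \<Longrightarrow> q \<in> FOb Q a \<Longrightarrow> psh_app t a q = v a q"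
  proof (rule E.arrE[OF Q X, of v])
    fix a q assume "a \<in> Ob A" "q \<in> FOb Q a" then show "v a q \<in> FOb X a" by (rule v)
  next
    fix k a b q assume k: "k \<in> Hom A a b" and q: "q \<in> FOb Q a"
    have ab: "a \<in> Ob A" "b \<in> Ob A" using Hom_Ob[OF k] by auto
    show "v b (psh_act Q k q) = psh_act X k (v a q)"
    proof (rule v_eq[OF ab(2) E.act_in[OF Q k q] E.act_in[OF X k v(1)[OF ab(1) q]], symmetric])
      fix d g assume d: "d \<in> X0" and g: "g \<in> Hom A b d"
      show "psh_act X g (psh_act X k (v a q)) = \<xi> (psh_act Q k q) g"
        using E.act_cmp[OF X k g v(1)[OF ab(1) q]] v(2)[OF ab(1) q d cmp_in[OF k g]] \<xi>[OF g] \<xi>[OF cmp_in[OF k g]]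
          E.act_cmp[OF Q k g q] by simp
    qed
  qed blast
  show "\<exists>!w. w \<in> Hom E Q X \<and> Cmp E w m = u"
  proof (rule ex1I[of _ t], intro conjI t)
    show "Cmp E t m = u"
    proof (rule E.arr_ext[OF E.E.cmp_in[OF m t] u])
      fix a x assume a: "a \<in> Ob A" and x: "x \<in> FOb P a"
      note mx = E.app_in[OF m a x]
      have "psh_app u a x = v a (psh_app m a x)"
      proof (rule v_eq[OF a mx E.app_in[OF u a x]])
        fix d g assume d: "d \<in> X0" and g: "g \<in> Hom A a d"
        show "psh_act X g (psh_app u a x) = \<xi> (psh_app m a x) g"
          using \<xi>[OF g] E.app_nat[OF m g x] E.app_nat[OF u g x] nm[OF Hom_Ob(2)[OF g] d E.act_in[OF P g x]] by simp
      qed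
      then show "psh_app (Cmp E t m) a x = psh_app u a x" using E.app_cmp[OF m t a x] t_app[OF a mx] by simp
    qed
    fix w assume w': "w \<in> Hom E Q X \<and> Cmp E w m = u"
    then have w: "w \<in> Hom E Q X" by simp
    show "w = t"
    proof (rule E.arr_ext[OF w t])
      fix a q assume a: "a \<in> Ob A" and q: "q \<in> FOb Q a"
      have "psh_app w a q = v a q"
      proof (rule v_eq[OF a q E.app_in[OF w a q]])
        fix d g assume d: "d \<in> X0" and g: "g \<in> Hom A a d"
        have d': "d \<in> Ob A" using Hom_Ob[OF g] by simp
        note gq = E.act_in[OF Q g q]
        note ng = n[OF d' d gq]
        show "psh_act X g (psh_app w a q) = \<xi> q g"
          using E.app_nat[OF w g q] E.app_cmp[OF m w d' ng(1)] ng(2) w' \<xi>[OF g] by simp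
      qed
      then show "psh_app w a q = psh_app t a q" using t_app[OF a q] by simp
    qed
  qed
qed

text \<open>Elements of a codiscrete object are functions of points. The object is known only
  through its universal property, so the two elements are compared as arrows out of the
  representable at \<open>c\<close>.\<close>

lemma couniversal_separated:
  assumes cu: "couniversal E S ev N T e" and c: "c \<in> Ob A" and t: "t \<in> FOb T c" "t' \<in> FOb T c"
    and eq: "\<And>\<chi>. \<chi> \<in> Hom A c z \<Longrightarrow> fn e (psh_act T \<chi> t) = fn e (psh_act T \<chi> t')"
  shows "t = t'"
proof -
  interpret S: category S by (rule category_set_cat)
  have T: "T \<in> Ob E" and e: "e \<in> Hom S (FOb T z) N" using cu by (auto simp: couniversal_def)
  obtain Y i r where Y: "Y \<in> Ob E"
    and i: "\<And>d f. f \<in> Hom A c d \<Longrightarrow> i d f \<in> FOb Y d"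
    and r: "\<And>d y. d \<in> Ob A \<Longrightarrow> y \<in> FOb Y d \<Longrightarrow> r d y \<in> Hom A c d"
    and ri: "\<And>d f. f \<in> Hom A c d \<Longrightarrow> r d (i d f) = f"
    and ir: "\<And>d y. d \<in> Ob A \<Longrightarrow> y \<in> FOb Y d \<Longrightarrow> i d (r d y) = y"
    and actY: "\<And>d e f g. f \<in> Hom A c d \<Longrightarrow> g \<in> Hom A d e \<Longrightarrow> psh_act Y g (i d f) = i e (Cmp A g f)"
    and yo: "\<And>F x. F \<in> Ob E \<Longrightarrow> x \<in> FOb F c \<Longrightarrow> \<exists>t \<in> Hom E Y F. \<forall>d. \<forall>f \<in> Hom A c d. psh_app t d (i d f) = psh_act F f x"
    by (rule E.representable[OF c]) blast
  obtain s where s: "s \<in> Hom E Y T" "\<forall>d. \<forall>f \<in> Hom A c d. psh_app s d (i d f) = psh_act T f t" using yo[OF T t(1)] by blast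
  obtain s' where s': "s' \<in> Hom E Y T" "\<forall>d. \<forall>f \<in> Hom A c d. psh_app s' d (i d f) = psh_act T f t'" using yo[OF T t(2)] by blast
  note es = S.cmp_in[OF ev_Hom[OF s(1)] e] and es' = S.cmp_in[OF ev_Hom[OF s'(1)] e]
  have "Cmp S e (FAr ev s) = Cmp S e (FAr ev s')"
  proof (rule set_ext[OF es es'])
    fix y assume y: "y \<in> FOb Y z"
    show "fn (Cmp S e (FAr ev s)) y = fn (Cmp S e (FAr ev s')) y"
      using fn_Cmp[OF ev_Hom[OF s(1)] y] fn_Cmp[OF ev_Hom[OF s'(1)] y] s(2) s'(2) r[OF z_Ob y] ir[OF z_Ob y] eq[OF r[OF z_Ob y]]
      by (metis ev_func_simps(2))
  qed
  moreover have "\<exists>!h. h \<in> Hom E Y T \<and> Cmp S e (FAr ev h) = Cmp S e (FAr ev s)"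
    using cu Y es unfolding couniversal_def by simp
  ultimately have "s = s'" using s(1) s'(1) by metis
  then have "psh_act T (Idt A c) t = psh_act T (Idt A c) t'" using s(2) s'(2) idt_in[OF c] by metis
  then show ?thesis using E.act_idt[OF T c] t by simp
qed

text \<open>A function of the points of \<open>c\<close> is a map of sets from the value at
  \<open>z\<close> of the representable at \<open>c\<close>; the universal property extends it to an
  arrow, which names an element.\<close>

lemma couniversal_surjective:
  assumes cu: "couniversal E S ev N T e" and c: "c \<in> Ob A" and \<zeta>: "\<And>\<chi>. \<chi> \<in> Hom A c z \<Longrightarrow> \<zeta> \<chi> \<in> N" and N: "N \<in> Ob S"
  shows "\<exists>t \<in> FOb T c. \<forall>\<chi> \<in> Hom A c z. fn e (psh_act T \<chi> t) = \<zeta> \<chi>"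
proof -
  interpret S: category S by (rule category_set_cat)
  have T: "T \<in> Ob E" and e: "e \<in> Hom S (FOb T z) N" using cu by (auto simp: couniversal_def)
  obtain Y i r where Y: "Y \<in> Ob E"
    and i: "\<And>d f. f \<in> Hom A c d \<Longrightarrow> i d f \<in> FOb Y d"
    and r: "\<And>d y. d \<in> Ob A \<Longrightarrow> y \<in> FOb Y d \<Longrightarrow> r d y \<in> Hom A c d"
    and ri: "\<And>d f. f \<in> Hom A c d \<Longrightarrow> r d (i d f) = f"
    and ir: "\<And>d y. d \<in> Ob A \<Longrightarrow> y \<in> FOb Y d \<Longrightarrow> i d (r d y) = y"
    and actY: "\<And>d e f g. f \<in> Hom A c d \<Longrightarrow> g \<in> Hom A d e \<Longrightarrow> psh_act Y g (i d f) = i e (Cmp A g f)"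
    and yo: "\<And>F x. F \<in> Ob E \<Longrightarrow> x \<in> FOb F c \<Longrightarrow> \<exists>t \<in> Hom E Y F. \<forall>d. \<forall>f \<in> Hom A c d. psh_app t d (i d f) = psh_act F f x"
    by (rule E.representable[OF c]) blast
  define g where "g = set_arrow (FOb Y z) N (\<lambda>y. \<zeta> (r z y))"
  have g: "g \<in> Hom S (FOb ev Y) N"
    using N \<zeta> r[OF z_Ob] E.el_small[OF Y z_Ob] unfolding g_def by (auto intro!: set_arrow_Hom)
  have "\<exists>!h. h \<in> Hom E Y T \<and> Cmp S e (FAr ev h) = g" using cu Y g unfolding couniversal_def by blast
  then obtain h where h: "h \<in> Hom E Y T" "Cmp S e (FAr ev h) = g" by blast
  have id: "i c (Idt A c) \<in> FOb Y c" using i idt_in[OF c] .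
  have "fn e (psh_act T \<chi> (psh_app h c (i c (Idt A c)))) = \<zeta> \<chi>" if \<chi>: "\<chi> \<in> Hom A c z" for \<chi>
  proof -
    have "psh_act T \<chi> (psh_app h c (i c (Idt A c))) = psh_app h z (i z \<chi>)"
      using E.app_nat[OF h(1) \<chi> id] actY[OF idt_in[OF c] \<chi>] cmp_id_right[OF \<chi>] by simp
    then show ?thesis
      using fn_Cmp[OF ev_Hom[OF h(1)] i[OF \<chi>], of e] h(2) i[OF \<chi>] ri[OF \<chi>] by (simp add: g_def)
  qed
  then show ?thesis using E.app_in[OF h(1) c id] by blast
qed

text \<open>A compatible family on Weil objects extends to the cosieve of arrows constant on points,
  since these factor through Weil objects. The sheaf is local for the inclusion of this cosieve, so
  the extended family has a unique gluing.\<close>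

lemma subquality_weil_sheaf:
  assumes k: "subquality E S p G k" and K: "inv_im p = K" and Y: "Y \<in> Ob G"
  shows "weil_sheaf (FOb (dir_im k) Y)"
  unfolding weil_sheaf_def
proof (intro ballI allI impI)
  define X where "X = FOb (dir_im k) Y"
  fix a \<xi> assume a: "a \<in> Ob A" and "matching a (FOb (dir_im k) Y) \<xi>"
  then have \<xi>: "\<xi> g \<in> FOb X d" "h \<in> Hom W d e \<Longrightarrow> \<xi> (Cmp A h g) = psh_act X h (\<xi> g)"
    if "d \<in> X0" "g \<in> Hom A a d" for d g e h
    using that unfolding matching_def X_def by blast+
  have gk: "geometric_morphism G E k" using k by (simp add: subquality_def subtopos_def)
  interpret k: adj E G "inv_im k" "dir_im k" "gunit k" "gcounit k"
    using gk by (intro adj.intro) (simp add: geometric_morphism_def)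
  have X: "X \<in> Ob E" unfolding X_def by (rule k.VOb[OF Y])
  \<comment> \<open>The points of \<open>a\<close>, encoded in the universe, are the set of
    constants to which the comparison is applied.\<close>
  obtain en :: "'f \<Rightarrow> 'u" where en: "inj_on en (Hom A a z)" by (rule small_enc[OF E.small_Hom])
  define N where "N = en ` Hom A a z"
  have N: "N \<in> Ob S" unfolding N_def using small_image[OF E.small_Hom] by simp
  note KN = const_Ob[OF N]
  obtain T e \<tau> where cu: "couniversal E S ev N T e" and \<tau>: "\<tau> \<in> Hom E (FOb K N) T"
    and \<tau>_iso: "iso_arrow G (FAr (inv_im k) \<tau>)" and sec: "\<And>x. x \<in> N \<Longrightarrow> fn e (psh_app \<tau> z x) = x"
    using subquality_ev[OF k K N] by metis
  have T: "T \<in> Ob E" and e: "e \<in> Hom S (FOb T z) N" using cu by (auto simp: couniversal_def)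
  \<comment> \<open>The tautological element: as a function of points it is the encoding, that is,
    the identity.\<close>
  obtain t0 where t0: "t0 \<in> FOb T a" "\<And>\<chi>. \<chi> \<in> Hom A a z \<Longrightarrow> fn e (psh_act T \<chi> t0) = en \<chi>"
    using couniversal_surjective[OF cu a, of en] N by (auto simp: N_def)
  have \<tau>_pt: "fn e (psh_act T \<chi> (psh_app \<tau> d n)) = n" if "\<chi> \<in> Hom A d z" "n \<in> N" for \<chi> d n
  proof -
    have "n \<in> FOb (FOb K N) d" using that Hom_Ob[OF that(1)] by simp
    then show ?thesis using E.app_nat[OF \<tau> that(1), of n] const_act[OF that] sec[OF that(2)] by simp
  qed
  have t0_pt: "fn e (psh_act T \<chi> (psh_act T f t0)) = en (Cmp A \<chi> f)" if "f \<in> Hom A a d" "\<chi> \<in> Hom A d z" for f d \<chi>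
    using E.act_cmp[OF T that t0(1)] t0(2)[OF cmp_in[OF that]] by simp
  \<comment> \<open>The arrow \<open>f\<close> induces a constant map from the points of
    \<open>d\<close> to those of \<open>a\<close>.\<close>
  define cp where "cp = (\<lambda>d f. f \<in> Hom A a d \<and> (\<forall>\<chi> \<in> Hom A d z. \<forall>\<chi>' \<in> Hom A d z. Cmp A \<chi> f = Cmp A \<chi>' f))"
  have cpD: "f \<in> Hom A a d" if "cp d f" for d f using that unfolding cp_def by blast
  have cp_cmp: "cp e (Cmp A h f)" if f: "cp d f" and h: "h \<in> Hom A d e" for d e f h
  proof -
    have f': "f \<in> Hom A a d" using f by (rule cpD)
    have "Cmp A \<chi> (Cmp A h f) = Cmp A \<chi>' (Cmp A h f)" if "\<chi> \<in> Hom A e z" "\<chi>' \<in> Hom A e z" for \<chi> \<chi>'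
    proof -
      have "Cmp A (Cmp A \<chi> h) f = Cmp A (Cmp A \<chi>' h) f"
        using f[unfolded cp_def, THEN conjunct2, rule_format, OF cmp_in[OF h that(1)] cmp_in[OF h that(2)]] .
      then show ?thesis using cmp_assoc[OF f' h that(1)] cmp_assoc[OF f' h that(2)] by simp
    qed
    then show ?thesis using cmp_in[OF f' h] unfolding cp_def by blast
  qed
  \<comment> \<open>A Weil object has a single point, so every map out of its set of points is
    constant.\<close>
  have cp_weil: "cp d g" if "d \<in> X0" "g \<in> Hom A a d" for d g
  proof -
    have "\<chi> = \<chi>'" if "\<chi> \<in> Hom A d z" "\<chi>' \<in> Hom A d z" for \<chi> \<chi>'
      using zero[OF Hom_Ob(2)[OF \<open>g \<in> Hom A a d\<close>] \<open>d \<in> X0\<close>] that by blast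
    then show ?thesis using that(2) unfolding cp_def by blast
  qed
  have fac: "im f \<in> X0" "quo f \<in> Hom A a (im f)" "inc f \<in> Hom A (im f) d" "Cmp A (inc f) (quo f) = f"
    "h \<in> Hom A d c \<Longrightarrow> \<exists>r \<in> Hom A (im f) (im (Cmp A h f)). Cmp A r (quo f) = quo (Cmp A h f) \<and> Cmp A (inc (Cmp A h f)) r = Cmp A h (inc f)"
    if "cp d f" for d f h c
  proof -
    have f: "f \<in> Hom A a d" and c: "\<And>\<chi> \<chi>'. \<chi> \<in> Hom A d z \<Longrightarrow> \<chi>' \<in> Hom A d z \<Longrightarrow> Cmp A \<chi> f = Cmp A \<chi>' f"
      using that unfolding cp_def by blast+
    note * = factor[OF f c]
    show "im f \<in> X0" "quo f \<in> Hom A a (im f)" "inc f \<in> Hom A (im f) d" "Cmp A (inc f) (quo f) = f"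
      "h \<in> Hom A d c \<Longrightarrow> \<exists>r \<in> Hom A (im f) (im (Cmp A h f)). Cmp A r (quo f) = quo (Cmp A h f) \<and> Cmp A (inc (Cmp A h f)) r = Cmp A h (inc f)"
      using * by blast+
  qed
  obtain Ya i r where Ya: "Ya \<in> Ob E"
    and i: "\<And>d f. f \<in> Hom A a d \<Longrightarrow> i d f \<in> FOb Ya d"
    and r: "\<And>d y. d \<in> Ob A \<Longrightarrow> y \<in> FOb Ya d \<Longrightarrow> r d y \<in> Hom A a d"
    and ri: "\<And>d f. f \<in> Hom A a d \<Longrightarrow> r d (i d f) = f"
    and ir: "\<And>d y. d \<in> Ob A \<Longrightarrow> y \<in> FOb Ya d \<Longrightarrow> i d (r d y) = y"
    and actY: "\<And>d e f g. f \<in> Hom A a d \<Longrightarrow> g \<in> Hom A d e \<Longrightarrow> psh_act Ya g (i d f) = i e (Cmp A g f)"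
    and yo: "\<And>F x. F \<in> Ob E \<Longrightarrow> x \<in> FOb F a \<Longrightarrow> \<exists>t \<in> Hom E Ya F. \<forall>d. \<forall>f \<in> Hom A a d. psh_app t d (i d f) = psh_act F f x"
    by (rule E.representable[OF a]) blast
  obtain zt where zt: "zt \<in> Hom E Ya T" "\<And>d f. f \<in> Hom A a d \<Longrightarrow> psh_app zt d (i d f) = psh_act T f t0"
    using yo[OF T t0(1)] by blast
  obtain Q j s where Q: "Q \<in> Ob E"
    and j: "\<And>d f. d \<in> Ob A \<Longrightarrow> f \<in> Collect (cp d) \<Longrightarrow> j d f \<in> FOb Q d"
    and s: "\<And>d y. d \<in> Ob A \<Longrightarrow> y \<in> FOb Q d \<Longrightarrow> s d y \<in> Collect (cp d)"
    and sj: "\<And>d f. d \<in> Ob A \<Longrightarrow> f \<in> Collect (cp d) \<Longrightarrow> s d (j d f) = f"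
    and js: "\<And>d y. d \<in> Ob A \<Longrightarrow> y \<in> FOb Q d \<Longrightarrow> j d (s d y) = y"
    and actj: "\<And>d e h f. h \<in> Hom A d e \<Longrightarrow> f \<in> Collect (cp d) \<Longrightarrow> psh_act Q h (j d f) = j e (Cmp A h f)"
    and acts: "\<And>d e h y. h \<in> Hom A d e \<Longrightarrow> y \<in> FOb Q d \<Longrightarrow> s e (psh_act Q h y) = Cmp A h (s d y)"
  proof (rule E.objE[of "\<lambda>d. Collect (cp d)" "\<lambda>h f. Cmp A h f"])
    fix d show "small_in U (Collect (cp d))" by (rule small_subset[OF E.small_Hom[of a d]]) (auto dest: cpD)
  next
    fix h d e f assume "h \<in> Hom A d e" "f \<in> Collect (cp d)" then show "Cmp A h f \<in> Collect (cp e)" using cp_cmp by simp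
  next
    fix d f assume "f \<in> Collect (cp d)" then show "Cmp A (Idt A d) f = f" using cmp_id_left[OF cpD] by simp
  next
    fix f g c d e x assume "f \<in> Hom A c d" "g \<in> Hom A d e" "x \<in> Collect (cp c)"
    then show "Cmp A (Cmp A g f) x = Cmp A g (Cmp A f x)" using cmp_assoc[OF cpD] by simp
  qed blast
  have s_Hom: "s d y \<in> Hom A a d" if "d \<in> Ob A" "y \<in> FOb Q d" for d y using s[OF that] cpD by simp
  \<comment> \<open>A point of \<open>d\<close> is chosen in order to read off the constant value of
    the induced map of points.\<close>
  define pt where "pt = (\<lambda>d. SOME \<chi>. \<chi> \<in> Hom A d z)"
  have pt: "pt d \<in> Hom A d z" if "d \<in> Ob A" for d using someI_ex[OF point[OF that]] by (simp add: pt_def)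
  obtain b where b: "b \<in> Hom E Q Ya" and b_app: "\<And>d y. d \<in> Ob A \<Longrightarrow> y \<in> FOb Q d \<Longrightarrow> psh_app b d y = i d (s d y)"
  proof (rule E.arrE[OF Q Ya, of "\<lambda>d y. i d (s d y)"])
    fix d y assume "d \<in> Ob A" "y \<in> FOb Q d" then show "i d (s d y) \<in> FOb Ya d" using i s_Hom by blast
  next
    fix h d c y assume h: "h \<in> Hom A d c" and y: "y \<in> FOb Q d"
    show "i c (s c (psh_act Q h y)) = psh_act Ya h (i d (s d y))"
      using acts[OF h y] actY[OF s_Hom[OF Hom_Ob(1)[OF h] y] h] by simp
  qed blast
  have nN: "en (Cmp A (pt d) (s d y)) \<in> N" if "d \<in> Ob A" "y \<in> FOb Q d" for d y
    using cmp_in[OF s_Hom[OF that] pt[OF that(1)]] by (simp add: N_def)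
  have s_cp: "Cmp A \<chi> (s d y) = Cmp A (pt d) (s d y)" if "d \<in> Ob A" "y \<in> FOb Q d" "\<chi> \<in> Hom A d z" for d y \<chi>
    using s[OF that(1,2)] pt[OF that(1)] that(3) unfolding cp_def by blast
  obtain l where l: "l \<in> Hom E Q (FOb K N)" and l_app: "\<And>d y. d \<in> Ob A \<Longrightarrow> y \<in> FOb Q d \<Longrightarrow> psh_app l d y = en (Cmp A (pt d) (s d y))"
  proof (rule E.arrE[OF Q KN, of "\<lambda>d y. en (Cmp A (pt d) (s d y))"])
    fix d y assume "d \<in> Ob A" "y \<in> FOb Q d" then show "en (Cmp A (pt d) (s d y)) \<in> FOb (FOb K N) d" using nN by simp
  next
    fix h d c y assume h: "h \<in> Hom A d c" and y: "y \<in> FOb Q d"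
    have dc: "d \<in> Ob A" "c \<in> Ob A" using Hom_Ob[OF h] by auto
    have "Cmp A (pt c) (s c (psh_act Q h y)) = Cmp A (pt d) (s d y)"
      using acts[OF h y] cmp_assoc[OF s_Hom[OF dc(1) y] h pt[OF dc(2)]] s_cp[OF dc(1) y cmp_in[OF h pt[OF dc(2)]]] by simp
    then show "en (Cmp A (pt c) (s c (psh_act Q h y))) = psh_act (FOb K N) h (en (Cmp A (pt d) (s d y)))"
      using const_act[OF h nN[OF dc(1) y]] by simp
  qed blast
  \<comment> \<open>The arrow \<open>f\<close> and the constant \<open>n\<close> have the same image
    in \<open>T\<close> exactly if each point of \<open>d\<close> composed with \<open>f\<close> is
    encoded by \<open>n\<close>. Injectivity of \<open>en\<close> then puts \<open>f\<close> into
    the cosieve, and the point \<open>pt d\<close> recovers \<open>n\<close>.\<close>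
  have "is_pullback E zt \<tau> b l"
  proof (rule E.is_pullbackI[OF zt(1) \<tau> b l])
    fix d y assume d: "d \<in> Ob A" and y: "y \<in> FOb Q d"
    note f = s_Hom[OF d y]
    have n: "en (Cmp A (pt d) (s d y)) \<in> FOb (FOb K N) d" using nN[OF d y] d by simp
    have "psh_act T (s d y) t0 = psh_app \<tau> d (en (Cmp A (pt d) (s d y)))"
      by (rule couniversal_separated[OF cu d E.act_in[OF T f t0(1)] E.app_in[OF \<tau> d n]])
        (simp add: t0_pt[OF f] \<tau>_pt[OF _ nN[OF d y]] s_cp[OF d y])
    then show "psh_app zt d (psh_app b d y) = psh_app \<tau> d (psh_app l d y)"
      using b_app[OF d y] l_app[OF d y] zt(2)[OF f] by simp
  next
    fix d y n assume d: "d \<in> Ob A" and y: "y \<in> FOb Ya d" and "n \<in> FOb (FOb K N) d" and eq: "psh_app zt d y = psh_app \<tau> d n"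
    then have n: "n \<in> N" by simp
    define f where "f = r d y"
    have f: "f \<in> Hom A a d" "i d f = y" using r[OF d y] ir[OF d y] by (auto simp: f_def)
    have enf: "en (Cmp A \<chi> f) = n" if "\<chi> \<in> Hom A d z" for \<chi>
      using t0_pt[OF f(1) that] \<tau>_pt[OF that n] zt(2)[OF f(1)] f(2) eq by simp
    have "cp d f"
      unfolding cp_def using f(1) enf en cmp_in[OF f(1)] by (metis inj_onD)
    then have f_cp: "f \<in> Collect (cp d)" by simp
    note jf = j[OF d f_cp]
    show "\<exists>!w. w \<in> FOb Q d \<and> psh_app b d w = y \<and> psh_app l d w = n"
    proof (rule ex1I[of _ "j d f"])
      show "j d f \<in> FOb Q d \<and> psh_app b d (j d f) = y \<and> psh_app l d (j d f) = n"
        using jf b_app[OF d jf] l_app[OF d jf] sj[OF d f_cp] f(2) enf[OF pt[OF d]] by simp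
      fix w assume w: "w \<in> FOb Q d \<and> psh_app b d w = y \<and> psh_app l d w = n"
      then have "i d (s d w) = y" using b_app[OF d, of w] by auto
      then have "s d w = f" using ri[OF s_Hom[OF d], of w] w by (simp add: f_def)
      then show "w = j d f" using js[OF d, of w] w by simp
    qed
  qed
  then have "is_pullback G (FAr (inv_im k) zt) (FAr (inv_im k) \<tau>) (FAr (inv_im k) b) (FAr (inv_im k) l)"
    using gk unfolding geometric_morphism_def preserves_finite_limits_def by blast
  then have "iso_arrow G (FAr (inv_im k) b)" by (rule pullback_of_iso[OF k.D.category_axioms _ \<tau>_iso])
  then have orth: "orthogonal E b X" unfolding X_def by (rule k.orthogonal_V[OF b _ Y])
  \<comment> \<open>The value of the family at the Weil quotient of the arrow, moved along the
    inclusion of that quotient.\<close>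
  obtain u where u: "u \<in> Hom E Q X"
    and u_app: "\<And>d y. d \<in> Ob A \<Longrightarrow> y \<in> FOb Q d \<Longrightarrow> psh_app u d y = psh_act X (inc (s d y)) (\<xi> (quo (s d y)))"
  proof (rule E.arrE[OF Q X, of "\<lambda>d y. psh_act X (inc (s d y)) (\<xi> (quo (s d y)))"])
    fix d y assume d: "d \<in> Ob A" and y: "y \<in> FOb Q d"
    then have f: "cp d (s d y)" using s by simp
    show "psh_act X (inc (s d y)) (\<xi> (quo (s d y))) \<in> FOb X d"
      by (rule E.act_in[OF X fac(3)[OF f] \<xi>(1)[OF fac(1,2)[OF f]]])
  next
    fix h d c y assume h: "h \<in> Hom A d c" and y: "y \<in> FOb Q d"
    define f where "f = s d y"
    have f: "cp d f" using s[OF Hom_Ob(1)[OF h] y] by (simp add: f_def)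
    have hf: "cp c (Cmp A h f)" by (rule cp_cmp[OF f h])
    obtain v where v: "v \<in> Hom A (im f) (im (Cmp A h f))" "Cmp A v (quo f) = quo (Cmp A h f)"
      "Cmp A (inc (Cmp A h f)) v = Cmp A h (inc f)" using fac(5)[OF f h] by blast
    have vW: "v \<in> Hom W (im f) (im (Cmp A h f))" using v(1) fac(1)[OF f] fac(1)[OF hf] by (simp add: W_Hom)
    note \<xi>f = \<xi>(1)[OF fac(1,2)[OF f]]
    have "psh_act X (inc (Cmp A h f)) (\<xi> (quo (Cmp A h f))) = psh_act X (inc (Cmp A h f)) (psh_act X v (\<xi> (quo f)))"
      using \<xi>(2)[OF fac(1,2)[OF f] vW] v(2) by simp
    also have "\<dots> = psh_act X h (psh_act X (inc f) (\<xi> (quo f)))"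
      using E.act_cmp[OF X v(1) fac(3)[OF hf] \<xi>f] v(3) E.act_cmp[OF X fac(3)[OF f] h \<xi>f] by simp
    finally show "psh_act X (inc (s c (psh_act Q h y))) (\<xi> (quo (s c (psh_act Q h y)))) =
      psh_act X h (psh_act X (inc (s d y)) (\<xi> (quo (s d y))))"
      using acts[OF h y] by (simp add: f_def)
  qed blast
  note ex = orthogonalD[OF orth b u]
  obtain v where v: "v \<in> Hom E Ya X" "Cmp E v b = u" using ex by blast
  have ida: "i a (Idt A a) \<in> FOb Ya a" using i idt_in[OF a] .
  show "\<exists>!x. x \<in> FOb (FOb (dir_im k) Y) a \<and> (\<forall>d \<in> X0. \<forall>g \<in> Hom A a d. psh_act (FOb (dir_im k) Y) g x = \<xi> g)"
    unfolding X_def[symmetric]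
  proof (rule ex1I[of _ "psh_app v a (i a (Idt A a))"], intro conjI ballI)
    show "psh_app v a (i a (Idt A a)) \<in> FOb X a" by (rule E.app_in[OF v(1) a ida])
    fix d g assume d: "d \<in> X0" and g: "g \<in> Hom A a d"
    have d': "d \<in> Ob A" using Hom_Ob[OF g] by simp
    have g_cp: "cp d g" by (rule cp_weil[OF d g])
    then have g_cp': "g \<in> Collect (cp d)" by simp
    note jg = j[OF d' g_cp']
    \<comment> \<open>For \<open>g\<close> with Weil codomain the inclusion is an arrow of the
      subcategory, so compatibility of \<open>\<xi>\<close> identifies the glued value with the
      prescribed one.\<close>
    have incW: "inc g \<in> Hom W (im g) d" using fac(1,3)[OF g_cp] d by (simp add: W_Hom)
    have "psh_act X g (psh_app v a (i a (Idt A a))) = psh_app v d (psh_app b d (j d g))"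
      using E.app_nat[OF v(1) g ida] actY[OF idt_in[OF a] g] cmp_id_right[OF g] b_app[OF d' jg] sj[OF d' g_cp'] by simp
    also have "\<dots> = psh_act X (inc g) (\<xi> (quo g))"
      using E.app_cmp[OF b v(1) d' jg] v(2) u_app[OF d' jg] sj[OF d' g_cp'] by simp
    also have "\<dots> = \<xi> g" using \<xi>(2)[OF fac(1,2)[OF g_cp] incW] fac(4)[OF g_cp] by simp
    finally show "psh_act X g (psh_app v a (i a (Idt A a))) = \<xi> g" .
  next
    fix x assume x: "x \<in> FOb X a \<and> (\<forall>d \<in> X0. \<forall>g \<in> Hom A a d. psh_act X g x = \<xi> g)"
    \<comment> \<open>A second solution defines an arrow out of the representable that also
      restricts to \<open>u\<close> on the cosieve, so it equals \<open>v\<close>.\<close>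
    then obtain w where w: "w \<in> Hom E Ya X" "\<And>d f. f \<in> Hom A a d \<Longrightarrow> psh_app w d (i d f) = psh_act X f x"
      using yo[OF X, of x] by blast
    have "Cmp E w b = u"
    proof (rule E.arr_ext[OF E.E.cmp_in[OF b w(1)] u])
      fix d y assume d: "d \<in> Ob A" and y: "y \<in> FOb Q d"
      define f where "f = s d y"
      have f: "cp d f" "f \<in> Hom A a d" using s[OF d y] cpD by (auto simp: f_def)
      have "psh_app (Cmp E w b) d y = psh_act X f x"
        using E.app_cmp[OF b w(1) d y] b_app[OF d y] w(2)[OF f(2)] by (simp add: f_def)
      also have "\<dots> = psh_act X (inc f) (psh_act X (quo f) x)"
        using E.act_cmp[OF X fac(2,3)[OF f(1)], of x] x fac(4)[OF f(1)] by simp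
      also have "\<dots> = psh_act X (inc f) (\<xi> (quo f))" using x fac(1,2)[OF f(1)] by simp
      finally show "psh_app (Cmp E w b) d y = psh_app u d y" using u_app[OF d y] by (simp add: f_def)
    qed
    then have "w = v" using ex w(1) v by blast
    then show "x = psh_app v a (i a (Idt A a))" using w(2)[OF idt_in[OF a]] E.act_idt[OF X a] x by simp
  qed
qed

text \<open>Sheaves for a subquality are local for the units of \<open>w\<close>, which puts
  \<open>w\<close> above it. For the centre the reason is simpler: restriction to Weil objects keeps
  the value at \<open>z\<close>, so arrows that it inverts are inverted by global sections
  too.\<close>

theorem weil_level:
  assumes p: "geometric_morphism E S p" and K: "inv_im p = K"
    and w: "subtopos E W.E w" and wR: "inv_im w = Rs"
  shows "essential_subquality E S p W.E w"
    and "\<And>G k. subquality E S p G k \<Longrightarrow> above E W.E w G k"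
proof -
  interpret S: category S by (rule category_set_cat)
  have gw: "geometric_morphism W.E E w" and ff: "fully_faithful W.E E (dir_im w)"
    using w by (auto simp: subtopos_def)
  interpret w: adj E W.E Rs "dir_im w" "gunit w" "gcounit w"
    using gw wR by (intro adj.intro) (simp add: geometric_morphism_def)
  have unit: "iso_arrow W.E (FAr Rs (gunit w X))" if "X \<in> Ob E" for X
    by (rule w.F_unit_iso[OF that w.counit_iso_of_ff[OF ff w.FOb[OF that]]])
  show "above E W.E w G k" if k: "subquality E S p G k" for G k
  proof -
    have gk: "geometric_morphism G E k" using k by (simp add: subquality_def subtopos_def)
    interpret k: adj E G "inv_im k" "dir_im k" "gunit k" "gcounit k"
      using gk by (intro adj.intro) (simp add: geometric_morphism_def)
    have "iso_arrow E (gunit w (FOb (dir_im k) Y))" if Y: "Y \<in> Ob G" for Y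
    proof (rule w.unit_iso_of_orthogonal[OF ff k.VOb[OF Y]])
      show "orthogonal E (gunit w (FOb (dir_im k) Y)) (FOb (dir_im k) Y)"
        by (rule weil_sheaf_orthogonal[OF k.VOb[OF Y] subquality_weil_sheaf[OF k K Y] w.\<eta>[OF k.VOb[OF Y]] unit[OF k.VOb[OF Y]]])
    qed
    then show ?thesis using w.nat_iso_of_unit_iso[OF k.V] unfolding above_def by blast
  qed
  obtain \<theta> where \<theta>: "nat_trans E S (dir_im p) ev \<theta>" "\<And>F. F \<in> Ob E \<Longrightarrow> iso_arrow S (\<theta> F)"
    using direct_image_ev[OF p K] by metis
  have p_iso: "iso_arrow S (FAr (dir_im p) m)" if m: "m \<in> Hom E P Q" and iso: "iso_arrow W.E (FAr Rs m)" for m P Q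
  proof -
    have PQ: "P \<in> Ob E" "Q \<in> Ob E" using E.E.Hom_Ob[OF m] by auto
    have "bij_betw (psh_app m z) (FOb P z) (FOb Q z)"
      using iso z_Ob z_X0 unfolding W.E.iso_arrow_iff[OF Rs_Hom[OF m]] by (simp add: Rs_app)
    then have ev: "iso_arrow S (FAr ev m)" using set_bij_iso[OF ev_Hom[OF m]] by simp
    have pm: "FAr (dir_im p) m \<in> Hom S (FOb (dir_im p) P) (FOb (dir_im p) Q)"
      using \<theta>(1) by (intro functor_Hom[OF _ m]) (simp add: nat_trans_def)
    note \<theta>P = nat_trans_Hom[OF \<theta>(1) PQ(1)] and \<theta>Q = nat_trans_Hom[OF \<theta>(1) PQ(2)]
    have evm: "FAr ev m \<in> Hom S (FOb ev P) (FOb ev Q)" using ev_Hom[OF m] by simp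
    have i: "inv_arrow S (\<theta> Q) \<in> Hom S (FOb ev Q) (FOb (dir_im p) Q)" "Cmp S (inv_arrow S (\<theta> Q)) (\<theta> Q) = Idt S (FOb (dir_im p) Q)"
      using S.inv_arrow[OF \<theta>(2)[OF PQ(2)] \<theta>Q] by auto
    have "FAr (dir_im p) m = Cmp S (inv_arrow S (\<theta> Q)) (Cmp S (FAr ev m) (\<theta> P))"
      using nat_trans_nat[OF \<theta>(1) m] S.cmp_assoc[OF pm \<theta>Q i(1)] i(2) S.cmp_id_left[OF pm] by simp
    moreover have "iso_arrow S (Cmp S (inv_arrow S (\<theta> Q)) (Cmp S (FAr ev m) (\<theta> P)))"
      by (rule S.iso_cmp[OF S.iso_cmp[OF \<theta>(2)[OF PQ(1)] ev \<theta>P evm] S.iso_inv_arrow[OF \<theta>(2)[OF PQ(2)] \<theta>Q] S.cmp_in[OF \<theta>P evm] i(1)])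
    ultimately show ?thesis by simp
  qed
  obtain R \<eta> \<epsilon> where R: "upper_shriek E S p R \<eta> \<epsilon>" using upper_shriek_exists[OF p K] by blast
  interpret r: adj E S "dir_im p" R \<eta> \<epsilon> using R by (intro adj.intro) (simp add: upper_shriek_def)
  have "iso_arrow E (gunit w (FOb R X))" if X: "X \<in> Ob S" for X
  proof (rule w.unit_iso_of_orthogonal[OF ff r.VOb[OF X]])
    show "orthogonal E (gunit w (FOb R X)) (FOb R X)"
      by (rule r.orthogonal_V[OF w.\<eta>[OF r.VOb[OF X]] p_iso[OF w.\<eta>[OF r.VOb[OF X]] unit[OF r.VOb[OF X]]] X])
  qed
  then have above: "above E W.E w S (centre p R \<eta> \<epsilon>)"
    using w.nat_iso_of_unit_iso[OF r.V] unfolding above_def centre_def by auto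
  \<comment> \<open>Within the Weil objects \<open>z\<close> is terminal as well as initial, which
    is the situation of \<open>quality_of_zero\<close>.\<close>
  have "quality_type W.E S (comp_geom W.E S p w)"
  proof (rule W.quality_of_zero[OF geometric_morphism_comp[OF p gw]])
    show "inv_im (comp_geom W.E S p w) = const_func W" using Rs_const by (simp add: comp_geom_def wR K)
    fix c assume "c \<in> Ob W" then show "\<exists>!f. f \<in> Hom W c z" using zero[of c] z_X0 by (simp add: W_Hom)
  qed
  then have "subquality E S p W.E w"
    using p R w above unfolding subquality_def local_geom_def by blast
  moreover have "essential W.E E w" using gw Rs_left_adjoint wR by (simp add: essential_def)
  ultimately show "essential_subquality E S p W.E w" by (simp add: essential_subquality_def)
qed

end

section \<open>The Nullstellensatz\<close>

text \<open>Gaussian elimination: a vector with nonzero last coordinate is the pivot that clears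
  this coordinate from the others, and its own coefficient \<open>c\<close> is solved for
  afterwards.\<close>

lemma linear_dependence:
  fixes a :: "'i \<Rightarrow> nat \<Rightarrow> complex"
  assumes "finite I" "card I > k"
  shows "\<exists>l. (\<exists>i\<in>I. l i \<noteq> 0) \<and> (\<forall>j<k. (\<Sum>i\<in>I. l i * a i j) = 0)"
  using assms
proof (induction k arbitrary: I a)
  case 0
  then show ?case by (intro exI[of _ "\<lambda>_. 1"]) (auto simp: card_gt_0_iff)
next
  case (Suc k)
  show ?case
  proof (cases "\<forall>i\<in>I. a i k = 0")
    case True
    obtain l where "\<exists>i\<in>I. l i \<noteq> 0" "\<forall>j<k. (\<Sum>i\<in>I. l i * a i j) = 0" using Suc.IH[of I a] Suc.prems by auto
    then show ?thesis using True by (intro exI[of _ l]) (auto simp: less_Suc_eq)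
  next
    case False
    then obtain p where p: "p \<in> I" "a p k \<noteq> 0" by blast
    define I' where "I' = I - {p}"
    have I': "finite I'" "card I' > k" "p \<notin> I'" "I = insert p I'" using Suc.prems p by (auto simp: I'_def)
    define a' where "a' = (\<lambda>i j. a i j - a i k / a p k * a p j)"
    obtain l where l: "\<exists>i\<in>I'. l i \<noteq> 0" "\<forall>j<k. (\<Sum>i\<in>I'. l i * a' i j) = 0" using Suc.IH[OF I'(1,2), of a'] by auto
    define c where "c = - (\<Sum>i\<in>I'. l i * a i k) / a p k"
    have eq: "(\<Sum>i\<in>I. (l(p := c)) i * a i j) = (\<Sum>i\<in>I'. l i * a' i j)" for j
    proof -
      have "(\<Sum>i\<in>I. (l(p := c)) i * a i j) = c * a p j + (\<Sum>i\<in>I'. (l(p := c)) i * a i j)"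
        using I' by simp
      also have "(\<Sum>i\<in>I'. (l(p := c)) i * a i j) = (\<Sum>i\<in>I'. l i * a i j)"
        using I'(3) by (intro sum.cong) auto
      also have "c * a p j = - (\<Sum>i\<in>I'. l i * (a i k / a p k * a p j))"
        unfolding c_def minus_mult_left[symmetric] minus_divide_left[symmetric] sum_divide_distrib sum_distrib_right
        by (simp add: ac_simps)
      finally show ?thesis by (simp add: a'_def right_diff_distrib sum_subtractf)
    qed
    have "a' i k = 0" for i using p by (simp add: a'_def)
    then have "\<forall>j<Suc k. (\<Sum>i\<in>I. (l(p := c)) i * a i j) = 0" using eq l(2) by (auto simp: less_Suc_eq)
    moreover have "\<exists>i\<in>I. (l(p := c)) i \<noteq> 0" using l(1) I' by auto
    ultimately show ?thesis by blast
  qed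
qed

lemma complex_ring_simps [simp]:
  "carrier complex_ring = UNIV" "x \<otimes>\<^bsub>complex_ring\<^esub> y = x * y" "\<one>\<^bsub>complex_ring\<^esub> = 1"
  "\<zero>\<^bsub>complex_ring\<^esub> = 0" "x \<oplus>\<^bsub>complex_ring\<^esub> y = x + y"
  by (simp_all add: complex_ring_def)

lemma complex_ring_cring: "cring complex_ring"
  by (intro cringI abelian_groupI comm_monoidI) (auto simp: algebra_simps intro: exI[of _ "- x" for x])

lemma complex_ring_a_inv [simp]: "\<ominus>\<^bsub>complex_ring\<^esub> x = - x"
proof -
  interpret cring complex_ring by (rule complex_ring_cring)
  show ?thesis by (rule minus_equality) auto
qed

section \<open>Scalars, linear combinations and polynomial values in a complex algebra\<close>

locale complex_algebra = algebra complex_ring B for B :: "(complex, 'a) module" (structure)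
begin

lemma smult_in [simp, intro]: "x \<in> carrier B \<Longrightarrow> c \<odot> x \<in> carrier B"
  by (rule smult_closed) simp_all

lemma smult_add_left: "x \<in> carrier B \<Longrightarrow> (c + d) \<odot> x = c \<odot> x \<oplus> d \<odot> x"
  using smult_l_distr[of c d x] by simp

lemma smult_add_right: "x \<in> carrier B \<Longrightarrow> y \<in> carrier B \<Longrightarrow> c \<odot> (x \<oplus> y) = c \<odot> x \<oplus> c \<odot> y"
  using smult_r_distr[of c x y] by simp

lemma smult_smult: "x \<in> carrier B \<Longrightarrow> c \<odot> (d \<odot> x) = (c * d) \<odot> x"
  using smult_assoc1[of c d x] by simp

lemma smult_1 [simp]: "x \<in> carrier B \<Longrightarrow> 1 \<odot> x = x"
  using smult_one[of x] by simp

lemma smult_0 [simp]: "x \<in> carrier B \<Longrightarrow> 0 \<odot> x = \<zero>"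
  using smult_l_null[of x] by simp

lemma smult_zero [simp]: "c \<odot> \<zero> = \<zero>"
  using smult_r_null[of c] by simp

lemma smult_mult_left: "x \<in> carrier B \<Longrightarrow> y \<in> carrier B \<Longrightarrow> (c \<odot> x) \<otimes> y = c \<odot> (x \<otimes> y)"
  using smult_assoc2[of c x y] by simp

lemma smult_mult_right: "x \<in> carrier B \<Longrightarrow> y \<in> carrier B \<Longrightarrow> x \<otimes> (c \<odot> y) = c \<odot> (x \<otimes> y)"
  using smult_mult_left[of y x c] m_comm[of x "c \<odot> y"] m_comm[of x y] by simp

lemma smult_minus_left: "x \<in> carrier B \<Longrightarrow> (- c) \<odot> x = \<ominus> (c \<odot> x)"
  using smult_l_minus[of c x] by simp

lemma smult_diff_left: "x \<in> carrier B \<Longrightarrow> (c - d) \<odot> x = c \<odot> x \<ominus> d \<odot> x"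
  using smult_add_left[of x c "- d"] smult_minus_left[of x d] by (simp add: minus_eq)

lemma ideal_smult:
  assumes "ideal I B" "x \<in> I" shows "c \<odot> x \<in> I"
proof -
  interpret ideal I B by fact
  have "c \<odot> x = (c \<odot> \<one>) \<otimes> x" using smult_mult_left[of \<one> x c] a_Hcarr[OF assms(2)] by simp
  then show ?thesis using I_l_closed[OF assms(2)] by simp
qed

text \<open>Combinations of the first \<open>k\<close> members of a sequence; a common bound
  \<open>k\<close> places elements in one finite-dimensional subspace.\<close>

primrec lin :: "nat \<Rightarrow> (nat \<Rightarrow> complex) \<Rightarrow> (nat \<Rightarrow> _) \<Rightarrow> _" where
  "lin 0 a y = \<zero>"
| "lin (Suc k) a y = lin k a y \<oplus> a k \<odot> y k"

lemma lin_in [simp, intro]: "(\<And>i. y i \<in> carrier B) \<Longrightarrow> lin k a y \<in> carrier B"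
  by (induction k) auto

lemma lin_cong: "(\<And>i. i < k \<Longrightarrow> a i = b i) \<Longrightarrow> (\<And>i. i < k \<Longrightarrow> y i = x i) \<Longrightarrow> lin k a y = lin k b x"
  by (induction k) auto

lemma lin_add: "(\<And>i. y i \<in> carrier B) \<Longrightarrow> lin k (\<lambda>i. a i + b i) y = lin k a y \<oplus> lin k b y"
  by (induction k) (auto simp: smult_add_left a_ac)

lemma lin_scale: "(\<And>i. y i \<in> carrier B) \<Longrightarrow> lin k (\<lambda>i. c * a i) y = c \<odot> lin k a y"
  by (induction k) (auto simp: smult_add_right smult_smult)

lemma lin_zero: "(\<And>i. y i \<in> carrier B) \<Longrightarrow> (\<And>i. i < k \<Longrightarrow> a i = 0) \<Longrightarrow> lin k a y = \<zero>"
  by (induction k) auto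

lemma lin_mult: "x \<in> carrier B \<Longrightarrow> (\<And>i. y i \<in> carrier B) \<Longrightarrow> x \<otimes> lin k a y = lin k a (\<lambda>i. x \<otimes> y i)"
  by (induction k) (auto simp: r_distr smult_mult_right)

lemma lin_lin:
  assumes "\<And>i. y i \<in> carrier B"
  shows "lin n l (\<lambda>i. lin k (a i) y) = lin k (\<lambda>j. \<Sum>i<n. l i * a i j) y"
  using assms by (induction n) (auto simp: lin_zero lin_add lin_scale)

lemma lin_extend:
  assumes "\<And>i. y i \<in> carrier B" "k \<le> n" shows "lin n (\<lambda>i. if i < k then a i else 0) y = lin k a y"
  using assms(2)
proof (induction n)
  case (Suc n)
  show ?case
  proof (cases "k \<le> n")
    case True then show ?thesis using Suc assms(1) by simp
  next
    case False
    then have "k = Suc n" using Suc by simp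
    then show ?thesis using lin_cong[of n "\<lambda>i. if i < Suc n then a i else 0" a y y] by simp
  qed
qed simp

lemma lin_unit:
  assumes "\<And>i. y i \<in> carrier B" "j < k" shows "lin k (\<lambda>i. if i = j then c else 0) y = c \<odot> y j"
  using assms(2)
proof (induction k)
  case (Suc k)
  show ?case
  proof (cases "j = k")
    case True then show ?thesis using lin_zero[of y k "\<lambda>i. if i = j then c else 0"] assms(1) by simp
  next
    case False then show ?thesis using Suc assms(1) by simp
  qed
qed simp

lemma lin_ideal:
  assumes I: "ideal I B" and "\<And>i. y i \<in> carrier B" "\<And>i. x i \<in> carrier B" "\<And>i. i < k \<Longrightarrow> y i \<ominus> x i \<in> I"
  shows "lin k l y \<ominus> lin k l x \<in> I"
  using assms(4)
proof (induction k)
  case 0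
  interpret ideal I B by fact
  show ?case by (simp add: minus_eq)
next
  case (Suc k)
  interpret ideal I B by fact
  have "lin k l y \<ominus> lin k l x \<in> I" using Suc by simp
  moreover have "l k \<odot> (y k \<ominus> x k) \<in> I" using ideal_smult[OF I] Suc.prems by simp
  moreover have "lin (Suc k) l y \<ominus> lin (Suc k) l x = (lin k l y \<ominus> lin k l x) \<oplus> l k \<odot> (y k \<ominus> x k)"
  proof -
    have "l k \<odot> (y k \<ominus> x k) = l k \<odot> y k \<ominus> l k \<odot> x k"
    proof -
      have "l k \<odot> (\<ominus> x k) = \<ominus> (l k \<odot> x k)"
        using smult_minus_left[of "x k" 1] smult_smult[of "x k" "l k" "-1"] smult_minus_left[of "x k" "l k"] assms(3) by simp
      then show ?thesis using smult_add_right[of "y k" "\<ominus> x k" "l k"] assms(2,3) by (simp add: minus_eq)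
    qed
    moreover have "(p \<oplus> q) \<ominus> (r \<oplus> s) = (p \<ominus> r) \<oplus> (q \<ominus> s)"
      if "p \<in> carrier B" "q \<in> carrier B" "r \<in> carrier B" "s \<in> carrier B" for p q r s
      using that by (simp add: minus_eq minus_add a_ac)
    ultimately show ?thesis using assms(2,3) by simp
  qed
  ultimately show ?case by (simp add: a_closed)
qed

text \<open>Horner's scheme for the value of a polynomial at \<open>s\<close>.\<close>

definition ev :: "'a \<Rightarrow> complex poly \<Rightarrow> 'a" where
  "ev s p = foldr (\<lambda>a r. a \<odot> \<one> \<oplus> s \<otimes> r) (coeffs p) \<zero>"

lemma ev_0 [simp]: "ev s 0 = \<zero>"
  by (simp add: ev_def)

lemma ev_pCons: "s \<in> carrier B \<Longrightarrow> ev s (pCons a p) = a \<odot> \<one> \<oplus> s \<otimes> ev s p"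
  by (cases "pCons a p = 0") (auto simp: ev_def cCons_def)

lemma ev_in [simp, intro]: "s \<in> carrier B \<Longrightarrow> ev s p \<in> carrier B"
  by (induction p) (auto simp: ev_pCons)

lemma ev_add: "s \<in> carrier B \<Longrightarrow> ev s (p + q) = ev s p \<oplus> ev s q"
  by (induction p q rule: poly_induct2) (auto simp: ev_pCons smult_add_left r_distr a_ac)

lemma ev_smult: "s \<in> carrier B \<Longrightarrow> ev s (Polynomial.smult c p) = c \<odot> ev s p"
  by (induction p) (auto simp: ev_pCons smult_add_right smult_smult smult_mult_right)

lemma ev_mult: "s \<in> carrier B \<Longrightarrow> ev s (p * q) = ev s p \<otimes> ev s q"
  by (induction p) (auto simp: ev_pCons ev_add ev_smult l_distr smult_mult_left m_assoc)

lemma ev_linear: "s \<in> carrier B \<Longrightarrow> ev s [:- c, 1:] = s \<ominus> c \<odot> \<one>"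
  by (simp add: ev_pCons smult_minus_left minus_eq a_comm)

lemma ev_sum: "s \<in> carrier B \<Longrightarrow> ev s (\<Sum>i<k. Polynomial.smult (l i) (q i)) = lin k l (\<lambda>i. ev s (q i))"
  by (induction k) (auto simp: ev_add ev_smult)

text \<open>The polynomial splits over \<complex>. Each linear factor is removed at the cost of a
  further power of \<open>b\<close>, which is a multiple of that factor modulo \<open>I\<close>; in
  the end a nonzero constant is left in front of a power of \<open>b\<close>.\<close>

lemma power_mem_ideal_of_ev:
  assumes I: "ideal I B" and s: "s \<in> carrier B" and b: "b \<in> carrier B"
    and inv: "\<And>c. \<exists>m. \<exists>y \<in> carrier B. b [^] (m::nat) \<ominus> (s \<ominus> c \<odot> \<one>) \<otimes> y \<in> I"
    and "q \<noteq> 0" "ev s q \<otimes> b [^] (n::nat) \<in> I"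
  shows "\<exists>n::nat. b [^] n \<in> I"
  using assms(5,6)
proof (induction "degree q" arbitrary: q n)
  case 0
  interpret ideal I B by fact
  obtain a where a: "q = [:a:]" using 0(1) by (metis degree_eq_zeroE)
  then have a0: "a \<noteq> 0" using 0 by simp
  have "a \<odot> (b [^] n) \<in> I" using 0(3) a s b by (simp add: ev_pCons smult_mult_left)
  then have "(1 / a) \<odot> (a \<odot> (b [^] n)) \<in> I" by (rule ideal_smult[OF I])
  then show ?case using a0 b by (auto simp: smult_smult)
next
  case (Suc d)
  interpret ideal I B by fact
  have "\<not> constant (poly q)" using Suc(2) constant_degree by (metis Zero_not_Suc)
  then obtain r where "poly q r = 0" using fundamental_theorem_of_algebra by blast
  then obtain q' where q': "q = [:- r, 1:] * q'" by (metis poly_eq_0_iff_dvd dvdE)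
  then have q'0: "q' \<noteq> 0" using Suc.prems by auto
  have "degree q = Suc (degree q')" using q' q'0 by (simp add: degree_mult_eq del: mult_pCons_left)
  then have d: "d = degree q'" using Suc(2) by simp
  obtain m y where y: "y \<in> carrier B" "b [^] (m::nat) \<ominus> (s \<ominus> r \<odot> \<one>) \<otimes> y \<in> I" using inv by blast
  define t where "t = s \<ominus> r \<odot> \<one>"
  have t: "t \<in> carrier B" using s by (simp add: t_def)
  define e where "e = ev s q'"
  have e: "e \<in> carrier B" using s by (simp add: e_def)
  have "ev s q = t \<otimes> e" using ev_mult[OF s, of "[:- r, 1:]" q'] ev_linear[OF s, of r] q' by (simp add: t_def e_def)
  then have 1: "(t \<otimes> e) \<otimes> b [^] n \<in> I" using Suc.prems(2) by simp
  have 2: "(e \<otimes> b [^] n) \<otimes> (b [^] m \<ominus> t \<otimes> y) \<in> I"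
    using y(2) e b by (intro I_l_closed) (simp_all add: t_def)
  have 3: "((t \<otimes> e) \<otimes> b [^] n) \<otimes> y \<in> I" by (rule I_r_closed[OF 1 y(1)])
  \<comment> \<open>The power \<open>b [^] m\<close> is split into a part in \<open>I\<close> and a
    multiple of \<open>t\<close>; the factor \<open>t\<close> completes \<open>e\<close> to
    \<open>ev s q\<close>.\<close>
  have "e \<otimes> b [^] (n + m) = ((e \<otimes> b [^] n) \<otimes> (b [^] m \<ominus> t \<otimes> y)) \<oplus> (((t \<otimes> e) \<otimes> b [^] n) \<otimes> y)"
  proof -
    define u v where "u = b [^] n" and "v = b [^] m"
    have uv: "u \<in> carrier B" "v \<in> carrier B" using b by (auto simp: u_def v_def)
    have "(e \<otimes> u) \<otimes> (v \<ominus> t \<otimes> y) \<oplus> ((t \<otimes> e) \<otimes> u) \<otimes> y = e \<otimes> (u \<otimes> v)"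
      using e t uv y(1) by algebra
    then show ?thesis using b by (simp add: u_def v_def nat_pow_mult)
  qed
  then have "ev s q' \<otimes> b [^] (n + m) \<in> I" using 2 3 by (simp add: e_def a_closed)
  then show ?case using Suc(1)[OF d q'0] by blast
qed

text \<open>Uncountably many complex numbers are distributed over countably many pairs, so some
  fibre is infinite.\<close>

lemma infinite_fibre:
  fixes \<phi> :: "complex \<Rightarrow> nat \<times> nat"
  shows "\<exists>c :: nat \<Rightarrow> complex. inj c \<and> (\<forall>i. \<phi> (c i) = \<phi> (c 0))"
proof -
  have "\<exists>v. infinite {x. \<phi> x = v}"
  proof (rule ccontr)
    assume "\<not> ?thesis"
    then have fin: "finite {x. \<phi> x = v}" for v by blast
    have "countable (\<Union>v. {x. \<phi> x = v})"
      by (rule countable_UN[OF countableI_type]) (rule countable_finite[OF fin])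
    moreover have "(\<Union>v. {x. \<phi> x = v}) = UNIV" by auto
    ultimately have "countable (UNIV :: complex set)" by simp
    then have "countable (range complex_of_real)" by (rule countable_subset[rotated]) simp
    then have "countable (UNIV :: real set)" using countable_image_inj_eq[of complex_of_real UNIV] by (simp add: inj_of_real)
    then show False using uncountable_UNIV_real by simp
  qed
  then obtain v where "infinite {x. \<phi> x = v}" by blast
  then obtain c :: "nat \<Rightarrow> complex" where "inj c" "range c \<subseteq> {x. \<phi> x = v}" by (meson infinite_countable_subset)
  then have "\<phi> (c i) = v" for i by blast
  then show ?thesis using \<open>inj c\<close> by metis
qed

text \<open>
  The weak Nullstellensatz over an uncountable field, without localisation: were \<open>b\<close> nilpotent
  modulo every \<open>I + (s - c)\<close>, then uncountably many \<open>y\<^sub>c\<close> with \<open>b\<^sup>n \<equiv> (s - c) y\<^sub>c\<close> would lie in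
  one finite-dimensional subspace, and a linear dependence between them is a nonzero
  polynomial \<open>q\<close> with \<open>q(s) b\<^sup>n \<in> I\<close>.
\<close>

lemma avoid_power_step:
  assumes I: "ideal I B" and b: "b \<in> carrier B" and bI: "\<And>n::nat. b [^] n \<notin> I" and s: "s \<in> carrier B"
    and M: "\<And>i::nat. M i \<in> carrier B" and span: "\<And>y. y \<in> carrier B \<Longrightarrow> \<exists>k a. y = lin k a M"
  shows "\<exists>c. \<forall>n::nat. b [^] n \<notin> I <+>\<^bsub>B\<^esub> PIdl (s \<ominus> c \<odot> \<one>)"
proof (rule ccontr)
  interpret ideal I B by fact
  assume neg: "\<not> ?thesis"
  have ex: "\<exists>n k a. b [^] (n::nat) \<ominus> (s \<ominus> c \<odot> \<one>) \<otimes> lin k a M \<in> I" for c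
  proof -
    have t: "s \<ominus> c \<odot> \<one> \<in> carrier B" using s by simp
    obtain n where "b [^] (n::nat) \<in> I <+>\<^bsub>B\<^esub> PIdl (s \<ominus> c \<odot> \<one>)" using neg by blast
    then obtain i y where iy: "i \<in> I" "y \<in> carrier B" "b [^] n = i \<oplus> y \<otimes> (s \<ominus> c \<odot> \<one>)"
      by (auto simp: set_add_def' cgenideal_def)
    obtain k a where y: "y = lin k a M" using span[OF iy(2)] by blast
    have i: "i \<in> carrier B" using iy(1) by (rule a_Hcarr)
    have "i = b [^] n \<ominus> (s \<ominus> c \<odot> \<one>) \<otimes> y"
    proof -
      define t where "t = s \<ominus> c \<odot> \<one>"
      have "t \<in> carrier B" using s by (simp add: t_def)
      then have "(i \<oplus> y \<otimes> t) \<ominus> t \<otimes> y = i" using i iy(2) by algebra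
      then show ?thesis using iy(3) by (simp add: t_def)
    qed
    then show ?thesis using iy(1) y by blast
  qed
  then obtain n k a where nka: "\<And>c. b [^] (n c :: nat) \<ominus> (s \<ominus> c \<odot> \<one>) \<otimes> lin (k c) (a c) M \<in> I" by metis
  \<comment> \<open>The pair attached to a scalar is its exponent of \<open>b\<close> and its number
    of vectors of \<open>M\<close>. Fixing the pair along infinitely many scalars makes one exponent
    and one finite-dimensional space serve all of them.\<close>
  obtain c :: "nat \<Rightarrow> complex" where c: "inj c" "\<And>i. (n (c i), k (c i)) = (n (c 0), k (c 0))"
    using infinite_fibre[of "\<lambda>c. (n c, k c)"] by blast
  define N m where "N = n (c 0)" and "m = k (c 0)"
  have nk: "n (c i) = N" "k (c i) = m" for i using c(2)[of i] by (auto simp: N_def m_def)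
  \<comment> \<open>\<open>Suc m\<close> elements of a space spanned by \<open>m\<close> vectors are
    dependent.\<close>
  obtain l where l: "\<exists>i\<in>{..<Suc m}. l i \<noteq> 0" "\<forall>j<m. (\<Sum>i\<in>{..<Suc m}. l i * a (c i) j) = 0"
    using linear_dependence[of "{..<Suc m}" m "\<lambda>i. a (c i)"] by auto
  define y where "y = (\<lambda>i. lin m (a (c i)) M)"
  have y: "y i \<in> carrier B" for i using M by (simp add: y_def)
  have ly: "lin (Suc m) l y = \<zero>"
    unfolding y_def lin_lin[OF M] by (rule lin_zero[OF M]) (use l(2) in simp)
  \<comment> \<open>The products of Lagrange interpolation: \<open>q i\<close> omits the factor at
    \<open>c i\<close>, so multiplying the congruence for \<open>c i\<close> by its value at
    \<open>s\<close> yields the same multiplier \<open>ev s Q\<close> for every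
    \<open>i\<close>.\<close>
  define q where "q = (\<lambda>i. \<Prod>j\<in>{..<Suc m} - {i}. [:- c j, 1:])"
  define Q where "Q = (\<Prod>j\<in>{..<Suc m}. [:- c j, 1:])"
  have Qq: "Q = q i * [:- c i, 1:]" if "i < Suc m" for i
    using that prod.remove[of "{..<Suc m}" i "\<lambda>j. [:- c j, 1:]"] unfolding Q_def q_def by (simp only: finite_lessThan lessThan_iff mult.commute)
  have cong: "ev s (q i) \<otimes> b [^] N \<ominus> ev s Q \<otimes> y i \<in> I" if i: "i < Suc m" for i
  proof -
    define t where "t = s \<ominus> c i \<odot> \<one>"
    have t: "t \<in> carrier B" using s by (simp add: t_def)
    have "b [^] N \<ominus> t \<otimes> y i \<in> I" using nka[of "c i"] by (simp add: nk y_def t_def)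
    then have "ev s (q i) \<otimes> (b [^] N \<ominus> t \<otimes> y i) \<in> I" using s by (intro I_l_closed) auto
    moreover have "ev s Q = ev s (q i) \<otimes> t" by (simp only: Qq[OF i] ev_mult[OF s] ev_linear[OF s] t_def)
    moreover have "e \<otimes> (u \<ominus> t \<otimes> w) = e \<otimes> u \<ominus> (e \<otimes> t) \<otimes> w" if "e \<in> carrier B" "u \<in> carrier B" "w \<in> carrier B" for e u w
      using that t by algebra
    ultimately show ?thesis using s b y by simp
  qed
  \<comment> \<open>In the combination of the congruences with coefficients \<open>l\<close> the
    terms with \<open>ev s Q\<close> cancel, since the elements \<open>y i\<close> combine to zero;
    the value of \<open>r\<close> is what stands in front of \<open>b [^] N\<close>.\<close>
  define r where "r = (\<Sum>i<Suc m. Polynomial.smult (l i) (q i))"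
  have "ev s r \<otimes> b [^] N = lin (Suc m) l (\<lambda>i. ev s (q i) \<otimes> b [^] N)"
    using lin_mult[of "b [^] N" "\<lambda>i. ev s (q i)" "Suc m" l] s b m_comm[of "b [^] N"]
    unfolding r_def ev_sum[OF s] by (simp del: lin.simps)
  moreover have "lin (Suc m) l (\<lambda>i. ev s Q \<otimes> y i) = \<zero>"
    using lin_mult[of "ev s Q" y "Suc m" l] y s ly by (simp del: lin.simps)
  moreover have "lin (Suc m) l (\<lambda>i. ev s (q i) \<otimes> b [^] N) \<ominus> lin (Suc m) l (\<lambda>i. ev s Q \<otimes> y i) \<in> I"
    by (rule lin_ideal[OF I]) (use s b y cong in auto)
  ultimately have evr: "ev s r \<otimes> b [^] N \<in> I" using s b by (simp add: minus_eq del: lin.simps)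
  \<comment> \<open>At \<open>c i\<close> all terms but the one with index \<open>i\<close> vanish,
    and that one is a product of differences of distinct scalars with a nonzero coefficient.\<close>
  have r0: "r \<noteq> 0"
  proof -
    obtain i where i: "i < Suc m" "l i \<noteq> 0" using l(1) by auto
    have "poly (q j) (c i) = 0" if "j < Suc m" "j \<noteq> i" for j
    proof -
      have "i \<in> {..<Suc m} - {j}" using i that by auto
      then show ?thesis unfolding q_def poly_prod by (intro prod_zero) (auto intro!: bexI[of _ i])
    qed
    then have "poly r (c i) = (\<Sum>j<Suc m. if j = i then l i * poly (q i) (c i) else 0)"
      unfolding r_def poly_sum by (intro sum.cong) auto
    also have "\<dots> = l i * poly (q i) (c i)" using i by (simp del: sum.lessThan_Suc)
    finally have "poly r (c i) = l i * (\<Prod>j\<in>{..<Suc m} - {i}. c i - c j)" by (simp add: q_def poly_prod)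
    moreover have "(\<Prod>j\<in>{..<Suc m} - {i}. c i - c j) \<noteq> 0" using c(1) by (auto simp: inj_eq)
    ultimately have "poly r (c i) \<noteq> 0" using i by simp
    then show ?thesis by auto
  qed
  have "\<exists>n::nat. b [^] n \<in> I"
  proof (rule power_mem_ideal_of_ev[OF I s b _ r0 evr])
    fix c show "\<exists>m. \<exists>y\<in>carrier B. b [^] (m::nat) \<ominus> (s \<ominus> c \<odot> \<one>) \<otimes> y \<in> I"
      using nka[of c] M by blast
  qed
  then show False using bI by blast
qed

text \<open>One element of \<open>T\<close> after another is made congruent to a scalar, while no
  power of \<open>b\<close> is allowed to enter the ideal.\<close>

lemma avoid_power:
  assumes "finite T" "T \<subseteq> carrier B" and b: "b \<in> carrier B" and b0: "\<And>n::nat. b [^] n \<noteq> \<zero>"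
    and M: "\<And>i::nat. M i \<in> carrier B" and span: "\<And>y. y \<in> carrier B \<Longrightarrow> \<exists>k a. y = lin k a M"
  shows "\<exists>I. ideal I B \<and> (\<forall>n::nat. b [^] n \<notin> I) \<and> (\<forall>s\<in>T. \<exists>c. s \<ominus> c \<odot> \<one> \<in> I)"
  using assms(1,2)
proof (induction T)
  case empty
  show ?case using zeroideal b0 by (intro exI[of _ "{\<zero>}"]) auto
next
  case (insert s T)
  then obtain I where I: "ideal I B" "\<And>n::nat. b [^] n \<notin> I" "\<forall>s\<in>T. \<exists>c. s \<ominus> c \<odot> \<one> \<in> I" by auto
  have s: "s \<in> carrier B" using insert by simp
  obtain c where c: "\<forall>n::nat. b [^] n \<notin> I <+>\<^bsub>B\<^esub> PIdl (s \<ominus> c \<odot> \<one>)"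
    using avoid_power_step[OF I(1) b I(2) s M span] by blast
  define t where "t = s \<ominus> c \<odot> \<one>"
  have t: "t \<in> carrier B" using s by (simp add: t_def)
  have P: "ideal (PIdl t) B" by (rule cgenideal_ideal[OF t])
  define J where "J = I <+>\<^bsub>B\<^esub> PIdl t"
  have J: "ideal J B" unfolding J_def by (rule add_ideals[OF I(1) P])
  have zI: "\<zero> \<in> I" "\<zero> \<in> PIdl t" using I(1) P additive_subgroup.zero_closed ideal.axioms(1) by metis+
  have "I \<subseteq> J"
  proof
    fix x assume x: "x \<in> I"
    then have "x \<in> carrier B" using I(1) ideal.Icarr by metis
    then show "x \<in> J" unfolding J_def set_add_def' using x zI by force
  qed
  moreover have "t \<in> J"
    unfolding J_def set_add_def' using cgenideal_self[OF t] zI t by force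
  ultimately have "\<forall>s'\<in>insert s T. \<exists>c. s' \<ominus> c \<odot> \<one> \<in> J" using I(3) unfolding t_def by blast
  then show ?case using J c unfolding J_def t_def by blast
qed

section \<open>Spanning by monomials in the generators\<close>

inductive_set monomials :: "'a set \<Rightarrow> 'a set" for T where
  mono_one: "\<one> \<in> monomials T"
| mono_mult: "t \<in> T \<Longrightarrow> m \<in> monomials T \<Longrightarrow> t \<otimes> m \<in> monomials T"

inductive_set lspan :: "'a set \<Rightarrow> 'a set" for X where
  lspan_zero: "\<zero> \<in> lspan X"
| lspan_add: "x \<in> X \<Longrightarrow> y \<in> lspan X \<Longrightarrow> a \<odot> x \<oplus> y \<in> lspan X"

lemma lspan_carrier: assumes "X \<subseteq> carrier B" "y \<in> lspan X" shows "y \<in> carrier B"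
  using assms(2) by (induction rule: lspan.induct) (use assms(1) in auto)

lemma lspan_base: "X \<subseteq> carrier B \<Longrightarrow> x \<in> X \<Longrightarrow> x \<in> lspan X"
  using lspan_add[OF _ lspan_zero, of x X 1] by (auto simp: subset_iff)

lemma lspan_plus:
  assumes X: "X \<subseteq> carrier B" and "y \<in> lspan X" and z: "z \<in> lspan X" shows "y \<oplus> z \<in> lspan X"
  using assms(2)
proof (induction rule: lspan.induct)
  case lspan_zero then show ?case using lspan_carrier[OF X z] z by simp
next
  case (lspan_add x y a)
  have "a \<odot> x \<oplus> y \<oplus> z = a \<odot> x \<oplus> (y \<oplus> z)"
    using lspan_add X lspan_carrier[OF X] z by (intro a_assoc) auto
  then show ?case using lspan.lspan_add[OF lspan_add(1) lspan_add(3)] by simp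
qed

lemma lspan_smult:
  assumes X: "X \<subseteq> carrier B" and "y \<in> lspan X" shows "c \<odot> y \<in> lspan X"
  using assms(2)
proof (induction rule: lspan.induct)
  case lspan_zero then show ?case using lspan.lspan_zero by simp
next
  case (lspan_add x y a)
  have x: "x \<in> carrier B" using lspan_add(1) X by blast
  have "c \<odot> (a \<odot> x \<oplus> y) = (c * a) \<odot> x \<oplus> c \<odot> y"
    using smult_add_right[of "a \<odot> x" y c] smult_smult[OF x] x lspan_carrier[OF X lspan_add(2)] by simp
  then show ?case using lspan.lspan_add[OF lspan_add(1) lspan_add(3)] by simp
qed

lemma lspan_mult:
  assumes X: "X \<subseteq> carrier B" and Y: "Y \<subseteq> carrier B" and t: "t \<in> carrier B"
    and step: "\<And>x. x \<in> X \<Longrightarrow> t \<otimes> x \<in> lspan Y" and "y \<in> lspan X"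
  shows "t \<otimes> y \<in> lspan Y"
  using assms(5)
proof (induction rule: lspan.induct)
  case lspan_zero then show ?case using t lspan.lspan_zero by simp
next
  case (lspan_add x y a)
  have x: "x \<in> carrier B" using lspan_add(1) X by blast
  have "t \<otimes> (a \<odot> x \<oplus> y) = a \<odot> (t \<otimes> x) \<oplus> t \<otimes> y"
    using r_distr[of "a \<odot> x" y t] smult_mult_right[OF t x] x t lspan_carrier[OF X lspan_add(2)] by simp
  then show ?case using lspan_plus[OF Y lspan_smult[OF Y step[OF lspan_add(1)]] lspan_add(3)] by simp
qed

lemma monomials_carrier: assumes "T \<subseteq> carrier B" "m \<in> monomials T" shows "m \<in> carrier B"
  using assms(2) by (induction rule: monomials.induct) (use assms(1) in auto)

lemma submodule_lspan: assumes X: "X \<subseteq> carrier B" shows "submodule (lspan X) complex_ring B"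
proof (rule submoduleI)
  fix y assume y: "y \<in> lspan X"
  show "\<ominus> y \<in> lspan X" using lspan_smult[OF X y, of "- 1"] smult_minus_left[OF lspan_carrier[OF X y], of 1] lspan_carrier[OF X y] by simp
qed (use lspan_carrier[OF X] lspan_plus[OF X] lspan_smult[OF X] lspan.lspan_zero in auto)

text \<open>A subspace containing \<open>1\<close> and stable under multiplication by generators is everything,
  because its stabiliser is a subalgebra.\<close>

lemma stable_subspace:
  assumes gen: "\<And>C. subalg complex_ring B C \<Longrightarrow> T \<subseteq> C \<Longrightarrow> C = carrier B" and T: "T \<subseteq> carrier B"
    and V: "submodule V complex_ring B" and V1: "\<one> \<in> V" and stab: "\<And>t v. t \<in> T \<Longrightarrow> v \<in> V \<Longrightarrow> t \<otimes> v \<in> V"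
  shows "V = carrier B"
proof
  note VE = submoduleE[OF V]
  show "V \<subseteq> carrier B" by (rule VE(1))
  have Vc: "v \<in> carrier B" if "v \<in> V" for v using that VE(1) by blast
  have V0: "\<zero> \<in> V" using subgroup.one_closed[OF submodule.axioms(1)[OF V]] by simp
  define C where "C = {x \<in> carrier B. \<forall>v\<in>V. x \<otimes> v \<in> V}"
  have neg: "\<ominus> x \<in> C" if "x \<in> C" for x
    using that VE(3) Vc by (auto simp: C_def l_minus)
  have "submodule C complex_ring B"
    by (rule submoduleI)
      (use VE Vc neg V0 in \<open>auto simp: C_def l_distr smult_mult_left\<close>)
  moreover have "subring C B"
    by (rule subringI) (use VE Vc neg in \<open>auto simp: C_def l_distr m_assoc\<close>)
  ultimately have "C = carrier B"
    using T stab by (intro gen) (auto simp: subalg_def C_def)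
  then have "x \<in> C" if "x \<in> carrier B" for x using that by simp
  then have "x \<otimes> \<one> \<in> V" if "x \<in> carrier B" for x using that V1 unfolding C_def by blast
  then show "carrier B \<subseteq> V" by auto
qed

lemma monomials_span:
  assumes gen: "\<And>C. subalg complex_ring B C \<Longrightarrow> T \<subseteq> C \<Longrightarrow> C = carrier B" and T: "T \<subseteq> carrier B"
  shows "lspan (monomials T) = carrier B"
proof -
  have M: "monomials T \<subseteq> carrier B" using monomials_carrier[OF T] by blast
  show ?thesis
  proof (rule stable_subspace[OF gen T submodule_lspan[OF M] lspan_base[OF M mono_one]])
    fix t v assume t: "t \<in> T" and v: "v \<in> lspan (monomials T)"
    show "t \<otimes> v \<in> lspan (monomials T)"
      by (rule lspan_mult[OF M M _ _ v]) (use t T lspan_base[OF M mono_mult[OF t]] in auto)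
  qed
qed

text \<open>Countability lets a spanning set be listed as a sequence, which is the form in which
  \<open>avoid_power\<close> takes it.\<close>

lemma countable_monomials:
  assumes "countable T" shows "countable (monomials T)"
proof -
  have "monomials T \<subseteq> (\<lambda>ts. foldr (\<otimes>) ts \<one>) ` lists T"
  proof
    fix m assume "m \<in> monomials T"
    then show "m \<in> (\<lambda>ts. foldr (\<otimes>) ts \<one>) ` lists T"
    proof (induction rule: monomials.induct)
      case mono_one show ?case by (rule image_eqI[of _ _ "[]"]) auto
    next
      case (mono_mult t m)
      then obtain ts where "ts \<in> lists T" "m = foldr (\<otimes>) ts \<one>" by blast
      then show ?case using mono_mult(1) by (intro image_eqI[of _ _ "t # ts"]) auto
    qed
  qed
  then show ?thesis by (rule countable_subset) (rule countable_image[OF countable_lists[OF assms]])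
qed

lemma lspan_lin:
  assumes M: "\<And>i::nat. M i \<in> carrier B" and "y \<in> lspan (range M)"
  shows "\<exists>k a. y = lin k a M"
  using assms(2)
proof (induction rule: lspan.induct)
  case lspan_zero show ?case by (intro exI[of _ 0]) simp
next
  case (lspan_add x y c)
  then obtain j k a where x: "x = M j" and y: "y = lin k a M" by blast
  \<comment> \<open>A common length that covers the index of the new vector and the old combination;
    coefficients are padded with zeros.\<close>
  define n where "n = max (Suc j) k"
  have "c \<odot> x = lin n (\<lambda>i. if i = j then c else 0) M" unfolding x by (rule lin_unit[OF M, symmetric]) (simp add: n_def)
  moreover have "y = lin n (\<lambda>i. if i < k then a i else 0) M" unfolding y by (rule lin_extend[OF M, symmetric]) (simp add: n_def)
  ultimately have "c \<odot> x \<oplus> y = lin n (\<lambda>i. (if i = j then c else 0) + (if i < k then a i else 0)) M"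
    by (simp add: lin_add[OF M])
  then show ?case by blast
qed

text \<open>Modulo the ideal \<open>I\<close> all generators are scalars, hence all elements are,
  and the scalar is unique because \<open>\<one>\<close> lies outside \<open>I\<close>. This scalar
  is the value of the character, nonzero at \<open>b\<close> because \<open>b\<close> lies outside
  \<open>I\<close> as well.\<close>

theorem nullstellensatz:
  assumes fg: "fg_algebra complex_ring B" and b: "b \<in> carrier B" and b0: "\<And>n::nat. b [^] n \<noteq> \<zero>"
  shows "\<exists>\<chi> \<in> ring_hom B complex_ring. (\<forall>c. \<forall>x \<in> carrier B. \<chi> (c \<odot> x) = c * \<chi> x) \<and> \<chi> b \<noteq> 0"
proof -
  obtain T where T: "finite T" "T \<subseteq> carrier B" and gen: "\<And>C. subalg complex_ring B C \<Longrightarrow> T \<subseteq> C \<Longrightarrow> C = carrier B"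
    using fg unfolding fg_algebra_def by blast
  define M where "M = from_nat_into (monomials T)"
  have ne: "monomials T \<noteq> {}" using mono_one by blast
  have rM: "range M = monomials T"
    unfolding M_def by (rule range_from_nat_into[OF ne countable_monomials[OF countable_finite[OF T(1)]]])
  have M: "M i \<in> carrier B" for i using rM monomials_carrier[OF T(2)] by blast
  have span: "\<exists>k a. y = lin k a M" if "y \<in> carrier B" for y
    using lspan_lin[OF M, of y] monomials_span[OF gen T(2)] that rM by simp
  obtain I where I: "ideal I B" and bI: "\<And>n::nat. b [^] n \<notin> I" and TI: "\<And>s. s \<in> T \<Longrightarrow> \<exists>c. s \<ominus> c \<odot> \<one> \<in> I"
    using avoid_power[OF T b b0 M span] by blast
  interpret ideal I B by fact
  \<comment> \<open>\<open>\<one>\<close> is the zeroth power of \<open>b\<close>.\<close>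
  have oneI: "\<one> \<notin> I" using bI[of 0] by simp
  define R where "R = (\<lambda>x c. x \<in> carrier B \<and> x \<ominus> c \<odot> \<one> \<in> I)"
  have R_add: "R (x \<oplus> y) (c + d)" if "R x c" "R y d" for x y c d
  proof -
    have "(x \<oplus> y) \<ominus> (c + d) \<odot> \<one> = (x \<ominus> c \<odot> \<one>) \<oplus> (y \<ominus> d \<odot> \<one>)"
      using that by (simp add: R_def smult_add_left minus_eq minus_add a_ac)
    then show ?thesis using that by (simp add: R_def a_closed)
  qed
  have R_mult: "R (x \<otimes> y) (c * d)" if "R x c" "R y d" for x y c d
  proof -
    have xy: "x \<in> carrier B" "y \<in> carrier B" using that by (auto simp: R_def)
    have e: "(c * d) \<odot> \<one> = (c \<odot> \<one>) \<otimes> (d \<odot> \<one>)" by (simp add: smult_mult_left smult_smult)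
    define u v where "u = c \<odot> \<one>" and "v = d \<odot> \<one>"
    have uv: "u \<in> carrier B" "v \<in> carrier B" by (auto simp: u_def v_def)
    have "x \<otimes> y \<ominus> u \<otimes> v = (x \<ominus> u) \<otimes> y \<oplus> u \<otimes> (y \<ominus> v)" using xy uv by algebra
    moreover have "(x \<ominus> u) \<otimes> y \<in> I" "u \<otimes> (y \<ominus> v) \<in> I"
      using I_r_closed[of "x \<ominus> u" y] I_l_closed[of "y \<ominus> v" u] that xy uv by (auto simp: R_def u_def v_def)
    ultimately show ?thesis using xy e by (simp add: R_def u_def v_def a_closed)
  qed
  have R_smult: "R (c \<odot> x) (c * d)" if "R x d" for c x d
  proof -
    have "R (c \<odot> \<one>) c" by (simp add: R_def r_neg minus_eq zero_closed)
    then show ?thesis using R_mult[OF _ that, of "c \<odot> \<one>" c] that by (simp add: R_def smult_mult_left)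
  qed
  have R_one: "R \<one> 1" by (simp add: R_def r_neg minus_eq)
  have R_zero: "R \<zero> 0" using R_smult[OF R_one, of 0] by simp
  \<comment> \<open>The elements congruent to a scalar form a subalgebra that contains the
    generators, so this is the whole algebra.\<close>
  define C where "C = {x. \<exists>c. R x c}"
  have C_add: "x \<oplus> y \<in> C" and C_mult: "x \<otimes> y \<in> C" if "x \<in> C" "y \<in> C" for x y
    using that R_add R_mult unfolding C_def by blast+
  have C_smult: "c \<odot> x \<in> C" if "x \<in> C" for x c
    using that R_smult unfolding C_def by blast
  have C_01: "\<zero> \<in> C" "\<one> \<in> C" using R_zero R_one unfolding C_def by blast+
  have C_neg: "\<ominus> x \<in> C" if x: "x \<in> C" for x
  proof -
    obtain c where "R x c" using x by (auto simp: C_def)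
    then have "R (\<ominus> x) (- 1 * c)" using R_smult[of x c "- 1"] smult_minus_left[of x 1] by (simp add: R_def)
    then show ?thesis by (auto simp: C_def)
  qed
  have "submodule C complex_ring B"
  proof (rule submoduleI)
    show "C \<subseteq> carrier B" by (auto simp: C_def R_def)
  qed (use C_01 C_add C_smult C_neg in auto)
  moreover have "subring C B"
  proof (rule subringI)
    show "C \<subseteq> carrier B" by (auto simp: C_def R_def)
  qed (use C_01 C_add C_mult C_neg in auto)
  moreover have "T \<subseteq> C" using TI T(2) by (auto simp: C_def R_def)
  ultimately have C: "C = carrier B" by (intro gen) (simp_all add: subalg_def)
  have R_unique: "c = d" if "R x c" "R x d" for x c d
  proof (rule ccontr)
    assume "c \<noteq> d"
    have x: "x \<in> carrier B" using that by (simp add: R_def)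
    have "(x \<ominus> d \<odot> \<one>) \<ominus> (x \<ominus> c \<odot> \<one>) \<in> I"
      using that by (simp add: R_def minus_eq a_closed a_inv_closed)
    moreover have "(x \<ominus> d \<odot> \<one>) \<ominus> (x \<ominus> c \<odot> \<one>) = (c - d) \<odot> \<one>"
    proof -
      define u v where "u = c \<odot> \<one>" and "v = d \<odot> \<one>"
      have "u \<in> carrier B" "v \<in> carrier B" by (auto simp: u_def v_def)
      then have "(x \<ominus> v) \<ominus> (x \<ominus> u) = u \<ominus> v" using x by algebra
      then show ?thesis by (simp add: u_def v_def smult_diff_left)
    qed
    ultimately have "(1 / (c - d)) \<odot> ((c - d) \<odot> \<one>) \<in> I" using ideal_smult[OF I] by simp
    then show False using \<open>c \<noteq> d\<close> oneI by (simp add: smult_smult)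
  qed
  define \<chi> where "\<chi> = (\<lambda>x. THE c. R x c)"
  have \<chi>_eq: "\<chi> x = c" if "R x c" for x c unfolding \<chi>_def using that R_unique by blast
  have \<chi>: "R x (\<chi> x)" if "x \<in> carrier B" for x
  proof -
    have "x \<in> C" using that C by simp
    then obtain c where "R x c" unfolding C_def by blast
    then show ?thesis using \<chi>_eq by simp
  qed
  have "\<chi> \<in> ring_hom B complex_ring"
    by (rule ring_hom_memI) (use \<chi> \<chi>_eq R_add R_mult R_one in auto)
  moreover have "\<chi> (c \<odot> x) = c * \<chi> x" if "x \<in> carrier B" for c x
    using \<chi>_eq[OF R_smult[OF \<chi>[OF that]]] .
  moreover have "\<chi> b \<noteq> 0"
  proof
    assume "\<chi> b = 0"
    then have "b \<in> I" using \<chi>[OF b] b by (simp add: R_def minus_eq)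
    then show False using bI[of 1] b by simp
  qed
  ultimately show ?thesis by blast
qed

end

section \<open>Weil algebras\<close>

text \<open>\<complex> as an algebra over itself; homomorphisms into it are the points of an
  algebra.\<close>

definition complex_alg :: "(complex, complex) module" where
  "complex_alg = \<lparr>carrier = UNIV, monoid.mult = (*), one = 1, zero = 0, add = (+), module.smult = (*)\<rparr>"

lemma complex_alg_simps [simp]:
  "carrier complex_alg = UNIV" "x \<otimes>\<^bsub>complex_alg\<^esub> y = x * y" "\<one>\<^bsub>complex_alg\<^esub> = 1"
  "\<zero>\<^bsub>complex_alg\<^esub> = 0" "x \<oplus>\<^bsub>complex_alg\<^esub> y = x + y" "x \<odot>\<^bsub>complex_alg\<^esub> y = x * y"
  by (simp_all add: complex_alg_def)

lemma complex_alg_algebra: "algebra complex_ring complex_alg"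
proof (rule algebraI[OF complex_ring_cring])
  show "cring complex_alg"
    by (intro cringI abelian_groupI comm_monoidI) (auto simp: algebra_simps intro: exI[of _ "- x" for x])
qed (simp_all add: algebra_simps)

lemma complex_algebra_complex_alg: "complex_algebra complex_alg"
  by (rule complex_algebra.intro[OF complex_alg_algebra])

lemma complex_alg_minus [simp]: "x \<ominus>\<^bsub>complex_alg\<^esub> y = x - y"
proof -
  interpret algebra complex_ring complex_alg by (rule complex_alg_algebra)
  have "\<ominus>\<^bsub>complex_alg\<^esub> y = - y" by (rule M.minus_equality) auto
  then show ?thesis by (simp add: a_minus_def)
qed

lemma alg_homI:
  assumes "\<And>x. x \<in> carrier A \<Longrightarrow> h x \<in> carrier B"
    "\<And>x y. x \<in> carrier A \<Longrightarrow> y \<in> carrier A \<Longrightarrow> h (x \<oplus>\<^bsub>A\<^esub> y) = h x \<oplus>\<^bsub>B\<^esub> h y"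
    "\<And>x y. x \<in> carrier A \<Longrightarrow> y \<in> carrier A \<Longrightarrow> h (x \<otimes>\<^bsub>A\<^esub> y) = h x \<otimes>\<^bsub>B\<^esub> h y"
    "h \<one>\<^bsub>A\<^esub> = \<one>\<^bsub>B\<^esub>" "\<And>c x. x \<in> carrier A \<Longrightarrow> h (c \<odot>\<^bsub>A\<^esub> x) = c \<odot>\<^bsub>B\<^esub> h x"
  shows "h \<in> alg_hom complex_ring A B"
  using assms by (auto simp: alg_hom_def intro: ring_hom_memI)

lemma alg_homD:
  assumes "h \<in> alg_hom complex_ring A B"
  shows "x \<in> carrier A \<Longrightarrow> h x \<in> carrier B"
    "x \<in> carrier A \<Longrightarrow> y \<in> carrier A \<Longrightarrow> h (x \<oplus>\<^bsub>A\<^esub> y) = h x \<oplus>\<^bsub>B\<^esub> h y"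
    "x \<in> carrier A \<Longrightarrow> y \<in> carrier A \<Longrightarrow> h (x \<otimes>\<^bsub>A\<^esub> y) = h x \<otimes>\<^bsub>B\<^esub> h y"
    "h \<one>\<^bsub>A\<^esub> = \<one>\<^bsub>B\<^esub>" "x \<in> carrier A \<Longrightarrow> h (c \<odot>\<^bsub>A\<^esub> x) = c \<odot>\<^bsub>B\<^esub> h x"
  using assms by (auto simp: alg_hom_def ring_hom_closed ring_hom_add ring_hom_mult ring_hom_one)

lemma alg_hom_comp:
  "h \<in> alg_hom complex_ring A B \<Longrightarrow> k \<in> alg_hom complex_ring B D \<Longrightarrow> compose (carrier A) k h \<in> alg_hom complex_ring A D"
  if "complex_algebra A"
proof -
  interpret complex_algebra A by fact
  assume h: "h \<in> alg_hom complex_ring A B" and k: "k \<in> alg_hom complex_ring B D"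
  show ?thesis
    by (rule alg_homI) (simp_all add: compose_def alg_homD[OF h] alg_homD[OF k])
qed

context complex_algebra
begin

lemma alg_hom_restrict: "h \<in> alg_hom complex_ring B D \<Longrightarrow> restrict h (carrier B) \<in> alg_hom complex_ring B D"
  by (rule alg_homI) (simp_all add: alg_homD)

lemma alg_hom_diff:
  assumes "complex_algebra D" and h: "h \<in> alg_hom complex_ring B D" and "x \<in> carrier B" "y \<in> carrier B"
  shows "h (x \<ominus> y) = h x \<ominus>\<^bsub>D\<^esub> h y"
proof -
  interpret D: complex_algebra D by fact
  have "h (\<ominus> y) = \<ominus>\<^bsub>D\<^esub> h y"
    using alg_homD(5)[OF h, of y "- 1"] smult_minus_left[of y 1] D.smult_minus_left[of "h y" 1] alg_homD(1)[OF h, of y] assms by simp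
  then show ?thesis using alg_homD(2)[OF h, of x "\<ominus> y"] assms by (simp add: minus_eq D.minus_eq)
qed

lemma subalgI:
  assumes "C \<subseteq> carrier B" "\<one> \<in> C" "\<And>x y. x \<in> C \<Longrightarrow> y \<in> C \<Longrightarrow> x \<oplus> y \<in> C"
    "\<And>x y. x \<in> C \<Longrightarrow> y \<in> C \<Longrightarrow> x \<otimes> y \<in> C" "\<And>c x. x \<in> C \<Longrightarrow> c \<odot> x \<in> C"
  shows "subalg complex_ring B C"
proof -
  have z: "\<zero> \<in> C" using assms(5)[OF assms(2), of 0] by simp
  have neg: "\<ominus> x \<in> C" if x: "x \<in> C" for x
    using assms(5)[OF x, of "- 1"] smult_minus_left[of x 1] x assms(1) by (auto simp: subset_iff)
  have "submodule C complex_ring B" by (rule submoduleI) (use assms z neg in auto)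
  moreover have "subring C B" by (rule subringI) (use assms z neg in auto)
  ultimately show ?thesis by (simp add: subalg_def)
qed

lemma subalgD:
  assumes "subalg complex_ring B C"
  shows "C \<subseteq> carrier B" "\<one> \<in> C" "x \<in> C \<Longrightarrow> y \<in> C \<Longrightarrow> x \<oplus> y \<in> C"
    "x \<in> C \<Longrightarrow> y \<in> C \<Longrightarrow> x \<otimes> y \<in> C" "x \<in> C \<Longrightarrow> c \<odot> x \<in> C"
proof -
  have s: "subring C B" "submodule C complex_ring B" using assms by (auto simp: subalg_def)
  show "C \<subseteq> carrier B" "\<one> \<in> C" "x \<in> C \<Longrightarrow> y \<in> C \<Longrightarrow> x \<oplus> y \<in> C"
    "x \<in> C \<Longrightarrow> y \<in> C \<Longrightarrow> x \<otimes> y \<in> C" using subringE[OF s(1)] by auto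
  show "x \<in> C \<Longrightarrow> c \<odot> x \<in> C" using submoduleE(4)[OF s(2), of c x] by simp
qed

lemma subalg_algebra:
  assumes C: "subalg complex_ring B C" shows "complex_algebra (B\<lparr>carrier := C\<rparr>)"
proof -
  have s: "subring C B" "submodule C complex_ring B" using assms by (auto simp: subalg_def)
  have "cring (B\<lparr>carrier := C\<rparr>)" using subcring_iff[OF subalgD(1)[OF C]] subcringI'[OF s(1)] by simp
  moreover have "module complex_ring (B\<lparr>carrier := C\<rparr>)" by (rule submodule.submodule_is_module[OF s(2) module])
  moreover have "(a \<odot> x) \<otimes> y = a \<odot> (x \<otimes> y)" if "x \<in> C" "y \<in> C" for a x y
    using smult_mult_left[of x y a] that subalgD(1)[OF C] by blast
  ultimately show ?thesis
    by (intro complex_algebra.intro algebra.intro algebra_axioms.intro) auto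
qed

text \<open>Products are indexed by lists because the pigeonhole count concerns lengths and
  repetitions.\<close>

definition pr :: "'a list \<Rightarrow> 'a" where
  "pr ts = foldr (\<otimes>) ts \<one>"

lemma pr_simps [simp]: "pr [] = \<one>" "pr (t # ts) = t \<otimes> pr ts"
  by (simp_all add: pr_def)

lemma pr_in [simp, intro]: "set ts \<subseteq> carrier B \<Longrightarrow> pr ts \<in> carrier B"
  by (induction ts) auto

lemma pr_append: "set xs \<subseteq> carrier B \<Longrightarrow> set ys \<subseteq> carrier B \<Longrightarrow> pr (xs @ ys) = pr xs \<otimes> pr ys"
  by (induction xs) (auto simp: m_assoc)

text \<open>Collecting the occurrences of \<open>t\<close> exhibits a power of \<open>t\<close> as a
  factor; if that power vanishes, so does the product.\<close>

lemma pr_filter: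
  assumes "set ts \<subseteq> carrier B" "t \<in> carrier B"
  shows "pr ts = t [^] count_list ts t \<otimes> pr (filter (\<lambda>s. s \<noteq> t) ts)"
  using assms(1)
proof (induction ts)
  case (Cons s ts)
  have f: "set (filter (\<lambda>s. s \<noteq> t) ts) \<subseteq> carrier B" using Cons by auto
  define a b where "a = t [^] count_list ts t" and "b = pr (filter (\<lambda>s. s \<noteq> t) ts)"
  have ab: "a \<in> carrier B" "b \<in> carrier B" using assms(2) f by (auto simp: a_def b_def)
  have IH: "pr ts = a \<otimes> b" using Cons by (simp add: a_def b_def)
  have s: "s \<in> carrier B" using Cons by simp
  show ?case
  proof (cases "s = t")
    case True
    have "t \<otimes> (a \<otimes> b) = (a \<otimes> t) \<otimes> b" using ab assms(2) by (simp add: m_ac)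
    then show ?thesis using True IH by (simp add: a_def b_def)
  next
    case False
    have "s \<otimes> (a \<otimes> b) = a \<otimes> (s \<otimes> b)" using ab s by (simp add: m_ac)
    then show ?thesis using False IH by (simp add: a_def b_def)
  qed
qed simp

lemma lspan_minimal:
  assumes V: "submodule V complex_ring B" and "X \<subseteq> V" and "y \<in> lspan X" shows "y \<in> V"
  using assms(3)
proof (induction rule: lspan.induct)
  case lspan_zero show ?case using subgroup.one_closed[OF submodule.axioms(1)[OF V]] by simp
next
  case (lspan_add x y a)
  then show ?case using submoduleE(4,5)[OF V] assms(2) by auto
qed

lemma lspan_mono: "X \<subseteq> Y \<Longrightarrow> Y \<subseteq> carrier B \<Longrightarrow> y \<in> lspan X \<Longrightarrow> y \<in> lspan Y"
  using lspan_minimal[OF submodule_lspan] lspan_base by blast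

lemma point_kernel_ideal:
  assumes \<chi>: "\<chi> \<in> alg_hom complex_ring B complex_alg"
  shows "ideal {x \<in> carrier B. \<chi> x = 0} B"
proof -
  have "ring_hom_ring B complex_ring \<chi>"
    by (rule ring_hom_ringI2[OF ring_axioms cring.axioms(1)[OF complex_ring_cring]], rule ring_hom_memI)
      (simp_all add: alg_homD[OF \<chi>])
  then show ?thesis using ring_hom_ring.kernel_is_ideal by (fastforce simp: a_kernel_def')
qed

text \<open>A larger ideal contains some \<open>x\<close> with \<open>\<chi> x \<noteq> 0\<close>.
  The element \<open>\<one> \<ominus> (1 / \<chi> x) \<odot> x\<close> lies in the kernel, so the
  ideal contains \<open>\<one>\<close>.\<close>

lemma point_kernel_maximal:
  assumes \<chi>: "\<chi> \<in> alg_hom complex_ring B complex_alg"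
  shows "maximalideal {x \<in> carrier B. \<chi> x = 0} B"
proof (rule maximalidealI[OF point_kernel_ideal[OF \<chi>]])
  have "\<one> \<notin> {x \<in> carrier B. \<chi> x = 0}" using alg_homD(4)[OF \<chi>] by simp
  then show "carrier B \<noteq> {x \<in> carrier B. \<chi> x = 0}" using one_closed by blast
  fix J assume J: "ideal J B" and sub: "{x \<in> carrier B. \<chi> x = 0} \<subseteq> J" and "J \<subseteq> carrier B"
  interpret J: ideal J B by fact
  show "J = {x \<in> carrier B. \<chi> x = 0} \<or> J = carrier B"
  proof (cases "J \<subseteq> {x \<in> carrier B. \<chi> x = 0}")
    case False
    then obtain x where x: "x \<in> J" "\<chi> x \<noteq> 0" using J.Icarr by auto
    have xB: "x \<in> carrier B" using x J.Icarr by auto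
    define y where "y = \<one> \<ominus> (1 / \<chi> x) \<odot> x"
    have yB: "y \<in> carrier B" using xB by (simp add: y_def)
    have "\<chi> y = 0"
      using alg_hom_diff[OF complex_algebra_complex_alg \<chi>, of \<one> "(1 / \<chi> x) \<odot> x"] xB x(2)
      by (simp add: y_def alg_homD[OF \<chi>])
    then have "y \<in> J" using sub yB by blast
    moreover have "(1 / \<chi> x) \<odot> x \<in> J" using ideal_smult[OF J x(1)] .
    moreover have "\<one> = y \<oplus> (1 / \<chi> x) \<odot> x"
    proof -
      define u where "u = (1 / \<chi> x) \<odot> x"
      have "u \<in> carrier B" using xB by (simp add: u_def)
      then show ?thesis unfolding y_def u_def[symmetric] by (simp add: minus_eq a_assoc l_neg)
    qed
    ultimately have "\<one> \<in> J" using J.a_closed by metis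
    then show ?thesis using J.one_imp_carrier by simp
  qed (use sub in blast)
qed

text \<open>Two elements have the same coset exactly if \<open>\<chi>\<close> agrees on them, and
  \<open>x\<close> has the coset of the scalar \<open>\<chi> x\<close>.\<close>

lemma point_residue_iso:
  assumes \<chi>: "\<chi> \<in> alg_hom complex_ring B complex_alg"
  shows "(\<lambda>c. {x \<in> carrier B. \<chi> x = 0} +> (c \<odot> \<one>)) \<in> ring_iso complex_ring (B Quot {x \<in> carrier B. \<chi> x = 0})"
proof -
  define m where "m = {x \<in> carrier B. \<chi> x = 0}"
  have m: "ideal m B" unfolding m_def by (rule point_kernel_ideal[OF \<chi>])
  interpret m: ideal m B by fact
  have eq: "m +> x = m +> y \<longleftrightarrow> \<chi> x = \<chi> y" if "x \<in> carrier B" "y \<in> carrier B" for x y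
  proof -
    have "m +> x = m +> y \<longleftrightarrow> x \<ominus> y \<in> m" using quotient_eq_iff_same_a_r_cos[OF m that] by simp
    also have "\<dots> \<longleftrightarrow> \<chi> (x \<ominus> y) = 0" unfolding m_def using minus_closed[OF that] by blast
    also have "\<chi> (x \<ominus> y) = \<chi> x - \<chi> y"
      using alg_hom_diff[OF complex_algebra_complex_alg \<chi> that] by (simp only: complex_alg_minus)
    also have "\<chi> x - \<chi> y = 0 \<longleftrightarrow> \<chi> x = \<chi> y" by (rule right_minus_eq)
    finally show ?thesis .
  qed
  have c1: "\<chi> (c \<odot> \<one>) = c" for c using alg_homD(4,5)[OF \<chi>] by simp
  have "(\<lambda>c. c \<odot> \<one>) \<in> ring_hom complex_ring B"
    by (rule ring_hom_memI) (simp_all add: smult_add_left smult_mult_left smult_smult)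
  then have "(\<lambda>x. m +> x) \<circ> (\<lambda>c. c \<odot> \<one>) \<in> ring_hom complex_ring (B Quot m)"
    using m.rcos_ring_hom ring_hom_trans by metis
  then have hom: "(\<lambda>c. m +> (c \<odot> \<one>)) \<in> ring_hom complex_ring (B Quot m)" by (simp add: comp_def)
  have "bij_betw (\<lambda>c. m +> (c \<odot> \<one>)) UNIV (a_rcosets m)"
    unfolding bij_betw_def
  proof
    show "inj (\<lambda>c. m +> (c \<odot> \<one>))" by (rule injI) (simp add: eq c1)
    show "range (\<lambda>c. m +> (c \<odot> \<one>)) = a_rcosets m"
    proof
      show "a_rcosets m \<subseteq> range (\<lambda>c. m +> (c \<odot> \<one>))"
      proof
        fix K assume "K \<in> a_rcosets m"
        then obtain x where x: "x \<in> carrier B" "K = m +> x" by (auto simp: A_RCOSETS_def')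
        then have "K = m +> (\<chi> x \<odot> \<one>)" using eq[of x "\<chi> x \<odot> \<one>"] c1 by simp
        then show "K \<in> range (\<lambda>c. m +> (c \<odot> \<one>))" by blast
      qed
      show "range (\<lambda>c. m +> (c \<odot> \<one>)) \<subseteq> a_rcosets m"
        unfolding A_RCOSETS_def' using smult_in[OF one_closed] by blast
    qed
  qed
  moreover have "carrier (B Quot m) = a_rcosets m" by (simp add: FactRing_def)
  ultimately have "(\<lambda>c. m +> (c \<odot> \<one>)) \<in> ring_iso complex_ring (B Quot m)"
    unfolding ring_iso_def using hom complex_ring_simps(1) by (intro CollectI conjI) (simp_all only:)
  then show ?thesis unfolding m_def .
qed

text \<open>\<open>G k\<close> is the set of products of at least \<open>k\<close> generators, \<open>lspan (G k)\<close> is the \<open>k\<close>-th power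
  of the maximal ideal, and long products vanish by the pigeonhole principle.\<close>

lemma weil_of_nilpotent_generators:
  assumes T: "finite T" "T \<subseteq> carrier B"
    and gen: "\<And>C. subalg complex_ring B C \<Longrightarrow> T \<subseteq> C \<Longrightarrow> C = carrier B"
    and \<chi>: "\<chi> \<in> alg_hom complex_ring B complex_alg" and \<chi>T: "\<And>t. t \<in> T \<Longrightarrow> \<chi> t = 0"
    and nil: "\<And>t. t \<in> T \<Longrightarrow> \<exists>n::nat. t [^] n = \<zero>"
  shows "weil_algebra complex_ring B"
proof -
  define m where "m = {x \<in> carrier B. \<chi> x = 0}"
  have m: "ideal m B" unfolding m_def by (rule point_kernel_ideal[OF \<chi>])
  have mmax: "maximalideal m B" unfolding m_def by (rule point_kernel_maximal[OF \<chi>])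
  interpret m: maximalideal m B by fact
  obtain n where n: "\<And>t. t \<in> T \<Longrightarrow> t [^] (n t :: nat) = \<zero>" using nil by metis
  \<comment> \<open>A single exponent that kills all generators; the sum is an upper bound of the
    individual ones.\<close>
  define N where "N = (\<Sum>t\<in>T. n t)"
  have N: "t [^] k = \<zero>" if t: "t \<in> T" and k: "N \<le> k" for t k
  proof -
    have "n t \<le> N" unfolding N_def using member_le_sum[of t T n] t T(1) by simp
    then have "k = n t + (k - n t)" using k by simp
    then have "t [^] k = t [^] n t \<otimes> t [^] (k - n t)" using nat_pow_mult[of t "n t" "k - n t"] t T(2) by auto
    then show ?thesis using n[OF t] t T(2) by auto
  qed
  define G where "G = (\<lambda>k. {pr ts | ts. set ts \<subseteq> T \<and> k \<le> length ts})"
  have G: "G k \<subseteq> carrier B" for k using T(2) by (auto simp: G_def)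
  \<comment> \<open>More than \<open>card T * N\<close> factors force some generator to occur at
    least \<open>N\<close> times.\<close>
  define L where "L = card T * N + 1"
  have G_L: "G L \<subseteq> {\<zero>}"
  proof
    fix g assume "g \<in> G L"
    then obtain ts where ts: "g = pr ts" "set ts \<subseteq> T" "L \<le> length ts" by (auto simp: G_def)
    have "\<exists>t\<in>T. N \<le> count_list ts t"
    proof (rule ccontr)
      assume "\<not> ?thesis"
      then have "\<And>t. t \<in> T \<Longrightarrow> count_list ts t \<le> N" by force
      then have "(\<Sum>t\<in>T. count_list ts t) \<le> card T * N" using sum_bounded_above[of T "count_list ts" N] by simp
      then show False using sum_count_set[OF ts(2) T(1)] ts(3) by (simp add: L_def)
    qed
    then obtain t where t: "t \<in> T" "N \<le> count_list ts t" by blast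
    have "set ts \<subseteq> carrier B" "t \<in> carrier B" "set (filter (\<lambda>s. s \<noteq> t) ts) \<subseteq> carrier B" using ts t T(2) by auto
    then have "pr ts = \<zero>" using pr_filter[of ts t] N[OF t] by simp
    then show "g \<in> {\<zero>}" using ts by simp
  qed
  have GG: "x \<otimes> y \<in> G (a + b)" if xy: "x \<in> G a" "y \<in> G b" for x y a b
  proof -
    obtain xs ys where "x = pr xs" "set xs \<subseteq> T" "a \<le> length xs" "y = pr ys" "set ys \<subseteq> T" "b \<le> length ys"
      using xy by (auto simp: G_def)
    then show ?thesis using pr_append[of xs ys] T(2) unfolding G_def by (intro CollectI exI[of _ "xs @ ys"]) auto
  qed
  \<comment> \<open>Bilinearity reduces this to products of generators; \<open>lspan_mult\<close>
    treats one argument at a time, and commutativity swaps them.\<close>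
  have JJ: "x \<otimes> y \<in> lspan (G (a + b))" if x: "x \<in> lspan (G a)" and y: "y \<in> lspan (G b)" for x y a b
  proof -
    have yB: "y \<in> carrier B" using lspan_carrier[OF G y] .
    have "g \<otimes> y \<in> lspan (G (a + b))" if g: "g \<in> G a" for g
      by (rule lspan_mult[OF G G _ _ y]) (use g G lspan_base[OF G GG[OF g]] in auto)
    then have "y \<otimes> g \<in> lspan (G (a + b))" if "g \<in> G a" for g
      using that m_comm[OF yB] G by (metis subsetD)
    then have "y \<otimes> x \<in> lspan (G (a + b))" by (rule lspan_mult[OF G G yB _ x])
    then show ?thesis using m_comm[OF yB lspan_carrier[OF G x]] by simp
  qed
  have T1: "t \<in> G 1" if "t \<in> T" for t
    unfolding G_def using that T(2) by (intro CollectI exI[of _ "[t]"]) auto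
  have one: "\<one> \<in> G 0" unfolding G_def by (intro CollectI exI[of _ "[]"]) auto
  have J0: "lspan (G 0) = carrier B"
  proof (rule stable_subspace[OF gen T(2) submodule_lspan[OF G] lspan_base[OF G one]])
    fix t v assume t: "t \<in> T" and v: "v \<in> lspan (G 0)"
    have "t \<otimes> v \<in> lspan (G (1 + 0))" by (rule JJ[OF lspan_base[OF G T1[OF t]] v])
    then show "t \<otimes> v \<in> lspan (G 0)" by (rule lspan_mono[OF _ G, rotated]) (auto simp: G_def)
  qed
  have \<chi>1: "\<chi> g = 0" if g: "g \<in> G 1" for g
  proof -
    obtain t ts where "g = t \<otimes> pr ts" "t \<in> T" "set ts \<subseteq> T" using g by (auto simp: G_def Suc_le_length_iff)
    then show ?thesis using alg_homD(3)[OF \<chi>, of t "pr ts"] \<chi>T T(2) by auto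
  qed
  have m_J1: "m = lspan (G 1)"
  proof
    have "G 1 \<subseteq> m" unfolding m_def using \<chi>1 G by blast
    moreover have "submodule m complex_ring B"
      by (rule submoduleI) (use ideal_smult[OF m] m.a_subset m.a_inv_closed m.a_closed m.zero_closed in auto)
    ultimately show "lspan (G 1) \<subseteq> m" using lspan_minimal by blast
    \<comment> \<open>Splitting off the empty product writes every element as a scalar plus a
      combination of nonempty products, and \<open>\<chi>\<close> detects the scalar.\<close>
    have dec: "\<exists>c y. y \<in> lspan (G 1) \<and> x = c \<odot> \<one> \<oplus> y" if "x \<in> lspan (G 0)" for x
      using that
    proof (induction rule: lspan.induct)
      case lspan_zero show ?case by (intro exI[of _ 0] exI[of _ \<zero>]) (auto intro: lspan.lspan_zero)
    next
      case (lspan_add g x a)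
      then obtain c y where y: "y \<in> lspan (G 1)" "x = c \<odot> \<one> \<oplus> y" by blast
      have yB: "y \<in> carrier B" using lspan_carrier[OF G y(1)] .
      obtain ts where ts: "g = pr ts" "set ts \<subseteq> T" using lspan_add(1) by (auto simp: G_def)
      have gB: "g \<in> carrier B" using lspan_add(1) G by blast
      show ?case
      proof (cases ts)
        case Nil
        have "a \<odot> g \<oplus> x = (a + c) \<odot> \<one> \<oplus> y" using y yB ts Nil by (simp add: smult_add_left a_assoc)
        then show ?thesis using y by blast
      next
        case (Cons t ts')
        then have "g \<in> G 1" using ts unfolding G_def by (intro CollectI exI[of _ ts]) auto
        then have "a \<odot> g \<oplus> y \<in> lspan (G 1)" using lspan.lspan_add y(1) by blast
        moreover have "a \<odot> g \<oplus> x = c \<odot> \<one> \<oplus> (a \<odot> g \<oplus> y)" using y yB gB by (simp add: a_ac)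
        ultimately show ?thesis by blast
      qed
    qed
    show "m \<subseteq> lspan (G 1)"
    proof
      fix x assume x: "x \<in> m"
      then have "x \<in> lspan (G 0)" and \<chi>x: "\<chi> x = 0" unfolding J0 m_def by blast+
      then obtain c y where y: "y \<in> lspan (G 1)" "x = c \<odot> \<one> \<oplus> y" using dec by blast
      have yB: "y \<in> carrier B" "\<chi> y = 0" using y(1) \<open>lspan (G 1) \<subseteq> m\<close> unfolding m_def by blast+
      have "\<chi> x = c" using y(2) yB alg_homD(2)[OF \<chi>, of "c \<odot> \<one>" y] alg_homD(4,5)[OF \<chi>] by simp
      then have "c = 0" using \<chi>x by simp
      then show "x \<in> lspan (G 1)" using y yB by simp
    qed
  qed
  \<comment> \<open>Membership of \<open>\<zero>\<close> is proved along with the inclusion, which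
    alone is only one half of the later equality with \<open>{\<zero>}\<close>.\<close>
  have mpow: "m [^]\<^bsub>ideals_set B\<^esub> (k::nat) \<subseteq> lspan (G k) \<and> \<zero> \<in> m [^]\<^bsub>ideals_set B\<^esub> k" for k
  proof (induction k)
    case 0
    show ?case using J0 by (simp add: nat_pow_def ideals_set_def)
  next
    case (Suc k)
    define P where "P = m [^]\<^bsub>ideals_set B\<^esub> k"
    have S: "m [^]\<^bsub>ideals_set B\<^esub> Suc k = ideal_prod B P m" by (simp add: P_def nat_pow_def ideals_set_def)
    have "x \<in> lspan (G (Suc k))" if "x \<in> ideal_prod B P m" for x
      using that
    proof (induction rule: ideal_prod.induct)
      case (prod i j)
      then have "i \<otimes> j \<in> lspan (G (k + 1))" using Suc m_J1 by (intro JJ) (auto simp: P_def)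
      then show ?case by simp
    next
      case (sum a b) then show ?case using lspan_plus[OF G] by blast
    qed
    moreover have "\<zero> \<in> ideal_prod B P m"
      using ideal_prod.prod[of \<zero> P \<zero> m B] Suc m.zero_closed by (simp add: P_def)
    ultimately show ?case unfolding S by blast
  qed
  have J_L: "lspan (G L) \<subseteq> {\<zero>}"
  proof
    fix y assume "y \<in> lspan (G L)" then show "y \<in> {\<zero>}"
      by (induction rule: lspan.induct) (use G_L in auto)
  qed
  have mL: "m [^]\<^bsub>ideals_set B\<^esub> L = {\<zero>}" using mpow[of L] J_L by blast
  have nilp: "x [^] k \<in> lspan (G k)" if x: "x \<in> m" for x and k :: nat
  proof (induction k)
    case 0 show ?case using J0 by simp
  next
    case (Suc k)
    then have "x [^] k \<otimes> x \<in> lspan (G (k + 1))" using x m_J1 by (intro JJ) auto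
    then show ?case by simp
  qed
  \<comment> \<open>The elements of \<open>m\<close> are nilpotent and so belong to every prime
    ideal, in particular to every maximal one.\<close>
  have uniq: "n' = m" if n': "maximalideal n' B" for n'
  proof -
    interpret n: maximalideal n' B by fact
    interpret p: primeideal n' B by (rule maximalideal_prime[OF n'])
    have "x \<in> n'" if x: "x \<in> m" for x
    proof -
      have xB: "x \<in> carrier B" using x unfolding m_def by blast
      have "x [^] k \<in> n' \<Longrightarrow> x \<in> n'" for k :: nat
      proof (induction k)
        case 0 then show ?case using n.one_imp_carrier n.I_notcarr by simp
      next
        case (Suc k) then show ?case using p.I_prime[of "x [^] k" x] xB by auto
      qed
      moreover have "x [^] L \<in> n'" using nilp[OF x, of L] J_L n.zero_closed by auto
      ultimately show ?thesis .
    qed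
    then have "m \<subseteq> n'" by blast
    then show ?thesis using m.I_maximal[OF n.is_ideal _ n.a_subset] n.I_notcarr by auto
  qed
  have "fg_module complex_ring B"
    unfolding fg_module_def
  proof (intro conjI exI allI impI)
    show "module complex_ring B" by (rule module)
    \<comment> \<open>Words of length at most \<open>L\<close> generate the module, because products
      of at least \<open>L\<close> generators vanish.\<close>
    define F where "F = {ts. set ts \<subseteq> T \<and> length ts \<le> L}"
    show "finite (pr ` F)" unfolding F_def by (intro finite_imageI finite_lists_length_le T(1))
    show "pr ` F \<subseteq> carrier B" using T(2) by (auto simp: F_def)
    fix V assume V: "submodule V complex_ring B \<and> pr ` F \<subseteq> V"
    have "G 0 \<subseteq> V"
    proof
      fix g assume "g \<in> G 0"
      then obtain ts where ts: "g = pr ts" "set ts \<subseteq> T" by (auto simp: G_def)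
      show "g \<in> V"
      proof (cases "length ts \<le> L")
        case True then show ?thesis using V ts by (auto simp: F_def)
      next
        case False
        then have "g \<in> G L" using ts unfolding G_def by (intro CollectI exI[of _ ts]) auto
        then show ?thesis using G_L subgroup.one_closed[OF submodule.axioms(1)] V by fastforce
      qed
    qed
    then have "carrier B \<subseteq> V" using lspan_minimal[of V "G 0"] V J0 by blast
    then show "V = carrier B" using submoduleE(1)[of V] V by blast
  qed
  then show ?thesis
    unfolding weil_algebra_def using algebra_axioms mmax uniq point_residue_iso[OF \<chi>] mL
    unfolding m_def by blast
qed

text \<open>Existence: follow the quotient map by the inverse of the residue isomorphism.
  Uniqueness: the kernels of two points are maximal and hence equal, and \<open>x\<close> minus its
  value at one point lies in both.\<close>

lemma weil_point:
  assumes "weil_algebra complex_ring B"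
  shows "\<exists>!\<chi>. \<chi> \<in> alg_hom complex_ring B complex_alg \<and> \<chi> \<in> extensional (carrier B)"
proof -
  obtain m where m: "maximalideal m B" and uniq: "\<And>n. maximalideal n B \<Longrightarrow> n = m"
    and iso: "(\<lambda>c. m +> (c \<odot> \<one>)) \<in> ring_iso complex_ring (B Quot m)"
    using assms unfolding weil_algebra_def by (elim conjE exE) blast
  interpret m: maximalideal m B by fact
  define \<phi> where "\<phi> = (\<lambda>c. m +> (c \<odot> \<one>))"
  have bij: "bij_betw \<phi> UNIV (a_rcosets m)" using iso by (simp add: ring_iso_def \<phi>_def FactRing_def)
  have inj: "c = d" if "\<phi> c = \<phi> d" for c d using bij that by (auto simp: bij_betw_def dest: injD)
  define \<chi> where "\<chi> = (\<lambda>x\<in>carrier B. THE c. \<phi> c = m +> x)"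
  have \<chi>_eq: "\<chi> x = c" if "x \<in> carrier B" "\<phi> c = m +> x" for x c
    unfolding \<chi>_def using that inj by (auto intro!: the_equality)
  have \<chi>: "\<phi> (\<chi> x) = m +> x" if x: "x \<in> carrier B" for x
  proof -
    have "m +> x \<in> a_rcosets m" using x by (auto simp: A_RCOSETS_def')
    then have "m +> x \<in> range \<phi>" using bij by (simp add: bij_betw_def)
    then obtain c where "\<phi> c = m +> x" by auto
    then show ?thesis using \<chi>_eq[OF x] by simp
  qed
  have \<phi>_hom: "\<phi> \<in> ring_hom complex_ring (B Quot m)" using iso by (simp add: ring_iso_def \<phi>_def)
  have q: "(+>) m \<in> ring_hom B (B Quot m)" by (rule m.rcos_ring_hom)
  have \<phi>1: "\<phi> c = m +> (c \<odot> \<one>)" for c by (simp add: \<phi>_def)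
  have hom: "\<chi> \<in> alg_hom complex_ring B complex_alg"
  proof (rule alg_homI)
    fix x y assume xy: "x \<in> carrier B" "y \<in> carrier B"
    show "\<chi> (x \<oplus> y) = \<chi> x \<oplus>\<^bsub>complex_alg\<^esub> \<chi> y"
      using ring_hom_add[OF \<phi>_hom, of "\<chi> x" "\<chi> y"] ring_hom_add[OF q xy] xy \<chi> by (intro \<chi>_eq) simp_all
    show "\<chi> (x \<otimes> y) = \<chi> x \<otimes>\<^bsub>complex_alg\<^esub> \<chi> y"
      using ring_hom_mult[OF \<phi>_hom, of "\<chi> x" "\<chi> y"] ring_hom_mult[OF q xy] xy \<chi> by (intro \<chi>_eq) simp_all
  next
    show "\<chi> \<one> = \<one>\<^bsub>complex_alg\<^esub>" by (intro \<chi>_eq) (simp_all add: \<phi>1)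
  next
    fix c x assume x: "x \<in> carrier B"
    have "\<phi> (c * \<chi> x) = \<phi> c \<otimes>\<^bsub>B Quot m\<^esub> \<phi> (\<chi> x)" using ring_hom_mult[OF \<phi>_hom, of c "\<chi> x"] by simp
    also have "\<dots> = m +> ((c \<odot> \<one>) \<otimes> x)" using ring_hom_mult[OF q, of "c \<odot> \<one>" x] x \<chi> \<phi>1 by simp
    also have "(c \<odot> \<one>) \<otimes> x = c \<odot> x" using x by (simp add: smult_mult_left)
    finally show "\<chi> (c \<odot> x) = c \<odot>\<^bsub>complex_alg\<^esub> \<chi> x" using x by (intro \<chi>_eq) simp_all
  qed simp
  show ?thesis
  proof (rule ex1I[of _ \<chi>])
    show "\<chi> \<in> alg_hom complex_ring B complex_alg \<and> \<chi> \<in> extensional (carrier B)" using hom by (simp add: \<chi>_def)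
    fix \<psi> assume \<psi>: "\<psi> \<in> alg_hom complex_ring B complex_alg \<and> \<psi> \<in> extensional (carrier B)"
    show "\<psi> = \<chi>"
    proof (rule extensionalityI[of _ "carrier B"])
      fix x assume x: "x \<in> carrier B"
      have k: "{x \<in> carrier B. \<psi> x = 0} = {x \<in> carrier B. \<chi> x = 0}"
        using uniq[OF point_kernel_maximal[OF hom]] uniq[OF point_kernel_maximal[OF \<psi>[THEN conjunct1]]] by simp
      define y where "y = x \<ominus> \<chi> x \<odot> \<one>"
      have y: "y \<in> carrier B" using x by (simp add: y_def)
      have d: "\<rho> y = \<rho> x - \<chi> x" if \<rho>: "\<rho> \<in> alg_hom complex_ring B complex_alg" for \<rho>
      proof -
        show ?thesis
          unfolding y_def using alg_hom_diff[OF complex_algebra_complex_alg \<rho> x, of "\<chi> x \<odot> \<one>"] alg_homD(4,5)[OF \<rho>] by simp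
      qed
      have "\<chi> y = 0" using d[OF hom] by simp
      then have "\<psi> y = 0" using k y by blast
      then show "\<psi> x = \<chi> x" using d[of \<psi>] \<psi> by simp
    qed (use \<psi> in \<open>auto simp: \<chi>_def\<close>)
  qed
qed

end

section \<open>Idempotents, images and preimages\<close>

context complex_algebra
begin

lemma indecomposable_iff:
  "indecomposable B \<longleftrightarrow> \<one> \<noteq> \<zero> \<and> (\<forall>e \<in> carrier B. e \<otimes> e = e \<longrightarrow> e = \<zero> \<or> e = \<one>)"
proof
  assume "indecomposable B"
  then have c: "card {e \<in> carrier B. e \<otimes> e = e} = 2" by (simp add: indecomposable_def)
  then have fin: "finite {e \<in> carrier B. e \<otimes> e = e}" by (intro card_ge_0_finite) simp
  have ne: "\<one> \<noteq> \<zero>"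
  proof
    assume "\<one> = \<zero>"
    then have "carrier B = {\<zero>}" using one_zeroD by simp
    then have "{e \<in> carrier B. e \<otimes> e = e} \<subseteq> {\<zero>}" by blast
    then have "card {e \<in> carrier B. e \<otimes> e = e} \<le> card {\<zero>}" by (intro card_mono) auto
    then show False using c by simp
  qed
  have "{\<zero>, \<one>} = {e \<in> carrier B. e \<otimes> e = e}"
    by (rule card_subset_eq[OF fin]) (auto simp: c ne[symmetric])
  then show "\<one> \<noteq> \<zero> \<and> (\<forall>e \<in> carrier B. e \<otimes> e = e \<longrightarrow> e = \<zero> \<or> e = \<one>)" using ne by blast
next
  assume *: "\<one> \<noteq> \<zero> \<and> (\<forall>e \<in> carrier B. e \<otimes> e = e \<longrightarrow> e = \<zero> \<or> e = \<one>)"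
  then have "{e \<in> carrier B. e \<otimes> e = e} = {\<zero>, \<one>}" by auto
  then show "indecomposable B" using *[THEN conjunct1, symmetric] by (simp add: indecomposable_def)
qed

lemma image_subalg:
  assumes "complex_algebra D" and h: "h \<in> alg_hom complex_ring B D"
  shows "subalg complex_ring D (h ` carrier B)"
proof -
  interpret D: complex_algebra D by fact
  show ?thesis
  proof (rule D.subalgI)
    show "\<one>\<^bsub>D\<^esub> \<in> h ` carrier B" using alg_homD(4)[OF h] one_closed by (metis imageI)
  next
    fix x y assume "x \<in> h ` carrier B" "y \<in> h ` carrier B"
    then obtain a b where ab: "a \<in> carrier B" "b \<in> carrier B" "x = h a" "y = h b" by blast
    show "x \<oplus>\<^bsub>D\<^esub> y \<in> h ` carrier B" using alg_homD(2)[OF h ab(1,2)] ab by (metis imageI a_closed)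
    show "x \<otimes>\<^bsub>D\<^esub> y \<in> h ` carrier B" using alg_homD(3)[OF h ab(1,2)] ab by (metis imageI m_closed)
  next
    fix c x assume "x \<in> h ` carrier B"
    then obtain a where a: "a \<in> carrier B" "x = h a" by blast
    show "c \<odot>\<^bsub>D\<^esub> x \<in> h ` carrier B" using alg_homD(5)[OF h a(1), of c] a by (metis imageI smult_in)
  qed (use alg_homD(1)[OF h] in blast)
qed

lemma subalg_preimage:
  assumes "complex_algebra D" and h: "h \<in> alg_hom complex_ring B D"
    and C: "C \<subseteq> carrier D" "\<one>\<^bsub>D\<^esub> \<in> C" "\<And>x y. x \<in> C \<Longrightarrow> y \<in> C \<Longrightarrow> x \<oplus>\<^bsub>D\<^esub> y \<in> C"
    "\<And>x y. x \<in> C \<Longrightarrow> y \<in> C \<Longrightarrow> x \<otimes>\<^bsub>D\<^esub> y \<in> C" "\<And>c x. x \<in> C \<Longrightarrow> c \<odot>\<^bsub>D\<^esub> x \<in> C"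
  shows "subalg complex_ring B {x \<in> carrier B. h x \<in> C}"
  by (rule subalgI) (use C in \<open>auto simp: alg_homD[OF h]\<close>)

end

text \<open>The image of a homomorphism \<open>h\<close> that is constant on points is generated by the elements
  \<open>h s - \<chi> (h s)\<close>, which vanish at every point and hence are nilpotent.\<close>

lemma image_weil:
  assumes A: "fg_algebra complex_ring A" and B: "fg_algebra complex_ring B" "indecomposable B"
    and h: "h \<in> alg_hom complex_ring A B"
    and const: "\<And>\<chi> \<chi>' x. \<chi> \<in> alg_hom complex_ring B complex_alg \<Longrightarrow> \<chi>' \<in> alg_hom complex_ring B complex_alg \<Longrightarrow>
      x \<in> carrier A \<Longrightarrow> \<chi> (h x) = \<chi>' (h x)"
  shows "fg_algebra complex_ring (B\<lparr>carrier := h ` carrier A\<rparr>)" (is "fg_algebra _ ?D")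
    and "indecomposable (B\<lparr>carrier := h ` carrier A\<rparr>)" and "weil_algebra complex_ring (B\<lparr>carrier := h ` carrier A\<rparr>)"
proof -
  interpret A: complex_algebra A using A by (intro complex_algebra.intro) (simp add: fg_algebra_def)
  interpret B: complex_algebra B using B by (intro complex_algebra.intro) (simp add: fg_algebra_def)
  have sub: "subalg complex_ring B (h ` carrier A)" by (rule A.image_subalg[OF B.complex_algebra_axioms h])
  note subD = B.subalgD[OF sub]
  have D: "complex_algebra ?D" by (rule B.subalg_algebra[OF sub])
  interpret D: complex_algebra ?D by (rule D)
  obtain T where T: "finite T" "T \<subseteq> carrier A" and genA: "\<And>C. subalg complex_ring A C \<Longrightarrow> T \<subseteq> C \<Longrightarrow> C = carrier A"
    using A unfolding fg_algebra_def by blast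
  \<comment> \<open>A subalgebra of the image that contains the images of the generators has full
    preimage in \<open>A\<close>.\<close>
  have genD: "C = carrier ?D" if C: "subalg complex_ring ?D C" and TC: "h ` T \<subseteq> C" for C
  proof -
    note C' = D.subalgD[OF C]
    have "subalg complex_ring A {x \<in> carrier A. h x \<in> C}"
      by (rule A.subalg_preimage[OF B.complex_algebra_axioms h]) (use C' subD(1) in auto)
    then have "{x \<in> carrier A. h x \<in> C} = carrier A" by (rule genA) (use T(2) TC in auto)
    then show ?thesis using C'(1) by auto
  qed
  show "fg_algebra complex_ring ?D"
    unfolding fg_algebra_def
  proof (intro conjI exI allI impI)
    show "finite (h ` T)" using T(1) by simp
    show "h ` T \<subseteq> carrier ?D" using T(2) by auto
  qed (use D.algebra_axioms genD in auto)
  \<comment> \<open>The subalgebra shares \<open>\<zero>\<close> and \<open>\<one>\<close> with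
    \<open>B\<close>, and its idempotents are idempotents of \<open>B\<close>.\<close>
  show "indecomposable ?D"
    using B(2) subD(1) unfolding D.indecomposable_iff B.indecomposable_iff by auto
  have one0: "\<one>\<^bsub>B\<^esub> [^]\<^bsub>B\<^esub> (n::nat) \<noteq> \<zero>\<^bsub>B\<^esub>" for n using B(2) B.indecomposable_iff by simp
  \<comment> \<open>Used contrapositively: an element that vanishes at all points is
    nilpotent.\<close>
  have null: "\<exists>\<chi> \<in> alg_hom complex_ring B complex_alg. \<chi> b \<noteq> 0"
    if b: "b \<in> carrier B" "\<And>n::nat. b [^]\<^bsub>B\<^esub> n \<noteq> \<zero>\<^bsub>B\<^esub>" for b
  proof -
    obtain \<chi> where \<chi>: "\<chi> \<in> ring_hom B complex_ring" "\<forall>c. \<forall>x \<in> carrier B. \<chi> (c \<odot>\<^bsub>B\<^esub> x) = c * \<chi> x" "\<chi> b \<noteq> 0"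
      using B.nullstellensatz[OF B(1) b] by blast
    have "\<chi> \<in> alg_hom complex_ring B complex_alg"
      by (rule alg_homI) (use \<chi>(2) ring_hom_add[OF \<chi>(1)] ring_hom_mult[OF \<chi>(1)] ring_hom_one[OF \<chi>(1)] in auto)
    then show ?thesis using \<chi>(3) by blast
  qed
  \<comment> \<open>A point exists because \<open>\<one>\<close> is not nilpotent in an
    indecomposable algebra.\<close>
  obtain \<chi> where \<chi>: "\<chi> \<in> alg_hom complex_ring B complex_alg" using null[OF B.one_closed one0] by blast
  define g where "g = (\<lambda>s. h s \<ominus>\<^bsub>B\<^esub> \<chi> (h s) \<odot>\<^bsub>B\<^esub> \<one>\<^bsub>B\<^esub>)"
  have hB: "h x \<in> carrier B" if "x \<in> carrier A" for x using alg_homD(1)[OF h that] .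
  have gB: "g s \<in> carrier B" if "s \<in> carrier A" for s using hB[OF that] by (simp add: g_def)
  have pt_g: "\<psi> (g s) = 0" if "s \<in> carrier A" "\<psi> \<in> alg_hom complex_ring B complex_alg" for s \<psi>
    using B.alg_hom_diff[OF complex_algebra_complex_alg that(2) hB[OF that(1)], of "\<chi> (h s) \<odot>\<^bsub>B\<^esub> \<one>\<^bsub>B\<^esub>"]
      alg_homD(4,5)[OF that(2)] const[OF that(2) \<chi> that(1)] by (simp add: g_def)
  have g_nil: "\<exists>n::nat. g s [^]\<^bsub>B\<^esub> n = \<zero>\<^bsub>B\<^esub>" if "s \<in> carrier A" for s
    using null[OF gB[OF that]] pt_g[OF that] by blast
  have g_eq: "g s = h s \<oplus>\<^bsub>B\<^esub> (- \<chi> (h s)) \<odot>\<^bsub>B\<^esub> \<one>\<^bsub>B\<^esub>" for s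
    by (simp add: g_def B.minus_eq B.smult_minus_left)
  have gD: "g s \<in> h ` carrier A" if "s \<in> carrier A" for s
    unfolding g_eq by (rule subD(3)[OF imageI[OF that] subD(5)[OF subD(2)]])
  have hg: "h s = g s \<oplus>\<^bsub>B\<^esub> \<chi> (h s) \<odot>\<^bsub>B\<^esub> \<one>\<^bsub>B\<^esub>" if "s \<in> carrier A" for s
  proof -
    define u where "u = \<chi> (h s) \<odot>\<^bsub>B\<^esub> \<one>\<^bsub>B\<^esub>"
    have "u \<in> carrier B" by (simp add: u_def)
    then show ?thesis using hB[OF that] unfolding g_def u_def[symmetric] by (simp add: B.minus_eq B.a_assoc B.l_neg)
  qed
  show "weil_algebra complex_ring ?D"
  proof (rule D.weil_of_nilpotent_generators[of "g ` T" \<chi>])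
    show "finite (g ` T)" using T(1) by simp
    show "g ` T \<subseteq> carrier ?D" using gD T(2) by auto
    show "\<chi> \<in> alg_hom complex_ring ?D complex_alg"
      by (rule alg_homI) (use hB in \<open>auto simp: alg_homD[OF \<chi>]\<close>)
    show "\<chi> t = 0" if "t \<in> g ` T" for t using pt_g[OF _ \<chi>] T(2) that by auto
    have "t [^]\<^bsub>?D\<^esub> (n::nat) = t [^]\<^bsub>B\<^esub> n" for t n by (simp add: nat_pow_def)
    then show "\<exists>n::nat. t [^]\<^bsub>?D\<^esub> n = \<zero>\<^bsub>?D\<^esub>" if "t \<in> g ` T" for t using g_nil T(2) that by auto
    fix C assume C: "subalg complex_ring ?D C" and TC: "g ` T \<subseteq> C"
    note C' = D.subalgD[OF C]
    have "h ` T \<subseteq> C"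
    proof
      fix y assume "y \<in> h ` T"
      then obtain s where s: "s \<in> T" "y = h s" by blast
      have "g s \<oplus>\<^bsub>?D\<^esub> \<chi> (h s) \<odot>\<^bsub>?D\<^esub> \<one>\<^bsub>?D\<^esub> \<in> C" using TC s(1) C'(2,3,5) by blast
      then show "y \<in> C" using hg[of s] s T(2) by auto
    qed
    then show "C = carrier ?D" by (rule genD[OF C])
  qed
qed

lemma subalg_complex_alg: "subalg complex_ring complex_alg C \<Longrightarrow> C = UNIV"
proof -
  interpret complex_algebra complex_alg by (rule complex_algebra_complex_alg)
  assume "subalg complex_ring complex_alg C"
  then have "c \<odot>\<^bsub>complex_alg\<^esub> \<one>\<^bsub>complex_alg\<^esub> \<in> C" for c using subalgD(2,5) by blast
  then show "C = UNIV" by auto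
qed

lemma complex_alg_fg: "fg_algebra complex_ring complex_alg"
  using complex_alg_algebra subalg_complex_alg by (auto simp: fg_algebra_def)

lemma complex_alg_indecomposable: "indecomposable complex_alg"
  unfolding complex_algebra.indecomposable_iff[OF complex_algebra_complex_alg] by auto

text \<open>As an algebra \<complex> is generated by the empty set, so the criterion for nilpotent
  generators applies.\<close>

lemma complex_alg_weil: "weil_algebra complex_ring complex_alg"
proof (rule complex_algebra.weil_of_nilpotent_generators[OF complex_algebra_complex_alg, of "{}" id])
  show "id \<in> alg_hom complex_ring complex_alg complex_alg" by (rule alg_homI) simp_all
qed (use subalg_complex_alg in auto)

section \<open>The category of finitely generated indecomposable algebras\<close>

definition hm :: "calgarr \<Rightarrow> complex \<Rightarrow> complex" where
  "hm f = snd (snd f)"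

lemma fg_Ob: "A \<in> Ob fg_indec_algebras \<longleftrightarrow> fg_algebra complex_ring A \<and> indecomposable A"
  by (simp add: fg_indec_algebras_def Let_def)

lemma fg_Hom: "f \<in> Hom fg_indec_algebras A B \<longleftrightarrow> A \<in> Ob fg_indec_algebras \<and> B \<in> Ob fg_indec_algebras \<and>
    fst f = A \<and> fst (snd f) = B \<and> hm f \<in> alg_hom complex_ring A B \<and> hm f \<in> extensional (carrier A)"
  by (cases f) (auto simp: fg_indec_algebras_def Let_def Hom_def hm_def)

lemma fg_algebra_Ob: "A \<in> Ob fg_indec_algebras \<Longrightarrow> complex_algebra A"
  by (rule complex_algebra.intro) (simp add: fg_Ob fg_algebra_def)

lemma fg_Cmp: "Cmp fg_indec_algebras g f = (fst f, fst (snd g), compose (carrier (fst f)) (hm g) (hm f))"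
  by (cases f; cases g) (simp add: fg_indec_algebras_def Let_def hm_def)

lemma fg_Idt: "Idt fg_indec_algebras A = (A, A, \<lambda>x\<in>carrier A. x)"
  by (simp add: fg_indec_algebras_def Let_def)

lemma fg_ext:
  "f \<in> Hom fg_indec_algebras A B \<Longrightarrow> g \<in> Hom fg_indec_algebras A B \<Longrightarrow> (\<And>x. x \<in> carrier A \<Longrightarrow> hm f x = hm g x) \<Longrightarrow> f = g"
  by (auto simp: fg_Hom hm_def prod_eq_iff intro: extensionalityI)

lemma hm_Cmp: "f \<in> Hom fg_indec_algebras A B \<Longrightarrow> x \<in> carrier A \<Longrightarrow> hm (Cmp fg_indec_algebras g f) x = hm g (hm f x)"
  by (simp add: fg_Cmp fg_Hom hm_def compose_def)

lemma hm_Idt: "x \<in> carrier A \<Longrightarrow> hm (Idt fg_indec_algebras A) x = x"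
  by (simp add: fg_Idt hm_def)

lemma hm_in: "f \<in> Hom fg_indec_algebras A B \<Longrightarrow> x \<in> carrier A \<Longrightarrow> hm f x \<in> carrier B"
  by (auto simp: fg_Hom intro: alg_homD)

lemma fg_HomI:
  assumes "A \<in> Ob fg_indec_algebras" "B \<in> Ob fg_indec_algebras" "h \<in> alg_hom complex_ring A B"
  shows "(A, B, restrict h (carrier A)) \<in> Hom fg_indec_algebras A B"
  using assms complex_algebra.alg_hom_restrict[OF fg_algebra_Ob[OF assms(1)] assms(3)] by (simp add: fg_Hom hm_def)

lemma fg_cmp_in:
  assumes f: "f \<in> Hom fg_indec_algebras A B" and g: "g \<in> Hom fg_indec_algebras B D"
  shows "Cmp fg_indec_algebras g f \<in> Hom fg_indec_algebras A D"
  using f g alg_hom_comp[OF fg_algebra_Ob[of A], of "hm f" B "hm g" D] by (simp add: fg_Hom fg_Cmp hm_def compose_def)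

lemma fg_idt_in:
  assumes "A \<in> Ob fg_indec_algebras" shows "Idt fg_indec_algebras A \<in> Hom fg_indec_algebras A A"
  unfolding fg_Idt by (rule fg_HomI[OF assms assms]) (rule alg_homI; simp)

lemma category_fg: "category fg_indec_algebras"
proof
  fix f assume "f \<in> Ar fg_indec_algebras"
  then have f: "f \<in> Hom fg_indec_algebras (Dom fg_indec_algebras f) (Cod fg_indec_algebras f)" by (rule Ar_Hom)
  then show A: "Dom fg_indec_algebras f \<in> Ob fg_indec_algebras" and B: "Cod fg_indec_algebras f \<in> Ob fg_indec_algebras"
    by (auto simp: fg_Hom)
  show "Cmp fg_indec_algebras f (Idt fg_indec_algebras (Dom fg_indec_algebras f)) = f"
    by (rule fg_ext[OF fg_cmp_in[OF fg_idt_in[OF A] f] f]) (simp add: hm_Cmp[OF fg_idt_in[OF A]] hm_Idt)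
  show "Cmp fg_indec_algebras (Idt fg_indec_algebras (Cod fg_indec_algebras f)) f = f"
    by (rule fg_ext[OF fg_cmp_in[OF f fg_idt_in[OF B]] f]) (simp add: hm_Cmp[OF f] hm_Idt hm_in[OF f])
next
  fix f g h A B D E assume f: "f \<in> Hom fg_indec_algebras A B" and g: "g \<in> Hom fg_indec_algebras B D"
    and h: "h \<in> Hom fg_indec_algebras D E"
  show "Cmp fg_indec_algebras h (Cmp fg_indec_algebras g f) = Cmp fg_indec_algebras (Cmp fg_indec_algebras h g) f"
    by (rule fg_ext[OF fg_cmp_in[OF fg_cmp_in[OF f g] h] fg_cmp_in[OF f fg_cmp_in[OF g h]]])
      (simp add: hm_Cmp[OF f] hm_Cmp[OF fg_cmp_in[OF f g]] hm_Cmp[OF g] hm_in[OF f])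
qed (rule fg_idt_in fg_cmp_in; assumption)+

lemma complex_alg_Ob: "complex_alg \<in> Ob fg_indec_algebras"
  using complex_alg_fg complex_alg_indecomposable by (simp add: fg_Ob)

text \<open>A homomorphism out of \<complex> is determined by linearity and its value at
  \<open>1\<close>.\<close>

lemma complex_alg_initial:
  assumes A: "A \<in> Ob fg_indec_algebras" shows "\<exists>!f. f \<in> Hom fg_indec_algebras complex_alg A"
proof -
  interpret A: complex_algebra A by (rule fg_algebra_Ob[OF A])
  have "(\<lambda>c. c \<odot>\<^bsub>A\<^esub> \<one>\<^bsub>A\<^esub>) \<in> alg_hom complex_ring complex_alg A"
    by (rule alg_homI) (simp_all add: A.smult_add_left A.smult_mult_left A.smult_smult)
  from fg_HomI[OF complex_alg_Ob A this] obtain f where f: "f \<in> Hom fg_indec_algebras complex_alg A" by blast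
  have "hm g c = c \<odot>\<^bsub>A\<^esub> \<one>\<^bsub>A\<^esub>" if "g \<in> Hom fg_indec_algebras complex_alg A" for g c
  proof -
    have g: "hm g \<in> alg_hom complex_ring complex_alg A" using that by (simp add: fg_Hom)
    show ?thesis using alg_homD(5)[OF g, of 1 c] alg_homD(4)[OF g] by simp
  qed
  then have "g = f" if "g \<in> Hom fg_indec_algebras complex_alg A" for g
    using fg_ext[OF that f] f that by simp
  then show ?thesis using f by blast
qed

text \<open>The image keeps the operations of the codomain and only the carrier shrinks, so its
  elements are still complex numbers and it can be an object of the same small category.\<close>

definition image_alg :: "calgarr \<Rightarrow> calg" where
  "image_alg f = (fst (snd f))\<lparr>carrier := hm f ` carrier (fst f)\<rparr>"

definition image_quo :: "calgarr \<Rightarrow> calgarr" where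
  "image_quo f = (fst f, image_alg f, hm f)"

definition image_inc :: "calgarr \<Rightarrow> calgarr" where
  "image_inc f = (image_alg f, fst (snd f), \<lambda>x\<in>carrier (image_alg f). x)"

lemma image_factorization:
  assumes f: "f \<in> Hom fg_indec_algebras A B"
    and const: "\<And>\<chi> \<chi>'. \<chi> \<in> Hom fg_indec_algebras B complex_alg \<Longrightarrow> \<chi>' \<in> Hom fg_indec_algebras B complex_alg \<Longrightarrow>
      Cmp fg_indec_algebras \<chi> f = Cmp fg_indec_algebras \<chi>' f"
  shows "weil_algebra complex_ring (image_alg f)" "image_alg f \<in> Ob fg_indec_algebras"
    "image_quo f \<in> Hom fg_indec_algebras A (image_alg f)" "image_inc f \<in> Hom fg_indec_algebras (image_alg f) B"
    "Cmp fg_indec_algebras (image_inc f) (image_quo f) = f"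
proof -
  have AB: "A \<in> Ob fg_indec_algebras" "B \<in> Ob fg_indec_algebras" and ff: "fst f = A" "fst (snd f) = B"
    and h: "hm f \<in> alg_hom complex_ring A B" and ext: "hm f \<in> extensional (carrier A)"
    using f by (auto simp: fg_Hom)
  have im: "image_alg f = B\<lparr>carrier := hm f ` carrier A\<rparr>" by (simp add: image_alg_def ff)
  \<comment> \<open>The hypothesis speaks of arrows of the category, which are extensional;
    restricting bare homomorphisms to the carrier gives the form that \<open>image_weil\<close>
    takes.\<close>
  have const': "\<chi> (hm f x) = \<chi>' (hm f x)"
    if \<chi>: "\<chi> \<in> alg_hom complex_ring B complex_alg" "\<chi>' \<in> alg_hom complex_ring B complex_alg" and x: "x \<in> carrier A" for \<chi> \<chi>' x
  proof -
    have "hm (Cmp fg_indec_algebras (B, complex_alg, restrict \<chi> (carrier B)) f) x =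
      hm (Cmp fg_indec_algebras (B, complex_alg, restrict \<chi>' (carrier B)) f) x"
      using const[OF fg_HomI[OF AB(2) complex_alg_Ob \<chi>(1)] fg_HomI[OF AB(2) complex_alg_Ob \<chi>(2)]] by simp
    then show ?thesis using hm_Cmp[OF f x] hm_in[OF f x] by (simp add: hm_def)
  qed
  have fg: "fg_algebra complex_ring A" "fg_algebra complex_ring B" "indecomposable B" using AB by (auto simp: fg_Ob)
  show "weil_algebra complex_ring (image_alg f)"
    unfolding im by (rule image_weil(3)[OF fg h]) (fact const')
  have "fg_algebra complex_ring (image_alg f)" unfolding im by (rule image_weil(1)[OF fg h]) (fact const')
  moreover have "indecomposable (image_alg f)" unfolding im by (rule image_weil(2)[OF fg h]) (fact const')
  ultimately show I: "image_alg f \<in> Ob fg_indec_algebras" by (simp add: fg_Ob)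
  have "hm f \<in> alg_hom complex_ring A (image_alg f)"
    by (rule alg_homI) (auto simp: im alg_homD[OF h])
  then show q: "image_quo f \<in> Hom fg_indec_algebras A (image_alg f)"
    using AB I ext by (simp add: fg_Hom image_quo_def hm_def ff)
  have "(\<lambda>x. x) \<in> alg_hom complex_ring (image_alg f) B"
    by (rule alg_homI) (use alg_homD(1)[OF h] in \<open>auto simp: im\<close>)
  from fg_HomI[OF I AB(2) this] show i: "image_inc f \<in> Hom fg_indec_algebras (image_alg f) B"
    by (simp add: image_inc_def ff)
  show "Cmp fg_indec_algebras (image_inc f) (image_quo f) = f"
    by (rule fg_ext[OF fg_cmp_in[OF q i] f]) (simp add: hm_Cmp[OF q], simp add: hm_def image_inc_def image_quo_def im)
qed

text \<open>The connecting arrow is \<open>g\<close> restricted to the image of \<open>f\<close>,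
  which it carries onto the image of the composite.\<close>

lemma image_functorial:
  assumes f: "f \<in> Hom fg_indec_algebras A B"
    and const: "\<And>\<chi> \<chi>'. \<chi> \<in> Hom fg_indec_algebras B complex_alg \<Longrightarrow> \<chi>' \<in> Hom fg_indec_algebras B complex_alg \<Longrightarrow>
      Cmp fg_indec_algebras \<chi> f = Cmp fg_indec_algebras \<chi>' f"
    and g: "g \<in> Hom fg_indec_algebras B D"
  shows "\<exists>r \<in> Hom fg_indec_algebras (image_alg f) (image_alg (Cmp fg_indec_algebras g f)).
    Cmp fg_indec_algebras r (image_quo f) = image_quo (Cmp fg_indec_algebras g f) \<and>
    Cmp fg_indec_algebras (image_inc (Cmp fg_indec_algebras g f)) r = Cmp fg_indec_algebras g (image_inc f)"
proof -
  interpret category fg_indec_algebras by (rule category_fg)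
  define k where "k = Cmp fg_indec_algebras g f"
  have k: "k \<in> Hom fg_indec_algebras A D" unfolding k_def by (rule cmp_in[OF f g])
  \<comment> \<open>A point of \<open>D\<close> composed with \<open>g\<close> is a point of
    \<open>B\<close>, so constancy on points survives composition with \<open>g\<close>.\<close>
  have constk: "Cmp fg_indec_algebras \<chi> k = Cmp fg_indec_algebras \<chi>' k"
    if \<chi>: "\<chi> \<in> Hom fg_indec_algebras D complex_alg" "\<chi>' \<in> Hom fg_indec_algebras D complex_alg" for \<chi> \<chi>'
    using const[OF cmp_in[OF g \<chi>(1)] cmp_in[OF g \<chi>(2)]] cmp_assoc[OF f g \<chi>(1)] cmp_assoc[OF f g \<chi>(2)] by (simp add: k_def)
  note F = image_factorization[OF f const] and K = image_factorization[OF k constk]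
  have hk: "hm k x = hm g (hm f x)" if "x \<in> carrier A" for x using hm_Cmp[OF f that] by (simp add: k_def)
  have ff: "fst f = A" "fst (snd f) = B" "fst k = A" "fst (snd k) = D" using f k by (auto simp: fg_Hom)
  have hg: "hm g \<in> alg_hom complex_ring B D" using g by (simp add: fg_Hom)
  have cI: "carrier (image_alg f) = hm f ` carrier A" "carrier (image_alg k) = hm k ` carrier A"
    by (simp_all add: image_alg_def ff)
  have hB: "x \<in> carrier B" if "x \<in> carrier (image_alg f)" for x using that hm_in[OF f] cI by auto
  have "hm g \<in> alg_hom complex_ring (image_alg f) (image_alg k)"
  proof (rule alg_homI)
    fix x assume "x \<in> carrier (image_alg f)"
    then obtain a where "a \<in> carrier A" "x = hm f a" using cI by auto
    then show "hm g x \<in> carrier (image_alg k)" using hk cI by (metis imageI)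
  qed (use hB alg_homD[OF hg] in \<open>auto simp: image_alg_def ff\<close>)
  from fg_HomI[OF F(2) K(2) this]
  have r: "(image_alg f, image_alg k, restrict (hm g) (carrier (image_alg f))) \<in> Hom fg_indec_algebras (image_alg f) (image_alg k)"
    (is "?r \<in> _") .
  have r_app: "hm ?r x = hm g x" if "x \<in> carrier (image_alg f)" for x using that by (simp add: hm_def)
  have q_app: "hm (image_quo f) x = hm f x" "hm (image_quo k) x = hm k x" for x by (simp_all add: hm_def image_quo_def)
  have i_app: "x \<in> carrier (image_alg f) \<Longrightarrow> hm (image_inc f) x = x" "x \<in> carrier (image_alg k) \<Longrightarrow> hm (image_inc k) x = x" for x
    by (simp_all add: hm_def image_inc_def)
  have "Cmp fg_indec_algebras ?r (image_quo f) = image_quo k"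
  proof (rule fg_ext[OF cmp_in[OF F(3) r] K(3)])
    fix x assume x: "x \<in> carrier A"
    have "hm (Cmp fg_indec_algebras ?r (image_quo f)) x = hm ?r (hm f x)" using hm_Cmp[OF F(3) x, of ?r] q_app by simp
    also have "\<dots> = hm k x" using r_app[of "hm f x"] x cI hk by simp
    finally show "hm (Cmp fg_indec_algebras ?r (image_quo f)) x = hm (image_quo k) x" using q_app by simp
  qed
  moreover have "Cmp fg_indec_algebras (image_inc k) ?r = Cmp fg_indec_algebras g (image_inc f)"
  proof (rule fg_ext[OF cmp_in[OF r K(4)] cmp_in[OF F(4) g]])
    fix x assume x: "x \<in> carrier (image_alg f)"
    have "hm (Cmp fg_indec_algebras (image_inc k) ?r) x = hm ?r x"
      using hm_Cmp[OF r x, of "image_inc k"] i_app(2)[OF hm_in[OF r x]] by simp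
    also have "\<dots> = hm (Cmp fg_indec_algebras g (image_inc f)) x"
      using hm_Cmp[OF F(4) x, of g] r_app[OF x] i_app(1)[OF x] by simp
    finally show "hm (Cmp fg_indec_algebras (image_inc k) ?r) x = hm (Cmp fg_indec_algebras g (image_inc f)) x" .
  qed
  ultimately show ?thesis using r unfolding k_def by blast
qed

text \<open>Uniqueness of points of Weil algebras is \<open>weil_point\<close>, existence of points
  is the Nullstellensatz applied to the unit element, and the factorization is through the
  image.\<close>

lemma weil_site_algebras:
  assumes "strongly_inaccessible TYPE('u)"
  shows "weil_site TYPE('u) fg_indec_algebras complex_alg {A. weil_algebra complex_ring A} image_alg image_quo image_inc"
proof -
  interpret universe "TYPE('u)" by (rule universe.intro[OF assms])
  interpret category fg_indec_algebras by (rule category_fg)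
  show ?thesis
  proof (intro weil_site.intro subsite.intro initial_site.intro small_category.intro small_category_axioms.intro
      initial_site_axioms.intro subsite_axioms.intro weil_site_axioms.intro universe_axioms category_axioms)
    show "small_in TYPE('u) (Ar fg_indec_algebras)" by (rule small_subset[OF small_calgarr]) simp
  next
    fix d assume d: "d \<in> Ob fg_indec_algebras" "d \<in> {A. weil_algebra complex_ring A}"
    interpret d: complex_algebra d by (rule fg_algebra_Ob[OF d(1)])
    obtain \<chi> where \<chi>: "\<chi> \<in> alg_hom complex_ring d complex_alg"
      and uniq: "\<And>\<psi>. \<psi> \<in> alg_hom complex_ring d complex_alg \<Longrightarrow> \<psi> \<in> extensional (carrier d) \<Longrightarrow> \<psi> = \<chi>"
      using d.weil_point d(2) by blast
    show "\<exists>!f. f \<in> Hom fg_indec_algebras d complex_alg"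
    proof (rule ex1I[of _ "(d, complex_alg, restrict \<chi> (carrier d))"])
      show "(d, complex_alg, restrict \<chi> (carrier d)) \<in> Hom fg_indec_algebras d complex_alg"
        by (rule fg_HomI[OF d(1) complex_alg_Ob \<chi>])
      fix f assume f: "f \<in> Hom fg_indec_algebras d complex_alg"
      then have "hm f = \<chi>" using uniq by (simp add: fg_Hom)
      then show "f = (d, complex_alg, restrict \<chi> (carrier d))"
        using f fg_ext[OF f fg_HomI[OF d(1) complex_alg_Ob \<chi>]] by (simp add: hm_def)
    qed
  next
    fix b assume b: "b \<in> Ob fg_indec_algebras"
    interpret b: complex_algebra b by (rule fg_algebra_Ob[OF b])
    have fg: "fg_algebra complex_ring b" "indecomposable b" using b by (auto simp: fg_Ob)
    have "\<one>\<^bsub>b\<^esub> [^]\<^bsub>b\<^esub> (n::nat) \<noteq> \<zero>\<^bsub>b\<^esub>" for n using fg(2) b.indecomposable_iff by simp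
    then obtain \<chi> where \<chi>: "\<chi> \<in> ring_hom b complex_ring" "\<forall>c. \<forall>x \<in> carrier b. \<chi> (c \<odot>\<^bsub>b\<^esub> x) = c * \<chi> x"
      using b.nullstellensatz[OF fg(1) b.one_closed] by blast
    have "\<chi> \<in> alg_hom complex_ring b complex_alg"
      by (rule alg_homI) (use \<chi>(2) ring_hom_add[OF \<chi>(1)] ring_hom_mult[OF \<chi>(1)] ring_hom_one[OF \<chi>(1)] in auto)
    from fg_HomI[OF b complex_alg_Ob this] show "\<exists>f. f \<in> Hom fg_indec_algebras b complex_alg" by blast
  next
    fix f a b assume f: "f \<in> Hom fg_indec_algebras a b"
      and c: "\<And>\<chi> \<chi>'. \<chi> \<in> Hom fg_indec_algebras b complex_alg \<Longrightarrow> \<chi>' \<in> Hom fg_indec_algebras b complex_alg \<Longrightarrow>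
        Cmp fg_indec_algebras \<chi> f = Cmp fg_indec_algebras \<chi>' f"
    show "image_alg f \<in> {A. weil_algebra complex_ring A} \<and> image_quo f \<in> Hom fg_indec_algebras a (image_alg f) \<and>
      image_inc f \<in> Hom fg_indec_algebras (image_alg f) b \<and> Cmp fg_indec_algebras (image_inc f) (image_quo f) = f \<and>
      (\<forall>c. \<forall>h \<in> Hom fg_indec_algebras b c. \<exists>r \<in> Hom fg_indec_algebras (image_alg f) (image_alg (Cmp fg_indec_algebras h f)).
        Cmp fg_indec_algebras r (image_quo f) = image_quo (Cmp fg_indec_algebras h f) \<and>
        Cmp fg_indec_algebras (image_inc (Cmp fg_indec_algebras h f)) r = Cmp fg_indec_algebras h (image_inc f))"
      using image_factorization[OF f c] image_functorial[OF f c] by blast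
  qed (use complex_alg_Ob complex_alg_initial complex_alg_weil in auto)
qed

text \<open>Constant functors and restrictions depend on the sets of objects and arrows only, so
  they do not see the passage to the opposite category.\<close>

lemma const_func_op [simp]: "const_func (op_cat A) = const_func A"
  by (simp add: const_func_def const_psh_def fun_eq_iff)

lemma restrict_func_op [simp]: "restrict_func (op_cat A) = restrict_func A"
  by (simp add: restrict_func_def restrict_psh_def fun_eq_iff)

text \<open>The two existence clauses ensure that the assertion about all \<open>p\<close> and
  \<open>w\<close> is not vacuous. The type variables \<open>'x\<close> and \<open>'y\<close> are
  free, so the comparison covers subqualities presented over any types.\<close>

theorem theorem7p7:
  assumes "strongly_inaccessible TYPE('u)"
  shows "(\<exists>p :: ('u calgpsh, 'u calgpsharr, 'u set, 'u setarr) geom. gaeta_canonical p) \<and>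
    (\<exists>w :: ('u calgpsh, 'u calgpsharr, 'u calgpsh, 'u calgpsharr) geom. weil_subtopos w) \<and>
    (\<forall>(p :: ('u calgpsh, 'u calgpsharr, 'u set, 'u setarr) geom)
      (w :: ('u calgpsh, 'u calgpsharr, 'u calgpsh, 'u calgpsharr) geom).
        gaeta_canonical p \<and> weil_subtopos w \<longrightarrow>
          level_epsilon TYPE('x) TYPE('y) gaeta_topos set_cat p weil_topos w \<and>
          largest_subquality TYPE('x) TYPE('y) gaeta_topos set_cat p weil_topos w)"
proof -
  interpret weil_site "TYPE('u)" fg_indec_algebras complex_alg "{A. weil_algebra complex_ring A}" image_alg image_quo image_inc
    by (rule weil_site_algebras[OF assms])
  have p: "gaeta_canonical p \<longleftrightarrow> geometric_morphism E S p \<and> inv_im p = K"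
    for p :: "('u calgpsh, 'u calgpsharr, 'u set, 'u setarr) geom"
    by (simp add: gaeta_canonical_def canonical_geom_def presheaves_def gaeta_site_def)
  have w: "weil_subtopos w \<longleftrightarrow> subtopos E W.E w \<and> inv_im w = Rs"
    for w :: "('u calgpsh, 'u calgpsharr, 'u calgpsh, 'u calgpsharr) geom"
    by (simp add: weil_subtopos_def induced_subtopos_def presheaves_def gaeta_site_def weil_algebras_def)
  have t: "gaeta_topos = E" "weil_topos = W.E"
    by (simp_all add: gaeta_topos_def weil_topos_def presheaves_def gaeta_site_def weil_algebras_def)
  show ?thesis
    unfolding p w t level_epsilon_def largest_subquality_def
  proof (intro conjI allI impI, goal_cases)
    case 1 show ?case by (rule canonical_exists)
  next
    case 2 show ?case by (rule weil_exists)
  next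
    case (3 p w) then show ?case by (intro weil_level(1)) auto
  next
    \<comment> \<open>The Weil subtopos is above every subquality, in particular above the essential
      ones; this is why level epsilon and the largest subquality coincide.\<close>
    case (4 p w G k) then show ?case by (intro weil_level(2)) (auto simp: essential_subquality_def)
  next
    case (5 p w) then have "essential_subquality E S p W.E w" by (intro weil_level(1)) auto
    then show ?case by (simp add: essential_subquality_def)
  next
    case (6 p w G k) then show ?case by (intro weil_level(2)) auto
  qed
qed

end
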